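(* Every complex Lie supergroup $(G,\mathcal{O}_G)$ is a split supermanifold.
   Context: Supermanifolds are in the sense of Berezin–Leites: a complex supermanifold is a pair $(M,\mathcal{O}_M)$ with $M$ a complex manifold and $\mathcal{O}_M$ a sheaf of commutative superalgebras locally isomorphic to $\mathcal{F}\otimes\bigwedge(\mathbb{C}^m)$, where $\mathcal{F}$ is the sheaf of holomorphic functions. It is called split if $\mathcal{O}_M\simeq\bigwedge_{\mathcal{F}_M}\mathcal{E}_M$ (as sheaves of superalgebras), where $\mathcal{F}_M$ is the sheaf of holomorphic functions on $M$ and $\mathcal{E}_M$ is the sheaf of holomorphic sections of some holomorphic vector bundle over $M$. A complex Lie supergroup is a group object in the category of complex supermanifolds. *)

theory Defs
  imports "HOL-Analysis.Analysis" "HOL-Algebra.QuotRing" "HOL-Algebra.Module"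
begin

section \<open>Complex manifolds\<close>

text \<open>
  The dimension has to vary (a group object involves its own square, and dimension 0 is
  allowed), so \<open>n\<close>-dimensional complex space is the set of sequences vanishing from
  index \<open>n\<close> on, with the topology induced by the product topology.
\<close>

definition Cn :: "nat \<Rightarrow> (nat \<Rightarrow> complex) set" where
  "Cn n = {z. \<forall>i\<ge>n. z i = 0}"

text \<open>
  Holomorphic in several variables: continuous and complex differentiable in each variable.
  Only used for \<open>W\<close> open in \<open>Cn n\<close>.
\<close>

definition holo :: "nat \<Rightarrow> (nat \<Rightarrow> complex) set \<Rightarrow> ((nat \<Rightarrow> complex) \<Rightarrow> complex) \<Rightarrow> bool" where
  "holo n W f \<longleftrightarrow>
     continuous_on W f \<and>
     (\<forall>z\<in>W. \<forall>i<n. (\<lambda>t. f (z(i := t))) field_differentiable (at (z i)))"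

record 'p cmanifold =
  mtop  :: "'p topology"
  mdim  :: nat
  atlas :: "('p set \<times> ('p \<Rightarrow> nat \<Rightarrow> complex)) set"

definition complex_manifold :: "'p cmanifold \<Rightarrow> bool" where
  "complex_manifold M \<longleftrightarrow>
     Hausdorff_space (mtop M) \<and> second_countable (mtop M) \<and>
     \<Union>(fst ` atlas M) = topspace (mtop M) \<and>
     (\<forall>(U, \<phi>)\<in>atlas M.
        openin (mtop M) U \<and>
        openin (top_of_set (Cn (mdim M))) (\<phi> ` U) \<and>
        homeomorphic_map (subtopology (mtop M) U) (top_of_set (\<phi> ` U)) \<phi>) \<and>
     (\<forall>(U, \<phi>)\<in>atlas M. \<forall>(V, \<psi>)\<in>atlas M. \<forall>j<mdim M.
        holo (mdim M) (\<phi> ` (U \<inter> V)) (\<lambda>z. \<psi> (inv_into U \<phi> z) j))"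

definition hol :: "'p cmanifold \<Rightarrow> 'p set \<Rightarrow> ('p \<Rightarrow> complex) set" where
  "hol M U = {f \<in> extensional U.
     \<forall>(V, \<phi>)\<in>atlas M. holo (mdim M) (\<phi> ` (U \<inter> V)) (\<lambda>z. f (inv_into V \<phi> z))}"

definition hol_ring :: "'p cmanifold \<Rightarrow> 'p set \<Rightarrow> ('p \<Rightarrow> complex) ring" where
  "hol_ring M U =
     \<lparr>carrier = hol M U,
      mult = (\<lambda>f g. \<lambda>x\<in>U. f x * g x), one = (\<lambda>x\<in>U. 1),
      zero = (\<lambda>x\<in>U. 0), add = (\<lambda>f g. \<lambda>x\<in>U. f x + g x)\<rparr>"


section \<open>Commutative superalgebras\<close>

definition complex_ring :: "complex ring" where
  "complex_ring = \<lparr>carrier = UNIV, mult = (*), one = 1, zero = 0, add = (+)\<rparr>"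

record ('k, 's) superalg = "('k, 's) module" +
  even_part :: "'s set"
  odd_part  :: "'s set"

text \<open>Supercommutative, associative and unital; the zero algebra is allowed.\<close>

locale comm_superalgebra = ring A + module complex_ring A
  for A :: "(complex, 's, 'z) superalg_scheme" (structure) +
  assumes smult_mult_left:
      "\<lbrakk>a \<in> carrier A; b \<in> carrier A\<rbrakk> \<Longrightarrow> c \<odot> (a \<otimes> b) = (c \<odot> a) \<otimes> b"
    and smult_mult_right:
      "\<lbrakk>a \<in> carrier A; b \<in> carrier A\<rbrakk> \<Longrightarrow> c \<odot> (a \<otimes> b) = a \<otimes> (c \<odot> b)"
    and even_submodule: "submodule (even_part A) complex_ring A"
    and odd_submodule: "submodule (odd_part A) complex_ring A"
    and parts_inter: "even_part A \<inter> odd_part A = {\<zero>}"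
    and parts_span: "a \<in> carrier A \<Longrightarrow> \<exists>b\<in>even_part A. \<exists>c\<in>odd_part A. a = b \<oplus> c"
    and one_even: "\<one> \<in> even_part A"
    and even_even: "\<lbrakk>a \<in> even_part A; b \<in> even_part A\<rbrakk> \<Longrightarrow> a \<otimes> b \<in> even_part A"
    and even_odd: "\<lbrakk>a \<in> even_part A; b \<in> odd_part A\<rbrakk> \<Longrightarrow> a \<otimes> b \<in> odd_part A"
    and odd_even: "\<lbrakk>a \<in> odd_part A; b \<in> even_part A\<rbrakk> \<Longrightarrow> a \<otimes> b \<in> odd_part A"
    and odd_odd: "\<lbrakk>a \<in> odd_part A; b \<in> odd_part A\<rbrakk> \<Longrightarrow> a \<otimes> b \<in> even_part A"
    and even_comm: "\<lbrakk>a \<in> even_part A; b \<in> carrier A\<rbrakk> \<Longrightarrow> a \<otimes> b = b \<otimes> a"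
    and odd_anticomm: "\<lbrakk>a \<in> odd_part A; b \<in> odd_part A\<rbrakk> \<Longrightarrow> a \<otimes> b = \<ominus> (b \<otimes> a)"

definition superalg_hom ::
  "(complex, 's) superalg \<Rightarrow> (complex, 't) superalg \<Rightarrow> ('s \<Rightarrow> 't) set" where
  "superalg_hom A B = {h \<in> ring_hom A B.
     (\<forall>c. \<forall>a\<in>carrier A. h (c \<odot>\<^bsub>A\<^esub> a) = c \<odot>\<^bsub>B\<^esub> h a) \<and>
     h ` even_part A \<subseteq> even_part B \<and> h ` odd_part A \<subseteq> odd_part B}"

definition superalg_iso ::
  "(complex, 's) superalg \<Rightarrow> (complex, 't) superalg \<Rightarrow> ('s \<Rightarrow> 't) set" where
  "superalg_iso A B = {h \<in> superalg_hom A B. bij_betw h (carrier A) (carrier B)}"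


section \<open>Sheaves of commutative superalgebras\<close>

text \<open>\<open>Res P U V\<close> restricts sections from \<open>U\<close> to \<open>V\<close>.\<close>

record ('p, 's) presheaf =
  Sec :: "'p set \<Rightarrow> (complex, 's) superalg"
  Res :: "'p set \<Rightarrow> 'p set \<Rightarrow> 's \<Rightarrow> 's"

definition superalg_presheaf :: "'p topology \<Rightarrow> ('p, 's) presheaf \<Rightarrow> bool" where
  "superalg_presheaf X P \<longleftrightarrow>
     (\<forall>U. openin X U \<longrightarrow> comm_superalgebra (Sec P U)) \<and>
     (\<forall>U V. openin X U \<and> openin X V \<and> V \<subseteq> U \<longrightarrow>
        Res P U V \<in> superalg_hom (Sec P U) (Sec P V)) \<and>
     (\<forall>U. openin X U \<longrightarrow> (\<forall>s\<in>carrier (Sec P U). Res P U U s = s)) \<and>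
     (\<forall>U V W. openin X U \<and> openin X V \<and> openin X W \<and> W \<subseteq> V \<and> V \<subseteq> U \<longrightarrow>
        (\<forall>s\<in>carrier (Sec P U). Res P V W (Res P U V s) = Res P U W s))"

definition superalg_sheaf :: "'p topology \<Rightarrow> ('p, 's) presheaf \<Rightarrow> bool" where
  "superalg_sheaf X P \<longleftrightarrow>
     superalg_presheaf X P \<and>
     (\<forall>\<U> s.
        (\<forall>V\<in>\<U>. openin X V \<and> s V \<in> carrier (Sec P V)) \<and>
        (\<forall>V\<in>\<U>. \<forall>W\<in>\<U>. Res P V (V \<inter> W) (s V) = Res P W (V \<inter> W) (s W)) \<longrightarrow>
        (\<exists>!t. t \<in> carrier (Sec P (\<Union>\<U>)) \<and> (\<forall>V\<in>\<U>. Res P (\<Union>\<U>) V t = s V)))"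

text \<open>Isomorphism, over the identity of \<open>U\<close>, of the restrictions to the open set \<open>U\<close>.\<close>

definition sheaf_isomorphic_on ::
  "'p topology \<Rightarrow> 'p set \<Rightarrow> ('p, 's) presheaf \<Rightarrow> ('p, 't) presheaf \<Rightarrow> bool" where
  "sheaf_isomorphic_on X U P Q \<longleftrightarrow>
     (\<exists>\<theta>. (\<forall>V. openin X V \<and> V \<subseteq> U \<longrightarrow> \<theta> V \<in> superalg_iso (Sec P V) (Sec Q V)) \<and>
          (\<forall>V W. openin X V \<and> openin X W \<and> W \<subseteq> V \<and> V \<subseteq> U \<longrightarrow>
             (\<forall>s\<in>carrier (Sec P V). \<theta> W (Res P V W s) = Res Q V W (\<theta> V s))))"


section \<open>Complex supermanifolds\<close>

text \<open>
  The sheaf of holomorphic functions tensored with the exterior algebra of an \<open>m\<close>-dimensional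
  space: \<open>F I\<close> is the coefficient of the monomial \<open>\<xi>\<^sub>I\<close>, the product of the generators
  with index in \<open>I\<close> in increasing order, so \<open>\<xi>\<^sub>I \<xi>\<^sub>J\<close> is \<open>shuffle_sign I J\<close> times the
  monomial of the union if \<open>I\<close> and \<open>J\<close> are disjoint, and 0 otherwise.
\<close>

definition shuffle_sign :: "nat set \<Rightarrow> nat set \<Rightarrow> complex" where
  "shuffle_sign I J = (-1) ^ card {(i, j). i \<in> I \<and> j \<in> J \<and> j < i}"

definition super_hol :: "'p cmanifold \<Rightarrow> nat \<Rightarrow> ('p, nat set \<Rightarrow> 'p \<Rightarrow> complex) presheaf" where
  "super_hol M m =
     \<lparr>Sec = (\<lambda>U.
       let C = Pow {..<m} \<rightarrow>\<^sub>E hol M U in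
       \<lparr>carrier = C,
        mult = (\<lambda>F G. \<lambda>K\<in>Pow {..<m}. \<lambda>x\<in>U.
                  \<Sum>I\<in>Pow K. shuffle_sign I (K - I) * F I x * G (K - I) x),
        one = (\<lambda>K\<in>Pow {..<m}. \<lambda>x\<in>U. if K = {} then 1 else 0),
        zero = (\<lambda>K\<in>Pow {..<m}. \<lambda>x\<in>U. 0),
        add = (\<lambda>F G. \<lambda>K\<in>Pow {..<m}. \<lambda>x\<in>U. F K x + G K x),
        smult = (\<lambda>c F. \<lambda>K\<in>Pow {..<m}. \<lambda>x\<in>U. c * F K x),
        even_part = {F \<in> C. \<forall>K\<in>Pow {..<m}. odd (card K) \<longrightarrow> F K = (\<lambda>x\<in>U. 0)},
        odd_part = {F \<in> C. \<forall>K\<in>Pow {..<m}. even (card K) \<longrightarrow> F K = (\<lambda>x\<in>U. 0)}\<rparr>),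
      Res = (\<lambda>U V F. \<lambda>K\<in>Pow {..<m}. restrict (F K) V)\<rparr>"

record ('p, 's) superspace =
  body   :: "'p cmanifold"
  osheaf :: "('p, 's) presheaf"

abbreviation sm_top :: "('p, 's) superspace \<Rightarrow> 'p topology" where
  "sm_top X \<equiv> mtop (body X)"

definition supermanifold :: "('p, 's) superspace \<Rightarrow> bool" where
  "supermanifold X \<longleftrightarrow>
     complex_manifold (body X) \<and>
     superalg_sheaf (sm_top X) (osheaf X) \<and>
     (\<exists>m. \<forall>x\<in>topspace (sm_top X). \<exists>U. openin (sm_top X) U \<and> x \<in> U \<and>
        sheaf_isomorphic_on (sm_top X) U (osheaf X) (super_hol (body X) m))"


section \<open>Split supermanifolds\<close>

text \<open>
  A holomorphic vector bundle as a family of complex vector spaces (the fibres; the ring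
  multiplication in the module record plays no role) with a bundle atlas: local trivialisations
  \<open>(U, \<Phi>)\<close>, \<open>\<Phi> x\<close> being a linear isomorphism from the fibre at \<open>x\<close> onto
  \<open>Cn (rank B)\<close>, with holomorphic transition functions.
\<close>

record ('p, 'v) vbundle =
  rank  :: nat
  fibre :: "'p \<Rightarrow> (complex, 'v) module"
  trivs :: "('p set \<times> ('p \<Rightarrow> 'v \<Rightarrow> nat \<Rightarrow> complex)) set"

definition holomorphic_vector_bundle :: "'p cmanifold \<Rightarrow> ('p, 'v) vbundle \<Rightarrow> bool" where
  "holomorphic_vector_bundle M B \<longleftrightarrow>
     (\<forall>x\<in>topspace (mtop M). module complex_ring (fibre B x)) \<and>
     \<Union>(fst ` trivs B) = topspace (mtop M) \<and>
     (\<forall>(U, \<Phi>)\<in>trivs B. openin (mtop M) U \<and>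
        (\<forall>x\<in>U. bij_betw (\<Phi> x) (carrier (fibre B x)) (Cn (rank B)) \<and>
           (\<forall>a\<in>carrier (fibre B x). \<forall>b\<in>carrier (fibre B x).
              \<Phi> x (a \<oplus>\<^bsub>fibre B x\<^esub> b) = (\<lambda>j. \<Phi> x a j + \<Phi> x b j)) \<and>
           (\<forall>c. \<forall>a\<in>carrier (fibre B x). \<Phi> x (c \<odot>\<^bsub>fibre B x\<^esub> a) = (\<lambda>j. c * \<Phi> x a j)))) \<and>
     (\<forall>(U, \<Phi>)\<in>trivs B. \<forall>(V, \<Psi>)\<in>trivs B. \<forall>w\<in>Cn (rank B). \<forall>j<rank B.
        (\<lambda>x\<in>U \<inter> V. \<Psi> x (inv_into (carrier (fibre B x)) (\<Phi> x) w) j) \<in> hol M (U \<inter> V))"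

text \<open>The \<open>hol_ring M U\<close>-module of holomorphic sections over \<open>U\<close>.\<close>

definition hol_sections ::
  "'p cmanifold \<Rightarrow> ('p, 'v) vbundle \<Rightarrow> 'p set \<Rightarrow> ('p \<Rightarrow> complex, 'p \<Rightarrow> 'v) module" where
  "hol_sections M B U =
     \<lparr>carrier = {s \<in> extensional U.
        (\<forall>x\<in>U. s x \<in> carrier (fibre B x)) \<and>
        (\<forall>(V, \<Phi>)\<in>trivs B. \<forall>j<rank B. (\<lambda>x\<in>U \<inter> V. \<Phi> x (s x) j) \<in> hol M (U \<inter> V))},
      mult = undefined, one = undefined,
      zero = (\<lambda>x\<in>U. \<zero>\<^bsub>fibre B x\<^esub>),
      add = (\<lambda>s t. \<lambda>x\<in>U. s x \<oplus>\<^bsub>fibre B x\<^esub> t x),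
      smult = (\<lambda>f s. \<lambda>x\<in>U. f x \<odot>\<^bsub>fibre B x\<^esub> s x)\<rparr>"

text \<open>
  The free associative \<open>R\<close>-algebra on a set \<open>X\<close>: finitely supported \<open>R\<close>-valued functions
  on words in \<open>X\<close>.
\<close>

definition free_alg :: "('r, 'z) ring_scheme \<Rightarrow> 'e set \<Rightarrow> ('r, 'e list \<Rightarrow> 'r) module" where
  "free_alg R X =
     \<lparr>carrier = {f. (\<forall>w. f w \<in> carrier R) \<and> finite {w. f w \<noteq> \<zero>\<^bsub>R\<^esub>} \<and>
                    (\<forall>w. f w \<noteq> \<zero>\<^bsub>R\<^esub> \<longrightarrow> set w \<subseteq> X)},
      mult = (\<lambda>f g w. \<Oplus>\<^bsub>R\<^esub>k\<in>{..length w}. f (take k w) \<otimes>\<^bsub>R\<^esub> g (drop k w)),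
      one = (\<lambda>w. if w = [] then \<one>\<^bsub>R\<^esub> else \<zero>\<^bsub>R\<^esub>),
      zero = (\<lambda>w. \<zero>\<^bsub>R\<^esub>),
      add = (\<lambda>f g w. f w \<oplus>\<^bsub>R\<^esub> g w),
      smult = (\<lambda>a f w. a \<otimes>\<^bsub>R\<^esub> f w)\<rparr>"

definition word :: "('r, 'z) ring_scheme \<Rightarrow> 'e list \<Rightarrow> 'e list \<Rightarrow> 'r" where
  "word R u = (\<lambda>w. if w = u then \<one>\<^bsub>R\<^esub> else \<zero>\<^bsub>R\<^esub>)"

text \<open>
  The exterior algebra of the \<open>R\<close>-module \<open>E\<close> is the tensor algebra modulo the squares of
  elements of \<open>E\<close>.  The relations of the tensor algebra (linearity of the inclusion of
  \<open>E\<close>) and the squares are divided out of the free algebra in a single step.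
\<close>

definition ext_ideal :: "('r, 'z) ring_scheme \<Rightarrow> ('r, 'e, 'y) module_scheme \<Rightarrow> ('e list \<Rightarrow> 'r) set" where
  "ext_ideal R E = (let A = free_alg R (carrier E) in
     Idl\<^bsub>A\<^esub>
       ({word R [x \<oplus>\<^bsub>E\<^esub> y] \<ominus>\<^bsub>A\<^esub> (word R [x] \<oplus>\<^bsub>A\<^esub> word R [y]) | x y.
           x \<in> carrier E \<and> y \<in> carrier E} \<union>
        {word R [a \<odot>\<^bsub>E\<^esub> x] \<ominus>\<^bsub>A\<^esub> (a \<odot>\<^bsub>A\<^esub> word R [x]) | a x.
           a \<in> carrier R \<and> x \<in> carrier E} \<union>
        {word R [x] \<otimes>\<^bsub>A\<^esub> word R [x] | x. x \<in> carrier E}))"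

definition ext_alg ::
  "('r, 'z) ring_scheme \<Rightarrow> ('r, 'e, 'y) module_scheme \<Rightarrow> ('r, ('e list \<Rightarrow> 'r) set) superalg" where
  "ext_alg R E = (let A = free_alg R (carrier E); I = ext_ideal R E in
     \<lparr>carrier = carrier (A Quot I), mult = mult (A Quot I), one = one (A Quot I),
      zero = zero (A Quot I), add = add (A Quot I),
      smult = (\<lambda>a C. \<Union>f\<in>C. I +>\<^bsub>A\<^esub> (a \<odot>\<^bsub>A\<^esub> f)),
      even_part = {I +>\<^bsub>A\<^esub> f | f. f \<in> carrier A \<and> (\<forall>w. odd (length w) \<longrightarrow> f w = \<zero>\<^bsub>R\<^esub>)},
      odd_part = {I +>\<^bsub>A\<^esub> f | f. f \<in> carrier A \<and> (\<forall>w. even (length w) \<longrightarrow> f w = \<zero>\<^bsub>R\<^esub>)}\<rparr>)"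

text \<open>
  The presheaf of exterior algebras of the modules of sections.  Complex scalars act through
  constant functions.  The restriction maps restrict the coefficients and the letters of words;
  the union over the representatives of a coset is a union of equal cosets.
\<close>

definition restrict_words ::
  "'p cmanifold \<Rightarrow> 'p set \<Rightarrow> (('p \<Rightarrow> 'v) list \<Rightarrow> 'p \<Rightarrow> complex) \<Rightarrow> ('p \<Rightarrow> 'v) list \<Rightarrow> 'p \<Rightarrow> complex" where
  "restrict_words M V f = (\<lambda>w.
     \<Oplus>\<^bsub>hol_ring M V\<^esub>u\<in>{u. restrict (f u) V \<noteq> \<zero>\<^bsub>hol_ring M V\<^esub> \<and> map (\<lambda>s. restrict s V) u = w}.
       restrict (f u) V)"

definition ext_presheaf ::
  "'p cmanifold \<Rightarrow> ('p, 'v) vbundle \<Rightarrow> ('p, (('p \<Rightarrow> 'v) list \<Rightarrow> 'p \<Rightarrow> complex) set) presheaf" where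
  "ext_presheaf M B =
     \<lparr>Sec = (\<lambda>U. let L = ext_alg (hol_ring M U) (hol_sections M B U) in
        \<lparr>carrier = carrier L, mult = mult L, one = one L, zero = zero L, add = add L,
         smult = (\<lambda>c. smult L (\<lambda>x\<in>U. c)),
         even_part = even_part L, odd_part = odd_part L\<rparr>),
      Res = (\<lambda>U V C.
        \<Union>f\<in>C. ext_ideal (hol_ring M V) (hol_sections M B V)
                 +>\<^bsub>free_alg (hol_ring M V) (carrier (hol_sections M B V))\<^esub> restrict_words M V f)\<rparr>"

text \<open>
  Sheafification: sections over \<open>U\<close> are the families of germs which locally come from
  sections of the presheaf.  A germ at \<open>x\<close> is the set of all its representatives, and the
  operations on germs are again unions of equal sets.
\<close>

definition germ ::
  "'p topology \<Rightarrow> ('p, 's) presheaf \<Rightarrow> 'p \<Rightarrow> 'p set \<Rightarrow> 's \<Rightarrow> ('p set \<times> 's) set" where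
  "germ X P x V s = {(W, t). openin X W \<and> x \<in> W \<and> t \<in> carrier (Sec P W) \<and>
     (\<exists>N. openin X N \<and> x \<in> N \<and> N \<subseteq> V \<inter> W \<and> Res P V N s = Res P W N t)}"

definition germ_map ::
  "'p topology \<Rightarrow> ('p, 's) presheaf \<Rightarrow> ('p set \<Rightarrow> 's \<Rightarrow> 's) \<Rightarrow> 'p \<Rightarrow>
   ('p set \<times> 's) set \<Rightarrow> ('p set \<times> 's) set" where
  "germ_map X P f x a = (\<Union>(N, s)\<in>a. germ X P x N (f N s))"

definition germ_map2 ::
  "'p topology \<Rightarrow> ('p, 's) presheaf \<Rightarrow> ('p set \<Rightarrow> 's \<Rightarrow> 's \<Rightarrow> 's) \<Rightarrow> 'p \<Rightarrow>
   ('p set \<times> 's) set \<Rightarrow> ('p set \<times> 's) set \<Rightarrow> ('p set \<times> 's) set" where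
  "germ_map2 X P f x a b = \<Union>{germ X P x N (f N s t) | N s t. (N, s) \<in> a \<and> (N, t) \<in> b}"

definition local_germs ::
  "'p topology \<Rightarrow> ('p, 's) presheaf \<Rightarrow> ('p set \<Rightarrow> 's set) \<Rightarrow> 'p set \<Rightarrow>
   ('p \<Rightarrow> ('p set \<times> 's) set) set" where
  "local_germs X P S U = {\<sigma> \<in> extensional U. \<forall>x\<in>U. \<exists>V s.
     openin X V \<and> x \<in> V \<and> V \<subseteq> U \<and> s \<in> S V \<and> (\<forall>y\<in>V. \<sigma> y = germ X P y V s)}"

definition sheafify ::
  "'p topology \<Rightarrow> ('p, 's) presheaf \<Rightarrow> ('p, 'p \<Rightarrow> ('p set \<times> 's) set) presheaf" where
  "sheafify X P =
     \<lparr>Sec = (\<lambda>U.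
        \<lparr>carrier = local_germs X P (\<lambda>V. carrier (Sec P V)) U,
         mult = (\<lambda>\<sigma> \<tau>. \<lambda>x\<in>U. germ_map2 X P (\<lambda>N. mult (Sec P N)) x (\<sigma> x) (\<tau> x)),
         one = (\<lambda>x\<in>U. germ X P x U \<one>\<^bsub>Sec P U\<^esub>),
         zero = (\<lambda>x\<in>U. germ X P x U \<zero>\<^bsub>Sec P U\<^esub>),
         add = (\<lambda>\<sigma> \<tau>. \<lambda>x\<in>U. germ_map2 X P (\<lambda>N. add (Sec P N)) x (\<sigma> x) (\<tau> x)),
         smult = (\<lambda>c \<sigma>. \<lambda>x\<in>U. germ_map X P (\<lambda>N. smult (Sec P N) c) x (\<sigma> x)),
         even_part = local_germs X P (\<lambda>V. even_part (Sec P V)) U,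
         odd_part = local_germs X P (\<lambda>V. odd_part (Sec P V)) U\<rparr>),
      Res = (\<lambda>U V \<sigma>. restrict \<sigma> V)\<rparr>"

definition exterior_sheaf ::
  "'p cmanifold \<Rightarrow> ('p, 'v) vbundle \<Rightarrow>
   ('p, 'p \<Rightarrow> ('p set \<times> (('p \<Rightarrow> 'v) list \<Rightarrow> 'p \<Rightarrow> complex) set) set) presheaf" where
  "exterior_sheaf M B = sheafify (mtop M) (ext_presheaf M B)"

text \<open>
  Every holomorphic vector bundle is isomorphic to one whose fibres are carried by
  \<open>Cn (rank B)\<close>, so it is no restriction to fix the type containing the fibres.
\<close>

definition split_supermanifold :: "('p, 's) superspace \<Rightarrow> bool" where
  "split_supermanifold X \<longleftrightarrow>
     supermanifold X \<and>
     (\<exists>B :: ('p, nat \<Rightarrow> complex) vbundle.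
        holomorphic_vector_bundle (body X) B \<and>
        sheaf_isomorphic_on (sm_top X) (topspace (sm_top X))
          (osheaf X) (exterior_sheaf (body X) B))"


section \<open>The category of complex supermanifolds\<close>

text \<open>
  Morphisms are morphisms of superringed spaces, with \<open>pull f W\<close> mapping sections over an open
  \<open>W\<close> in the target to sections over its preimage; holomorphy of the underlying map is
  automatic.  All components are extensional, so that equality of morphisms is equality in HOL.
\<close>

record ('p, 's) supermap =
  sdom :: "('p, 's) superspace"
  scod :: "('p, 's) superspace"
  pmap :: "'p \<Rightarrow> 'p"
  pull :: "'p set \<Rightarrow> 's \<Rightarrow> 's"

definition preimg :: "('p, 's) supermap \<Rightarrow> 'p set \<Rightarrow> 'p set" where
  "preimg f W = {x \<in> topspace (sm_top (sdom f)). pmap f x \<in> W}"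

definition is_supermap :: "('p, 's) supermap \<Rightarrow> bool" where
  "is_supermap f \<longleftrightarrow>
     pmap f \<in> extensional (topspace (sm_top (sdom f))) \<and>
     continuous_map (sm_top (sdom f)) (sm_top (scod f)) (pmap f) \<and>
     pull f \<in> extensional {W. openin (sm_top (scod f)) W} \<and>
     (\<forall>W. openin (sm_top (scod f)) W \<longrightarrow>
        pull f W \<in> extensional (carrier (Sec (osheaf (scod f)) W)) \<and>
        pull f W \<in> superalg_hom (Sec (osheaf (scod f)) W) (Sec (osheaf (sdom f)) (preimg f W))) \<and>
     (\<forall>V W. openin (sm_top (scod f)) V \<and> openin (sm_top (scod f)) W \<and> W \<subseteq> V \<longrightarrow>
        (\<forall>s\<in>carrier (Sec (osheaf (scod f)) V).
           pull f W (Res (osheaf (scod f)) V W s) =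
           Res (osheaf (sdom f)) (preimg f V) (preimg f W) (pull f V s)))"

record ('o, 'a) category =
  Obj  :: "'o set"
  Hom  :: "'o \<Rightarrow> 'o \<Rightarrow> 'a set"
  Comp :: "'a \<Rightarrow> 'a \<Rightarrow> 'a"
  Ident :: "'o \<Rightarrow> 'a"

definition SMan :: "(('p, 's) superspace, ('p, 's) supermap) category" where
  "SMan =
     \<lparr>Obj = Collect supermanifold,
      Hom = (\<lambda>X Y. {f. is_supermap f \<and> sdom f = X \<and> scod f = Y}),
      Comp = (\<lambda>g f.
        \<lparr>sdom = sdom f, scod = scod g,
         pmap = (\<lambda>x\<in>topspace (sm_top (sdom f)). pmap g (pmap f x)),
         pull = (\<lambda>W\<in>{W. openin (sm_top (scod g)) W}.
                   \<lambda>s\<in>carrier (Sec (osheaf (scod g)) W). pull f (preimg g W) (pull g W s))\<rparr>),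
      Ident = (\<lambda>X.
        \<lparr>sdom = X, scod = X,
         pmap = (\<lambda>x\<in>topspace (sm_top X). x),
         pull = (\<lambda>W\<in>{W. openin (sm_top X) W}. \<lambda>s\<in>carrier (Sec (osheaf X) W). s)\<rparr>)\<rparr>"


section \<open>Group objects\<close>

definition is_terminal :: "('o, 'a) category \<Rightarrow> 'o \<Rightarrow> bool" where
  "is_terminal C E \<longleftrightarrow> E \<in> Obj C \<and> (\<forall>T\<in>Obj C. \<exists>!h. h \<in> Hom C T E)"

definition is_product :: "('o, 'a) category \<Rightarrow> 'o \<Rightarrow> 'o \<Rightarrow> 'o \<Rightarrow> 'a \<Rightarrow> 'a \<Rightarrow> bool" where
  "is_product C A B P p q \<longleftrightarrow>
     P \<in> Obj C \<and> p \<in> Hom C P A \<and> q \<in> Hom C P B \<and>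
     (\<forall>T\<in>Obj C. \<forall>a\<in>Hom C T A. \<forall>b\<in>Hom C T B.
        \<exists>!h. h \<in> Hom C T P \<and> Comp C p h = a \<and> Comp C q h = b)"

definition to_terminal :: "('o, 'a) category \<Rightarrow> 'o \<Rightarrow> 'o \<Rightarrow> 'a" where
  "to_terminal C E T = (THE h. h \<in> Hom C T E)"

definition pairing :: "('o, 'a) category \<Rightarrow> 'o \<Rightarrow> 'a \<Rightarrow> 'a \<Rightarrow> 'o \<Rightarrow> 'a \<Rightarrow> 'a \<Rightarrow> 'a" where
  "pairing C P p q T a b = (THE h. h \<in> Hom C T P \<and> Comp C p h = a \<and> Comp C q h = b)"

text \<open>
  \<open>E\<close> is terminal, \<open>P\<close> is the product of \<open>G\<close> with itself and \<open>Q\<close> that of \<open>P\<close>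
  with \<open>G\<close>; \<open>mu\<close>, \<open>e\<close>, \<open>iota\<close> are the multiplication, the unit and the inversion.
\<close>

locale group_object =
  fixes C :: "('o, 'a) category" and G E P Q :: 'o and p q r s mu e iota :: 'a
  assumes obj: "G \<in> Obj C"
    and terminal: "is_terminal C E"
    and product2: "is_product C G G P p q"
    and product3: "is_product C P G Q r s"
    and mu: "mu \<in> Hom C P G"
    and e: "e \<in> Hom C E G"
    and iota: "iota \<in> Hom C G G"
    and assoc:
      "Comp C mu (pairing C P p q Q (Comp C mu r) s) =
       Comp C mu (pairing C P p q Q (Comp C p r)
         (Comp C mu (pairing C P p q Q (Comp C q r) s)))"
    and unit_left:
      "Comp C mu (pairing C P p q G (Comp C e (to_terminal C E G)) (Ident C G)) = Ident C G"
    and unit_right: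
      "Comp C mu (pairing C P p q G (Ident C G) (Comp C e (to_terminal C E G))) = Ident C G"
    and inv_left:
      "Comp C mu (pairing C P p q G iota (Ident C G)) = Comp C e (to_terminal C E G)"
    and inv_right:
      "Comp C mu (pairing C P p q G (Ident C G) iota) = Comp C e (to_terminal C E G)"

text \<open>
  The category consists of the supermanifolds whose points and sections are taken from the types
  \<open>'p\<close> and \<open>'s\<close> of \<open>G\<close>.  If both types have at least the cardinality of the continuum, every
  supermanifold is isomorphic to one of these.
\<close>

definition complex_Lie_supergroup :: "('p, 's) superspace \<Rightarrow> bool" where
  "complex_Lie_supergroup G \<longleftrightarrow> (\<exists>E P Q p q r s mu e iota. group_object SMan G E P Q p q r s mu e iota)"

end

theory Submission
  imports Defs
begin

text \<open>
  A complex Lie supergroup \<open>G\<close> of odd dimension \<open>m\<close> is trivialized by its own multiplication.  Let \<open>M\<close> be the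
  underlying complex manifold, and let \<open>T\<close> be the product of \<open>M\<close> with the purely odd space of
  dimension \<open>m\<close>; its sections are the superfunctions, that is the holomorphic functions with values in the exterior
  algebra on \<open>m\<close> generators.  There are two morphisms from \<open>T\<close> to \<open>G\<close>: the first one forgets the odd parameters
  and includes \<open>M\<close> into \<open>G\<close> (\<open>reduced_inclusion\<close>), the second one forgets the point of \<open>M\<close> and
  maps the odd parameters to an odd disc \<open>b\<close> through the unit (\<open>odd_disc\<close>).  Their product in the group of
  \<open>T\<close>-valued points of \<open>G\<close>, that is \<open>(g, \<xi>) \<mapsto> g b(\<xi>)\<close>, is an isomorphism from \<open>T\<close> to \<open>G\<close>, and \<open>T\<close> is split
  by construction: its sheaf is the exterior sheaf of the trivial bundle of rank \<open>m\<close>.  So the bundle in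
  the theorem is even trivial.

  The reduced inclusion exists because a section \<open>s\<close> has a value at each point \<open>x\<close>, which can be characterized
  intrinsically as the only number \<open>c\<close> such that \<open>s - c\<close> is not invertible near \<open>x\<close>.  For the same reason every
  homomorphism from a stalk to the complex numbers is the evaluation (\<open>character_is_val\<close>).  This determines the
  morphisms to \<open>G\<close> that factor through a reduced point, and it shows that the product map above is the
  identity on points (\<open>h_pmap\<close>).

  It remains to see that the pullback \<open>\<kappa>\<close> along the product map, a homomorphism from the structure sheaf of \<open>G\<close> to
  superfunctions, is bijective; this is a local question (\<open>locally_bij_imp_bij\<close>).  Left translation by
  \<open>g\<^sup>-\<^sup>1\<close> maps \<open>g b(\<xi>)\<close> to \<open>b(\<xi>)\<close>, so that the translates of the odd coordinates at the unit are odd sections near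
  \<open>g\<close> which \<open>\<kappa>\<close> maps to the odd generators, as far as the fibre at \<open>g\<close> is concerned
  (\<open>kappa_odd_coordinates\<close>).  Gaussian elimination makes their linear parts equal to the
  generators in a whole neighbourhood (\<open>normalize_coordinates\<close>).  In a trivialization, \<open>\<kappa>\<close> thus becomes an
  endomorphism of the algebra of superfunctions which preserves values and hits the generators up to terms of higher
  order.  It is surjective by induction over the powers of the nilpotent ideal
  (\<open>value_preserving_surj\<close>), and injective because it multiplies the top exterior power by an
  invertible function (\<open>value_preserving_inj\<close>).

  The definition of the exterior sheaf is by generators and relations followed by sheafification.  Modulo
  the relations every word in sections of the trivial bundle can be rewritten in terms of increasing words in the basis
  sections, whose values in the exterior algebra are independent; therefore evaluation identifies the exterior algebra of the
  module of sections with superfunctions (\<open>word_eval_kernel\<close>, \<open>word_eval_surj\<close>).  Superfunctions form a sheaf, so that sheafification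
  changes nothing (\<open>sheafify_super_hol\<close>).

  The objects of the category have points and sections in fixed types.  This is harmless for \<open>T\<close>, because superfunctions are
  determined by their values on a countable dense set and can be named by elements of any type that contains the sections of a
  nonempty supermanifold (\<open>S_inj\<close>).
\<close>

section \<open>The exterior algebra in terms of coefficients\<close>

text \<open>The coefficients of a product in the exterior algebra.\<close>

definition wedge :: "(nat set \<Rightarrow> complex) \<Rightarrow> (nat set \<Rightarrow> complex) \<Rightarrow> nat set \<Rightarrow> complex" where
  "wedge f g K = (\<Sum>I\<in>Pow K. shuffle_sign I (K - I) * f I * g (K - I))"

lemma shuffle_sign_empty [simp]: "shuffle_sign {} J = 1" "shuffle_sign I {} = 1"
  by (simp_all add: shuffle_sign_def)

lemma shuffle_sign_square [simp]: "shuffle_sign I J * shuffle_sign I J = 1"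
  by (simp add: shuffle_sign_def flip: power_add mult_2)

lemma shuffle_sign_Un_left:
  assumes "finite I" "finite J" "finite N" "I \<inter> J = {}"
  shows "shuffle_sign (I \<union> J) N = shuffle_sign I N * shuffle_sign J N"
proof -
  let ?P = "\<lambda>I. {(i, j). i \<in> I \<and> j \<in> N \<and> j < i}"
  have "?P (I \<union> J) = ?P I \<union> ?P J" "?P I \<inter> ?P J = {}" using assms(4) by auto
  moreover have "finite (?P I)" "finite (?P J)"
    by (rule finite_subset[of _ "I \<times> N"] finite_subset[of _ "J \<times> N"]; use assms in auto)+
  ultimately show ?thesis by (simp add: shuffle_sign_def card_Un_disjoint power_add)
qed

lemma shuffle_sign_Un_right:
  assumes "finite I" "finite J" "finite N" "J \<inter> N = {}"
  shows "shuffle_sign I (J \<union> N) = shuffle_sign I J * shuffle_sign I N"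
proof -
  let ?P = "\<lambda>J. {(i, j). i \<in> I \<and> j \<in> J \<and> j < i}"
  have "?P (J \<union> N) = ?P J \<union> ?P N" "?P J \<inter> ?P N = {}" using assms(4) by auto
  moreover have "finite (?P J)" "finite (?P N)"
    by (rule finite_subset[of _ "I \<times> J"] finite_subset[of _ "I \<times> N"]; use assms in auto)+
  ultimately show ?thesis by (simp add: shuffle_sign_def card_Un_disjoint power_add)
qed

lemma shuffle_sign_commute:
  assumes "finite I" "finite J" "I \<inter> J = {}"
  shows "shuffle_sign J I = (-1) ^ (card I * card J) * shuffle_sign I J"
proof -
  let ?P = "{(i, j). i \<in> I \<and> j \<in> J \<and> j < i}" and ?Q = "{(j, i). j \<in> J \<and> i \<in> I \<and> i < j}"
  have "card ?Q = card (prod.swap ` ?Q)" by (rule card_image[symmetric]) auto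
  also have "prod.swap ` ?Q = {(i, j). i \<in> I \<and> j \<in> J \<and> i < j}" by (auto simp: image_iff)
  finally have Q: "card ?Q = card {(i, j). i \<in> I \<and> j \<in> J \<and> i < j}" .
  have "I \<times> J = ?P \<union> {(i, j). i \<in> I \<and> j \<in> J \<and> i < j}" 
    using assms(3) by (auto simp: neq_iff dest: linorder_neqE_nat)
  moreover have "?P \<inter> {(i, j). i \<in> I \<and> j \<in> J \<and> i < j} = {}" by auto
  moreover have "finite ?P" "finite {(i, j). i \<in> I \<and> j \<in> J \<and> i < j}"
    by (rule finite_subset[of _ "I \<times> J"]; use assms in auto)+
  ultimately have "card I * card J = card ?P + card ?Q"
    unfolding Q by (simp only: card_Un_disjoint flip: card_cartesian_product)
  moreover have "(-1 :: complex) ^ (p + q) * (-1) ^ p = (-1) ^ q" for p q :: nat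
    by (induction p) auto
  ultimately show ?thesis by (simp add: shuffle_sign_def)
qed

lemma wedge_cong:
  assumes "\<And>I. I \<subseteq> K \<Longrightarrow> f I = f' I" "\<And>I. I \<subseteq> K \<Longrightarrow> g I = g' I"
  shows "wedge f g K = wedge f' g' K"
  unfolding wedge_def by (rule sum.cong) (use assms in auto)

text \<open>Both sides are sums over all partitions of \<open>K\<close> into three parts; the signs agree because
  \<open>shuffle_sign\<close> is multiplicative under disjoint unions in each argument.\<close>

lemma wedge_assoc:
  assumes "finite K"
  shows "wedge (wedge f g) h K = wedge f (wedge g h) K"
proof -
  let ?t = "\<lambda>I J N. shuffle_sign I (J \<union> N) * shuffle_sign J N * f I * g J * h N"
  have fin: "finite L" if "L \<subseteq> K" for L using assms that finite_subset by blast
  have d: "K - I - (L - I) = K - L" "(L - I) \<union> (K - I) = (L - I) \<union> (K - L)" if "I \<subseteq> L" "L \<subseteq> K" for I L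
    using that by auto
  have "wedge (wedge f g) h K = (\<Sum>L\<in>Pow K. \<Sum>I\<in>Pow L. ?t I (L - I) (K - L))"
    unfolding wedge_def sum_distrib_left sum_distrib_right
  proof (intro sum.cong refl)
    fix L I assume L: "L \<in> Pow K" and I: "I \<in> Pow L"
    have "shuffle_sign L (K - L) * shuffle_sign I (L - I) =
        shuffle_sign I (L - I) * shuffle_sign I (K - L) * shuffle_sign (L - I) (K - L)"
      using shuffle_sign_Un_left[of I "L - I" "K - L"] L I fin
      by (auto simp: Un_absorb1 mult_ac)
    also have "shuffle_sign I (L - I) * shuffle_sign I (K - L) = shuffle_sign I ((L - I) \<union> (K - L))"
      by (rule shuffle_sign_Un_right[symmetric]) (use L I fin in auto)
    finally show "shuffle_sign L (K - L) * (shuffle_sign I (L - I) * f I * g (L - I)) * h (K - L) =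
        ?t I (L - I) (K - L)" by (simp add: algebra_simps)
  qed
  also have "\<dots> = (\<Sum>(L, I)\<in>Sigma (Pow K) Pow. ?t I (L - I) (K - L))"
    using fin by (subst sum.Sigma) (auto simp: assms)
  also have "\<dots> = (\<Sum>(I, J)\<in>Sigma (Pow K) (\<lambda>I. Pow (K - I)). ?t I J (K - I - J))"
    by (rule sum.reindex_bij_witness[of _ "\<lambda>(I, J). (I \<union> J, I)" "\<lambda>(L, I). (I, L - I)"])
      (auto simp: d)
  also have "\<dots> = (\<Sum>I\<in>Pow K. \<Sum>J\<in>Pow (K - I). ?t I J (K - I - J))"
    using fin by (subst sum.Sigma) (auto simp: assms)
  also have "\<dots> = wedge f (wedge g h) K"
    unfolding wedge_def sum_distrib_left sum_distrib_right
    by (intro sum.cong refl) (auto simp: algebra_simps Un_absorb1)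
  finally show ?thesis .
qed

lemma wedge_one_left: "finite K \<Longrightarrow> wedge (\<lambda>K. if K = {} then c else 0) g K = c * g K"
  unfolding wedge_def
  by (subst sum.mono_neutral_right[of _ "{{}}"]) auto

lemma wedge_one_right: "finite K \<Longrightarrow> wedge f (\<lambda>K. if K = {} then c else 0) K = f K * c"
  unfolding wedge_def
  by (subst sum.mono_neutral_right[of _ "{K}"]) auto

lemma wedge_add_left: "wedge (\<lambda>K. f K + f' K) g K = wedge f g K + wedge f' g K"
  by (simp add: wedge_def algebra_simps sum.distrib)

lemma wedge_add_right: "wedge f (\<lambda>K. g K + g' K) K = wedge f g K + wedge f g' K"
  by (simp add: wedge_def algebra_simps sum.distrib)

lemma wedge_scale_left: "wedge (\<lambda>K. c * f K) g K = c * wedge f g K"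
  by (simp add: wedge_def algebra_simps sum_distrib_left)

lemma wedge_scale_right: "wedge f (\<lambda>K. c * g K) K = c * wedge f g K"
  by (simp add: wedge_def algebra_simps sum_distrib_left)

lemma wedge_sum_left: "wedge (\<lambda>K. \<Sum>i\<in>A. f i K) g K = (\<Sum>i\<in>A. wedge (f i) g K)"
  unfolding wedge_def by (subst sum.swap) (simp add: sum_distrib_left sum_distrib_right)

lemma wedge_sum_right: "wedge f (\<lambda>K. \<Sum>i\<in>A. g i K) K = (\<Sum>i\<in>A. wedge f (g i) K)"
  unfolding wedge_def by (subst sum.swap) (simp add: sum_distrib_left sum_distrib_right)

lemma wedge_reverse:
  assumes "finite K"
  shows "wedge f g K = (\<Sum>I\<in>Pow K. (-1) ^ (card I * card (K - I)) * shuffle_sign I (K - I) * f (K - I) * g I)"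
proof -
  have "wedge f g K = (\<Sum>I\<in>Pow K. shuffle_sign (K - I) I * f (K - I) * g I)"
    unfolding wedge_def
    by (rule sum.reindex_bij_witness[of _ "\<lambda>I. K - I" "\<lambda>I. K - I"]) (auto simp: double_diff)
  also have "\<dots> = (\<Sum>I\<in>Pow K. (-1) ^ (card I * card (K - I)) * shuffle_sign I (K - I) * f (K - I) * g I)"
    using assms by (intro sum.cong refl) (subst shuffle_sign_commute, auto intro: finite_subset)
  finally show ?thesis .
qed

lemma wedge_even_commute:
  assumes "finite K" "\<And>I. I \<subseteq> K \<Longrightarrow> odd (card I) \<Longrightarrow> f I = 0"
  shows "wedge f g K = wedge g f K"
  unfolding wedge_reverse[OF assms(1), of g f] unfolding wedge_def
proof (intro sum.cong refl)
  fix I assume "I \<in> Pow K"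
  then show "shuffle_sign I (K - I) * f I * g (K - I) =
      (-1) ^ (card I * card (K - I)) * shuffle_sign I (K - I) * g (K - I) * f I"
    using assms(2)[of I] by (cases "even (card I)") auto
qed

lemma wedge_odd_anticommute:
  assumes "finite K" "\<And>I. I \<subseteq> K \<Longrightarrow> even (card I) \<Longrightarrow> f I = 0" "\<And>I. I \<subseteq> K \<Longrightarrow> even (card I) \<Longrightarrow> g I = 0"
  shows "wedge f g K = - wedge g f K"
  unfolding wedge_reverse[OF assms(1), of g f] unfolding wedge_def sum_negf[symmetric]
proof (intro sum.cong refl)
  fix I assume "I \<in> Pow K"
  then show "shuffle_sign I (K - I) * f I * g (K - I) =
      - ((-1) ^ (card I * card (K - I)) * shuffle_sign I (K - I) * g (K - I) * f I)"
    using assms(2)[of I] assms(3)[of "K - I"]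
    by (cases "even (card I)"; cases "even (card (K - I))") auto
qed

lemma wedge_parity:
  assumes "finite K" "\<And>I. I \<subseteq> K \<Longrightarrow> odd (card I + p) \<Longrightarrow> f I = 0" "\<And>I. I \<subseteq> K \<Longrightarrow> odd (card I + q) \<Longrightarrow> g I = 0"
    and "odd (card K + p + q)"
  shows "wedge f g K = 0"
  unfolding wedge_def
proof (intro sum.neutral ballI)
  fix I assume I: "I \<in> Pow K"
  then have "card K = card I + card (K - I)"
    by (metis Pow_iff assms(1) card_Diff_subset card_mono finite_subset le_add_diff_inverse)
  then have "odd (card I + p) \<or> odd (card (K - I) + q)" using assms(4) by auto
  then show "shuffle_sign I (K - I) * f I * g (K - I) = 0"
    using assms(2)[of I] assms(3)[of "K - I"] I by auto
qed


section \<open>Holomorphic functions\<close>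

text \<open>Equality on \<open>W\<close> is enough because moving one coordinate slightly does not leave the relatively open
  set \<open>W\<close>.\<close>

lemma holo_cong:
  assumes W: "openin (top_of_set (Cn n)) W" and fg: "\<And>z. z \<in> W \<Longrightarrow> f z = g z" and f: "holo n W f"
  shows "holo n W g"
  unfolding holo_def
proof (intro conjI ballI allI impI)
  show "continuous_on W g" using f fg by (metis (no_types, lifting) continuous_on_cong holo_def)
next
  fix z i assume z: "z \<in> W" and i: "i < n"
  obtain T where T: "open T" "W = Cn n \<inter> T" using W by (metis openin_open)
  have c: "continuous_on UNIV (\<lambda>t. z(i := t))"
  proof (rule continuous_on_coordinatewise_then_product)
    show "continuous_on UNIV (\<lambda>t. (z(i := t)) j)" for j by (cases "j = i") auto
  qed
  have "open ((\<lambda>t. z(i := t)) -` T)" using c T(1) by (simp add: open_vimage)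
  moreover have "z i \<in> (\<lambda>t. z(i := t)) -` T" using z T by simp
  moreover have "f (z(i := t)) = g (z(i := t))" if "t \<in> (\<lambda>t. z(i := t)) -` T" for t
    using that z T i by (intro fg) (auto simp: Cn_def)
  moreover have "(\<lambda>t. f (z(i := t))) field_differentiable (at (z i))"
    using f z i by (simp add: holo_def)
  ultimately show "(\<lambda>t. g (z(i := t))) field_differentiable (at (z i))"
    unfolding field_differentiable_def by (metis (no_types, lifting) has_field_derivative_transform_within_open)
qed

lemma holo_subset: "holo n W f \<Longrightarrow> W' \<subseteq> W \<Longrightarrow> holo n W' f"
  unfolding holo_def using continuous_on_subset by blast

lemma holo_local:
  assumes "\<And>z. z \<in> W \<Longrightarrow> \<exists>N. openin (top_of_set W) N \<and> z \<in> N \<and> holo n N f"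
  shows "holo n W f"
  unfolding holo_def
proof (intro conjI)
  show "continuous_on W f" unfolding continuous_on_eq_continuous_within
  proof
    fix z assume "z \<in> W"
    then obtain N T where N: "N = W \<inter> T" "open T" "z \<in> N" "holo n N f"
      using assms by (metis openin_open)
    have "at z within W = at z within N" by (rule at_within_nhd[of _ T]) (use N in auto)
    then show "continuous (at z within W) f"
      using N by (metis continuous_on_eq_continuous_within holo_def)
  qed
  show "\<forall>z\<in>W. \<forall>i<n. (\<lambda>t. f (z(i := t))) field_differentiable at (z i)"
    using assms unfolding holo_def by metis
qed

lemma holo_const: "holo n W (\<lambda>z. c)" by (simp add: holo_def)

lemma holo_add: "holo n W f \<Longrightarrow> holo n W g \<Longrightarrow> holo n W (\<lambda>z. f z + g z)"
  by (auto simp: holo_def intro!: continuous_intros field_differentiable_add)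

lemma holo_mult: "holo n W f \<Longrightarrow> holo n W g \<Longrightarrow> holo n W (\<lambda>z. f z * g z)"
  by (auto simp: holo_def intro!: continuous_intros field_differentiable_mult)

lemma holo_inverse: "holo n W f \<Longrightarrow> (\<And>z. z \<in> W \<Longrightarrow> f z \<noteq> 0) \<Longrightarrow> holo n W (\<lambda>z. inverse (f z))"
  by (auto simp: holo_def intro!: continuous_intros field_differentiable_inverse)

locale cman =
  fixes M :: "'p cmanifold"
  assumes M: "complex_manifold M"
begin

abbreviation X where "X \<equiv> mtop M"
abbreviation n where "n \<equiv> mdim M"

lemma chart:
  assumes "(V, \<phi>) \<in> atlas M"
  shows "openin X V" "openin (top_of_set (Cn n)) (\<phi> ` V)" 
    "homeomorphic_map (subtopology X V) (top_of_set (\<phi> ` V)) \<phi>"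
  using M assms unfolding complex_manifold_def by auto

lemma chart_inj: "(V, \<phi>) \<in> atlas M \<Longrightarrow> inj_on \<phi> V"
  using chart[of V \<phi>] by (metis homeomorphic_eq_everything_map topspace_subtopology_subset openin_subset)

lemma chart_cover: "x \<in> topspace X \<Longrightarrow> \<exists>V \<phi>. (V, \<phi>) \<in> atlas M \<and> x \<in> V"
  using M unfolding complex_manifold_def by (smt (verit, best) UN_E eq_fst_iff)

lemma chart_open:
  assumes "(V, \<phi>) \<in> atlas M" "openin X U"
  shows "openin (top_of_set (Cn n)) (\<phi> ` (U \<inter> V))"
proof -
  have "openin (subtopology X V) (U \<inter> V)" using assms by (simp add: openin_subtopology_Int)
  then have "openin (top_of_set (\<phi> ` V)) (\<phi> ` (U \<inter> V))"
    using chart(3)[OF assms(1)] by (meson homeomorphic_imp_open_map open_map_def)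
  then show ?thesis using chart(2)[OF assms(1)] openin_trans by blast
qed

lemma chart_inv: "(V, \<phi>) \<in> atlas M \<Longrightarrow> x \<in> V \<Longrightarrow> inv_into V \<phi> (\<phi> x) = x"
  by (simp add: chart_inj)

lemma holI:
  assumes "openin X U" "f \<in> extensional U"
    and "\<And>V \<phi>. (V, \<phi>) \<in> atlas M \<Longrightarrow> \<exists>g. holo n (\<phi> ` (U \<inter> V)) g \<and> (\<forall>x\<in>U \<inter> V. g (\<phi> x) = f x)"
  shows "f \<in> hol M U"
  unfolding hol_def
proof (intro CollectI conjI ballI, rule assms(2), clarify)
  fix V \<phi> assume V: "(V, \<phi>) \<in> atlas M"
  then obtain g where g: "holo n (\<phi> ` (U \<inter> V)) g" "\<forall>x\<in>U \<inter> V. g (\<phi> x) = f x" using assms(3) by blast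
  show "holo n (\<phi> ` (U \<inter> V)) (\<lambda>z. f (inv_into V \<phi> z))"
    by (rule holo_cong[OF chart_open[OF V assms(1)] _ g(1)]) (use g(2) chart_inv[OF V] in auto)
qed

lemma holD: "f \<in> hol M U \<Longrightarrow> (V, \<phi>) \<in> atlas M \<Longrightarrow> holo n (\<phi> ` (U \<inter> V)) (\<lambda>z. f (inv_into V \<phi> z))"
  unfolding hol_def by blast

lemma hol_ext: "f \<in> hol M U \<Longrightarrow> f \<in> extensional U" unfolding hol_def by blast

lemma hol_const: "openin X U \<Longrightarrow> (\<lambda>x\<in>U. c) \<in> hol M U"
  by (rule holI) (auto intro!: exI[of _ "\<lambda>z. c"] holo_const)

lemma hol_add:
  assumes U: "openin X U" and f: "f \<in> hol M U" and g: "g \<in> hol M U"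
  shows "(\<lambda>x\<in>U. f x + g x) \<in> hol M U"
proof (rule holI)
  fix V \<phi> assume V: "(V, \<phi>) \<in> atlas M"
  show "\<exists>h. holo n (\<phi> ` (U \<inter> V)) h \<and> (\<forall>x\<in>U \<inter> V. h (\<phi> x) = (\<lambda>x\<in>U. f x + g x) x)"
    by (rule exI[of _ "\<lambda>z. f (inv_into V \<phi> z) + g (inv_into V \<phi> z)"])
      (auto intro!: holo_add[OF holD[OF f V] holD[OF g V]] simp: chart_inv[OF V])
qed (auto simp: U)

lemma hol_mult:
  assumes U: "openin X U" and f: "f \<in> hol M U" and g: "g \<in> hol M U"
  shows "(\<lambda>x\<in>U. f x * g x) \<in> hol M U"
proof (rule holI)
  fix V \<phi> assume V: "(V, \<phi>) \<in> atlas M"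
  show "\<exists>h. holo n (\<phi> ` (U \<inter> V)) h \<and> (\<forall>x\<in>U \<inter> V. h (\<phi> x) = (\<lambda>x\<in>U. f x * g x) x)"
    by (rule exI[of _ "\<lambda>z. f (inv_into V \<phi> z) * g (inv_into V \<phi> z)"])
      (auto intro!: holo_mult[OF holD[OF f V] holD[OF g V]] simp: chart_inv[OF V])
qed (auto simp: U)

lemma hol_cmult: "openin X U \<Longrightarrow> f \<in> hol M U \<Longrightarrow> (\<lambda>x\<in>U. c * f x) \<in> hol M U"
  using hol_mult[OF _ hol_const[of U c]] by (simp cong: restrict_cong)

lemma hol_uminus: "openin X U \<Longrightarrow> f \<in> hol M U \<Longrightarrow> (\<lambda>x\<in>U. - f x) \<in> hol M U"
  using hol_cmult[of U f "-1"] by simp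

lemma hol_inverse:
  assumes U: "openin X U" and f: "f \<in> hol M U" and nz: "\<And>x. x \<in> U \<Longrightarrow> f x \<noteq> 0"
  shows "(\<lambda>x\<in>U. inverse (f x)) \<in> hol M U"
proof (rule holI)
  fix V \<phi> assume V: "(V, \<phi>) \<in> atlas M"
  show "\<exists>h. holo n (\<phi> ` (U \<inter> V)) h \<and> (\<forall>x\<in>U \<inter> V. h (\<phi> x) = (\<lambda>x\<in>U. inverse (f x)) x)"
    by (rule exI[of _ "\<lambda>z. inverse (f (inv_into V \<phi> z))"])
      (auto intro!: holo_inverse[OF holD[OF f V]] simp: chart_inv[OF V] nz)
qed (auto simp: U)

lemma hol_sum:
  assumes "openin X U" "\<And>i. i \<in> A \<Longrightarrow> (\<lambda>x\<in>U. f i x) \<in> hol M U"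
  shows "(\<lambda>x\<in>U. \<Sum>i\<in>A. f i x) \<in> hol M U"
  using assms(2)
proof (induction A rule: infinite_finite_induct)
  case (insert a A)
  have "(\<lambda>x\<in>U. (\<lambda>x\<in>U. f a x) x + (\<lambda>x\<in>U. \<Sum>i\<in>A. f i x) x) \<in> hol M U"
    by (rule hol_add) (use insert assms in auto)
  then show ?case by (rule back_subst[of "\<lambda>f. f \<in> hol M U"]) (use insert in \<open>auto simp: restrict_def\<close>)
qed (use assms hol_const in auto)

lemma hol_restrict:
  assumes "openin X V" "V \<subseteq> U" "f \<in> hol M U"
  shows "restrict f V \<in> hol M V"
proof (rule holI)
  fix W \<phi> assume W: "(W, \<phi>) \<in> atlas M"
  have "holo n (\<phi> ` (V \<inter> W)) (\<lambda>z. f (inv_into W \<phi> z))"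
    by (rule holo_subset[OF holD[OF assms(3) W]]) (use assms in auto)
  then show "\<exists>g. holo n (\<phi> ` (V \<inter> W)) g \<and> (\<forall>x\<in>V \<inter> W. g (\<phi> x) = restrict f V x)"
    using chart_inv[OF W] by auto
qed (use assms in auto)

lemma hol_local:
  assumes "openin X U" "f \<in> extensional U"
    and loc: "\<And>x. x \<in> U \<Longrightarrow> \<exists>N. openin X N \<and> x \<in> N \<and> N \<subseteq> U \<and> restrict f N \<in> hol M N"
  shows "f \<in> hol M U"
proof (rule holI[OF assms(1,2)])
  fix V \<phi> assume V: "(V, \<phi>) \<in> atlas M"
  have "holo n (\<phi> ` (U \<inter> V)) (\<lambda>z. f (inv_into V \<phi> z))"
  proof (rule holo_local)
    fix z assume "z \<in> \<phi> ` (U \<inter> V)"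
    then obtain x where x: "x \<in> U" "x \<in> V" "z = \<phi> x" by auto
    obtain N where N: "openin X N" "x \<in> N" "N \<subseteq> U" "restrict f N \<in> hol M N" using loc[OF x(1)] by auto
    have o: "openin (top_of_set (Cn n)) (\<phi> ` (N \<inter> V))" by (rule chart_open[OF V N(1)])
    have "openin (top_of_set (\<phi> ` (U \<inter> V))) (\<phi> ` (N \<inter> V))"
      by (rule openin_subset_trans[OF o]) (use N openin_imp_subset[OF chart_open[OF V assms(1)]] in auto)
    moreover have "holo n (\<phi> ` (N \<inter> V)) (\<lambda>z. f (inv_into V \<phi> z))"
      by (rule holo_cong[OF o _ holD[OF N(4) V]]) (auto simp: chart_inv[OF V])
    ultimately show "\<exists>N. openin (top_of_set (\<phi> ` (U \<inter> V))) N \<and> z \<in> N \<and> holo n N (\<lambda>z. f (inv_into V \<phi> z))"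
      using x N by blast
  qed
  then show "\<exists>g. holo n (\<phi> ` (U \<inter> V)) g \<and> (\<forall>x\<in>U \<inter> V. g (\<phi> x) = f x)"
    using chart_inv[OF V] by auto
qed

lemma hol_continuous:
  assumes "openin X U" "f \<in> hol M U"
  shows "continuous_map (subtopology X U) euclidean f"
proof -
  have "continuous_map (subtopology X (U \<inter> V)) euclidean f" if V: "(V, \<phi>) \<in> atlas M" for V \<phi>
  proof -
    have "continuous_map (subtopology X (U \<inter> V)) (top_of_set (\<phi> ` (U \<inter> V))) \<phi>"
    proof -
      have "continuous_map (subtopology X V) (top_of_set (\<phi> ` V)) \<phi>"
        using chart(3)[OF V] homeomorphic_imp_continuous_map by blast
      then have "continuous_map (subtopology (subtopology X V) (U \<inter> V)) (top_of_set (\<phi> ` V)) \<phi>"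
        by (rule continuous_map_from_subtopology)
      then have "continuous_map (subtopology X (U \<inter> V)) euclidean \<phi>"
        by (simp add: subtopology_subtopology Int_commute Int_left_commute continuous_map_in_subtopology)
      then show ?thesis
        by (simp add: continuous_map_in_subtopology)
    qed
    moreover have "continuous_map (top_of_set (\<phi> ` (U \<inter> V))) euclidean (\<lambda>z. f (inv_into V \<phi> z))"
      using holD[OF assms(2) V] unfolding holo_def by simp
    ultimately have "continuous_map (subtopology X (U \<inter> V)) euclidean ((\<lambda>z. f (inv_into V \<phi> z)) \<circ> \<phi>)"
      by (rule continuous_map_compose)
    then show ?thesis
      by (rule continuous_map_eq) (auto simp: chart_inv[OF V])
  qed
  note * = this
  show ?thesis unfolding continuous_map
  proof (intro conjI allI impI)
    fix T :: "complex set" assume T: "openin euclidean T"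
    have "{x \<in> topspace (subtopology X U). f x \<in> T} =
        \<Union>{{x \<in> U \<inter> V. f x \<in> T} |V \<phi>. (V, \<phi>) \<in> atlas M}"
    proof (intro equalityI subsetI)
      fix x assume x: "x \<in> {x \<in> topspace (subtopology X U). f x \<in> T}"
      then obtain V \<phi> where "(V, \<phi>) \<in> atlas M" "x \<in> V" using chart_cover[of x] by auto
      with x show "x \<in> \<Union>{{x \<in> U \<inter> V. f x \<in> T} |V \<phi>. (V, \<phi>) \<in> atlas M}" by auto
    next
      fix x assume "x \<in> \<Union>{{x \<in> U \<inter> V. f x \<in> T} |V \<phi>. (V, \<phi>) \<in> atlas M}"
      then show "x \<in> {x \<in> topspace (subtopology X U). f x \<in> T}"
        using openin_subset[OF assms(1)] by auto
    qed
    moreover have "openin (subtopology X U) {x \<in> U \<inter> V. f x \<in> T}" if V: "(V, \<phi>) \<in> atlas M" for V \<phi>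
    proof -
      have "openin (subtopology X (U \<inter> V)) {x \<in> topspace (subtopology X (U \<inter> V)). f x \<in> T}"
        using *[OF V] T by (simp add: continuous_map)
      moreover have "topspace (subtopology X (U \<inter> V)) = U \<inter> V"
        using openin_subset[OF assms(1)] by auto
      moreover have "openin X (U \<inter> V)" using assms(1) chart(1)[OF V] by blast
      ultimately have "openin X {x \<in> U \<inter> V. f x \<in> T}" by (metis openin_trans_full)
      then show ?thesis using assms(1) by (simp add: openin_open_subtopology)
    qed
    ultimately show "openin (subtopology X U) {x \<in> topspace (subtopology X U). f x \<in> T}"
      by (simp only:) (rule openin_Union, blast)
  qed auto
qed

lemma hol_open_nonzero:
  assumes "openin X U" "f \<in> hol M U"
  shows "openin X {x \<in> U. f x \<noteq> 0}"
proof -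
  have "openin (subtopology X U) {x \<in> topspace (subtopology X U). f x \<in> - {0}}"
    by (rule openin_continuous_map_preimage[OF hol_continuous[OF assms]]) (simp add: open_Compl)
  moreover have "{x \<in> topspace (subtopology X U). f x \<in> - {0}} = {x \<in> U. f x \<noteq> 0}"
    using openin_subset[OF assms(1)] by auto
  ultimately show ?thesis using openin_trans_full assms(1) by metis
qed

end

section \<open>The sheaf of superfunctions\<close>

lemma complex_ring_simps [simp]:
  "carrier complex_ring = UNIV" "mult complex_ring = (*)" "one complex_ring = 1"
  "zero complex_ring = 0" "add complex_ring = (+)"
  by (simp_all add: complex_ring_def)

lemma cring_complex_ring: "cring complex_ring"
proof (rule cringI)
  show "abelian_group complex_ring"
  proof (rule abelian_groupI)
    fix x show "\<exists>y\<in>carrier complex_ring. y \<oplus>\<^bsub>complex_ring\<^esub> x = \<zero>\<^bsub>complex_ring\<^esub>"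
      by (rule bexI[of _ "- x"]) auto
  qed (auto simp: add_ac)
  show "comm_monoid complex_ring" by unfold_locales (auto simp: mult_ac)
qed (auto simp: algebra_simps)

context cman
begin

abbreviation S where "S m U \<equiv> Sec (super_hol M m) U"

lemma S_carrier: "carrier (S m U) = Pow {..<m} \<rightarrow>\<^sub>E hol M U"
  and S_add: "add (S m U) F G = (\<lambda>K\<in>Pow {..<m}. \<lambda>x\<in>U. F K x + G K x)"
  and S_mult: "mult (S m U) F G = (\<lambda>K\<in>Pow {..<m}. \<lambda>x\<in>U. wedge (\<lambda>I. F I x) (\<lambda>I. G I x) K)"
  and S_zero: "zero (S m U) = (\<lambda>K\<in>Pow {..<m}. \<lambda>x\<in>U. 0)"
  and S_one: "one (S m U) = (\<lambda>K\<in>Pow {..<m}. \<lambda>x\<in>U. if K = {} then 1 else 0)"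
  and S_smult: "smult (S m U) c F = (\<lambda>K\<in>Pow {..<m}. \<lambda>x\<in>U. c * F K x)"
  and S_Res: "Res (super_hol M m) U V F = (\<lambda>K\<in>Pow {..<m}. restrict (F K) V)"
  by (simp_all add: super_hol_def Let_def wedge_def)

lemma S_even: "even_part (S m U) = {F \<in> carrier (S m U). \<forall>K\<in>Pow {..<m}. odd (card K) \<longrightarrow> (\<forall>x\<in>U. F K x = 0)}"
  and S_odd: "odd_part (S m U) = {F \<in> carrier (S m U). \<forall>K\<in>Pow {..<m}. even (card K) \<longrightarrow> (\<forall>x\<in>U. F K x = 0)}"
proof -
  have *: "F K = (\<lambda>x\<in>U. 0) \<longleftrightarrow> (\<forall>x\<in>U. F K x = 0)" if "F \<in> Pow {..<m} \<rightarrow>\<^sub>E hol M U" "K \<subseteq> {..<m}" for F K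
  proof -
    have "F K \<in> extensional U" using that hol_ext by (auto simp: PiE_iff)
    then show ?thesis by (auto simp: extensional_def fun_eq_iff)
  qed
  show "even_part (S m U) = {F \<in> carrier (S m U). \<forall>K\<in>Pow {..<m}. odd (card K) \<longrightarrow> (\<forall>x\<in>U. F K x = 0)}"
    "odd_part (S m U) = {F \<in> carrier (S m U). \<forall>K\<in>Pow {..<m}. even (card K) \<longrightarrow> (\<forall>x\<in>U. F K x = 0)}"
    unfolding S_carrier by (auto simp: super_hol_def Let_def *)
qed

lemma S_parity_carrier:
  "F \<in> even_part (S m U) \<Longrightarrow> F \<in> carrier (S m U)" "F \<in> odd_part (S m U) \<Longrightarrow> F \<in> carrier (S m U)"
  by (auto simp: S_even S_odd)

lemma S_parity_zero:
  "F \<in> even_part (S m U) \<Longrightarrow> K \<subseteq> {..<m} \<Longrightarrow> odd (card K) \<Longrightarrow> x \<in> U \<Longrightarrow> F K x = 0"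
  "F \<in> odd_part (S m U) \<Longrightarrow> K \<subseteq> {..<m} \<Longrightarrow> even (card K) \<Longrightarrow> x \<in> U \<Longrightarrow> F K x = 0"
  by (auto simp: S_even S_odd)

lemma S_evenI: "F \<in> carrier (S m U) \<Longrightarrow>
    (\<And>K x. K \<subseteq> {..<m} \<Longrightarrow> odd (card K) \<Longrightarrow> x \<in> U \<Longrightarrow> F K x = 0) \<Longrightarrow> F \<in> even_part (S m U)"
  and S_oddI: "F \<in> carrier (S m U) \<Longrightarrow>
    (\<And>K x. K \<subseteq> {..<m} \<Longrightarrow> even (card K) \<Longrightarrow> x \<in> U \<Longrightarrow> F K x = 0) \<Longrightarrow> F \<in> odd_part (S m U)"
  by (auto simp: S_even S_odd)

lemma S_hol: "F \<in> carrier (S m U) \<Longrightarrow> K \<subseteq> {..<m} \<Longrightarrow> F K \<in> hol M U"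
  by (auto simp: S_carrier PiE_iff)

lemma S_eqI:
  assumes "F \<in> carrier (S m U)" "G \<in> carrier (S m U)"
    and "\<And>K x. K \<subseteq> {..<m} \<Longrightarrow> x \<in> U \<Longrightarrow> F K x = G K x"
  shows "F = G"
proof (rule PiE_ext)
  show "F \<in> Pow {..<m} \<rightarrow>\<^sub>E hol M U" "G \<in> Pow {..<m} \<rightarrow>\<^sub>E hol M U" using assms by (auto simp: S_carrier)
  fix K assume "K \<in> Pow {..<m}"
  then show "F K = G K"
    using hol_ext[OF S_hol[OF assms(1)]] hol_ext[OF S_hol[OF assms(2)]] assms(3)
    by (intro extensionalityI[of _ U]) auto
qed

lemma S_memI:
  "(\<And>K. K \<subseteq> {..<m} \<Longrightarrow> (\<lambda>x\<in>U. F K x) \<in> hol M U) \<Longrightarrow> (\<lambda>K\<in>Pow {..<m}. \<lambda>x\<in>U. F K x) \<in> carrier (S m U)"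
  by (auto simp: S_carrier)

lemma hol_shift: "f \<in> hol M U \<Longrightarrow> (\<lambda>x\<in>U. f x) \<in> hol M U"
  by (simp add: extensional_restrict[OF hol_ext])

lemma hol_wedge:
  assumes "openin X U" "\<And>I. I \<subseteq> K \<Longrightarrow> F I \<in> hol M U" "\<And>I. I \<subseteq> K \<Longrightarrow> G I \<in> hol M U"
  shows "(\<lambda>x\<in>U. wedge (\<lambda>I. F I x) (\<lambda>I. G I x) K) \<in> hol M U"
  unfolding wedge_def
proof (rule hol_sum[OF assms(1)])
  fix I assume "I \<in> Pow K"
  then have "(\<lambda>x\<in>U. (\<lambda>x\<in>U. shuffle_sign I (K - I) * F I x) x * G (K - I) x) \<in> hol M U"
    by (intro hol_mult hol_cmult assms) auto
  then show "(\<lambda>x\<in>U. shuffle_sign I (K - I) * F I x * G (K - I) x) \<in> hol M U"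
    by (rule back_subst[of "\<lambda>f. f \<in> hol M U"]) auto
qed

context
  fixes m :: nat and U :: "'p set"
  assumes U: "openin X U"
begin

lemmas S_eq = S_eqI[where m = m and U = U]

lemma S_add_closed: "F \<in> carrier (S m U) \<Longrightarrow> G \<in> carrier (S m U) \<Longrightarrow> F \<oplus>\<^bsub>S m U\<^esub> G \<in> carrier (S m U)"
  unfolding S_add by (intro S_memI hol_add U S_hol)

lemma S_mult_closed: "F \<in> carrier (S m U) \<Longrightarrow> G \<in> carrier (S m U) \<Longrightarrow> F \<otimes>\<^bsub>S m U\<^esub> G \<in> carrier (S m U)"
  unfolding S_mult by (intro S_memI hol_wedge U S_hol) auto

lemma S_zero_closed: "\<zero>\<^bsub>S m U\<^esub> \<in> carrier (S m U)"
  unfolding S_zero by (intro S_memI hol_const U)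

lemma S_one_closed: "\<one>\<^bsub>S m U\<^esub> \<in> carrier (S m U)"
  unfolding S_one by (intro S_memI hol_const U)

lemma S_smult_closed: "F \<in> carrier (S m U) \<Longrightarrow> c \<odot>\<^bsub>S m U\<^esub> F \<in> carrier (S m U)"
  unfolding S_smult by (intro S_memI hol_cmult U S_hol)

lemmas S_closed = S_add_closed S_mult_closed S_zero_closed S_one_closed S_smult_closed

lemma S_apply:
  assumes "K \<subseteq> {..<m}" "x \<in> U"
  shows "(F \<oplus>\<^bsub>S m U\<^esub> G) K x = F K x + G K x"
    "(F \<otimes>\<^bsub>S m U\<^esub> G) K x = wedge (\<lambda>I. F I x) (\<lambda>I. G I x) K"
    "\<zero>\<^bsub>S m U\<^esub> K x = 0" "\<one>\<^bsub>S m U\<^esub> K x = (if K = {} then 1 else 0)"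
    "(c \<odot>\<^bsub>S m U\<^esub> F) K x = c * F K x"
  using assms by (simp_all add: S_add S_mult S_zero S_one S_smult)

lemma abelian_group_S: "abelian_group (S m U)"
proof (rule abelian_groupI)
  fix F assume F: "F \<in> carrier (S m U)"
  show "\<exists>G\<in>carrier (S m U). G \<oplus>\<^bsub>S m U\<^esub> F = \<zero>\<^bsub>S m U\<^esub>"
    by (rule bexI[of _ "(-1) \<odot>\<^bsub>S m U\<^esub> F"], rule S_eq) (auto simp: S_apply intro!: S_closed F)
qed (auto intro!: S_closed intro: S_eq[OF S_add_closed S_add_closed] S_eq[OF S_add_closed]
   S_eq[OF S_add_closed[OF S_add_closed] S_add_closed[OF _ S_add_closed]] simp: S_apply add_ac)

lemma fin_gens: "K \<subseteq> {..<m} \<Longrightarrow> finite K" using finite_subset by blast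

lemma S_wedge_apply: 
  assumes "K \<subseteq> {..<m}" "x \<in> U"
  shows "wedge (\<lambda>I. (F \<otimes>\<^bsub>S m U\<^esub> G) I x) (\<lambda>I. H I x) K = wedge (wedge (\<lambda>I. F I x) (\<lambda>I. G I x)) (\<lambda>I. H I x) K"
    "wedge (\<lambda>I. H I x) (\<lambda>I. (F \<otimes>\<^bsub>S m U\<^esub> G) I x) K = wedge (\<lambda>I. H I x) (wedge (\<lambda>I. F I x) (\<lambda>I. G I x)) K"
    "wedge (\<lambda>I. (F \<oplus>\<^bsub>S m U\<^esub> G) I x) (\<lambda>I. H I x) K = wedge (\<lambda>I. F I x) (\<lambda>I. H I x) K + wedge (\<lambda>I. G I x) (\<lambda>I. H I x) K"
    "wedge (\<lambda>I. H I x) (\<lambda>I. (F \<oplus>\<^bsub>S m U\<^esub> G) I x) K = wedge (\<lambda>I. H I x) (\<lambda>I. F I x) K + wedge (\<lambda>I. H I x) (\<lambda>I. G I x) K"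
    "wedge (\<lambda>I. (c \<odot>\<^bsub>S m U\<^esub> F) I x) (\<lambda>I. H I x) K = c * wedge (\<lambda>I. F I x) (\<lambda>I. H I x) K"
    "wedge (\<lambda>I. H I x) (\<lambda>I. (c \<odot>\<^bsub>S m U\<^esub> F) I x) K = c * wedge (\<lambda>I. H I x) (\<lambda>I. F I x) K"
    "wedge (\<lambda>I. \<one>\<^bsub>S m U\<^esub> I x) (\<lambda>I. H I x) K = H K x"
    "wedge (\<lambda>I. H I x) (\<lambda>I. \<one>\<^bsub>S m U\<^esub> I x) K = H K x"
proof -
  note * = order_trans[OF _ assms(1)]
  show "wedge (\<lambda>I. (F \<otimes>\<^bsub>S m U\<^esub> G) I x) (\<lambda>I. H I x) K = wedge (wedge (\<lambda>I. F I x) (\<lambda>I. G I x)) (\<lambda>I. H I x) K"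
    "wedge (\<lambda>I. H I x) (\<lambda>I. (F \<otimes>\<^bsub>S m U\<^esub> G) I x) K = wedge (\<lambda>I. H I x) (wedge (\<lambda>I. F I x) (\<lambda>I. G I x)) K"
    by (rule wedge_cong; simp add: S_apply * assms)+
  show "wedge (\<lambda>I. (F \<oplus>\<^bsub>S m U\<^esub> G) I x) (\<lambda>I. H I x) K = wedge (\<lambda>I. F I x) (\<lambda>I. H I x) K + wedge (\<lambda>I. G I x) (\<lambda>I. H I x) K"
    "wedge (\<lambda>I. H I x) (\<lambda>I. (F \<oplus>\<^bsub>S m U\<^esub> G) I x) K = wedge (\<lambda>I. H I x) (\<lambda>I. F I x) K + wedge (\<lambda>I. H I x) (\<lambda>I. G I x) K"
    by (subst wedge_add_left[symmetric] wedge_add_right[symmetric], rule wedge_cong; simp add: S_apply * assms)+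
  show "wedge (\<lambda>I. (c \<odot>\<^bsub>S m U\<^esub> F) I x) (\<lambda>I. H I x) K = c * wedge (\<lambda>I. F I x) (\<lambda>I. H I x) K"
    "wedge (\<lambda>I. H I x) (\<lambda>I. (c \<odot>\<^bsub>S m U\<^esub> F) I x) K = c * wedge (\<lambda>I. H I x) (\<lambda>I. F I x) K"
    by (subst wedge_scale_left[symmetric] wedge_scale_right[symmetric], rule wedge_cong; simp add: S_apply * assms)+
  have "wedge (\<lambda>I. \<one>\<^bsub>S m U\<^esub> I x) (\<lambda>I. H I x) K = wedge (\<lambda>I. if I = {} then 1 else 0) (\<lambda>I. H I x) K"
    "wedge (\<lambda>I. H I x) (\<lambda>I. \<one>\<^bsub>S m U\<^esub> I x) K = wedge (\<lambda>I. H I x) (\<lambda>I. if I = {} then 1 else 0) K"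
    by (rule wedge_cong; simp add: S_apply * assms)+
  then show "wedge (\<lambda>I. \<one>\<^bsub>S m U\<^esub> I x) (\<lambda>I. H I x) K = H K x"
    "wedge (\<lambda>I. H I x) (\<lambda>I. \<one>\<^bsub>S m U\<^esub> I x) K = H K x"
    by (simp_all add: wedge_one_left wedge_one_right fin_gens assms)
qed

lemma S_mult_assoc:
  assumes "F \<in> carrier (S m U)" "G \<in> carrier (S m U)" "H \<in> carrier (S m U)"
  shows "F \<otimes>\<^bsub>S m U\<^esub> G \<otimes>\<^bsub>S m U\<^esub> H = F \<otimes>\<^bsub>S m U\<^esub> (G \<otimes>\<^bsub>S m U\<^esub> H)"
  by (rule S_eq) (auto intro!: S_closed assms simp: S_apply S_wedge_apply wedge_assoc fin_gens)

lemma ring_S: "ring (S m U)"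
proof (rule ringI[OF abelian_group_S])
  show "monoid (S m U)"
  proof (rule monoidI)
    fix F assume F: "F \<in> carrier (S m U)"
    show "\<one>\<^bsub>S m U\<^esub> \<otimes>\<^bsub>S m U\<^esub> F = F" "F \<otimes>\<^bsub>S m U\<^esub> \<one>\<^bsub>S m U\<^esub> = F"
      by (rule S_eq; simp add: S_closed F S_apply S_wedge_apply)+
  qed (auto intro: S_closed S_mult_assoc)
next
  fix F G H assume F: "F \<in> carrier (S m U)" "G \<in> carrier (S m U)" "H \<in> carrier (S m U)"
  show "(F \<oplus>\<^bsub>S m U\<^esub> G) \<otimes>\<^bsub>S m U\<^esub> H = F \<otimes>\<^bsub>S m U\<^esub> H \<oplus>\<^bsub>S m U\<^esub> G \<otimes>\<^bsub>S m U\<^esub> H"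
    "H \<otimes>\<^bsub>S m U\<^esub> (F \<oplus>\<^bsub>S m U\<^esub> G) = H \<otimes>\<^bsub>S m U\<^esub> F \<oplus>\<^bsub>S m U\<^esub> H \<otimes>\<^bsub>S m U\<^esub> G"
    by (rule S_eq; simp add: S_closed F S_apply S_wedge_apply)+
qed

lemma module_S: "module complex_ring (S m U)"
proof (rule moduleI[OF cring_complex_ring abelian_group_S])
  fix a b F assume F: "F \<in> carrier (S m U)"
  show "(a \<oplus>\<^bsub>complex_ring\<^esub> b) \<odot>\<^bsub>S m U\<^esub> F = a \<odot>\<^bsub>S m U\<^esub> F \<oplus>\<^bsub>S m U\<^esub> b \<odot>\<^bsub>S m U\<^esub> F"
    "(a \<otimes>\<^bsub>complex_ring\<^esub> b) \<odot>\<^bsub>S m U\<^esub> F = a \<odot>\<^bsub>S m U\<^esub> (b \<odot>\<^bsub>S m U\<^esub> F)"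
    "\<one>\<^bsub>complex_ring\<^esub> \<odot>\<^bsub>S m U\<^esub> F = F"
    by (rule S_eq; simp add: S_closed F S_apply algebra_simps)+
  fix G assume G: "G \<in> carrier (S m U)"
  show "a \<odot>\<^bsub>S m U\<^esub> (F \<oplus>\<^bsub>S m U\<^esub> G) = a \<odot>\<^bsub>S m U\<^esub> F \<oplus>\<^bsub>S m U\<^esub> a \<odot>\<^bsub>S m U\<^esub> G"
    by (rule S_eq; simp add: S_closed F G S_apply algebra_simps)
qed (auto intro: S_closed)

lemma S_uminus:
  assumes "F \<in> carrier (S m U)"
  shows "\<ominus>\<^bsub>S m U\<^esub> F = (-1) \<odot>\<^bsub>S m U\<^esub> F"
proof -
  interpret abelian_group "S m U" by (rule abelian_group_S)
  show ?thesis
    by (rule minus_equality, rule S_eq) (auto simp: S_apply intro!: S_closed assms)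
qed

lemma comm_superalgebra_S: "comm_superalgebra (S m U)"
proof (intro comm_superalgebra.intro ring_S module_S comm_superalgebra_axioms.intro)
  interpret module complex_ring "S m U" by (rule module_S)
  show "submodule (even_part (S m U)) complex_ring (S m U)" "submodule (odd_part (S m U)) complex_ring (S m U)"
    by (intro submoduleI; auto simp: S_even S_odd S_closed S_apply S_uminus)+
  show "even_part (S m U) \<inter> odd_part (S m U) = {\<zero>\<^bsub>S m U\<^esub>}"
  proof (intro equalityI subsetI)
    fix F assume "F \<in> even_part (S m U) \<inter> odd_part (S m U)"
    then have F: "F \<in> carrier (S m U)" "\<forall>K\<in>Pow {..<m}. \<forall>x\<in>U. F K x = 0" unfolding S_even S_odd by auto
    show "F \<in> {\<zero>\<^bsub>S m U\<^esub>}" unfolding singleton_iff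
      by (rule S_eq) (use F in \<open>auto simp: S_apply intro: S_closed\<close>)
  qed (auto simp: S_even S_odd S_closed S_apply)
next
  fix F assume F: "F \<in> carrier (S m U)"
  let ?E = "\<lambda>p. \<lambda>K\<in>Pow {..<m}. \<lambda>x\<in>U. (if p (card K) then 1 else 0) * F K x"
  have E: "?E p \<in> carrier (S m U)" for p by (intro S_memI hol_cmult U S_hol[OF F])
  show "\<exists>b\<in>even_part (S m U). \<exists>c\<in>odd_part (S m U). F = b \<oplus>\<^bsub>S m U\<^esub> c"
    by (rule bexI[of _ "?E even"], rule bexI[of _ "?E odd"], rule S_eq[OF F S_add_closed[OF E E]])
      (use E in \<open>auto simp: S_even S_odd S_apply\<close>)
next
  show "\<one>\<^bsub>S m U\<^esub> \<in> even_part (S m U)" by (auto simp: S_even S_closed S_apply)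
next
  fix c :: complex and F G assume F: "F \<in> carrier (S m U)" "G \<in> carrier (S m U)"
  show "c \<odot>\<^bsub>S m U\<^esub> (F \<otimes>\<^bsub>S m U\<^esub> G) = (c \<odot>\<^bsub>S m U\<^esub> F) \<otimes>\<^bsub>S m U\<^esub> G"
    "c \<odot>\<^bsub>S m U\<^esub> (F \<otimes>\<^bsub>S m U\<^esub> G) = F \<otimes>\<^bsub>S m U\<^esub> (c \<odot>\<^bsub>S m U\<^esub> G)"
    by (rule S_eq; simp add: S_closed F S_apply S_wedge_apply)+
next
  fix F G assume F: "F \<in> even_part (S m U)" and G: "G \<in> even_part (S m U)"
  show "F \<otimes>\<^bsub>S m U\<^esub> G \<in> even_part (S m U)"
  proof (rule S_evenI)
    fix K x assume K: "K \<subseteq> {..<m}" "odd (card K)" "x \<in> U"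
    have "wedge (\<lambda>I. F I x) (\<lambda>I. G I x) K = 0"
      by (rule wedge_parity[where p = 0 and q = 0])
        (use K F G in \<open>auto simp: fin_gens S_parity_zero dest: order_trans[OF _ K(1)]\<close>)
    then show "(F \<otimes>\<^bsub>S m U\<^esub> G) K x = 0" using K by (simp add: S_apply)
  qed (use F G in \<open>auto intro: S_closed S_parity_carrier\<close>)
next
  fix F G assume F: "F \<in> even_part (S m U)" and G: "G \<in> odd_part (S m U)"
  show "F \<otimes>\<^bsub>S m U\<^esub> G \<in> odd_part (S m U)"
  proof (rule S_oddI)
    fix K x assume K: "K \<subseteq> {..<m}" "even (card K)" "x \<in> U"
    have "wedge (\<lambda>I. F I x) (\<lambda>I. G I x) K = 0"
      by (rule wedge_parity[where p = 0 and q = 1])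
        (use K F G in \<open>auto simp: fin_gens S_parity_zero dest: order_trans[OF _ K(1)]\<close>)
    then show "(F \<otimes>\<^bsub>S m U\<^esub> G) K x = 0" using K by (simp add: S_apply)
  qed (use F G in \<open>auto intro: S_closed S_parity_carrier\<close>)
next
  fix F G assume F: "F \<in> odd_part (S m U)" and G: "G \<in> even_part (S m U)"
  show "F \<otimes>\<^bsub>S m U\<^esub> G \<in> odd_part (S m U)"
  proof (rule S_oddI)
    fix K x assume K: "K \<subseteq> {..<m}" "even (card K)" "x \<in> U"
    have "wedge (\<lambda>I. F I x) (\<lambda>I. G I x) K = 0"
      by (rule wedge_parity[where p = 1 and q = 0])
        (use K F G in \<open>auto simp: fin_gens S_parity_zero dest: order_trans[OF _ K(1)]\<close>)
    then show "(F \<otimes>\<^bsub>S m U\<^esub> G) K x = 0" using K by (simp add: S_apply)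
  qed (use F G in \<open>auto intro: S_closed S_parity_carrier\<close>)
next
  fix F G assume F: "F \<in> odd_part (S m U)" and G: "G \<in> odd_part (S m U)"
  show "F \<otimes>\<^bsub>S m U\<^esub> G \<in> even_part (S m U)"
  proof (rule S_evenI)
    fix K x assume K: "K \<subseteq> {..<m}" "odd (card K)" "x \<in> U"
    have "wedge (\<lambda>I. F I x) (\<lambda>I. G I x) K = 0"
      by (rule wedge_parity[where p = 1 and q = 1])
        (use K F G in \<open>auto simp: fin_gens S_parity_zero dest: order_trans[OF _ K(1)]\<close>)
    then show "(F \<otimes>\<^bsub>S m U\<^esub> G) K x = 0" using K by (simp add: S_apply)
  qed (use F G in \<open>auto intro: S_closed S_parity_carrier\<close>)
  have c: "F \<in> carrier (S m U)" "G \<in> carrier (S m U)" using F G by (auto intro: S_parity_carrier)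
  show "F \<otimes>\<^bsub>S m U\<^esub> G = \<ominus>\<^bsub>S m U\<^esub> (G \<otimes>\<^bsub>S m U\<^esub> F)"
  proof (rule S_eq)
    fix K x assume K: "K \<subseteq> {..<m}" "x \<in> U"
    have "wedge (\<lambda>I. F I x) (\<lambda>I. G I x) K = - wedge (\<lambda>I. G I x) (\<lambda>I. F I x) K"
      by (rule wedge_odd_anticommute)
        (use K F G in \<open>auto simp: fin_gens S_parity_zero dest: order_trans[OF _ K(1)]\<close>)
    then show "(F \<otimes>\<^bsub>S m U\<^esub> G) K x = (\<ominus>\<^bsub>S m U\<^esub> (G \<otimes>\<^bsub>S m U\<^esub> F)) K x"
      using K c by (simp add: S_apply S_uminus S_closed)
  qed (use c in \<open>simp_all add: S_uminus S_closed\<close>)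
next
  fix F G assume F: "F \<in> even_part (S m U)" and G: "G \<in> carrier (S m U)"
  have c: "F \<in> carrier (S m U)" using F by (rule S_parity_carrier)
  show "F \<otimes>\<^bsub>S m U\<^esub> G = G \<otimes>\<^bsub>S m U\<^esub> F"
  proof (rule S_eq)
    fix K x assume K: "K \<subseteq> {..<m}" "x \<in> U"
    have "wedge (\<lambda>I. F I x) (\<lambda>I. G I x) K = wedge (\<lambda>I. G I x) (\<lambda>I. F I x) K"
      by (rule wedge_even_commute)
        (use K F in \<open>auto simp: fin_gens S_parity_zero dest: order_trans[OF _ K(1)]\<close>)
    then show "(F \<otimes>\<^bsub>S m U\<^esub> G) K x = (G \<otimes>\<^bsub>S m U\<^esub> F) K x" using K by (simp add: S_apply)
  qed (use c G in \<open>simp_all add: S_closed\<close>)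
qed

end

lemma S_Res_closed:
  "openin X V \<Longrightarrow> V \<subseteq> U \<Longrightarrow> F \<in> carrier (S m U) \<Longrightarrow> Res (super_hol M m) U V F \<in> carrier (S m V)"
  unfolding S_Res by (intro S_memI) (simp add: hol_restrict S_hol)

lemma S_Res_apply: "K \<subseteq> {..<m} \<Longrightarrow> x \<in> V \<Longrightarrow> Res (super_hol M m) U V F K x = F K x"
  by (simp add: S_Res)

lemma S_presheaf: "superalg_presheaf X (super_hol M m)"
  unfolding superalg_presheaf_def
proof (intro conjI allI impI comm_superalgebra_S ballI; (elim conjE)?)
  fix U V assume *: "openin X U" "openin X V" "V \<subseteq> U"
  have w: "wedge (\<lambda>I. Res (super_hol M m) U V F I x) (\<lambda>I. Res (super_hol M m) U V G I x) K =
      wedge (\<lambda>I. F I x) (\<lambda>I. G I x) K" if "K \<subseteq> {..<m}" "x \<in> V" for F G K x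
    using that by (intro wedge_cong) (auto simp: S_Res_apply)
  show "Res (super_hol M m) U V \<in> superalg_hom (S m U) (S m V)"
    unfolding superalg_hom_def
  proof (intro CollectI conjI ring_hom_memI allI ballI)
    show "Res (super_hol M m) U V ` even_part (S m U) \<subseteq> even_part (S m V)"
      "Res (super_hol M m) U V ` odd_part (S m U) \<subseteq> odd_part (S m V)"
      using * by (auto simp: S_even S_odd S_Res_closed S_Res_apply subset_iff)
  qed (use * in \<open>auto intro!: S_eqI[of _ m V] S_Res_closed S_closed simp: S_apply S_Res_apply w subset_iff\<close>)
next
  fix U F assume *: "openin X U" "F \<in> carrier (S m U)"
  then show "Res (super_hol M m) U U F = F"
    by (intro S_eqI) (auto simp: S_Res_closed S_Res_apply)
next
  fix U V W F assume *: "openin X U" "openin X V" "openin X W" "W \<subseteq> V" "V \<subseteq> U" "F \<in> carrier (S m U)"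
  then show "Res (super_hol M m) V W (Res (super_hol M m) U V F) = Res (super_hol M m) U W F"
    by (intro S_eqI[of _ m W]) (auto simp: S_Res_closed S_Res_apply)
qed

lemma S_sheaf: "superalg_sheaf X (super_hol M m)"
  unfolding superalg_sheaf_def
proof (intro conjI S_presheaf allI impI; elim conjE)
  fix \<U> s
  assume s: "\<forall>V\<in>\<U>. openin X V \<and> s V \<in> carrier (S m V)"
    and eq: "\<forall>V\<in>\<U>. \<forall>W\<in>\<U>. Res (super_hol M m) V (V \<inter> W) (s V) = Res (super_hol M m) W (V \<inter> W) (s W)"
  have eq: "s V K x = s W K x" if "V \<in> \<U>" "W \<in> \<U>" "x \<in> V" "x \<in> W" "K \<subseteq> {..<m}" for V W K x
    using eq that S_Res_apply by (metis IntI)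
  define c where "c x = (SOME V. V \<in> \<U> \<and> x \<in> V)" for x
  have c: "c x \<in> \<U> \<and> x \<in> c x" if "x \<in> \<Union>\<U>" for x
    unfolding c_def by (rule someI_ex) (use that in auto)
  define t where "t = (\<lambda>K\<in>Pow {..<m}. \<lambda>x\<in>\<Union>\<U>. s (c x) K x)"
  have t: "t K x = s V K x" if "V \<in> \<U>" "x \<in> V" "K \<subseteq> {..<m}" for V K x
    using that c[of x] eq[of "c x" V x K] by (auto simp: t_def)
  have op: "openin X (\<Union>\<U>)" using s by blast
  have tc: "t \<in> carrier (S m (\<Union>\<U>))" unfolding t_def
  proof (rule S_memI)
    fix K assume K: "K \<subseteq> {..<m}"
    show "(\<lambda>x\<in>\<Union>\<U>. s (c x) K x) \<in> hol M (\<Union>\<U>)"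
    proof (rule hol_local[OF op])
      fix x assume "x \<in> \<Union>\<U>"
      then obtain V where V: "V \<in> \<U>" "x \<in> V" by auto
      have h: "s V K \<in> hol M V" using s V K S_hol by blast
      have "s (c y) K y = s V K y" if "y \<in> V" for y
        using eq[of "c y" V y K] c[of y] V K that by auto
      then have "restrict (\<lambda>x\<in>\<Union>\<U>. s (c x) K x) V = s V K"
        by (intro extensionalityI[OF restrict_extensional hol_ext[OF h]])
          (use V in auto)
      then show "\<exists>N. openin X N \<and> x \<in> N \<and> N \<subseteq> \<Union>\<U> \<and> restrict (\<lambda>x\<in>\<Union>\<U>. s (c x) K x) N \<in> hol M N"
        using V s h by (intro exI[of _ V]) auto
    qed simp
  qed
  show "\<exists>!t. t \<in> carrier (S m (\<Union>\<U>)) \<and> (\<forall>V\<in>\<U>. Res (super_hol M m) (\<Union>\<U>) V t = s V)"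
  proof (rule ex1I[of _ t], intro conjI tc ballI)
    fix V assume V: "V \<in> \<U>"
    then show "Res (super_hol M m) (\<Union>\<U>) V t = s V"
      using s tc by (intro S_eqI[of _ m V] S_Res_closed) (auto simp: S_Res_apply t)
  next
    fix u assume u: "u \<in> carrier (S m (\<Union>\<U>)) \<and> (\<forall>V\<in>\<U>. Res (super_hol M m) (\<Union>\<U>) V u = s V)"
    show "u = t"
    proof (rule S_eqI[of _ m "\<Union>\<U>"])
      fix K x assume K: "K \<subseteq> {..<m}" and "x \<in> \<Union>\<U>"
      then obtain V where V: "V \<in> \<U>" "x \<in> V" by auto
      have "u K x = Res (super_hol M m) (\<Union>\<U>) V u K x" using K V by (simp add: S_Res_apply)
      then show "u K x = t K x" using u V K t by simp
    qed (use u tc in auto)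
  qed
qed

end

section \<open>Generalized elements of a group object\<close>

locale category_laws =
  fixes C :: "('o, 'a) category"
  assumes comp_hom: "\<lbrakk>A \<in> Obj C; B \<in> Obj C; D \<in> Obj C; f \<in> Hom C A B; g \<in> Hom C B D\<rbrakk> \<Longrightarrow> Comp C g f \<in> Hom C A D"
    and comp_assoc: "\<lbrakk>A \<in> Obj C; B \<in> Obj C; D \<in> Obj C; E \<in> Obj C; f \<in> Hom C A B; g \<in> Hom C B D; h \<in> Hom C D E\<rbrakk>
      \<Longrightarrow> Comp C (Comp C h g) f = Comp C h (Comp C g f)"
    and ident_hom: "A \<in> Obj C \<Longrightarrow> Ident C A \<in> Hom C A A"
    and ident_left: "\<lbrakk>A \<in> Obj C; B \<in> Obj C; f \<in> Hom C A B\<rbrakk> \<Longrightarrow> Comp C (Ident C B) f = f"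
    and ident_right: "\<lbrakk>A \<in> Obj C; B \<in> Obj C; f \<in> Hom C A B\<rbrakk> \<Longrightarrow> Comp C f (Ident C A) = f"
begin

context
  fixes A B P p q
  assumes prod: "is_product C A B P p q" and A: "A \<in> Obj C" and B: "B \<in> Obj C"
begin

lemma pairing_props:
  assumes "T \<in> Obj C" "a \<in> Hom C T A" "b \<in> Hom C T B"
  shows "pairing C P p q T a b \<in> Hom C T P" "Comp C p (pairing C P p q T a b) = a"
    "Comp C q (pairing C P p q T a b) = b"
proof -
  have "\<exists>!h. h \<in> Hom C T P \<and> Comp C p h = a \<and> Comp C q h = b"
    using prod assms unfolding is_product_def by blast
  from theI'[OF this] show "pairing C P p q T a b \<in> Hom C T P" "Comp C p (pairing C P p q T a b) = a"
    "Comp C q (pairing C P p q T a b) = b" by (auto simp: pairing_def)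
qed

lemma pairing_unique:
  assumes "T \<in> Obj C" "h \<in> Hom C T P" "Comp C p h \<in> Hom C T A" "Comp C q h \<in> Hom C T B"
  shows "h = pairing C P p q T (Comp C p h) (Comp C q h)"
proof -
  have "\<exists>!k. k \<in> Hom C T P \<and> Comp C p k = Comp C p h \<and> Comp C q k = Comp C q h"
    using prod assms unfolding is_product_def by blast
  from the1_equality[OF this, of h] show ?thesis using assms by (simp add: pairing_def)
qed

lemma pairing_comp:
  assumes "T \<in> Obj C" "T' \<in> Obj C" "a \<in> Hom C T A" "b \<in> Hom C T B" "k \<in> Hom C T' T"
  shows "Comp C (pairing C P p q T a b) k = pairing C P p q T' (Comp C a k) (Comp C b k)"
proof -
  note pp = pairing_props[OF assms(1,3,4)]
  have P: "P \<in> Obj C" "p \<in> Hom C P A" "q \<in> Hom C P B" using prod by (auto simp: is_product_def)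
  let ?h = "Comp C (pairing C P p q T a b) k"
  have h: "?h \<in> Hom C T' P" using comp_hom assms pp P by blast
  have e: "Comp C p ?h = Comp C a k" "Comp C q ?h = Comp C b k"
    using comp_assoc[OF assms(2,1) P(1) A assms(5) pp(1) P(2)] comp_assoc[OF assms(2,1) P(1) B assms(5) pp(1) P(3)] pp
    by simp_all
  show ?thesis
    using pairing_unique[OF assms(2) h] e comp_hom[OF assms(2,1) A assms(5,3)] comp_hom[OF assms(2,1) B assms(5,4)]
    by simp
qed

end
end

locale group_object_laws = category_laws C + group_object C G E P Q p q r s mu e iota
  for C :: "('o, 'a) category" and G E P Q p q r s mu e iota
begin

definition gmult :: "'o \<Rightarrow> 'a \<Rightarrow> 'a \<Rightarrow> 'a" where
  "gmult T a b = Comp C mu (pairing C P p q T a b)"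

definition gunit :: "'o \<Rightarrow> 'a" where
  "gunit T = Comp C e (to_terminal C E T)"

lemma objs: "P \<in> Obj C" "Q \<in> Obj C" "E \<in> Obj C" "p \<in> Hom C P G" "q \<in> Hom C P G" "r \<in> Hom C Q P" "s \<in> Hom C Q G"
  using product2 product3 terminal by (auto simp: is_product_def is_terminal_def)

lemma terminal_hom: "T \<in> Obj C \<Longrightarrow> to_terminal C E T \<in> Hom C T E"
  using terminal unfolding is_terminal_def to_terminal_def by (metis theI')

lemma gunit_hom: "T \<in> Obj C \<Longrightarrow> gunit T \<in> Hom C T G"
  unfolding gunit_def by (rule comp_hom[OF _ _ obj terminal_hom e]) (auto simp: objs)

lemma gunit_comp:
  assumes "T \<in> Obj C" "T' \<in> Obj C" "k \<in> Hom C T' T"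
  shows "Comp C (gunit T) k = gunit T'"
proof -
  have "Comp C (to_terminal C E T) k = to_terminal C E T'"
    using terminal terminal_hom comp_hom[OF assms(2,1) objs(3) assms(3)] assms
    unfolding is_terminal_def by metis
  then show ?thesis
    unfolding gunit_def using comp_assoc[OF assms(2,1) objs(3) obj assms(3) terminal_hom e] assms by simp
qed

lemma gmult_hom: "T \<in> Obj C \<Longrightarrow> a \<in> Hom C T G \<Longrightarrow> b \<in> Hom C T G \<Longrightarrow> gmult T a b \<in> Hom C T G"
  unfolding gmult_def using comp_hom[OF _ objs(1) obj pairing_props(1)[OF product2] mu] obj by blast

lemma gmult_comp:
  assumes "T \<in> Obj C" "T' \<in> Obj C" "a \<in> Hom C T G" "b \<in> Hom C T G" "k \<in> Hom C T' T"
  shows "Comp C (gmult T a b) k = gmult T' (Comp C a k) (Comp C b k)"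
  unfolding gmult_def
  using comp_assoc[OF assms(2,1) objs(1) obj assms(5) pairing_props(1)[OF product2 obj obj assms(1,3,4)] mu]
    pairing_comp[OF product2 obj obj assms] by simp

text \<open>The axioms of a group object speak about the universal points of \<open>P\<close>, \<open>Q\<close> and \<open>G\<close>; composing with a map into
  these yields the group laws for the \<open>T\<close>-valued points of \<open>G\<close>, for every object \<open>T\<close>.\<close>

lemma gmult_assoc:
  assumes T: "T \<in> Obj C" and abc: "a \<in> Hom C T G" "b \<in> Hom C T G" "c \<in> Hom C T G"
  shows "gmult T (gmult T a b) c = gmult T a (gmult T b c)"
proof -
  define ab where "ab = pairing C P p q T a b"
  note ab = pairing_props[OF product2 obj obj T abc(1,2), folded ab_def]
  define k where "k = pairing C Q r s T ab c"
  note k = pairing_props[OF product3 objs(1) obj T ab(1) abc(3), folded k_def]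
  have Qh: "Comp C mu r \<in> Hom C Q G" "Comp C p r \<in> Hom C Q G" "Comp C q r \<in> Hom C Q G"
    using comp_hom[OF objs(2,1) obj objs(6)] mu objs by auto
  have Qk: "Comp C (Comp C mu r) k = gmult T a b" "Comp C (Comp C p r) k = a" "Comp C (Comp C q r) k = b"
    using comp_assoc[OF T objs(2,1) obj k(1) objs(6)] k ab mu objs by (auto simp: gmult_def ab_def)
  have "Comp C (gmult Q (Comp C mu r) s) k = Comp C (gmult Q (Comp C p r) (gmult Q (Comp C q r) s)) k"
    using assoc by (simp add: gmult_def)
  then show ?thesis
    using gmult_comp[OF objs(2) T _ _ k(1)] Qh objs gmult_hom[OF objs(2)] by (simp add: Qk k)
qed

lemma gmult_unit_right: 
  assumes T: "T \<in> Obj C" and a: "a \<in> Hom C T G"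
  shows "gmult T a (gunit T) = a"
proof -
  have "Comp C (gmult G (Ident C G) (gunit G)) a = Comp C (Ident C G) a"
    using unit_right by (simp add: gmult_def gunit_def)
  then show ?thesis
    using gmult_comp[OF obj T ident_hom[OF obj] gunit_hom[OF obj] a] gunit_comp[OF obj T a] ident_left[OF T obj a] by simp
qed

lemma gmult_unit_left: 
  assumes T: "T \<in> Obj C" and a: "a \<in> Hom C T G"
  shows "gmult T (gunit T) a = a"
proof -
  have "Comp C (gmult G (gunit G) (Ident C G)) a = Comp C (Ident C G) a"
    using unit_left by (simp add: gmult_def gunit_def)
  then show ?thesis
    using gmult_comp[OF obj T gunit_hom[OF obj] ident_hom[OF obj] a] gunit_comp[OF obj T a] ident_left[OF T obj a] by simp
qed

lemma gmult_inverse_left: 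
  assumes T: "T \<in> Obj C" and a: "a \<in> Hom C T G"
  shows "gmult T (Comp C iota a) a = gunit T"
proof -
  have "Comp C (gmult G iota (Ident C G)) a = Comp C (gunit G) a"
    using inv_left by (simp add: gmult_def gunit_def)
  then show ?thesis
    using gmult_comp[OF obj T iota ident_hom[OF obj] a] gunit_comp[OF obj T a] ident_left[OF T obj a] by simp
qed

end


section \<open>The category laws for supermanifolds\<close>

lemma superalg_hom_closed: "h \<in> superalg_hom A B \<Longrightarrow> a \<in> carrier A \<Longrightarrow> h a \<in> carrier B"
  by (auto simp: superalg_hom_def ring_hom_def)

lemma superalg_hom_comp:
  assumes "h \<in> superalg_hom A B" "k \<in> superalg_hom B D"
  shows "(\<lambda>a. k (h a)) \<in> superalg_hom A D"
proof -
  have "k \<circ> h \<in> ring_hom A D" using assms ring_hom_trans by (auto simp: superalg_hom_def)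
  then show ?thesis using assms superalg_hom_closed[OF assms(1)]
    by (auto simp: superalg_hom_def image_subset_iff comp_def)
qed

lemma superalg_parts_subset:
  assumes "comm_superalgebra A" 
  shows "even_part A \<subseteq> carrier A" "odd_part A \<subseteq> carrier A"
proof -
  interpret comm_superalgebra A by fact
  show "even_part A \<subseteq> carrier A" "odd_part A \<subseteq> carrier A"
    using submoduleE(1)[OF even_submodule] submoduleE(1)[OF odd_submodule] by auto
qed

lemma superalg_hom_cong:
  assumes A: "comm_superalgebra A" and h: "h \<in> superalg_hom A B" and eq: "\<And>a. a \<in> carrier A \<Longrightarrow> h' a = h a"
  shows "h' \<in> superalg_hom A B"
proof -
  interpret comm_superalgebra A by fact
  note s = superalg_parts_subset[OF A]
  have "h' ` even_part A = h ` even_part A" "h' ` odd_part A = h ` odd_part A"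
    using s eq by (auto intro!: image_cong)
  then show ?thesis
    using h eq by (auto simp: superalg_hom_def ring_hom_def)
qed

lemma superalg_hom_id: "(\<lambda>s. s) \<in> superalg_hom A A"
  by (auto simp: superalg_hom_def ring_hom_def)

lemma supermanifoldD:
  assumes "supermanifold X"
  shows "complex_manifold (body X)" "superalg_sheaf (sm_top X) (osheaf X)" "superalg_presheaf (sm_top X) (osheaf X)"
    "openin (sm_top X) U \<Longrightarrow> comm_superalgebra (Sec (osheaf X) U)"
    "openin (sm_top X) U \<Longrightarrow> openin (sm_top X) V \<Longrightarrow> V \<subseteq> U \<Longrightarrow>
       Res (osheaf X) U V \<in> superalg_hom (Sec (osheaf X) U) (Sec (osheaf X) V)"
    "openin (sm_top X) U \<Longrightarrow> s \<in> carrier (Sec (osheaf X) U) \<Longrightarrow> Res (osheaf X) U U s = s"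
    "openin (sm_top X) U \<Longrightarrow> openin (sm_top X) V \<Longrightarrow> openin (sm_top X) W \<Longrightarrow> W \<subseteq> V \<Longrightarrow> V \<subseteq> U \<Longrightarrow>
       s \<in> carrier (Sec (osheaf X) U) \<Longrightarrow> Res (osheaf X) V W (Res (osheaf X) U V s) = Res (osheaf X) U W s"
proof -
  show "complex_manifold (body X)" and sh: "superalg_sheaf (sm_top X) (osheaf X)"
    using assms unfolding supermanifold_def by auto
  show pre: "superalg_presheaf (sm_top X) (osheaf X)" using sh unfolding superalg_sheaf_def by (rule conjunct1)
  note p = pre[unfolded superalg_presheaf_def]
  show "openin (sm_top X) U \<Longrightarrow> comm_superalgebra (Sec (osheaf X) U)"
    by (rule p[THEN conjunct1, rule_format])
  show "openin (sm_top X) U \<Longrightarrow> openin (sm_top X) V \<Longrightarrow> V \<subseteq> U \<Longrightarrow>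
       Res (osheaf X) U V \<in> superalg_hom (Sec (osheaf X) U) (Sec (osheaf X) V)"
    by (rule p[THEN conjunct2, THEN conjunct1, rule_format]) simp
  show "openin (sm_top X) U \<Longrightarrow> s \<in> carrier (Sec (osheaf X) U) \<Longrightarrow> Res (osheaf X) U U s = s"
    by (rule p[THEN conjunct2, THEN conjunct2, THEN conjunct1, rule_format])
  show "openin (sm_top X) U \<Longrightarrow> openin (sm_top X) V \<Longrightarrow> openin (sm_top X) W \<Longrightarrow> W \<subseteq> V \<Longrightarrow> V \<subseteq> U \<Longrightarrow>
       s \<in> carrier (Sec (osheaf X) U) \<Longrightarrow> Res (osheaf X) V W (Res (osheaf X) U V s) = Res (osheaf X) U W s"
    by (rule p[THEN conjunct2, THEN conjunct2, THEN conjunct2, rule_format]) simp_all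
qed

lemma preimg_open: "is_supermap f \<Longrightarrow> openin (sm_top (scod f)) W \<Longrightarrow> openin (sm_top (sdom f)) (preimg f W)"
  unfolding is_supermap_def preimg_def by (auto simp: continuous_map)

lemma is_supermapD:
  assumes "is_supermap f"
  shows "x \<in> topspace (sm_top (sdom f)) \<Longrightarrow> pmap f x \<in> topspace (sm_top (scod f))"
    "openin (sm_top (scod f)) W \<Longrightarrow>
       pull f W \<in> superalg_hom (Sec (osheaf (scod f)) W) (Sec (osheaf (sdom f)) (preimg f W))"
    "openin (sm_top (scod f)) W \<Longrightarrow> a \<in> carrier (Sec (osheaf (scod f)) W) \<Longrightarrow>
       pull f W a \<in> carrier (Sec (osheaf (sdom f)) (preimg f W))"
    "openin (sm_top (scod f)) V \<Longrightarrow> openin (sm_top (scod f)) W \<Longrightarrow> W \<subseteq> V \<Longrightarrow> a \<in> carrier (Sec (osheaf (scod f)) V) \<Longrightarrow>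
       pull f W (Res (osheaf (scod f)) V W a) = Res (osheaf (sdom f)) (preimg f V) (preimg f W) (pull f V a)"
    "continuous_map (sm_top (sdom f)) (sm_top (scod f)) (pmap f)"
    "pmap f \<in> extensional (topspace (sm_top (sdom f)))"
    "pull f \<in> extensional {W. openin (sm_top (scod f)) W}"
    "openin (sm_top (scod f)) W \<Longrightarrow> pull f W \<in> extensional (carrier (Sec (osheaf (scod f)) W))"
proof -
  note f = assms[unfolded is_supermap_def]
  note f4 = f[THEN conjunct2, THEN conjunct2, THEN conjunct2, THEN conjunct1, rule_format]
  note f5 = f[THEN conjunct2, THEN conjunct2, THEN conjunct2, THEN conjunct2, rule_format]
  show c: "continuous_map (sm_top (sdom f)) (sm_top (scod f)) (pmap f)"
    "pmap f \<in> extensional (topspace (sm_top (sdom f)))"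
    "pull f \<in> extensional {W. openin (sm_top (scod f)) W}"
    using f by simp_all
  show "x \<in> topspace (sm_top (sdom f)) \<Longrightarrow> pmap f x \<in> topspace (sm_top (scod f))"
    using c(1) by (auto simp: continuous_map_def)
  show h: "openin (sm_top (scod f)) W \<Longrightarrow>
       pull f W \<in> superalg_hom (Sec (osheaf (scod f)) W) (Sec (osheaf (sdom f)) (preimg f W))" for W
    using f4 by blast
  show "openin (sm_top (scod f)) W \<Longrightarrow> pull f W \<in> extensional (carrier (Sec (osheaf (scod f)) W))"
    using f4 by blast
  show "openin (sm_top (scod f)) W \<Longrightarrow> a \<in> carrier (Sec (osheaf (scod f)) W) \<Longrightarrow>
       pull f W a \<in> carrier (Sec (osheaf (sdom f)) (preimg f W))"
    using superalg_hom_closed[OF h] .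
  show "openin (sm_top (scod f)) V \<Longrightarrow> openin (sm_top (scod f)) W \<Longrightarrow> W \<subseteq> V \<Longrightarrow> a \<in> carrier (Sec (osheaf (scod f)) V) \<Longrightarrow>
       pull f W (Res (osheaf (scod f)) V W a) = Res (osheaf (sdom f)) (preimg f V) (preimg f W) (pull f V a)"
    by (rule f5) simp_all
qed

lemma supermap_eqI:
  assumes "is_supermap f" "is_supermap g" "sdom f = sdom g" "scod f = scod g"
    and "\<And>x. x \<in> topspace (sm_top (sdom f)) \<Longrightarrow> pmap f x = pmap g x"
    and "\<And>W s. openin (sm_top (scod f)) W \<Longrightarrow> s \<in> carrier (Sec (osheaf (scod f)) W) \<Longrightarrow> pull f W s = pull g W s"
  shows "f = (g :: ('p, 's) supermap)"
proof -
  have "pmap f = pmap g"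
    by (rule extensionalityI[OF is_supermapD(6)[OF assms(1)]]) (use assms is_supermapD(6)[OF assms(2)] in auto)
  moreover have "pull f = pull g"
  proof (rule extensionalityI[OF is_supermapD(7)[OF assms(1)]])
    show "pull g \<in> extensional {W. openin (sm_top (scod f)) W}" using is_supermapD(7)[OF assms(2)] assms(4) by simp
    fix W assume "W \<in> {W. openin (sm_top (scod f)) W}"
    then have W: "openin (sm_top (scod f)) W" by simp
    show "pull f W = pull g W"
      by (rule extensionalityI[OF is_supermapD(8)[OF assms(1) W]])
        (use W assms(4,6) is_supermapD(8)[OF assms(2), of W] in auto)
  qed
  ultimately show ?thesis using assms(3,4) by (cases f; cases g) auto
qed

lemma SMan_simps: "Obj SMan = Collect supermanifold" "f \<in> Hom SMan X Y \<longleftrightarrow> is_supermap f \<and> sdom f = X \<and> scod f = Y"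
  by (simp_all add: SMan_def)

lemma SMan_comp:
  "sdom (Comp SMan g f) = sdom f" "scod (Comp SMan g f) = scod g"
  "x \<in> topspace (sm_top (sdom f)) \<Longrightarrow> pmap (Comp SMan g f) x = pmap g (pmap f x)"
  "openin (sm_top (scod g)) W \<Longrightarrow> s \<in> carrier (Sec (osheaf (scod g)) W) \<Longrightarrow>
     pull (Comp SMan g f) W s = pull f (preimg g W) (pull g W s)"
  by (simp_all add: SMan_def)

lemma preimg_comp:
  assumes "is_supermap f" "scod f = sdom g"
  shows "preimg (Comp SMan g f) W = preimg f (preimg g W)"
  using is_supermapD(1)[OF assms(1)] assms(2) by (auto simp: preimg_def SMan_comp)

lemma is_supermap_comp:
  assumes f: "is_supermap f" and g: "is_supermap g" and fg: "scod f = sdom g" and X: "supermanifold (scod g)"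
  shows "is_supermap (Comp SMan g f)"
  unfolding is_supermap_def SMan_comp
proof (intro conjI allI impI ballI)
  show "pmap (Comp SMan g f) \<in> extensional (topspace (sm_top (sdom f)))"
    "pull (Comp SMan g f) \<in> extensional {W. openin (sm_top (scod g)) W}"
    by (simp_all add: SMan_def)
  have "continuous_map (sm_top (sdom f)) (sm_top (scod g)) (pmap g \<circ> pmap f)"
    using is_supermapD(5)[OF f] is_supermapD(5)[OF g] fg continuous_map_compose by metis
  then show "continuous_map (sm_top (sdom f)) (sm_top (scod g)) (pmap (Comp SMan g f))"
    by (rule continuous_map_eq) (simp add: SMan_comp)
next
  fix W assume W: "openin (sm_top (scod g)) W"
  show "pull (Comp SMan g f) W \<in> extensional (carrier (Sec (osheaf (scod g)) W))"
    using W by (simp add: SMan_def)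
  have gW: "openin (sm_top (scod f)) (preimg g W)" using preimg_open[OF g W] fg by simp
  show "pull (Comp SMan g f) W \<in> superalg_hom (Sec (osheaf (scod g)) W) (Sec (osheaf (sdom f)) (preimg (Comp SMan g f) W))"
    unfolding preimg_comp[OF f fg]
  proof (rule superalg_hom_cong[OF supermanifoldD(4)[OF X W] superalg_hom_comp[OF is_supermapD(2)[OF g W]]])
    show "pull f (preimg g W) \<in> superalg_hom (Sec (osheaf (sdom g)) (preimg g W)) (Sec (osheaf (sdom f)) (preimg f (preimg g W)))"
      using is_supermapD(2)[OF f gW] fg by simp
  qed (simp add: SMan_comp W)
next
  fix V W s assume *: "openin (sm_top (scod g)) V \<and> openin (sm_top (scod g)) W \<and> W \<subseteq> V"
    and s: "s \<in> carrier (Sec (osheaf (scod g)) V)"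
  then have V: "openin (sm_top (scod g)) V" and W: "openin (sm_top (scod g)) W" and WV: "W \<subseteq> V" by auto
  have r: "Res (osheaf (scod g)) V W s \<in> carrier (Sec (osheaf (scod g)) W)"
    using superalg_hom_closed[OF supermanifoldD(5)[OF X V W WV] s] .
  have gV: "openin (sm_top (scod f)) (preimg g V)" and gW: "openin (sm_top (scod f)) (preimg g W)"
    using preimg_open[OF g V] preimg_open[OF g W] fg by simp_all
  have sub: "preimg g W \<subseteq> preimg g V" using WV by (auto simp: preimg_def)
  have gs: "pull g V s \<in> carrier (Sec (osheaf (scod f)) (preimg g V))"
    using is_supermapD(3)[OF g V s] fg by simp
  show "pull (Comp SMan g f) W (Res (osheaf (scod g)) V W s) =
     Res (osheaf (sdom f)) (preimg (Comp SMan g f) V) (preimg (Comp SMan g f) W) (pull (Comp SMan g f) V s)"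
    using is_supermapD(4)[OF f gV gW sub gs] is_supermapD(4)[OF g V W WV s] fg
    by (simp add: SMan_comp r s V W preimg_comp[OF f fg])
qed

lemma preimg_ident: "openin (sm_top X) W \<Longrightarrow> preimg (Ident SMan X) W = W"
  using openin_subset by (fastforce simp: preimg_def SMan_def)

lemma ident_supermap:
  assumes X: "supermanifold X"
  shows "is_supermap (Ident SMan X)" "sdom (Ident SMan X) = X" "scod (Ident SMan X) = X"
    "x \<in> topspace (sm_top X) \<Longrightarrow> pmap (Ident SMan X) x = x"
    "openin (sm_top X) W \<Longrightarrow> s \<in> carrier (Sec (osheaf X) W) \<Longrightarrow> pull (Ident SMan X) W s = s"
proof -
  show d: "sdom (Ident SMan X) = X" "scod (Ident SMan X) = X"
    "x \<in> topspace (sm_top X) \<Longrightarrow> pmap (Ident SMan X) x = x"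
    "openin (sm_top X) W \<Longrightarrow> s \<in> carrier (Sec (osheaf X) W) \<Longrightarrow> pull (Ident SMan X) W s = s" for x W s
    by (simp_all add: SMan_def)
  show "is_supermap (Ident SMan X)"
    unfolding is_supermap_def d
  proof (intro conjI allI impI ballI)
    show "pmap (Ident SMan X) \<in> extensional (topspace (sm_top X))"
      "pull (Ident SMan X) \<in> extensional {W. openin (sm_top X) W}"
      by (simp_all add: SMan_def)
    have "continuous_map (sm_top X) (sm_top X) (\<lambda>x. x)" by simp
    then show "continuous_map (sm_top X) (sm_top X) (pmap (Ident SMan X))"
      by (rule continuous_map_eq) (simp add: d)
  next
    fix W assume W: "openin (sm_top X) W"
    show "pull (Ident SMan X) W \<in> extensional (carrier (Sec (osheaf X) W))" using W by (simp add: SMan_def)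
    show "pull (Ident SMan X) W \<in> superalg_hom (Sec (osheaf X) W) (Sec (osheaf X) (preimg (Ident SMan X) W))"
      unfolding preimg_ident[OF W]
      by (rule superalg_hom_cong[OF supermanifoldD(4)[OF X W] superalg_hom_id]) (simp add: d W)
  next
    fix V W s assume *: "openin (sm_top X) V \<and> openin (sm_top X) W \<and> W \<subseteq> V" and s: "s \<in> carrier (Sec (osheaf X) V)"
    then have "Res (osheaf X) V W s \<in> carrier (Sec (osheaf X) W)"
      using superalg_hom_closed[OF supermanifoldD(5)[OF X, of V W] s] by blast
    then show "pull (Ident SMan X) W (Res (osheaf X) V W s) =
       Res (osheaf X) (preimg (Ident SMan X) V) (preimg (Ident SMan X) W) (pull (Ident SMan X) V s)"
      using * s by (simp add: d preimg_ident)
  qed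
qed

lemma SMan_laws: "category_laws SMan"
proof (unfold_locales, goal_cases)
  case (1 A B D f g)
  then show ?case using is_supermap_comp[of f g] by (auto simp: SMan_simps SMan_comp)
next
  case (2 A B D E f g h)
  then have f: "is_supermap f" "sdom f = A" "scod f = B" and g: "is_supermap g" "sdom g = B" "scod g = D"
    and h: "is_supermap h" "sdom h = D" "scod h = E"
    and sm: "supermanifold A" "supermanifold B" "supermanifold D" "supermanifold E" by (auto simp: SMan_simps)
  have gf: "is_supermap (Comp SMan g f)"
    by (rule is_supermap_comp[OF f(1) g(1)]) (use f g sm in simp_all)
  have hg: "is_supermap (Comp SMan h g)"
    by (rule is_supermap_comp[OF g(1) h(1)]) (use h g sm in simp_all)
  show ?case
  proof (rule supermap_eqI)
    show "is_supermap (Comp SMan (Comp SMan h g) f)"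
      by (rule is_supermap_comp[OF f(1) hg]) (use f g h sm in \<open>simp_all add: SMan_comp\<close>)
    show "is_supermap (Comp SMan h (Comp SMan g f))"
      by (rule is_supermap_comp[OF gf h(1)]) (use f g h sm in \<open>simp_all add: SMan_comp\<close>)
    fix x assume "x \<in> topspace (sm_top (sdom (Comp SMan (Comp SMan h g) f)))"
    then show "pmap (Comp SMan (Comp SMan h g) f) x = pmap (Comp SMan h (Comp SMan g f)) x"
      using is_supermapD(1)[OF f(1)] f g by (simp add: SMan_comp)
  next
    fix W s assume "openin (sm_top (scod (Comp SMan (Comp SMan h g) f))) W"
      "s \<in> carrier (Sec (osheaf (scod (Comp SMan (Comp SMan h g) f))) W)"
    then have W: "openin (sm_top (scod h)) W" "s \<in> carrier (Sec (osheaf (scod h)) W)" by (simp_all add: SMan_comp)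
    have "openin (sm_top (scod g)) (preimg h W)" "pull h W s \<in> carrier (Sec (osheaf (scod g)) (preimg h W))"
      using preimg_open[OF h(1) W(1)] is_supermapD(3)[OF h(1) W] g h by auto
    then show "pull (Comp SMan (Comp SMan h g) f) W s = pull (Comp SMan h (Comp SMan g f)) W s"
      using W preimg_comp[OF g(1), of h W] g h by (simp add: SMan_comp)
  qed (auto simp: SMan_comp)
next
  case (3 A)
  then show ?case using ident_supermap by (auto simp: SMan_simps)
next
  case (4 A B f)
  then have f: "is_supermap f" "sdom f = A" "scod f = B" and sm: "supermanifold A" "supermanifold B"
    by (auto simp: SMan_simps)
  note i = ident_supermap[OF sm(2)]
  show ?case
  proof (rule supermap_eqI)
    show "is_supermap (Comp SMan (Ident SMan B) f)"
      by (rule is_supermap_comp) (use i f sm in auto)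
  qed (use i f sm is_supermapD(1)[OF f(1)] in \<open>auto simp: SMan_comp preimg_ident\<close>)
next
  case (5 A B f)
  then have f: "is_supermap f" "sdom f = A" "scod f = B" and sm: "supermanifold A" "supermanifold B"
    by (auto simp: SMan_simps)
  note i = ident_supermap[OF sm(1)]
  show ?case
  proof (rule supermap_eqI)
    show "is_supermap (Comp SMan f (Ident SMan A))"
      by (rule is_supermap_comp) (use i f sm in auto)
    fix W s assume "openin (sm_top (scod (Comp SMan f (Ident SMan A)))) W"
      "s \<in> carrier (Sec (osheaf (scod (Comp SMan f (Ident SMan A)))) W)"
    then show "pull (Comp SMan f (Ident SMan A)) W s = pull f W s"
      using i(5) is_supermapD(3)[OF f(1)] preimg_open[OF f(1)] f by (simp add: SMan_comp)
  qed (use i f sm in \<open>auto simp: SMan_comp\<close>)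
qed

section \<open>Transport of structure\<close>

definition superalg_transport ::
  "(complex, 's) superalg \<Rightarrow> (complex, 't) superalg \<Rightarrow> ('s \<Rightarrow> 't) \<Rightarrow> bool" where
  "superalg_transport A B h \<longleftrightarrow> bij_betw h (carrier A) (carrier B) \<and>
     (\<forall>a\<in>carrier A. \<forall>b\<in>carrier A. h (a \<otimes>\<^bsub>A\<^esub> b) = h a \<otimes>\<^bsub>B\<^esub> h b \<and> h (a \<oplus>\<^bsub>A\<^esub> b) = h a \<oplus>\<^bsub>B\<^esub> h b) \<and>
     h \<one>\<^bsub>A\<^esub> = \<one>\<^bsub>B\<^esub> \<and> h \<zero>\<^bsub>A\<^esub> = \<zero>\<^bsub>B\<^esub> \<and>
     (\<forall>c. \<forall>a\<in>carrier A. h (c \<odot>\<^bsub>A\<^esub> a) = c \<odot>\<^bsub>B\<^esub> h a) \<and>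
     even_part B = h ` even_part A \<and> odd_part B = h ` odd_part A"

lemma superalg_closed:
  assumes "comm_superalgebra A"
  shows "a \<in> carrier A \<Longrightarrow> b \<in> carrier A \<Longrightarrow> a \<otimes>\<^bsub>A\<^esub> b \<in> carrier A"
    "a \<in> carrier A \<Longrightarrow> b \<in> carrier A \<Longrightarrow> a \<oplus>\<^bsub>A\<^esub> b \<in> carrier A"
    "\<one>\<^bsub>A\<^esub> \<in> carrier A" "\<zero>\<^bsub>A\<^esub> \<in> carrier A"
    "a \<in> carrier A \<Longrightarrow> c \<odot>\<^bsub>A\<^esub> a \<in> carrier A"
    "a \<in> even_part A \<Longrightarrow> a \<in> carrier A" "a \<in> odd_part A \<Longrightarrow> a \<in> carrier A"
proof -
  interpret comm_superalgebra A by fact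
  show "a \<in> carrier A \<Longrightarrow> b \<in> carrier A \<Longrightarrow> a \<otimes>\<^bsub>A\<^esub> b \<in> carrier A"
    "a \<in> carrier A \<Longrightarrow> b \<in> carrier A \<Longrightarrow> a \<oplus>\<^bsub>A\<^esub> b \<in> carrier A"
    "\<one>\<^bsub>A\<^esub> \<in> carrier A" "\<zero>\<^bsub>A\<^esub> \<in> carrier A"
    "a \<in> carrier A \<Longrightarrow> c \<odot>\<^bsub>A\<^esub> a \<in> carrier A" by auto
  show "a \<in> even_part A \<Longrightarrow> a \<in> carrier A" "a \<in> odd_part A \<Longrightarrow> a \<in> carrier A"
    using superalg_parts_subset[OF assms] by auto
qed

lemma superalg_parts_closed:
  assumes "comm_superalgebra A"
  shows "\<zero>\<^bsub>A\<^esub> \<in> even_part A" "\<zero>\<^bsub>A\<^esub> \<in> odd_part A"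
    "a \<in> even_part A \<Longrightarrow> \<ominus>\<^bsub>A\<^esub> a \<in> even_part A" "a \<in> odd_part A \<Longrightarrow> \<ominus>\<^bsub>A\<^esub> a \<in> odd_part A"
    "a \<in> even_part A \<Longrightarrow> b \<in> even_part A \<Longrightarrow> a \<oplus>\<^bsub>A\<^esub> b \<in> even_part A"
    "a \<in> odd_part A \<Longrightarrow> b \<in> odd_part A \<Longrightarrow> a \<oplus>\<^bsub>A\<^esub> b \<in> odd_part A"
    "a \<in> even_part A \<Longrightarrow> c \<odot>\<^bsub>A\<^esub> a \<in> even_part A" "a \<in> odd_part A \<Longrightarrow> c \<odot>\<^bsub>A\<^esub> a \<in> odd_part A"
proof -
  interpret comm_superalgebra A by fact
  note e = submoduleE[OF even_submodule] and o = submoduleE[OF odd_submodule]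
  show "\<zero>\<^bsub>A\<^esub> \<in> even_part A" "\<zero>\<^bsub>A\<^esub> \<in> odd_part A"
    using subgroup.one_closed[OF submodule.axioms(1)[OF even_submodule]]
      subgroup.one_closed[OF submodule.axioms(1)[OF odd_submodule]] by simp_all
  show "a \<in> even_part A \<Longrightarrow> \<ominus>\<^bsub>A\<^esub> a \<in> even_part A" "a \<in> odd_part A \<Longrightarrow> \<ominus>\<^bsub>A\<^esub> a \<in> odd_part A"
    "a \<in> even_part A \<Longrightarrow> b \<in> even_part A \<Longrightarrow> a \<oplus>\<^bsub>A\<^esub> b \<in> even_part A"
    "a \<in> odd_part A \<Longrightarrow> b \<in> odd_part A \<Longrightarrow> a \<oplus>\<^bsub>A\<^esub> b \<in> odd_part A"
    "a \<in> even_part A \<Longrightarrow> c \<odot>\<^bsub>A\<^esub> a \<in> even_part A" "a \<in> odd_part A \<Longrightarrow> c \<odot>\<^bsub>A\<^esub> a \<in> odd_part A"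
    using e o by simp_all
qed

lemma superalg_transport_comm_superalgebra:
  fixes A :: "(complex, 's) superalg" and B :: "(complex, 't) superalg"
  assumes A: "comm_superalgebra A" and tr: "superalg_transport A B h"
  shows "comm_superalgebra B"
proof -
  interpret RA: ring A by (rule comm_superalgebra.axioms(1)[OF A])
  interpret A: comm_superalgebra A by fact
  note cl = superalg_closed[OF A]
  have carr: "carrier B = h ` carrier A" and inj: "inj_on h (carrier A)"
    using tr by (auto simp: superalg_transport_def bij_betw_def)
  have ops: "h a \<otimes>\<^bsub>B\<^esub> h b = h (a \<otimes>\<^bsub>A\<^esub> b)" "h a \<oplus>\<^bsub>B\<^esub> h b = h (a \<oplus>\<^bsub>A\<^esub> b)" "\<one>\<^bsub>B\<^esub> = h \<one>\<^bsub>A\<^esub>" "\<zero>\<^bsub>B\<^esub> = h \<zero>\<^bsub>A\<^esub>"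
    "c \<odot>\<^bsub>B\<^esub> h a = h (c \<odot>\<^bsub>A\<^esub> a)" if "a \<in> carrier A" "b \<in> carrier A" for a b c
    using tr that by (auto simp: superalg_transport_def)
  have one: "\<one>\<^bsub>B\<^esub> = h \<one>\<^bsub>A\<^esub>" and zero: "\<zero>\<^bsub>B\<^esub> = h \<zero>\<^bsub>A\<^esub>" and sm: "\<And>c a. a \<in> carrier A \<Longrightarrow> c \<odot>\<^bsub>B\<^esub> h a = h (c \<odot>\<^bsub>A\<^esub> a)"
    and ev: "even_part B = h ` even_part A" and od: "odd_part B = h ` odd_part A"
    using tr by (auto simp: superalg_transport_def)
  note ops = ops(1,2) one zero sm
  have agB: "abelian_group B"
  proof (rule abelian_groupI)
    fix x assume "x \<in> carrier B"
    then obtain a where a: "a \<in> carrier A" "x = h a" unfolding carr by auto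
    then show "\<exists>y\<in>carrier B. y \<oplus>\<^bsub>B\<^esub> x = \<zero>\<^bsub>B\<^esub>"
      by (intro bexI[of _ "h (\<ominus>\<^bsub>A\<^esub> a)"]) (auto simp: ops carr RA.l_neg)
  qed (auto simp: carr ops cl RA.a_ac)
  interpret B: abelian_group B by (rule agB)
  have neg: "\<ominus>\<^bsub>B\<^esub> h a = h (\<ominus>\<^bsub>A\<^esub> a)" if "a \<in> carrier A" for a
    using that by (intro B.minus_equality) (auto simp: ops carr RA.l_neg)
  have ring: "ring B"
  proof (rule ringI[OF agB])
    show "monoid B" by (rule monoidI) (auto simp: carr ops cl RA.m_assoc)
  qed (auto simp: carr ops cl RA.l_distr RA.r_distr)
  have mod: "module complex_ring B"
    by (rule moduleI[OF cring_complex_ring agB]) (auto simp: carr ops cl A.smult_l_distr[simplified] A.smult_r_distr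
      A.smult_assoc1[simplified] A.smult_one[simplified])
  interpret B: module complex_ring B by (rule mod)
  note pc = superalg_parts_closed[OF A]
  show ?thesis
  proof (intro comm_superalgebra.intro ring mod comm_superalgebra_axioms.intro)
    show "submodule (even_part B) complex_ring B" "submodule (odd_part B) complex_ring B"
      unfolding ev od
      by (intro B.submoduleI; use cl(6,7) pc in \<open>auto simp: carr ops neg intro!: imageI\<close>)+
    show "even_part B \<inter> odd_part B = {\<zero>\<^bsub>B\<^esub>}"
    proof -
      have "even_part B \<inter> odd_part B = h ` (even_part A \<inter> odd_part A)"
        unfolding ev od by (rule inj_on_image_Int[OF inj, symmetric]) (use cl in auto)
      then show ?thesis by (simp add: A.parts_inter zero)
    qed
  next
    fix x assume "x \<in> carrier B"
    then obtain a where a: "a \<in> carrier A" "x = h a" unfolding carr by auto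
    obtain b c where bc: "b \<in> even_part A" "c \<in> odd_part A" "a = b \<oplus>\<^bsub>A\<^esub> c" using A.parts_span[OF a(1)] by auto
    then show "\<exists>b\<in>even_part B. \<exists>c\<in>odd_part B. x = b \<oplus>\<^bsub>B\<^esub> c"
      by (intro bexI[of _ "h b"] bexI[of _ "h c"]) (auto simp: a ev od ops cl)
  next
    fix x y c assume "x \<in> carrier B" "y \<in> carrier B"
    then show "c \<odot>\<^bsub>B\<^esub> (x \<otimes>\<^bsub>B\<^esub> y) = (c \<odot>\<^bsub>B\<^esub> x) \<otimes>\<^bsub>B\<^esub> y" "c \<odot>\<^bsub>B\<^esub> (x \<otimes>\<^bsub>B\<^esub> y) = x \<otimes>\<^bsub>B\<^esub> (c \<odot>\<^bsub>B\<^esub> y)"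
      by (auto simp: carr ops cl A.smult_mult_left[symmetric] A.smult_mult_right[symmetric])
  next
    fix x y assume "x \<in> even_part B" "y \<in> even_part B"
    then show "x \<otimes>\<^bsub>B\<^esub> y \<in> even_part B" by (auto simp: ev ops cl A.even_even)
  next
    fix x y assume "x \<in> even_part B" "y \<in> odd_part B"
    then show "x \<otimes>\<^bsub>B\<^esub> y \<in> odd_part B" by (auto simp: ev od ops cl A.even_odd)
  next
    fix x y assume "x \<in> odd_part B" "y \<in> even_part B"
    then show "x \<otimes>\<^bsub>B\<^esub> y \<in> odd_part B" by (auto simp: ev od ops cl A.odd_even)
  next
    fix x y assume "x \<in> odd_part B" "y \<in> odd_part B"
    then show "x \<otimes>\<^bsub>B\<^esub> y \<in> even_part B" "x \<otimes>\<^bsub>B\<^esub> y = \<ominus>\<^bsub>B\<^esub> (y \<otimes>\<^bsub>B\<^esub> x)"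
      by (auto simp: ev od ops cl neg A.odd_odd intro!: A.odd_anticomm arg_cong[where f = h])
  next
    fix x y assume "x \<in> even_part B" "y \<in> carrier B"
    then show "x \<otimes>\<^bsub>B\<^esub> y = y \<otimes>\<^bsub>B\<^esub> x" by (auto simp: carr ev ops cl intro!: A.even_comm arg_cong[where f = h])
  qed (auto simp: ev one A.one_even)
qed

lemma superalg_transport_iso:
  "superalg_transport A B h \<Longrightarrow> h \<in> superalg_iso A B"
  by (auto simp: superalg_transport_def superalg_iso_def superalg_hom_def ring_hom_def bij_betw_def)

lemma superalg_hom_zero:
  fixes A :: "(complex, 's) superalg" and B :: "(complex, 't) superalg"
  assumes "comm_superalgebra A" "comm_superalgebra B" "h \<in> superalg_hom A B"
  shows "h \<zero>\<^bsub>A\<^esub> = \<zero>\<^bsub>B\<^esub>"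
proof -
  interpret A: comm_superalgebra A by fact
  interpret B: comm_superalgebra B by fact
  have "h (0 \<odot>\<^bsub>A\<^esub> \<zero>\<^bsub>A\<^esub>) = 0 \<odot>\<^bsub>B\<^esub> h \<zero>\<^bsub>A\<^esub>"
    using assms(3) superalg_closed(4)[OF assms(1)] unfolding superalg_hom_def by blast
  then show ?thesis
    using A.smult_l_null[of "\<zero>\<^bsub>A\<^esub>"] B.smult_l_null[of "h \<zero>\<^bsub>A\<^esub>"] superalg_hom_closed[OF assms(3)] by simp
qed

text \<open>A bijective homomorphism reflects parities: the component of the wrong parity of a preimage is
  mapped into the intersection of the even and the odd part.\<close>

lemma superalg_iso_transport:
  fixes A :: "(complex, 's) superalg" and B :: "(complex, 't) superalg"
  assumes A: "comm_superalgebra A" and B: "comm_superalgebra B" and h: "h \<in> superalg_iso A B"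
  shows "superalg_transport A B h"
proof -
  interpret RB: ring B by (rule comm_superalgebra.axioms(1)[OF B])
  interpret A: comm_superalgebra A by fact
  interpret B: comm_superalgebra B by fact
  note cA = superalg_closed[OF A] and cB = superalg_closed[OF B]
  have hom: "h \<in> superalg_hom A B" and bij: "bij_betw h (carrier A) (carrier B)" using h by (auto simp: superalg_iso_def)
  have hz: "h \<zero>\<^bsub>A\<^esub> = \<zero>\<^bsub>B\<^esub>" by (rule superalg_hom_zero[OF A B hom])
  have par: "h a \<in> even_part B" if "a \<in> even_part A" for a using hom that by (auto simp: superalg_hom_def)
  have par': "h a \<in> odd_part B" if "a \<in> odd_part A" for a using hom that by (auto simp: superalg_hom_def)
  have add: "h (a \<oplus>\<^bsub>A\<^esub> b) = h a \<oplus>\<^bsub>B\<^esub> h b" if "a \<in> carrier A" "b \<in> carrier A" for a b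
    using hom that by (auto simp: superalg_hom_def ring_hom_def)
  note pc = superalg_parts_closed[OF B]
  have inj: "a = b" if "h a = h b" "a \<in> carrier A" "b \<in> carrier A" for a b
    using bij that by (auto simp: bij_betw_def inj_on_def)
  have ex: "\<exists>a0\<in>even_part A. \<exists>a1\<in>odd_part A. y = h a0 \<oplus>\<^bsub>B\<^esub> h a1" if "y \<in> carrier B" for y
  proof -
    obtain a where a: "a \<in> carrier A" "y = h a" using bij \<open>y \<in> carrier B\<close> by (auto simp: bij_betw_def)
    obtain b c where bc: "b \<in> even_part A" "c \<in> odd_part A" "a = b \<oplus>\<^bsub>A\<^esub> c" using A.parts_span[OF a(1)] by auto
    have "y = h b \<oplus>\<^bsub>B\<^esub> h c" using bc a add[OF cA(6)[OF bc(1)] cA(7)[OF bc(2)]] by simp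
    then show ?thesis using bc by auto
  qed
  have key: "y = h a0" if "y \<oplus>\<^bsub>B\<^esub> \<ominus>\<^bsub>B\<^esub> h a0 \<in> even_part B \<inter> odd_part B" "y \<in> carrier B" "h a0 \<in> carrier B" for y a0
  proof -
    have "y \<oplus>\<^bsub>B\<^esub> \<ominus>\<^bsub>B\<^esub> h a0 = \<zero>\<^bsub>B\<^esub>" using that B.parts_inter by auto
    then show ?thesis using that RB.minus_equality[of y "\<ominus>\<^bsub>B\<^esub> h a0"] by simp
  qed
  have "even_part B \<subseteq> h ` even_part A"
  proof
    fix y assume y: "y \<in> even_part B"
    obtain a0 a1 where a: "a0 \<in> even_part A" "a1 \<in> odd_part A" "y = h a0 \<oplus>\<^bsub>B\<^esub> h a1"
      using ex[OF cB(6)[OF y]] by blast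
    have c: "h a0 \<in> carrier B" "h a1 \<in> carrier B" using cB(6)[OF par[OF a(1)]] cB(7)[OF par'[OF a(2)]] .
    have "y \<oplus>\<^bsub>B\<^esub> \<ominus>\<^bsub>B\<^esub> h a0 = h a1" using a(3) c 
      using c RB.a_comm[of "h a0" "h a1"] by (simp add: RB.a_assoc RB.r_neg)
    moreover have "y \<oplus>\<^bsub>B\<^esub> \<ominus>\<^bsub>B\<^esub> h a0 \<in> even_part B" using pc(5)[OF y pc(3)[OF par[OF a(1)]]] .
    ultimately have "y = h a0" using par'[OF a(2)] c cB(6)[OF y] by (intro key) simp_all
    then show "y \<in> h ` even_part A" using a by auto
  qed
  moreover have "odd_part B \<subseteq> h ` odd_part A"
  proof
    fix y assume y: "y \<in> odd_part B"
    obtain a0 a1 where a: "a0 \<in> even_part A" "a1 \<in> odd_part A" "y = h a0 \<oplus>\<^bsub>B\<^esub> h a1"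
      using ex[OF cB(7)[OF y]] by blast
    have c: "h a0 \<in> carrier B" "h a1 \<in> carrier B" using cB(6)[OF par[OF a(1)]] cB(7)[OF par'[OF a(2)]] .
    have "y \<oplus>\<^bsub>B\<^esub> \<ominus>\<^bsub>B\<^esub> h a1 = h a0" using a(3) c by (simp add: RB.a_assoc RB.r_neg)
    moreover have "y \<oplus>\<^bsub>B\<^esub> \<ominus>\<^bsub>B\<^esub> h a1 \<in> odd_part B" using pc(6)[OF y pc(4)[OF par'[OF a(2)]]] .
    ultimately have "y = h a1" using par[OF a(1)] c cB(7)[OF y] by (intro key) simp_all
    then show "y \<in> h ` odd_part A" using a by auto
  qed
  ultimately show ?thesis
    using hom bij hz par par' by (auto simp: superalg_transport_def superalg_hom_def ring_hom_def)
qed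

lemma superalg_transport_inverse:
  fixes A :: "(complex, 's) superalg" and B :: "(complex, 't) superalg"
  assumes A: "comm_superalgebra A" and tr: "superalg_transport A B h"
  shows "superalg_transport B A (inv_into (carrier A) h)"
proof -
  note cA = superalg_closed[OF A]
  have carr: "carrier B = h ` carrier A" and inj: "inj_on h (carrier A)" and bij: "bij_betw h (carrier A) (carrier B)"
    using tr by (auto simp: superalg_transport_def bij_betw_def)
  have i: "inv_into (carrier A) h (h a) = a" if "a \<in> carrier A" for a using inj that by simp
  have ops: "h a \<otimes>\<^bsub>B\<^esub> h b = h (a \<otimes>\<^bsub>A\<^esub> b)" "h a \<oplus>\<^bsub>B\<^esub> h b = h (a \<oplus>\<^bsub>A\<^esub> b)" if "a \<in> carrier A" "b \<in> carrier A" for a b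
    using tr that by (auto simp: superalg_transport_def)
  have one: "\<one>\<^bsub>B\<^esub> = h \<one>\<^bsub>A\<^esub>" and zero: "\<zero>\<^bsub>B\<^esub> = h \<zero>\<^bsub>A\<^esub>" and sm: "\<And>c a. a \<in> carrier A \<Longrightarrow> c \<odot>\<^bsub>B\<^esub> h a = h (c \<odot>\<^bsub>A\<^esub> a)"
    and ev: "even_part B = h ` even_part A" and od: "odd_part B = h ` odd_part A"
    using tr by (auto simp: superalg_transport_def)
  have "inv_into (carrier A) h ` h ` E = E" if "E \<subseteq> carrier A" for E
    using that i by (auto simp: image_image subset_iff image_iff)
  then show ?thesis unfolding superalg_transport_def
    using bij_betw_inv_into[OF bij] cA by (auto simp: carr ops one zero sm ev od i subset_iff)
qed

lemma superalg_iso_inverse: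
  fixes A :: "(complex, 's) superalg" and B :: "(complex, 't) superalg"
  assumes "comm_superalgebra A" "comm_superalgebra B" "h \<in> superalg_iso A B"
  shows "inv_into (carrier A) h \<in> superalg_iso B A"
  using superalg_transport_iso[OF superalg_transport_inverse[OF assms(1) superalg_iso_transport[OF assms]]] .

lemma superalg_iso_comp:
  assumes "h \<in> superalg_iso A B" "k \<in> superalg_iso B D"
  shows "(\<lambda>a. k (h a)) \<in> superalg_iso A D"
  using assms superalg_hom_comp[of h A B k D] bij_betw_trans[of h "carrier A" "carrier B" k "carrier D"]
  by (auto simp: superalg_iso_def comp_def)

lemma sheaf_isomorphic_on_trans:
  fixes P :: "('p, 's) presheaf" and Q :: "('p, 't) presheaf" and R :: "('p, 'u) presheaf"
  assumes "sheaf_isomorphic_on X U P Q" "sheaf_isomorphic_on X U Q R"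
  shows "sheaf_isomorphic_on X U P R"
proof -
  obtain h where h0: "(\<forall>V. openin X V \<and> V \<subseteq> U \<longrightarrow> h V \<in> superalg_iso (Sec P V) (Sec Q V)) \<and>
      (\<forall>V W. openin X V \<and> openin X W \<and> W \<subseteq> V \<and> V \<subseteq> U \<longrightarrow>
         (\<forall>s\<in>carrier (Sec P V). h W (Res P V W s) = Res Q V W (h V s)))"
    using assms(1) unfolding sheaf_isomorphic_on_def by (rule exE)
  have h: "h V \<in> superalg_iso (Sec P V) (Sec Q V)" if "openin X V" "V \<subseteq> U" for V
    by (rule h0[THEN conjunct1, rule_format]) (use that in simp)
  have hR: "h W (Res P V W s) = Res Q V W (h V s)"
    if "openin X V" "openin X W" "W \<subseteq> V" "V \<subseteq> U" "s \<in> carrier (Sec P V)" for V W s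
    by (rule h0[THEN conjunct2, rule_format]) (use that in simp_all)
  obtain k where k0: "(\<forall>V. openin X V \<and> V \<subseteq> U \<longrightarrow> k V \<in> superalg_iso (Sec Q V) (Sec R V)) \<and>
      (\<forall>V W. openin X V \<and> openin X W \<and> W \<subseteq> V \<and> V \<subseteq> U \<longrightarrow>
         (\<forall>s\<in>carrier (Sec Q V). k W (Res Q V W s) = Res R V W (k V s)))"
    using assms(2) unfolding sheaf_isomorphic_on_def by (rule exE)
  have k: "k V \<in> superalg_iso (Sec Q V) (Sec R V)" if "openin X V" "V \<subseteq> U" for V
    by (rule k0[THEN conjunct1, rule_format]) (use that in simp)
  have kR: "k W (Res Q V W s) = Res R V W (k V s)"
    if "openin X V" "openin X W" "W \<subseteq> V" "V \<subseteq> U" "s \<in> carrier (Sec Q V)" for V W s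
    by (rule k0[THEN conjunct2, rule_format]) (use that in simp_all)
  have hc: "h V s \<in> carrier (Sec Q V)" if "openin X V" "V \<subseteq> U" "s \<in> carrier (Sec P V)" for V s
    using superalg_hom_closed[OF _ that(3), of "h V" "Sec Q V"] h[OF that(1,2)] by (simp add: superalg_iso_def)
  show ?thesis unfolding sheaf_isomorphic_on_def
  proof (intro exI[of _ "\<lambda>V s. k V (h V s)"] conjI allI impI ballI; elim conjE)
    fix V assume "openin X V" "V \<subseteq> U"
    then show "(\<lambda>s. k V (h V s)) \<in> superalg_iso (Sec P V) (Sec R V)"
      by (intro superalg_iso_comp[OF h k])
  next
    fix V W s assume *: "openin X V" "openin X W" "W \<subseteq> V" "V \<subseteq> U" "s \<in> carrier (Sec P V)"
    show "k W (h W (Res P V W s)) = Res R V W (k V (h V s))"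
      using hR[OF *] kR[OF *(1-4) hc[OF *(1,4,5)]] by simp
  qed
qed

lemma superalg_sheaf_transport:
  fixes P :: "('p, 's) presheaf" and Q :: "('p, 't) presheaf"
  assumes Q: "superalg_sheaf X Q"
    and tr: "\<And>U. openin X U \<Longrightarrow> superalg_transport (Sec Q U) (Sec P U) (h U)"
    and res: "\<And>U V s. openin X U \<Longrightarrow> openin X V \<Longrightarrow> V \<subseteq> U \<Longrightarrow> s \<in> carrier (Sec Q U) \<Longrightarrow>
      Res P U V (h U s) = h V (Res Q U V s)"
  shows "superalg_sheaf X P"
proof -
  have pre: "superalg_presheaf X Q" using Q by (simp add: superalg_sheaf_def)
  note q = pre[unfolded superalg_presheaf_def]
  have CQ: "comm_superalgebra (Sec Q U)" if "openin X U" for U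
    by (rule q[THEN conjunct1, rule_format, OF that])
  have RQ: "Res Q U V \<in> superalg_hom (Sec Q U) (Sec Q V)" if "openin X U" "openin X V" "V \<subseteq> U" for U V
    by (rule q[THEN conjunct2, THEN conjunct1, rule_format]) (use that in simp)
  have RId: "Res Q U U s = s" if "openin X U" "s \<in> carrier (Sec Q U)" for U s
    by (rule q[THEN conjunct2, THEN conjunct2, THEN conjunct1, rule_format]) (use that in simp_all)
  have RC: "Res Q V W (Res Q U V s) = Res Q U W s"
    if "openin X U" "openin X V" "openin X W" "W \<subseteq> V" "V \<subseteq> U" "s \<in> carrier (Sec Q U)" for U V W s
    by (rule q[THEN conjunct2, THEN conjunct2, THEN conjunct2, rule_format]) (use that in simp_all)
  have CP: "comm_superalgebra (Sec P U)" if "openin X U" for U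
    using superalg_transport_comm_superalgebra[OF CQ tr] that by blast
  let ?d = "\<lambda>U. inv_into (carrier (Sec Q U)) (h U)"
  have carr: "carrier (Sec P U) = h U ` carrier (Sec Q U)" if "openin X U" for U
    using tr[OF that] by (auto simp: superalg_transport_def bij_betw_def)
  have inj: "h U a = h U b \<longleftrightarrow> a = b" if "openin X U" "a \<in> carrier (Sec Q U)" "b \<in> carrier (Sec Q U)" for U a b
    using tr[OF that(1)] that by (auto simp: superalg_transport_def bij_betw_def inj_on_def)
  have RQc: "Res Q U V s \<in> carrier (Sec Q V)" if "openin X U" "openin X V" "V \<subseteq> U" "s \<in> carrier (Sec Q U)" for U V s
    using superalg_hom_closed[OF RQ] that by blast
  have hom: "h U \<in> superalg_hom (Sec Q U) (Sec P U)" and dom: "?d U \<in> superalg_hom (Sec P U) (Sec Q U)" if "openin X U" for U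
    using superalg_transport_iso[OF tr[OF that]] superalg_transport_iso[OF superalg_transport_inverse[OF CQ[OF that] tr[OF that]]]
    by (auto simp: superalg_iso_def)
  have d: "?d U (h U a) = a" if "openin X U" "a \<in> carrier (Sec Q U)" for U a
    using tr[OF that(1)] that by (auto simp: superalg_transport_def bij_betw_def)
  have pP: "superalg_presheaf X P" unfolding superalg_presheaf_def
  proof (intro conjI allI impI CP ballI; (elim conjE)?)
    fix U V assume *: "openin X U" "openin X V" "V \<subseteq> U"
    show "Res P U V \<in> superalg_hom (Sec P U) (Sec P V)"
      by (rule superalg_hom_cong[OF CP[OF *(1)] superalg_hom_comp[OF superalg_hom_comp[OF dom[OF *(1)] RQ[OF *]] hom[OF *(2)]]])
        (use * in \<open>auto simp: carr res d\<close>)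
  next
    fix U s assume "openin X U" "s \<in> carrier (Sec P U)"
    then show "Res P U U s = s" by (auto simp: carr res RId)
  next
    fix U V W s assume *: "openin X U" "openin X V" "openin X W" "W \<subseteq> V" "V \<subseteq> U" "s \<in> carrier (Sec P U)"
    then have "W \<subseteq> U" by auto
    with * show "Res P V W (Res P U V s) = Res P U W s" by (auto simp: carr res RC RQc)
  qed
  show ?thesis unfolding superalg_sheaf_def
  proof (intro conjI pP allI impI; elim conjE)
    fix \<U> s assume s: "\<forall>V\<in>\<U>. openin X V \<and> s V \<in> carrier (Sec P V)"
      and eq: "\<forall>V\<in>\<U>. \<forall>W\<in>\<U>. Res P V (V \<inter> W) (s V) = Res P W (V \<inter> W) (s W)"
    define s' where "s' V = ?d V (s V)" for V
    have s': "s' V \<in> carrier (Sec Q V) \<and> s V = h V (s' V)" if "V \<in> \<U>" for V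
    proof -
      have "s V \<in> h V ` carrier (Sec Q V)" using s that carr[of V] by auto
      then show ?thesis unfolding s'_def using f_inv_into_f inv_into_into by metis
    qed
    have op: "openin X V" if "V \<in> \<U>" for V using s that by blast
    have opU: "openin X (\<Union>\<U>)" using op by blast
    have "Res Q V (V \<inter> W) (s' V) = Res Q W (V \<inter> W) (s' W)" if VW: "V \<in> \<U>" "W \<in> \<U>" for V W
    proof -
      have o: "openin X (V \<inter> W)" using op VW by blast
      have "h (V \<inter> W) (Res Q V (V \<inter> W) (s' V)) = h (V \<inter> W) (Res Q W (V \<inter> W) (s' W))"
        using eq VW s' res[OF op[OF VW(1)] o, of "s' V"] res[OF op[OF VW(2)] o, of "s' W"] by auto
      then show ?thesis using inj[OF o] RQc[OF op[OF VW(1)] o] RQc[OF op[OF VW(2)] o] s' VW by auto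
    qed
    then have "\<exists>!t. t \<in> carrier (Sec Q (\<Union>\<U>)) \<and> (\<forall>V\<in>\<U>. Res Q (\<Union>\<U>) V t = s' V)"
      using s' op by (intro Q[unfolded superalg_sheaf_def, THEN conjunct2, rule_format, of \<U> s'] conjI ballI) blast+
    then obtain t where t: "t \<in> carrier (Sec Q (\<Union>\<U>))" "\<And>V. V \<in> \<U> \<Longrightarrow> Res Q (\<Union>\<U>) V t = s' V"
      and uniq: "\<And>u. u \<in> carrier (Sec Q (\<Union>\<U>)) \<Longrightarrow> (\<And>V. V \<in> \<U> \<Longrightarrow> Res Q (\<Union>\<U>) V u = s' V) \<Longrightarrow> u = t"
      by blast
    have resU: "Res P (\<Union>\<U>) V (h (\<Union>\<U>) u) = h V (Res Q (\<Union>\<U>) V u)" if "V \<in> \<U>" "u \<in> carrier (Sec Q (\<Union>\<U>))" for u V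
      by (rule res[OF opU op[OF that(1)] _ that(2)]) (use that in auto)
    show "\<exists>!t. t \<in> carrier (Sec P (\<Union>\<U>)) \<and> (\<forall>V\<in>\<U>. Res P (\<Union>\<U>) V t = s V)"
    proof (rule ex1I[of _ "h (\<Union>\<U>) t"], intro conjI ballI)
      show "h (\<Union>\<U>) t \<in> carrier (Sec P (\<Union>\<U>))" using t carr[OF opU] by blast
      fix V assume "V \<in> \<U>"
      then show "Res P (\<Union>\<U>) V (h (\<Union>\<U>) t) = s V" using resU t s' by simp
    next
      fix u assume u: "u \<in> carrier (Sec P (\<Union>\<U>)) \<and> (\<forall>V\<in>\<U>. Res P (\<Union>\<U>) V u = s V)"
      then obtain u' where u': "u' \<in> carrier (Sec Q (\<Union>\<U>))" "u = h (\<Union>\<U>) u'" using carr[OF opU] by blast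
      have "Res Q (\<Union>\<U>) V u' = s' V" if V: "V \<in> \<U>" for V
      proof -
        have "h V (Res Q (\<Union>\<U>) V u') = h V (s' V)" using resU[OF V u'(1)] u u' s' V by simp
        then show ?thesis using inj[OF op[OF V]] RQc[OF opU op[OF V] _ u'(1)] s' V by blast
      qed
      then show "u = h (\<Union>\<U>) t" using uniq u' by blast
    qed
  qed
qed

text \<open>The sections of a test object have to be elements of the type \<open>'s\<close>; \<open>enc U\<close> names the sections over \<open>U\<close>
  by such elements.\<close>

definition coded :: "('p set \<Rightarrow> 't \<Rightarrow> 's) \<Rightarrow> ('p, 't) presheaf \<Rightarrow> ('p, 's) presheaf" where
  "coded enc Q = \<lparr>Sec = (\<lambda>U. let A = Sec Q U; d = inv_into (carrier A) (enc U) in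
     \<lparr>carrier = enc U ` carrier A, mult = (\<lambda>a b. enc U (d a \<otimes>\<^bsub>A\<^esub> d b)), one = enc U \<one>\<^bsub>A\<^esub>,
      zero = enc U \<zero>\<^bsub>A\<^esub>, add = (\<lambda>a b. enc U (d a \<oplus>\<^bsub>A\<^esub> d b)), smult = (\<lambda>c a. enc U (c \<odot>\<^bsub>A\<^esub> d a)),
      even_part = enc U ` even_part A, odd_part = enc U ` odd_part A\<rparr>),
    Res = (\<lambda>U V a. enc V (Res Q U V (inv_into (carrier (Sec Q U)) (enc U) a)))\<rparr>"

lemma coded_transport:
  "inj_on (enc U) (carrier (Sec Q U)) \<Longrightarrow> superalg_transport (Sec Q U) (Sec (coded enc Q) U) (enc U)"
  by (auto simp: superalg_transport_def coded_def Let_def bij_betw_def)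

section \<open>Values of superfunctions\<close>

context cman
begin

lemma wedge_leading:
  assumes "finite K" "card K \<le> k" "\<And>I. I \<subseteq> K \<Longrightarrow> card I < k \<Longrightarrow> e I = 0"
  shows "wedge d e K = d {} * e K"
proof -
  have "wedge d e K = (\<Sum>I\<in>{{}}. shuffle_sign I (K - I) * d I * e (K - I))"
    unfolding wedge_def
  proof (rule sum.mono_neutral_right)
    show "\<forall>I\<in>Pow K - {{}}. shuffle_sign I (K - I) * d I * e (K - I) = 0"
    proof
      fix I assume I: "I \<in> Pow K - {{}}"
      then have "card (K - I) < card K" using assms(1) by (intro psubset_card_mono) auto
      then show "shuffle_sign I (K - I) * d I * e (K - I) = 0" using assms(2,3) by auto
    qed
  qed (use assms in auto)
  then show ?thesis by simp
qed

text \<open>The nilpotent part of a superfunction does not matter for its invertibility: the inverse is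
  corrected degree by degree in the generators.\<close>

lemma S_invertible:
  assumes U: "openin X U" and D: "D \<in> carrier (S m U)" and nz: "\<And>x. x \<in> U \<Longrightarrow> D {} x \<noteq> 0"
  shows "\<exists>H\<in>carrier (S m U). D \<otimes>\<^bsub>S m U\<^esub> H = \<one>\<^bsub>S m U\<^esub>"
proof -
  have "\<exists>H\<in>carrier (S m U). \<forall>K\<subseteq>{..<m}. card K < k \<longrightarrow>
      (\<forall>x\<in>U. (D \<otimes>\<^bsub>S m U\<^esub> H) K x = \<one>\<^bsub>S m U\<^esub> K x)" for k
  proof (induction k)
    case 0
    then show ?case using S_zero_closed[OF U] by auto
  next
    case (Suc k)
    then obtain H where H: "H \<in> carrier (S m U)"
      "\<And>K x. K \<subseteq> {..<m} \<Longrightarrow> card K < k \<Longrightarrow> x \<in> U \<Longrightarrow> (D \<otimes>\<^bsub>S m U\<^esub> H) K x = \<one>\<^bsub>S m U\<^esub> K x" by blast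
    define E where "E = \<one>\<^bsub>S m U\<^esub> \<oplus>\<^bsub>S m U\<^esub> (-1) \<odot>\<^bsub>S m U\<^esub> (D \<otimes>\<^bsub>S m U\<^esub> H)"
    have E: "E \<in> carrier (S m U)" unfolding E_def by (intro S_closed U D H)
    have E0: "E K x = 0" if "K \<subseteq> {..<m}" "card K < k" "x \<in> U" for K x
      using H(2)[OF that] that by (simp add: E_def S_apply[OF U])
    define E' where "E' = (\<lambda>K\<in>Pow {..<m}. \<lambda>x\<in>U. (\<lambda>x\<in>U. inverse (D {} x)) x * E K x)"
    have E': "E' \<in> carrier (S m U)" unfolding E'_def
      by (intro S_memI hol_mult U hol_inverse S_hol[OF E] S_hol[OF D] nz) auto
    show ?case
    proof (intro bexI[of _ "H \<oplus>\<^bsub>S m U\<^esub> E'"] allI impI ballI)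
      fix K x assume K: "K \<subseteq> {..<m}" "card K < Suc k" "x \<in> U"
      have "wedge (\<lambda>I. D I x) (\<lambda>I. E' I x) K = D {} x * E' K x"
        by (rule wedge_leading[of _ k]) (use K E0 in \<open>auto simp: E'_def fin_gens[OF U]\<close>)
      also have "\<dots> = E K x" using K nz by (simp add: E'_def)
      finally show "(D \<otimes>\<^bsub>S m U\<^esub> (H \<oplus>\<^bsub>S m U\<^esub> E')) K x = \<one>\<^bsub>S m U\<^esub> K x"
        using K by (simp add: S_apply[OF U] S_wedge_apply[OF U] E_def)
    qed (intro S_closed U H E')
  qed
  then obtain H where H: "H \<in> carrier (S m U)" "\<And>K x. K \<subseteq> {..<m} \<Longrightarrow> card K < Suc m \<Longrightarrow> x \<in> U \<Longrightarrow>
      (D \<otimes>\<^bsub>S m U\<^esub> H) K x = \<one>\<^bsub>S m U\<^esub> K x" by metis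
  have c: "card K < Suc m" if "K \<subseteq> {..<m}" for K using that card_mono[of "{..<m}" K] by simp
  show ?thesis
    by (rule bexI[OF _ H(1)], rule S_eqI[of _ m U]) (use H c in \<open>auto intro: S_closed[OF U] D\<close>)
qed

lemma const_coeff_hom:
  assumes V: "openin X V" and P: "openin X P" and x: "x \<in> V"
  shows "(\<lambda>F. \<lambda>K\<in>Pow {..<m}. \<lambda>y\<in>P. F K x) \<in> superalg_hom (S m V) (S m P)"
proof -
  let ?h = "\<lambda>F. \<lambda>K\<in>Pow {..<m}. \<lambda>y\<in>P. F K x"
  have c: "?h F \<in> carrier (S m P)" for F :: "nat set \<Rightarrow> 'p \<Rightarrow> complex" by (intro S_memI hol_const P)
  have w: "wedge (\<lambda>I. ?h F I y) (\<lambda>I. ?h F' I y) K = wedge (\<lambda>I. F I x) (\<lambda>I. F' I x) K"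
    if "K \<subseteq> {..<m}" "y \<in> P" for K y F F' using that by (intro wedge_cong) auto
  show ?thesis
    unfolding superalg_hom_def
  proof (intro CollectI conjI ring_hom_memI allI ballI c)
    fix F F' 
    show "?h (F \<otimes>\<^bsub>S m V\<^esub> F') = ?h F \<otimes>\<^bsub>S m P\<^esub> ?h F'"
      by (rule S_eqI[OF c S_mult_closed[OF P c c]]) (use w x in \<open>simp add: S_apply[OF P] S_apply[OF V]\<close>)
    show "?h (F \<oplus>\<^bsub>S m V\<^esub> F') = ?h F \<oplus>\<^bsub>S m P\<^esub> ?h F'"
      by (rule S_eqI[OF c S_add_closed[OF P c c]]) (use x in \<open>simp add: S_apply[OF P] S_apply[OF V]\<close>)
  next
    show "?h \<one>\<^bsub>S m V\<^esub> = \<one>\<^bsub>S m P\<^esub>"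
      by (rule S_eqI[OF c S_one_closed[OF P]]) (use x in \<open>simp add: S_apply[OF P] S_apply[OF V]\<close>)
  next
    fix d F show "?h (d \<odot>\<^bsub>S m V\<^esub> F) = d \<odot>\<^bsub>S m P\<^esub> ?h F"
      by (rule S_eqI[OF c S_smult_closed[OF P c]]) (use x in \<open>simp add: S_apply[OF P] S_apply[OF V]\<close>)
  next
    show "?h ` even_part (S m V) \<subseteq> even_part (S m P)"
      using x by (auto intro!: S_evenI c simp: S_parity_zero)
    show "?h ` odd_part (S m V) \<subseteq> odd_part (S m P)"
      using x by (auto intro!: S_oddI c simp: S_parity_zero)
  qed
qed

end

text \<open>The odd dimension is a parameter because a supermanifold only has some odd dimension, which
  is not even determined if the manifold is empty.\<close>

locale super_manifold =
  fixes G :: "('p, 's) superspace" and m :: nat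
  assumes G: "supermanifold G"
    and triv: "\<forall>x\<in>topspace (sm_top G). \<exists>U. openin (sm_top G) U \<and> x \<in> U \<and>
        sheaf_isomorphic_on (sm_top G) U (osheaf G) (super_hol (body G) m)"
begin

sublocale cman "body G" by unfold_locales (rule supermanifoldD(1)[OF G])

abbreviation SecG where "SecG W \<equiv> Sec (osheaf G) W"
abbreviation ResG where "ResG V W \<equiv> Res (osheaf G) V W"

lemmas SecG = supermanifoldD(4)[OF G]
lemmas ResG_hom = supermanifoldD(5)[OF G]
lemmas ResG_id = supermanifoldD(6)[OF G]
lemmas ResG_comp = supermanifoldD(7)[OF G]
lemmas SecG_closed = superalg_closed[OF SecG]

lemma ResG_closed: "openin X U \<Longrightarrow> openin X V \<Longrightarrow> V \<subseteq> U \<Longrightarrow> s \<in> carrier (SecG U) \<Longrightarrow> ResG U V s \<in> carrier (SecG V)"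
  using superalg_hom_closed[OF ResG_hom] by blast

definition trivialization :: "'p set \<Rightarrow> ('p set \<Rightarrow> 's \<Rightarrow> nat set \<Rightarrow> 'p \<Rightarrow> complex) \<Rightarrow> bool" where
  "trivialization U \<theta> \<longleftrightarrow> openin X U \<and>
     (\<forall>V. openin X V \<and> V \<subseteq> U \<longrightarrow> \<theta> V \<in> superalg_iso (SecG V) (S m V)) \<and>
     (\<forall>V W. openin X V \<and> openin X W \<and> W \<subseteq> V \<and> V \<subseteq> U \<longrightarrow>
        (\<forall>s\<in>carrier (SecG V). \<theta> W (ResG V W s) = Res (super_hol (body G) m) V W (\<theta> V s)))"

lemma trivialization_ex:
  assumes "x \<in> topspace X" obtains U \<theta> where "trivialization U \<theta>" "x \<in> U"
  using triv[rule_format, OF assms] that unfolding sheaf_isomorphic_on_def trivialization_def by metis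

lemma trivialization_subset: "trivialization U \<theta> \<Longrightarrow> openin X V \<Longrightarrow> V \<subseteq> U \<Longrightarrow> trivialization V \<theta>"
  unfolding trivialization_def by (meson order_trans)

lemma trivializationD:
  assumes "trivialization U \<theta>"
  shows "openin X U" "openin X V \<Longrightarrow> V \<subseteq> U \<Longrightarrow> \<theta> V \<in> superalg_iso (SecG V) (S m V)"
    "openin X V \<Longrightarrow> V \<subseteq> U \<Longrightarrow> \<theta> V \<in> superalg_hom (SecG V) (S m V)"
    "openin X V \<Longrightarrow> V \<subseteq> U \<Longrightarrow> bij_betw (\<theta> V) (carrier (SecG V)) (carrier (S m V))"
    "openin X V \<Longrightarrow> openin X W \<Longrightarrow> W \<subseteq> V \<Longrightarrow> V \<subseteq> U \<Longrightarrow> s \<in> carrier (SecG V) \<Longrightarrow>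
       \<theta> W (ResG V W s) = Res (super_hol (body G) m) V W (\<theta> V s)"
    "openin X V \<Longrightarrow> V \<subseteq> U \<Longrightarrow> s \<in> carrier (SecG V) \<Longrightarrow> \<theta> V s \<in> carrier (S m V)"
proof -
  note t = assms[unfolded trivialization_def]
  show "openin X U" using t by blast
  show i: "openin X V \<Longrightarrow> V \<subseteq> U \<Longrightarrow> \<theta> V \<in> superalg_iso (SecG V) (S m V)" for V
    by (rule t[THEN conjunct2, THEN conjunct1, rule_format]) simp
  show h: "openin X V \<Longrightarrow> V \<subseteq> U \<Longrightarrow> \<theta> V \<in> superalg_hom (SecG V) (S m V)"
    "openin X V \<Longrightarrow> V \<subseteq> U \<Longrightarrow> bij_betw (\<theta> V) (carrier (SecG V)) (carrier (S m V))" for V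
    using i[of V] by (auto simp: superalg_iso_def)
  show "openin X V \<Longrightarrow> openin X W \<Longrightarrow> W \<subseteq> V \<Longrightarrow> V \<subseteq> U \<Longrightarrow> s \<in> carrier (SecG V) \<Longrightarrow>
       \<theta> W (ResG V W s) = Res (super_hol (body G) m) V W (\<theta> V s)"
    by (rule t[THEN conjunct2, THEN conjunct2, rule_format]) simp_all
  show "openin X V \<Longrightarrow> V \<subseteq> U \<Longrightarrow> s \<in> carrier (SecG V) \<Longrightarrow> \<theta> V s \<in> carrier (S m V)"
    using superalg_hom_closed[OF h(1)] .
qed

lemma superalg_homD:
  assumes "h \<in> superalg_hom A B"
  shows "a \<in> carrier A \<Longrightarrow> b \<in> carrier A \<Longrightarrow> h (a \<otimes>\<^bsub>A\<^esub> b) = h a \<otimes>\<^bsub>B\<^esub> h b"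
    "a \<in> carrier A \<Longrightarrow> b \<in> carrier A \<Longrightarrow> h (a \<oplus>\<^bsub>A\<^esub> b) = h a \<oplus>\<^bsub>B\<^esub> h b"
    "h \<one>\<^bsub>A\<^esub> = \<one>\<^bsub>B\<^esub>" "a \<in> carrier A \<Longrightarrow> h (c \<odot>\<^bsub>A\<^esub> a) = c \<odot>\<^bsub>B\<^esub> h a"
    "a \<in> even_part A \<Longrightarrow> h a \<in> even_part B" "a \<in> odd_part A \<Longrightarrow> h a \<in> odd_part B"
  using assms by (auto simp: superalg_hom_def ring_hom_def)

text \<open>A section minus a constant is invertible near a point unless the constant is the value of the
  section there, so that every character of the stalk is the evaluation.\<close>

lemma character_is_value:
  fixes \<kappa> :: "'p set \<Rightarrow> 's \<Rightarrow> complex"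
  assumes tr: "trivialization U \<theta>" and x: "x \<in> V" and V: "openin X V" "V \<subseteq> U" and s: "s \<in> carrier (SecG V)"
    and add: "\<And>W a b. openin X W \<Longrightarrow> x \<in> W \<Longrightarrow> W \<subseteq> U \<Longrightarrow> a \<in> carrier (SecG W) \<Longrightarrow> b \<in> carrier (SecG W) \<Longrightarrow>
      \<kappa> W (a \<oplus>\<^bsub>SecG W\<^esub> b) = \<kappa> W a + \<kappa> W b"
    and mult: "\<And>W a b. openin X W \<Longrightarrow> x \<in> W \<Longrightarrow> W \<subseteq> U \<Longrightarrow> a \<in> carrier (SecG W) \<Longrightarrow> b \<in> carrier (SecG W) \<Longrightarrow>
      \<kappa> W (a \<otimes>\<^bsub>SecG W\<^esub> b) = \<kappa> W a * \<kappa> W b"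
    and one: "\<And>W. openin X W \<Longrightarrow> x \<in> W \<Longrightarrow> W \<subseteq> U \<Longrightarrow> \<kappa> W \<one>\<^bsub>SecG W\<^esub> = 1"
    and smult: "\<And>W a c. openin X W \<Longrightarrow> x \<in> W \<Longrightarrow> W \<subseteq> U \<Longrightarrow> a \<in> carrier (SecG W) \<Longrightarrow>
      \<kappa> W (c \<odot>\<^bsub>SecG W\<^esub> a) = c * \<kappa> W a"
    and res: "\<And>W W' a. openin X W \<Longrightarrow> openin X W' \<Longrightarrow> x \<in> W' \<Longrightarrow> W' \<subseteq> W \<Longrightarrow> W \<subseteq> U \<Longrightarrow> a \<in> carrier (SecG W) \<Longrightarrow>
      \<kappa> W' (ResG W W' a) = \<kappa> W a"
  shows "\<kappa> V s = \<theta> V s {} x"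
proof (rule ccontr)
  assume ne: "\<kappa> V s \<noteq> \<theta> V s {} x"
  note cl = SecG_closed[OF V(1)] and th = trivializationD[OF tr]
  define D where "D = s \<oplus>\<^bsub>SecG V\<^esub> (- \<kappa> V s) \<odot>\<^bsub>SecG V\<^esub> \<one>\<^bsub>SecG V\<^esub>"
  have D: "D \<in> carrier (SecG V)" unfolding D_def by (intro cl s)
  have D0: "\<kappa> V D = 0" unfolding D_def using V x s cl by (simp add: add smult one)
  have "\<theta> V D {} x = \<theta> V s {} x - \<kappa> V s"
    unfolding D_def using superalg_homD[OF th(3)[OF V]] cl s x by (simp add: S_apply[OF V(1)])
  then have Dx: "\<theta> V D {} x \<noteq> 0" using ne by simp
  define N where "N = {y \<in> V. \<theta> V D {} y \<noteq> 0}"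
  have N: "openin X N" "N \<subseteq> V" "x \<in> N" "N \<subseteq> U"
    unfolding N_def using hol_open_nonzero[OF V(1) S_hol[OF th(6)[OF V D]]] x Dx V by auto
  define R where "R = ResG V N D"
  have R: "R \<in> carrier (SecG N)" unfolding R_def using ResG_closed V N D by blast
  have tR: "\<theta> N R {} y = \<theta> V D {} y" if "y \<in> N" for y
    unfolding R_def th(5)[OF V(1) N(1,2) V(2) D] by (rule S_Res_apply) (use that in auto)
  obtain H where H: "H \<in> carrier (S m N)" "\<theta> N R \<otimes>\<^bsub>S m N\<^esub> H = \<one>\<^bsub>S m N\<^esub>"
    using S_invertible[OF N(1) th(6)[OF N(1,4) R]] tR by (auto simp: N_def)
  have "H \<in> \<theta> N ` carrier (SecG N)" using th(4)[OF N(1,4)] H(1) by (simp add: bij_betw_def)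
  then obtain t where t: "t \<in> carrier (SecG N)" "\<theta> N t = H" by (metis imageE)
  note clN = SecG_closed[OF N(1)]
  have "\<theta> N (R \<otimes>\<^bsub>SecG N\<^esub> t) = \<theta> N \<one>\<^bsub>SecG N\<^esub>"
    using superalg_homD[OF th(3)[OF N(1,4)]] R t H by simp
  then have "R \<otimes>\<^bsub>SecG N\<^esub> t = \<one>\<^bsub>SecG N\<^esub>"
    using th(4)[OF N(1,4)] clN R t by (auto simp: bij_betw_def inj_on_def)
  then have "\<kappa> N R * \<kappa> N t = 1" using mult[OF N(1,3,4) R t(1)] one[OF N(1,3,4)] by simp
  moreover have "\<kappa> N R = 0" unfolding R_def using res[OF V(1) N(1,3,2) V(2) D] D0 by simp
  ultimately show False by simp
qed

lemma trivialization_value_unique: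
  assumes t: "trivialization U \<theta>" and t': "trivialization U \<theta>'" and V: "openin X V" "V \<subseteq> U" "x \<in> V" and s: "s \<in> carrier (SecG V)"
  shows "\<theta>' V s {} x = \<theta> V s {} x"
  by (rule character_is_value[OF t V(3,1,2) s, where \<kappa> = "\<lambda>V s. \<theta>' V s {} x"])
    (simp_all add: superalg_homD[OF trivializationD(3)[OF t']] S_apply wedge_def trivializationD(5)[OF t'] S_Res_apply)

text \<open>The value at \<open>x\<close> read off in an arbitrary trivialization; by the preceding lemma all of them agree.\<close>

definition val :: "'p set \<Rightarrow> 's \<Rightarrow> 'p \<Rightarrow> complex" where
  "val W s x = (SOME c. \<exists>U \<theta>. trivialization U \<theta> \<and> x \<in> U \<and> U \<subseteq> W \<and> c = \<theta> U (ResG W U s) {} x)"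

lemma val_eq:
  assumes W: "openin X W" and t: "trivialization U \<theta>" and x: "x \<in> U" and UW: "U \<subseteq> W" and s: "s \<in> carrier (SecG W)"
  shows "val W s x = \<theta> U (ResG W U s) {} x"
proof -
  have uniq: "\<theta>' U' (ResG W U' s) {} x = \<theta> U (ResG W U s) {} x"
    if t': "trivialization U' \<theta>'" and x': "x \<in> U'" "U' \<subseteq> W" for U' \<theta>'
  proof -
    define V where "V = U \<inter> U'"
    note o = trivializationD(1)[OF t] trivializationD(1)[OF t']
    have V: "openin X V" "x \<in> V" "V \<subseteq> U" "V \<subseteq> U'" "V \<subseteq> W" unfolding V_def using o x x' UW by auto
    have "\<theta> U (ResG W U s) {} x = \<theta> V (ResG W V s) {} x"
      using trivializationD(5)[OF t o(1) V(1,3) subset_refl ResG_closed[OF W o(1) UW s]]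
      by (simp add: ResG_comp[OF W o(1) V(1,3) UW s] S_Res_apply V)
    moreover have "\<theta>' U' (ResG W U' s) {} x = \<theta>' V (ResG W V s) {} x"
      using trivializationD(5)[OF t' o(2) V(1,4) subset_refl ResG_closed[OF W o(2) x'(2) s]]
      by (simp add: ResG_comp[OF W o(2) V(1,4) x'(2) s] S_Res_apply V)
    moreover have "\<theta>' V (ResG W V s) {} x = \<theta> V (ResG W V s) {} x"
      by (rule trivialization_value_unique[OF trivialization_subset[OF t V(1,3)] trivialization_subset[OF t' V(1,4)] V(1) subset_refl V(2)])
        (rule ResG_closed[OF W V(1,5) s])
    ultimately show ?thesis by simp
  qed
  have "\<exists>c U \<theta>. trivialization U \<theta> \<and> x \<in> U \<and> U \<subseteq> W \<and> c = \<theta> U (ResG W U s) {} x" using t x UW by blast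
  from someI_ex[OF this] show ?thesis unfolding val_def[symmetric] using uniq by auto
qed

lemma small_trivialization:
  assumes "openin X W" "x \<in> W" obtains U \<theta> where "trivialization U \<theta>" "x \<in> U" "U \<subseteq> W" "openin X U"
proof -
  have "x \<in> topspace X" using assms openin_subset by blast
  then obtain U \<theta> where t: "trivialization U \<theta>" "x \<in> U" by (rule trivialization_ex)
  have "openin X (U \<inter> W)" using trivializationD(1)[OF t(1)] assms by blast
  then show ?thesis using that[of "U \<inter> W" \<theta>] trivialization_subset[OF t(1)] t assms by blast
qed

text \<open>Restricting to a small neighbourhood reduces this to the case of a trivialized sheaf.\<close>

lemma character_is_val:
  fixes \<kappa> :: "'p set \<Rightarrow> 's \<Rightarrow> complex"
  assumes x: "x \<in> V" and V: "openin X V" and s: "s \<in> carrier (SecG V)"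
    and add: "\<And>W a b. openin X W \<Longrightarrow> x \<in> W \<Longrightarrow> a \<in> carrier (SecG W) \<Longrightarrow> b \<in> carrier (SecG W) \<Longrightarrow>
      \<kappa> W (a \<oplus>\<^bsub>SecG W\<^esub> b) = \<kappa> W a + \<kappa> W b"
    and mult: "\<And>W a b. openin X W \<Longrightarrow> x \<in> W \<Longrightarrow> a \<in> carrier (SecG W) \<Longrightarrow> b \<in> carrier (SecG W) \<Longrightarrow>
      \<kappa> W (a \<otimes>\<^bsub>SecG W\<^esub> b) = \<kappa> W a * \<kappa> W b"
    and one: "\<And>W. openin X W \<Longrightarrow> x \<in> W \<Longrightarrow> \<kappa> W \<one>\<^bsub>SecG W\<^esub> = 1"
    and smult: "\<And>W a c. openin X W \<Longrightarrow> x \<in> W \<Longrightarrow> a \<in> carrier (SecG W) \<Longrightarrow>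
      \<kappa> W (c \<odot>\<^bsub>SecG W\<^esub> a) = c * \<kappa> W a"
    and res: "\<And>W W' a. openin X W \<Longrightarrow> openin X W' \<Longrightarrow> x \<in> W' \<Longrightarrow> W' \<subseteq> W \<Longrightarrow> a \<in> carrier (SecG W) \<Longrightarrow>
      \<kappa> W' (ResG W W' a) = \<kappa> W a"
  shows "\<kappa> V s = val V s x"
proof -
  obtain U \<theta> where t: "trivialization U \<theta>" and U: "x \<in> U" "U \<subseteq> V" "openin X U" using small_trivialization[OF V x] .
  have "\<kappa> U (ResG V U s) = \<theta> U (ResG V U s) {} x"
    by (rule character_is_value[OF t U(1,3) subset_refl ResG_closed[OF V U(3,2) s]]) (use assms in auto)
  then show ?thesis using res[OF V U(3,1,2) s] val_eq[OF V t U(1,2) s] by simp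
qed

lemma val_simps:
  assumes W: "openin X W" and x: "x \<in> W"
  shows "a \<in> carrier (SecG W) \<Longrightarrow> b \<in> carrier (SecG W) \<Longrightarrow> val W (a \<oplus>\<^bsub>SecG W\<^esub> b) x = val W a x + val W b x"
    "a \<in> carrier (SecG W) \<Longrightarrow> b \<in> carrier (SecG W) \<Longrightarrow> val W (a \<otimes>\<^bsub>SecG W\<^esub> b) x = val W a x * val W b x"
    "val W \<one>\<^bsub>SecG W\<^esub> x = 1"
    "a \<in> carrier (SecG W) \<Longrightarrow> val W (c \<odot>\<^bsub>SecG W\<^esub> a) x = c * val W a x"
    "a \<in> odd_part (SecG W) \<Longrightarrow> val W a x = 0"
proof -
  obtain U \<theta> where t: "trivialization U \<theta>" and U: "x \<in> U" "U \<subseteq> W" "openin X U" using small_trivialization[OF W x] .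
  note v = val_eq[OF W t U(1,2)] and h = superalg_homD[OF trivializationD(3)[OF t U(3) subset_refl]]
    and r = superalg_homD[OF ResG_hom[OF W U(3,2)]] and cl = SecG_closed[OF W] and rc = ResG_closed[OF W U(3,2)]
  show "a \<in> carrier (SecG W) \<Longrightarrow> b \<in> carrier (SecG W) \<Longrightarrow> val W (a \<oplus>\<^bsub>SecG W\<^esub> b) x = val W a x + val W b x"
    "a \<in> carrier (SecG W) \<Longrightarrow> b \<in> carrier (SecG W) \<Longrightarrow> val W (a \<otimes>\<^bsub>SecG W\<^esub> b) x = val W a x * val W b x"
    "val W \<one>\<^bsub>SecG W\<^esub> x = 1"
    "a \<in> carrier (SecG W) \<Longrightarrow> val W (c \<odot>\<^bsub>SecG W\<^esub> a) x = c * val W a x"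
    using U by (simp_all add: v cl r h rc S_apply[OF U(3)] wedge_def)
  assume a: "a \<in> odd_part (SecG W)"
  then show "val W a x = 0" using S_parity_zero(2)[OF h(6)[OF r(6)[OF a]], of "{}" x] U by (simp add: v cl)
qed

lemma val_Res:
  assumes "openin X W" "openin X V" "V \<subseteq> W" "x \<in> V" "s \<in> carrier (SecG W)"
  shows "val V (ResG W V s) x = val W s x"
proof -
  obtain U \<theta> where t: "trivialization U \<theta>" and U: "x \<in> U" "U \<subseteq> V" "openin X U" using small_trivialization[OF assms(2,4)] .
  have UW: "U \<subseteq> W" using U assms by auto
  show ?thesis
    using val_eq[OF assms(2) t U(1,2) ResG_closed[OF assms(1-3,5)]] val_eq[OF assms(1) t U(1) UW assms(5)]
    by (simp add: ResG_comp[OF assms(1,2) U(3,2) assms(3,5)])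
qed

lemma val_hol:
  assumes W: "openin X W" and s: "s \<in> carrier (SecG W)"
  shows "(\<lambda>x\<in>W. val W s x) \<in> hol (body G) W"
proof (rule hol_local[OF W])
  fix x assume x: "x \<in> W"
  obtain U \<theta> where t: "trivialization U \<theta>" and U: "x \<in> U" "U \<subseteq> W" "openin X U" using small_trivialization[OF W x] .
  have h: "\<theta> U (ResG W U s) {} \<in> hol (body G) U"
    by (rule S_hol[OF trivializationD(6)[OF t U(3) subset_refl ResG_closed[OF W U(3,2) s]]]) simp
  have "restrict (\<lambda>x\<in>W. val W s x) U = \<theta> U (ResG W U s) {}"
    by (rule extensionalityI[OF restrict_extensional hol_ext[OF h]]) (use U val_eq[OF W t _ U(2) s] in auto)
  then show "\<exists>N. openin X N \<and> x \<in> N \<and> N \<subseteq> W \<and> restrict (\<lambda>x\<in>W. val W s x) N \<in> hol (body G) N"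
    using U h by metis
qed simp

lemma val_trivialization:
  assumes "trivialization U \<theta>" "openin X V" "V \<subseteq> U" "x \<in> V" "s \<in> carrier (SecG V)"
  shows "\<theta> V s {} x = val V s x"
  using val_eq[OF assms(2) trivialization_subset[OF assms(1-3)] assms(4) subset_refl assms(5)] ResG_id[OF assms(2,5)] by simp

end

section \<open>A test object\<close>

lemma sheaf_empty:
  assumes "superalg_sheaf X P" "a \<in> carrier (Sec P {})" "b \<in> carrier (Sec P {})"
  shows "a = b"
proof -
  have "\<exists>!t. t \<in> carrier (Sec P (\<Union>{})) \<and> (\<forall>V\<in>{}. Res P (\<Union>{}) V t = undefined V)"
    by (rule assms(1)[unfolded superalg_sheaf_def, THEN conjunct2, rule_format]) simp
  then show ?thesis using assms(2,3) by auto
qed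

lemma superalg_hom_trivial:
  fixes A :: "(complex, 's) superalg" and B :: "(complex, 't) superalg"
  assumes A: "comm_superalgebra A" and B: "comm_superalgebra B" and triv: "\<And>a b. a \<in> carrier B \<Longrightarrow> b \<in> carrier B \<Longrightarrow> a = b"
    and h: "\<And>a. a \<in> carrier A \<Longrightarrow> h a \<in> carrier B"
  shows "h \<in> superalg_hom A B"
proof -
  note cA = superalg_closed[OF A] and cB = superalg_closed[OF B] and pB = superalg_parts_closed[OF B]
  have z: "x = \<zero>\<^bsub>B\<^esub>" if "x \<in> carrier B" for x using triv[OF that cB(4)] .
  have e: "x \<in> even_part B" "x \<in> odd_part B" if "x \<in> carrier B" for x using z[OF that] pB(1,2) by auto
  show ?thesis unfolding superalg_hom_def
  proof (intro CollectI conjI ring_hom_memI allI ballI h)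
    show "h ` even_part A \<subseteq> even_part B" using e(1)[OF h[OF cA(6)]] by auto
    show "h ` odd_part A \<subseteq> odd_part B" using e(2)[OF h[OF cA(7)]] by auto
  qed (auto intro!: triv h cA(1-5) cB(1-5))
qed

lemma superalg_hom_scalar:
  fixes A :: "(complex, 's) superalg" and B :: "(complex, 't) superalg"
  assumes A: "comm_superalgebra A" and B: "comm_superalgebra B"
    and add: "\<And>a b. a \<in> carrier A \<Longrightarrow> b \<in> carrier A \<Longrightarrow> f (a \<oplus>\<^bsub>A\<^esub> b) = f a + f b"
    and mult: "\<And>a b. a \<in> carrier A \<Longrightarrow> b \<in> carrier A \<Longrightarrow> f (a \<otimes>\<^bsub>A\<^esub> b) = f a * f b"
    and one: "f \<one>\<^bsub>A\<^esub> = 1" and smult: "\<And>a c. a \<in> carrier A \<Longrightarrow> f (c \<odot>\<^bsub>A\<^esub> a) = c * f a"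
    and odd: "\<And>a. a \<in> odd_part A \<Longrightarrow> f a = 0"
  shows "(\<lambda>a. f a \<odot>\<^bsub>B\<^esub> \<one>\<^bsub>B\<^esub>) \<in> superalg_hom A B"
proof -
  interpret RB: ring B by (rule comm_superalgebra.axioms(1)[OF B])
  interpret B: comm_superalgebra B by fact
  note cB = superalg_closed[OF B] and pB = superalg_parts_closed[OF B]
  have m: "(c * d) \<odot>\<^bsub>B\<^esub> \<one>\<^bsub>B\<^esub> = (c \<odot>\<^bsub>B\<^esub> \<one>\<^bsub>B\<^esub>) \<otimes>\<^bsub>B\<^esub> (d \<odot>\<^bsub>B\<^esub> \<one>\<^bsub>B\<^esub>)" for c d
    using B.smult_mult_left[of "\<one>\<^bsub>B\<^esub>" "d \<odot>\<^bsub>B\<^esub> \<one>\<^bsub>B\<^esub>" c] B.smult_assoc1[of c d "\<one>\<^bsub>B\<^esub>"] cB by simp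
  show ?thesis unfolding superalg_hom_def
  proof (intro CollectI conjI ring_hom_memI allI ballI)
    show "(\<lambda>a. f a \<odot>\<^bsub>B\<^esub> \<one>\<^bsub>B\<^esub>) ` even_part A \<subseteq> even_part B" using pB(7)[OF B.one_even] by auto
    show "(\<lambda>a. f a \<odot>\<^bsub>B\<^esub> \<one>\<^bsub>B\<^esub>) ` odd_part A \<subseteq> odd_part B"
      using odd B.smult_l_null[of "\<one>\<^bsub>B\<^esub>"] pB(2) cB by auto
    show "f \<one>\<^bsub>A\<^esub> \<odot>\<^bsub>B\<^esub> \<one>\<^bsub>B\<^esub> = \<one>\<^bsub>B\<^esub>" using one B.smult_one[of "\<one>\<^bsub>B\<^esub>"] cB by simp
  next
    fix a b assume "a \<in> carrier A" "b \<in> carrier A"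
    then show "f (a \<oplus>\<^bsub>A\<^esub> b) \<odot>\<^bsub>B\<^esub> \<one>\<^bsub>B\<^esub> = f a \<odot>\<^bsub>B\<^esub> \<one>\<^bsub>B\<^esub> \<oplus>\<^bsub>B\<^esub> f b \<odot>\<^bsub>B\<^esub> \<one>\<^bsub>B\<^esub>"
      "f (a \<otimes>\<^bsub>A\<^esub> b) \<odot>\<^bsub>B\<^esub> \<one>\<^bsub>B\<^esub> = (f a \<odot>\<^bsub>B\<^esub> \<one>\<^bsub>B\<^esub>) \<otimes>\<^bsub>B\<^esub> (f b \<odot>\<^bsub>B\<^esub> \<one>\<^bsub>B\<^esub>)"
      using B.smult_l_distr[of "f a" "f b" "\<one>\<^bsub>B\<^esub>"] cB m by (simp_all add: add mult)
  next
    fix c a assume "a \<in> carrier A"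
    then show "f (c \<odot>\<^bsub>A\<^esub> a) \<odot>\<^bsub>B\<^esub> \<one>\<^bsub>B\<^esub> = c \<odot>\<^bsub>B\<^esub> (f a \<odot>\<^bsub>B\<^esub> \<one>\<^bsub>B\<^esub>)"
      using B.smult_assoc1[of c "f a" "\<one>\<^bsub>B\<^esub>"] cB smult by simp
  qed (use cB in auto)
qed

text \<open>Morphisms are given by a map of points and a family of pullbacks, which become extensional here.\<close>

definition mk_map :: "('p, 's) superspace \<Rightarrow> ('p, 's) superspace \<Rightarrow> ('p \<Rightarrow> 'p) \<Rightarrow> ('p set \<Rightarrow> 's \<Rightarrow> 's) \<Rightarrow> ('p, 's) supermap" where
  "mk_map Y Z \<phi> \<Psi> = \<lparr>sdom = Y, scod = Z, pmap = restrict \<phi> (topspace (sm_top Y)),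
     pull = (\<lambda>W\<in>{W. openin (sm_top Z) W}. \<lambda>s\<in>carrier (Sec (osheaf Z) W). \<Psi> W s)\<rparr>"

definition pre :: "('p, 's) superspace \<Rightarrow> ('p \<Rightarrow> 'p) \<Rightarrow> 'p set \<Rightarrow> 'p set" where
  "pre Y \<phi> W = {x \<in> topspace (sm_top Y). \<phi> x \<in> W}"

lemma mk_map_simps:
  "sdom (mk_map Y Z \<phi> \<Psi>) = Y" "scod (mk_map Y Z \<phi> \<Psi>) = Z"
  "x \<in> topspace (sm_top Y) \<Longrightarrow> pmap (mk_map Y Z \<phi> \<Psi>) x = \<phi> x"
  "openin (sm_top Z) W \<Longrightarrow> s \<in> carrier (Sec (osheaf Z) W) \<Longrightarrow> pull (mk_map Y Z \<phi> \<Psi>) W s = \<Psi> W s"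
  "preimg (mk_map Y Z \<phi> \<Psi>) W = pre Y \<phi> W"
  by (auto simp: mk_map_def preimg_def pre_def)

text \<open>The conditions over open sets with empty preimage are automatic: by the sheaf axiom for the empty
  cover, the sections over the empty set form the zero algebra.\<close>

lemma mk_map_supermap:
  fixes Y Z :: "('p, 's) superspace"
  assumes Y: "supermanifold Y" and Z: "supermanifold Z" and \<phi>: "continuous_map (sm_top Y) (sm_top Z) \<phi>"
    and cl: "\<And>W s. openin (sm_top Z) W \<Longrightarrow> s \<in> carrier (Sec (osheaf Z) W) \<Longrightarrow> \<Psi> W s \<in> carrier (Sec (osheaf Y) (pre Y \<phi> W))"
    and hom: "\<And>W. openin (sm_top Z) W \<Longrightarrow> pre Y \<phi> W \<noteq> {} \<Longrightarrow> \<Psi> W \<in> superalg_hom (Sec (osheaf Z) W) (Sec (osheaf Y) (pre Y \<phi> W))"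
    and nat: "\<And>V W s. openin (sm_top Z) V \<Longrightarrow> openin (sm_top Z) W \<Longrightarrow> W \<subseteq> V \<Longrightarrow> pre Y \<phi> W \<noteq> {} \<Longrightarrow> s \<in> carrier (Sec (osheaf Z) V) \<Longrightarrow>
      \<Psi> W (Res (osheaf Z) V W s) = Res (osheaf Y) (pre Y \<phi> V) (pre Y \<phi> W) (\<Psi> V s)"
  shows "is_supermap (mk_map Y Z \<phi> \<Psi>)"
  unfolding is_supermap_def mk_map_simps
proof (intro conjI allI impI ballI; (elim conjE)?)
  show "pmap (mk_map Y Z \<phi> \<Psi>) \<in> extensional (topspace (sm_top Y))"
    "pull (mk_map Y Z \<phi> \<Psi>) \<in> extensional {W. openin (sm_top Z) W}"
    by (simp_all add: mk_map_def)
  show "continuous_map (sm_top Y) (sm_top Z) (pmap (mk_map Y Z \<phi> \<Psi>))"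
    by (rule continuous_map_eq[OF \<phi>]) (simp add: mk_map_simps)
next
  fix W assume W: "openin (sm_top Z) W"
  show "pull (mk_map Y Z \<phi> \<Psi>) W \<in> extensional (carrier (Sec (osheaf Z) W))" using W by (simp add: mk_map_def)
  have pW: "openin (sm_top Y) (pre Y \<phi> W)" using \<phi> W by (simp add: continuous_map pre_def)
  have "\<Psi> W \<in> superalg_hom (Sec (osheaf Z) W) (Sec (osheaf Y) (pre Y \<phi> W))"
  proof (cases "pre Y \<phi> W = {}")
    case True
    show ?thesis
      by (rule superalg_hom_trivial[OF supermanifoldD(4)[OF Z W] supermanifoldD(4)[OF Y pW] _ cl[OF W]])
        (use True sheaf_empty[OF supermanifoldD(2)[OF Y]] in auto)
  qed (rule hom[OF W])
  then show "pull (mk_map Y Z \<phi> \<Psi>) W \<in> superalg_hom (Sec (osheaf Z) W) (Sec (osheaf Y) (pre Y \<phi> W))"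
    by (rule superalg_hom_cong[OF supermanifoldD(4)[OF Z W]]) (simp add: mk_map_simps W)
next
  fix V W s assume V: "openin (sm_top Z) V" and W: "openin (sm_top Z) W" and WV: "W \<subseteq> V"
    and s: "s \<in> carrier (Sec (osheaf Z) V)"
  have r: "Res (osheaf Z) V W s \<in> carrier (Sec (osheaf Z) W)"
    using superalg_hom_closed[OF supermanifoldD(5)[OF Z V W WV] s] .
  have p: "openin (sm_top Y) (pre Y \<phi> V)" "openin (sm_top Y) (pre Y \<phi> W)" "pre Y \<phi> W \<subseteq> pre Y \<phi> V"
    using \<phi> V W WV by (auto simp: continuous_map pre_def)
  have "\<Psi> W (Res (osheaf Z) V W s) = Res (osheaf Y) (pre Y \<phi> V) (pre Y \<phi> W) (\<Psi> V s)"
  proof (cases "pre Y \<phi> W = {}")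
    case True
    have "Res (osheaf Y) (pre Y \<phi> V) (pre Y \<phi> W) (\<Psi> V s) \<in> carrier (Sec (osheaf Y) (pre Y \<phi> W))"
      using superalg_hom_closed[OF supermanifoldD(5)[OF Y p] cl[OF V s]] .
    then show ?thesis using cl[OF W r] True sheaf_empty[OF supermanifoldD(2)[OF Y]] by auto
  qed (rule nat[OF V W WV _ s])
  then show "pull (mk_map Y Z \<phi> \<Psi>) W (Res (osheaf Z) V W s) =
      Res (osheaf Y) (pre Y \<phi> V) (pre Y \<phi> W) (pull (mk_map Y Z \<phi> \<Psi>) V s)"
    by (simp add: mk_map_simps V W s r)
qed

lemma supermap_eqI':
  fixes f g :: "('p, 's) supermap"
  assumes f: "is_supermap f" and g: "is_supermap g" and d: "sdom f = sdom g" "scod f = scod g" and Y: "supermanifold (sdom f)"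
    and p: "\<And>x. x \<in> topspace (sm_top (sdom f)) \<Longrightarrow> pmap f x = pmap g x"
    and q: "\<And>W s x. openin (sm_top (scod f)) W \<Longrightarrow> s \<in> carrier (Sec (osheaf (scod f)) W) \<Longrightarrow>
      x \<in> topspace (sm_top (sdom f)) \<Longrightarrow> pmap f x \<in> W \<Longrightarrow> pull f W s = pull g W s"
  shows "f = g"
proof (rule supermap_eqI[OF f g d p])
  fix W s assume W: "openin (sm_top (scod f)) W" "s \<in> carrier (Sec (osheaf (scod f)) W)"
  have e: "preimg f W = preimg g W" using p d by (auto simp: preimg_def)
  show "pull f W s = pull g W s"
  proof (cases "preimg f W = {}")
    case True
    then show ?thesis
      using is_supermapD(3)[OF f W] is_supermapD(3)[OF g, of W s] W d e sheaf_empty[OF supermanifoldD(2)[OF Y]] by auto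
  next
    case False
    then show ?thesis using q W by (auto simp: preimg_def)
  qed
qed

text \<open>A sequence of complex numbers is coded by a set of natural numbers.\<close>

lemma seq_complex_inj: "\<exists>e :: (nat \<Rightarrow> complex) \<Rightarrow> complex. inj e"
proof -
  obtain r' :: "nat set \<Rightarrow> real" where r': "bij r'" using nat_sets_eqpoll_reals unfolding eqpoll_def by auto
  define r where "r = inv_into UNIV r'"
  have r: "inj r" unfolding r_def using r' by (simp add: bij_imp_bij_inv bij_is_inj)
  define c where "c f = {prod_encode (i, prod_encode (b, j)) |i b j. (b = 0 \<and> j \<in> r (Re (f i))) \<or> (b = 1 \<and> j \<in> r (Im (f i)))}"
    for f :: "nat \<Rightarrow> complex"
  have m: "prod_encode (i, prod_encode (b, j)) \<in> c f \<longleftrightarrow> (b = 0 \<and> j \<in> r (Re (f i))) \<or> (b = 1 \<and> j \<in> r (Im (f i)))" for f i b j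
    unfolding c_def by (auto simp: prod_encode_eq)
  have "inj c"
  proof (rule injI)
    fix f g assume eq: "c f = c g"
    have "r (Re (f i)) = r (Re (g i))" "r (Im (f i)) = r (Im (g i))" for i
      using m[of i 0 _ f] m[of i 0 _ g] m[of i 1 _ f] m[of i 1 _ g] eq by auto
    then show "f = g" using r by (auto simp: inj_eq fun_eq_iff complex_eq_iff)
  qed
  then have "inj (\<lambda>f. complex_of_real (r' (c f)))"
    using r' by (auto simp: inj_def bij_def)
  then show ?thesis by blast
qed

context super_manifold
begin

lemma complex_inj:
  assumes "x \<in> topspace X"
  shows "\<exists>i :: complex \<Rightarrow> 's. inj i"
proof -
  obtain U \<theta> where t: "trivialization U \<theta>" "x \<in> U" using trivialization_ex[OF assms] .
  have U: "openin X U" using trivializationD(1)[OF t(1)] .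
  have "\<theta> U (c \<odot>\<^bsub>SecG U\<^esub> \<one>\<^bsub>SecG U\<^esub>) {} x = c" for c
    using superalg_homD[OF trivializationD(3)[OF t(1) U subset_refl]] SecG_closed[OF U] t by (simp add: S_apply[OF U])
  then have "inj (\<lambda>c. c \<odot>\<^bsub>SecG U\<^esub> \<one>\<^bsub>SecG U\<^esub>)"
    by (rule inj_on_inverseI[where g = "\<lambda>s. \<theta> U s {} x"])
  then show ?thesis by blast
qed

text \<open>A superfunction is determined by the values of its coefficients on a countable dense set,
  hence there are only as many superfunctions as complex numbers.\<close>

lemma S_inj:
  assumes "x \<in> topspace X" and U: "openin X U"
  shows "\<exists>e :: (nat set \<Rightarrow> 'p \<Rightarrow> complex) \<Rightarrow> 's. inj_on e (carrier (S m U))"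
proof -
  have "separable_space X"
    using M second_countable_imp_separable_space unfolding complex_manifold_def by blast
  then obtain D where D: "countable D" "D \<subseteq> topspace X" "X closure_of D = topspace X"
    unfolding separable_space_def by blast
  let ?A = "Pow {..<m} \<times> D"
  define u where "u = from_nat_into ?A"
  have "D \<noteq> {}" using D(3) assms(1) by auto
  then have u: "range u = ?A"
    unfolding u_def using D(1) by (intro range_from_nat_into) (auto simp: countable_finite)
  define r where "r F i = F (fst (u i)) (snd (u i))" for F :: "nat set \<Rightarrow> 'p \<Rightarrow> complex" and i
  have rinj: "inj_on r (carrier (S m U))"
  proof (rule inj_onI)
    fix F F' assume F: "F \<in> carrier (S m U)" "F' \<in> carrier (S m U)" and eq: "r F = r F'"
    have eqD: "F K d = F' K d" if K: "K \<subseteq> {..<m}" "d \<in> D" for K d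
    proof -
      have "(K, d) \<in> range u" using K unfolding u by simp
      then obtain i where "u i = (K, d)" by force
      then show ?thesis using fun_cong[OF eq, of i] by (simp add: r_def)
    qed
    show "F = F'"
    proof (rule S_eqI[OF F], rule ccontr)
      fix K x assume K: "K \<subseteq> {..<m}" "x \<in> U" "F K x \<noteq> F' K x"
      let ?f = "\<lambda>x\<in>U. F K x + (\<lambda>x\<in>U. (-1) * F' K x) x"
      have "?f \<in> hol (body G) U" by (intro hol_add hol_cmult U S_hol[OF F(1) K(1)] S_hol[OF F(2) K(1)])
      from hol_open_nonzero[OF U this] have o: "openin X {x \<in> U. ?f x \<noteq> 0}" .
      have xn: "x \<in> {x \<in> U. ?f x \<noteq> 0}" using K by simp
      have "x \<in> X closure_of D" unfolding D(3) using openin_subset[OF U] K(2) by (rule subsetD)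
      then have "\<forall>T. x \<in> T \<and> openin X T \<longrightarrow> (\<exists>y. y \<in> D \<and> y \<in> T)" unfolding in_closure_of by (rule conjunct2)
      from this[rule_format, OF conjI[OF xn o]] obtain d where d: "d \<in> D" "d \<in> {x \<in> U. ?f x \<noteq> 0}" by (elim exE conjE)
      then have "F K d \<noteq> F' K d" by (auto split: if_splits)
      then show False using eqD[OF K(1) d(1)] by simp
    qed
  qed
  obtain e :: "(nat \<Rightarrow> complex) \<Rightarrow> complex" where e: "inj e" using seq_complex_inj by (rule exE)
  obtain i :: "complex \<Rightarrow> 's" where i: "inj i" using complex_inj[OF assms(1)] by (rule exE)
  have "inj_on (i \<circ> (e \<circ> r)) (carrier (S m U))"
    by (intro comp_inj_on rinj inj_on_subset[OF e] inj_on_subset[OF i]) simp_all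
  then show ?thesis by (intro exI[of _ "i \<circ> (e \<circ> r)"])
qed

end

locale pointed_super_manifold = super_manifold G m for G :: "('p, 's) superspace" and m +
  fixes x0 :: 'p
  assumes x0: "x0 \<in> topspace (sm_top G)"
begin

definition enc :: "'p set \<Rightarrow> (nat set \<Rightarrow> 'p \<Rightarrow> complex) \<Rightarrow> 's" where
  "enc U = (SOME e. inj_on e (carrier (S m U)))"

definition dec :: "'p set \<Rightarrow> 's \<Rightarrow> nat set \<Rightarrow> 'p \<Rightarrow> complex" where
  "dec U = inv_into (carrier (S m U)) (enc U)"

text \<open>The product of the reduced manifold with a point of odd dimension \<open>m\<close>.\<close>

definition T :: "('p, 's) superspace" where
  "T = \<lparr>body = body G, osheaf = coded enc (super_hol (body G) m)\<rparr>"

abbreviation SecT where "SecT W \<equiv> Sec (osheaf T) W"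

lemma T_top [simp]: "sm_top T = X" "body T = body G" by (simp_all add: T_def)

lemma enc_inj: "openin X U \<Longrightarrow> inj_on (enc U) (carrier (S m U))"
  unfolding enc_def using S_inj[OF x0] by (rule someI_ex)

lemma enc_transport: "openin X U \<Longrightarrow> superalg_transport (S m U) (SecT U) (enc U)"
  unfolding T_def using coded_transport[of enc U "super_hol (body G) m"] enc_inj by simp

lemma enc_hom: "openin X U \<Longrightarrow> enc U \<in> superalg_hom (S m U) (SecT U)"
  using superalg_transport_iso[OF enc_transport] by (simp add: superalg_iso_def)

lemma dec_iso: "openin X U \<Longrightarrow> dec U \<in> superalg_iso (SecT U) (S m U)"
  unfolding dec_def using superalg_transport_iso[OF superalg_transport_inverse[OF comm_superalgebra_S enc_transport]] by blast

lemma dec_hom: "openin X U \<Longrightarrow> dec U \<in> superalg_hom (SecT U) (S m U)"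
  using dec_iso by (simp add: superalg_iso_def)

lemma dec_enc [simp]: "openin X U \<Longrightarrow> F \<in> carrier (S m U) \<Longrightarrow> dec U (enc U F) = F"
  unfolding dec_def using enc_inj by simp

lemma enc_closed: "openin X U \<Longrightarrow> F \<in> carrier (S m U) \<Longrightarrow> enc U F \<in> carrier (SecT U)"
  using superalg_hom_closed[OF enc_hom] .

lemma dec_closed: "openin X U \<Longrightarrow> c \<in> carrier (SecT U) \<Longrightarrow> dec U c \<in> carrier (S m U)"
  using superalg_hom_closed[OF dec_hom] .

lemma T_Res: "openin X U \<Longrightarrow> c \<in> carrier (SecT U) \<Longrightarrow>
    Res (osheaf T) U V c = enc V (Res (super_hol (body G) m) U V (dec U c))"
  by (simp add: T_def coded_def dec_def)

lemma T_supermanifold: "supermanifold T"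
  unfolding supermanifold_def T_top
proof (intro conjI M exI ballI)
  show "superalg_sheaf X (osheaf T)"
    by (rule superalg_sheaf_transport[OF S_sheaf enc_transport]) (simp_all add: T_Res enc_closed)
  fix x assume "x \<in> topspace X"
  then show "openin X (topspace X)" "x \<in> topspace X" by auto
  show "sheaf_isomorphic_on X (topspace X) (osheaf T) (super_hol (body G) m)"
    unfolding sheaf_isomorphic_on_def
    by (rule exI[of _ dec]) (auto simp: dec_iso T_Res S_Res_closed dec_closed)
qed

end

section \<open>Left translation of an odd neighbourhood of the unit\<close>

lemma SMan_hom_comp: "\<lbrakk>f \<in> Hom SMan A B; g \<in> Hom SMan B D; supermanifold D\<rbrakk> \<Longrightarrow> Comp SMan g f \<in> Hom SMan A D"
  using is_supermap_comp[of f g] by (auto simp: SMan_simps SMan_comp)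

context pointed_super_manifold
begin

abbreviation top where "top \<equiv> topspace X"

lemma pre_const: "p \<in> W \<Longrightarrow> pre Y (\<lambda>_. p) W = topspace (sm_top Y)"
  by (auto simp: pre_def)

lemma pre_id: "openin X W \<Longrightarrow> pre T (\<lambda>x. x) W = W"
  using openin_subset by (fastforce simp: pre_def)

lemma SecT_superalg: "openin X W \<Longrightarrow> comm_superalgebra (SecT W)"
  using supermanifoldD(4)[OF T_supermanifold] by simp

text \<open>The constant morphism to the reduced base point.\<close>

definition base_map :: "('p, 's) superspace \<Rightarrow> ('p, 's) supermap" where
  "base_map Y = mk_map Y T (\<lambda>_. x0) (\<lambda>W c. dec W c {} x0 \<odot>\<^bsub>Sec (osheaf Y) (pre Y (\<lambda>_. x0) W)\<^esub> \<one>\<^bsub>Sec (osheaf Y) (pre Y (\<lambda>_. x0) W)\<^esub>)"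

lemma dec_Res: "openin X V \<Longrightarrow> openin X W \<Longrightarrow> W \<subseteq> V \<Longrightarrow> c \<in> carrier (SecT V) \<Longrightarrow> K \<subseteq> {..<m} \<Longrightarrow> x \<in> W \<Longrightarrow>
    dec W (Res (osheaf T) V W c) K x = dec V c K x"
  by (simp add: T_Res S_Res_closed dec_closed S_Res_apply)

lemma base_map_hom:
  assumes Y: "supermanifold Y"
  shows "base_map Y \<in> Hom SMan Y T"
  unfolding SMan_simps base_map_def mk_map_simps
proof (intro conjI refl mk_map_supermap[OF Y T_supermanifold])
  show "continuous_map (sm_top Y) (sm_top T) (\<lambda>_. x0)" using x0 by simp
next
  fix W s assume W: "openin (sm_top T) W" and s: "s \<in> carrier (SecT W)"
  have o: "openin (sm_top Y) (pre Y (\<lambda>_. x0) W)" by (cases "x0 \<in> W") (auto simp: pre_def)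
  show "dec W s {} x0 \<odot>\<^bsub>Sec (osheaf Y) (pre Y (\<lambda>_. x0) W)\<^esub> \<one>\<^bsub>Sec (osheaf Y) (pre Y (\<lambda>_. x0) W)\<^esub> \<in> carrier (Sec (osheaf Y) (pre Y (\<lambda>_. x0) W))"
    using superalg_closed[OF supermanifoldD(4)[OF Y o]] by blast
next
  fix W assume "openin (sm_top T) W" and p: "pre Y (\<lambda>_. x0) W \<noteq> {}"
  then have W: "openin X W" and xW: "x0 \<in> W" by (auto simp: pre_def)
  have o: "openin (sm_top Y) (pre Y (\<lambda>_. x0) W)" using xW by (simp add: pre_const)
  note d = superalg_homD[OF dec_hom[OF W]]
  show "(\<lambda>c. dec W c {} x0 \<odot>\<^bsub>Sec (osheaf Y) (pre Y (\<lambda>_. x0) W)\<^esub> \<one>\<^bsub>Sec (osheaf Y) (pre Y (\<lambda>_. x0) W)\<^esub>) \<in>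
      superalg_hom (SecT W) (Sec (osheaf Y) (pre Y (\<lambda>_. x0) W))"
    by (rule superalg_hom_scalar[OF SecT_superalg[OF W] supermanifoldD(4)[OF Y o]])
      (use xW in \<open>simp_all add: d S_apply[OF W] wedge_def S_parity_zero(2)[OF d(6)]\<close>)
next
  fix V W s assume "openin (sm_top T) V" "openin (sm_top T) W" and WV: "W \<subseteq> V" and p: "pre Y (\<lambda>_. x0) W \<noteq> {}"
    and s: "s \<in> carrier (SecT V)"
  then have V: "openin X V" and W: "openin X W" and xW: "x0 \<in> W" and xV: "x0 \<in> V" by (auto simp: pre_def)
  have o: "openin (sm_top Y) (topspace (sm_top Y))" by simp
  note r = superalg_homD[OF supermanifoldD(5)[OF Y o o subset_refl]] and c = superalg_closed[OF supermanifoldD(4)[OF Y o]]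
  show "dec W (Res (osheaf T) V W s) {} x0 \<odot>\<^bsub>Sec (osheaf Y) (pre Y (\<lambda>_. x0) W)\<^esub> \<one>\<^bsub>Sec (osheaf Y) (pre Y (\<lambda>_. x0) W)\<^esub> =
    Res (osheaf Y) (pre Y (\<lambda>_. x0) V) (pre Y (\<lambda>_. x0) W)
      (dec V s {} x0 \<odot>\<^bsub>Sec (osheaf Y) (pre Y (\<lambda>_. x0) V)\<^esub> \<one>\<^bsub>Sec (osheaf Y) (pre Y (\<lambda>_. x0) V)\<^esub>)"
    using xW xV V W WV s by (simp add: pre_const dec_Res r c)
qed

lemma base_map_simps:
  assumes "supermanifold Y"
  shows "sdom (base_map Y) = Y" "scod (base_map Y) = T" "x \<in> topspace (sm_top Y) \<Longrightarrow> pmap (base_map Y) x = x0"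
    "x0 \<in> W \<Longrightarrow> preimg (base_map Y) W = topspace (sm_top Y)"
    "openin X W \<Longrightarrow> x0 \<in> W \<Longrightarrow> c \<in> carrier (SecT W) \<Longrightarrow> pull (base_map Y) W c =
       dec W c {} x0 \<odot>\<^bsub>Sec (osheaf Y) (topspace (sm_top Y))\<^esub> \<one>\<^bsub>Sec (osheaf Y) (topspace (sm_top Y))\<^esub>"
  unfolding base_map_def by (simp_all add: mk_map_simps pre_const)

lemma base_map_comp:
  assumes Y: "supermanifold Y" and Y': "supermanifold Y'" and f: "f \<in> Hom SMan Y' Y"
  shows "Comp SMan (base_map Y) f = base_map Y'"
proof (rule supermap_eqI')
  have f': "is_supermap f" "sdom f = Y'" "scod f = Y" using f by (auto simp: SMan_simps)
  have c: "Comp SMan (base_map Y) f \<in> Hom SMan Y' T" using SMan_hom_comp[OF f base_map_hom[OF Y] T_supermanifold] .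
  then show "is_supermap (Comp SMan (base_map Y) f)" "is_supermap (base_map Y')" "sdom (Comp SMan (base_map Y) f) = sdom (base_map Y')"
    "scod (Comp SMan (base_map Y) f) = scod (base_map Y')" "supermanifold (sdom (Comp SMan (base_map Y) f))"
    using base_map_hom[OF Y'] Y' by (auto simp: SMan_simps)
  show pm: "pmap (Comp SMan (base_map Y) f) x = pmap (base_map Y') x" if "x \<in> topspace (sm_top (sdom (Comp SMan (base_map Y) f)))" for x
    using that is_supermapD(1)[OF f'(1)] f' by (simp add: SMan_comp base_map_simps Y Y')
  fix W c x assume a: "openin (sm_top (scod (Comp SMan (base_map Y) f))) W" "c \<in> carrier (Sec (osheaf (scod (Comp SMan (base_map Y) f))) W)"
    "x \<in> topspace (sm_top (sdom (Comp SMan (base_map Y) f)))" "pmap (Comp SMan (base_map Y) f) x \<in> W"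
  have W: "openin X W" "c \<in> carrier (SecT W)" using a by (simp_all add: SMan_comp base_map_simps Y)
  have xW: "x0 \<in> W" using a(4) pm[OF a(3)] a(3) f' by (simp add: SMan_comp base_map_simps Y')
  have o: "openin (sm_top (scod f)) (topspace (sm_top Y))" using f' by simp
  have pr: "preimg f (topspace (sm_top Y)) = topspace (sm_top Y')"
    using is_supermapD(1)[OF f'(1)] f' by (auto simp: preimg_def)
  note h = superalg_homD[OF is_supermapD(2)[OF f'(1) o]] and cl = superalg_closed[OF supermanifoldD(4)[OF Y, of "topspace (sm_top Y)"]]
  show "pull (Comp SMan (base_map Y) f) W c = pull (base_map Y') W c"
    using W xW h f' cl by (simp add: SMan_comp base_map_simps Y Y' pr)
qed

text \<open>The endomorphism \<open>(x, \<xi>) \<mapsto> (g, \<xi>)\<close> of \<open>T\<close>.\<close>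

definition slice_map :: "'p \<Rightarrow> ('p, 's) supermap" where
  "slice_map g = mk_map T T (\<lambda>_. g) (\<lambda>W c. enc (pre T (\<lambda>_. g) W) (\<lambda>K\<in>Pow {..<m}. \<lambda>y\<in>pre T (\<lambda>_. g) W. dec W c K g))"

lemma slice_map_hom:
  assumes g: "g \<in> top"
  shows "slice_map g \<in> Hom SMan T T"
  unfolding SMan_simps slice_map_def mk_map_simps
proof (intro conjI refl mk_map_supermap[OF T_supermanifold T_supermanifold])
  show "continuous_map (sm_top T) (sm_top T) (\<lambda>_. g)" using g by simp
next
  fix W s assume W: "openin (sm_top T) W" and s: "s \<in> carrier (SecT W)"
  have o: "openin X (pre T (\<lambda>_. g) W)" by (cases "g \<in> W") (auto simp: pre_def)
  show "enc (pre T (\<lambda>_. g) W) (\<lambda>K\<in>Pow {..<m}. \<lambda>y\<in>pre T (\<lambda>_. g) W. dec W s K g) \<in> carrier (SecT (pre T (\<lambda>_. g) W))"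
    by (intro enc_closed o S_memI hol_const)
next
  fix W assume "openin (sm_top T) W" and p: "pre T (\<lambda>_. g) W \<noteq> {}"
  then have W: "openin X W" and gW: "g \<in> W" by (auto simp: pre_def)
  have o: "openin X top" by simp
  show "(\<lambda>c. enc (pre T (\<lambda>_. g) W) (\<lambda>K\<in>Pow {..<m}. \<lambda>y\<in>pre T (\<lambda>_. g) W. dec W c K g)) \<in>
      superalg_hom (SecT W) (SecT (pre T (\<lambda>_. g) W))"
    using superalg_hom_comp[OF superalg_hom_comp[OF dec_hom[OF W] const_coeff_hom[OF W o gW]] enc_hom[OF o]] gW
    by (simp add: pre_const)
next
  fix V W s assume "openin (sm_top T) V" "openin (sm_top T) W" and WV: "W \<subseteq> V" and p: "pre T (\<lambda>_. g) W \<noteq> {}"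
    and s: "s \<in> carrier (SecT V)"
  then have V: "openin X V" and W: "openin X W" and xW: "g \<in> W" and xV: "g \<in> V" by (auto simp: pre_def)
  have o: "openin X top" by simp
  have c: "(\<lambda>K\<in>Pow {..<m}. \<lambda>y\<in>top. dec V s K g) \<in> carrier (S m top)" by (intro S_memI hol_const o)
  have "(\<lambda>K\<in>Pow {..<m}. \<lambda>y\<in>top. dec W (Res (osheaf T) V W s) K g) = (\<lambda>K\<in>Pow {..<m}. \<lambda>y\<in>top. dec V s K g)"
    using xW V W WV s by (auto simp: dec_Res intro!: restrict_ext)
  then show "enc (pre T (\<lambda>_. g) W) (\<lambda>K\<in>Pow {..<m}. \<lambda>y\<in>pre T (\<lambda>_. g) W. dec W (Res (osheaf T) V W s) K g) =
      Res (osheaf T) (pre T (\<lambda>_. g) V) (pre T (\<lambda>_. g) W)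
        (enc (pre T (\<lambda>_. g) V) (\<lambda>K\<in>Pow {..<m}. \<lambda>y\<in>pre T (\<lambda>_. g) V. dec V s K g))"
    using xW xV c o supermanifoldD(6)[OF T_supermanifold, of top, OF _ enc_closed[OF o c]] by (simp add: pre_const)
qed

lemma slice_map_simps:
  shows "sdom (slice_map g) = T" "scod (slice_map g) = T" "x \<in> top \<Longrightarrow> pmap (slice_map g) x = g"
    "g \<in> W \<Longrightarrow> preimg (slice_map g) W = top"
    "openin X W \<Longrightarrow> g \<in> W \<Longrightarrow> c \<in> carrier (SecT W) \<Longrightarrow>
       pull (slice_map g) W c = enc top (\<lambda>K\<in>Pow {..<m}. \<lambda>y\<in>top. dec W c K g)"
  unfolding slice_map_def by (simp_all add: mk_map_simps pre_const)

text \<open>The algebra homomorphism which only retains the values of a section.\<close>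

definition lift :: "'p set \<Rightarrow> 's \<Rightarrow> nat set \<Rightarrow> 'p \<Rightarrow> complex" where
  "lift W s = (\<lambda>K\<in>Pow {..<m}. \<lambda>x\<in>W. if K = {} then val W s x else 0)"

lemma lift_closed:
  assumes W: "openin X W" and s: "s \<in> carrier (SecG W)"
  shows "lift W s \<in> carrier (S m W)"
  unfolding lift_def
proof (rule S_memI)
  fix K show "(\<lambda>x\<in>W. if K = {} then val W s x else 0) \<in> hol (body G) W"
    using val_hol[OF W s] hol_const[OF W] by (cases "K = {}") auto
qed

lemma lift_apply: "K \<subseteq> {..<m} \<Longrightarrow> x \<in> W \<Longrightarrow> lift W s K x = (if K = {} then val W s x else 0)"
  by (simp add: lift_def)

lemma lift_hom:
  assumes W: "openin X W"
  shows "lift W \<in> superalg_hom (SecG W) (S m W)"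
  unfolding superalg_hom_def
proof (intro CollectI conjI ring_hom_memI allI ballI lift_closed W)
  note cl = SecG_closed[OF W] and lc = lift_closed[OF W]
  fix a b assume a: "a \<in> carrier (SecG W)" and b: "b \<in> carrier (SecG W)"
  show "lift W (a \<otimes>\<^bsub>SecG W\<^esub> b) = lift W a \<otimes>\<^bsub>S m W\<^esub> lift W b"
  proof (rule S_eqI[OF lc[OF cl(1)[OF a b]] S_mult_closed[OF W lc[OF a] lc[OF b]]])
    fix K x assume K: "K \<subseteq> {..<m}" "x \<in> W"
    have "wedge (\<lambda>I. lift W a I x) (\<lambda>I. lift W b I x) K = wedge (\<lambda>I. if I = {} then val W a x else 0) (\<lambda>I. lift W b I x) K"
      by (rule wedge_cong) (use K in \<open>auto simp: lift_def\<close>)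
    also have "\<dots> = val W a x * lift W b K x" by (rule wedge_one_left) (rule fin_gens[OF W K(1)])
    finally show "lift W (a \<otimes>\<^bsub>SecG W\<^esub> b) K x = (lift W a \<otimes>\<^bsub>S m W\<^esub> lift W b) K x"
      using K a b by (simp add: lift_apply S_apply[OF W] val_simps[OF W])
  qed
  show "lift W (a \<oplus>\<^bsub>SecG W\<^esub> b) = lift W a \<oplus>\<^bsub>S m W\<^esub> lift W b"
    by (rule S_eqI[OF lc[OF cl(2)[OF a b]] S_add_closed[OF W lc[OF a] lc[OF b]]])
      (use a b in \<open>simp add: lift_apply S_apply[OF W] val_simps[OF W]\<close>)
next
  note cl = SecG_closed[OF W] and lc = lift_closed[OF W]
  show "lift W \<one>\<^bsub>SecG W\<^esub> = \<one>\<^bsub>S m W\<^esub>"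
    by (rule S_eqI[OF lc[OF cl(3)] S_one_closed[OF W]]) (simp add: lift_apply S_apply[OF W] val_simps[OF W])
  fix c a assume a: "a \<in> carrier (SecG W)"
  show "lift W (c \<odot>\<^bsub>SecG W\<^esub> a) = c \<odot>\<^bsub>S m W\<^esub> lift W a"
    by (rule S_eqI[OF lc[OF cl(5)[OF a]] S_smult_closed[OF W lc[OF a]]]) (use a in \<open>simp add: lift_apply S_apply[OF W] val_simps[OF W]\<close>)
next
  note cl = SecG_closed[OF W] and lc = lift_closed[OF W]
  show "lift W ` even_part (SecG W) \<subseteq> even_part (S m W)"
  proof (rule image_subsetI, rule S_evenI)
    fix a K x assume "a \<in> even_part (SecG W)" "K \<subseteq> {..<m}" "odd (card K)" "x \<in> W"
    then show "lift W a K x = 0" by (cases "K = {}") (simp_all add: lift_apply)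
  qed (rule lc[OF cl(6)])
  show "lift W ` odd_part (SecG W) \<subseteq> odd_part (S m W)"
  proof (rule image_subsetI, rule S_oddI)
    fix a K x assume "a \<in> odd_part (SecG W)" "K \<subseteq> {..<m}" "even (card K)" "x \<in> W"
    then show "lift W a K x = 0" using val_simps(5)[OF W] by (cases "K = {}") (simp_all add: lift_apply)
  qed (rule lc[OF cl(7)])
qed

text \<open>On points this is \<open>(x, \<xi>) \<mapsto> x\<close>.\<close>

definition reduced_inclusion :: "('p, 's) supermap" where
  "reduced_inclusion = mk_map T G (\<lambda>x. x) (\<lambda>W s. enc W (lift W s))"

lemma reduced_inclusion_hom: "reduced_inclusion \<in> Hom SMan T G"
  unfolding SMan_simps reduced_inclusion_def mk_map_simps
proof (intro conjI refl mk_map_supermap[OF T_supermanifold G])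
  show "continuous_map (sm_top T) X (\<lambda>x. x)" by simp
next
  fix W s assume "openin X W" "s \<in> carrier (SecG W)"
  then show "enc W (lift W s) \<in> carrier (SecT (pre T (\<lambda>x. x) W))" by (simp add: pre_id enc_closed lift_closed)
next
  fix W assume "openin X W"
  then show "(\<lambda>s. enc W (lift W s)) \<in> superalg_hom (SecG W) (SecT (pre T (\<lambda>x. x) W))"
    using superalg_hom_comp[OF lift_hom enc_hom] by (simp add: pre_id)
next
  fix V W s assume V: "openin X V" and W: "openin X W" "W \<subseteq> V" and s: "s \<in> carrier (SecG V)"
  have "lift W (ResG V W s) = Res (super_hol (body G) m) V W (lift V s)"
    by (rule S_eqI[OF lift_closed[OF W(1) ResG_closed[OF V W s]] S_Res_closed[OF W lift_closed[OF V s]]])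
      (use V W s subsetD[OF W(2)] in \<open>simp add: lift_apply S_Res_apply val_Res\<close>)
  then show "enc W (lift W (ResG V W s)) = Res (osheaf T) (pre T (\<lambda>x. x) V) (pre T (\<lambda>x. x) W) (enc V (lift V s))"
    using V W s by (simp add: pre_id T_Res enc_closed lift_closed)
qed

lemma reduced_inclusion_simps:
  "sdom reduced_inclusion = T" "scod reduced_inclusion = G" "x \<in> top \<Longrightarrow> pmap reduced_inclusion x = x" "openin X W \<Longrightarrow> preimg reduced_inclusion W = W"
  "openin X W \<Longrightarrow> s \<in> carrier (SecG W) \<Longrightarrow> pull reduced_inclusion W s = enc W (lift W s)"
  unfolding reduced_inclusion_def by (simp_all add: mk_map_simps pre_id)

text \<open>A trivialization at \<open>p\<close> determines odd coordinates there; this is the morphism \<open>(x, \<xi>) \<mapsto> \<xi>\<close> into the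
  odd disc through \<open>p\<close>.\<close>

definition odd_disc :: "'p \<Rightarrow> 'p set \<Rightarrow> ('p set \<Rightarrow> 's \<Rightarrow> nat set \<Rightarrow> 'p \<Rightarrow> complex) \<Rightarrow> ('p, 's) supermap" where
  "odd_disc p U \<theta> = mk_map T G (\<lambda>_. p) (\<lambda>W s. enc (pre T (\<lambda>_. p) W)
     (\<lambda>K\<in>Pow {..<m}. \<lambda>y\<in>pre T (\<lambda>_. p) W. \<theta> (U \<inter> W) (ResG W (U \<inter> W) s) K p))"

lemma odd_disc_hom:
  assumes t: "trivialization U \<theta>" and p: "p \<in> U"
  shows "odd_disc p U \<theta> \<in> Hom SMan T G"
  unfolding SMan_simps odd_disc_def mk_map_simps
proof (intro conjI refl mk_map_supermap[OF T_supermanifold G])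
  note U = trivializationD(1)[OF t]
  show "continuous_map (sm_top T) X (\<lambda>_. p)" using p openin_subset[OF U] by auto
next
  fix W s assume W: "openin X W" and s: "s \<in> carrier (SecG W)"
  have o: "openin X (pre T (\<lambda>_. p) W)" by (cases "p \<in> W") (auto simp: pre_def)
  show "enc (pre T (\<lambda>_. p) W) (\<lambda>K\<in>Pow {..<m}. \<lambda>y\<in>pre T (\<lambda>_. p) W. \<theta> (U \<inter> W) (ResG W (U \<inter> W) s) K p) \<in> carrier (SecT (pre T (\<lambda>_. p) W))"
    by (intro enc_closed o S_memI hol_const)
next
  note U = trivializationD(1)[OF t]
  fix W assume W: "openin X W" and "pre T (\<lambda>_. p) W \<noteq> {}"
  then have pW: "p \<in> W" by (auto simp: pre_def)
  have o: "openin X top" "openin X (U \<inter> W)" using U W by auto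
  have pU: "p \<in> U \<inter> W" using p pW by simp
  show "(\<lambda>s. enc (pre T (\<lambda>_. p) W) (\<lambda>K\<in>Pow {..<m}. \<lambda>y\<in>pre T (\<lambda>_. p) W. \<theta> (U \<inter> W) (ResG W (U \<inter> W) s) K p)) \<in>
      superalg_hom (SecG W) (SecT (pre T (\<lambda>_. p) W))"
    using superalg_hom_comp[OF superalg_hom_comp[OF superalg_hom_comp[OF ResG_hom[OF W o(2)] trivializationD(3)[OF t o(2)]]
       const_coeff_hom[OF o(2,1) pU]] enc_hom[OF o(1)]] pW
    by (simp add: pre_const)
next
  note U = trivializationD(1)[OF t]
  fix V W s assume V: "openin X V" and W: "openin X W" "W \<subseteq> V" and pr: "pre T (\<lambda>_. p) W \<noteq> {}" and s: "s \<in> carrier (SecG V)"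
  then have xW: "p \<in> W" and xV: "p \<in> V" by (auto simp: pre_def)
  have o: "openin X top" "openin X (U \<inter> W)" "openin X (U \<inter> V)" using U V W by auto
  have c: "(\<lambda>K\<in>Pow {..<m}. \<lambda>y\<in>top. \<theta> (U \<inter> V) (ResG V (U \<inter> V) s) K p) \<in> carrier (S m top)" by (intro S_memI hol_const o)
  have sub: "U \<inter> W \<subseteq> U \<inter> V" "U \<inter> V \<subseteq> U" "U \<inter> V \<subseteq> V" "U \<inter> W \<subseteq> W" using W by auto
  have "ResG W (U \<inter> W) (ResG V W s) = ResG (U \<inter> V) (U \<inter> W) (ResG V (U \<inter> V) s)"
    using ResG_comp[OF V W(1) o(2) sub(4) W(2) s] ResG_comp[OF V o(3,2) sub(1,3) s] by simp
  then have "\<theta> (U \<inter> W) (ResG W (U \<inter> W) (ResG V W s)) K p = \<theta> (U \<inter> V) (ResG V (U \<inter> V) s) K p" if "K \<subseteq> {..<m}" for K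
    using trivializationD(5)[OF t o(3,2) sub(1,2) ResG_closed[OF V o(3) sub(3) s]] that p xW by (simp add: S_Res_apply)
  then have "(\<lambda>K\<in>Pow {..<m}. \<lambda>y\<in>top. \<theta> (U \<inter> W) (ResG W (U \<inter> W) (ResG V W s)) K p) =
      (\<lambda>K\<in>Pow {..<m}. \<lambda>y\<in>top. \<theta> (U \<inter> V) (ResG V (U \<inter> V) s) K p)"
    by (intro restrict_ext) simp
  then show "enc (pre T (\<lambda>_. p) W) (\<lambda>K\<in>Pow {..<m}. \<lambda>y\<in>pre T (\<lambda>_. p) W. \<theta> (U \<inter> W) (ResG W (U \<inter> W) (ResG V W s)) K p) =
      Res (osheaf T) (pre T (\<lambda>_. p) V) (pre T (\<lambda>_. p) W)
        (enc (pre T (\<lambda>_. p) V) (\<lambda>K\<in>Pow {..<m}. \<lambda>y\<in>pre T (\<lambda>_. p) V. \<theta> (U \<inter> V) (ResG V (U \<inter> V) s) K p))"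
    using xW xV c o supermanifoldD(6)[OF T_supermanifold, of top, OF _ enc_closed[OF o(1) c]] by (simp add: pre_const)
qed

lemma odd_disc_simps:
  "sdom (odd_disc p U \<theta>) = T" "scod (odd_disc p U \<theta>) = G" "x \<in> top \<Longrightarrow> pmap (odd_disc p U \<theta>) x = p"
  "p \<in> W \<Longrightarrow> preimg (odd_disc p U \<theta>) W = top"
  "openin X W \<Longrightarrow> p \<in> W \<Longrightarrow> s \<in> carrier (SecG W) \<Longrightarrow>
     pull (odd_disc p U \<theta>) W s = enc top (\<lambda>K\<in>Pow {..<m}. \<lambda>y\<in>top. \<theta> (U \<inter> W) (ResG W (U \<inter> W) s) K p)"
  unfolding odd_disc_def by (simp_all add: mk_map_simps pre_const)

text \<open>The constant morphism to the reduced point \<open>g\<close>.\<close>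

definition point_map :: "'p \<Rightarrow> ('p, 's) supermap" where "point_map g = Comp SMan reduced_inclusion (slice_map g)"

lemma point_map_hom: "g \<in> top \<Longrightarrow> point_map g \<in> Hom SMan T G"
  unfolding point_map_def by (rule SMan_hom_comp[OF slice_map_hom reduced_inclusion_hom G])

lemma point_map_simps:
  assumes g: "g \<in> top"
  shows "sdom (point_map g) = T" "scod (point_map g) = G" "x \<in> top \<Longrightarrow> pmap (point_map g) x = g" "g \<in> W \<Longrightarrow> preimg (point_map g) W = top"
    "openin X W \<Longrightarrow> g \<in> W \<Longrightarrow> s \<in> carrier (SecG W) \<Longrightarrow> pull (point_map g) W s = val W s g \<odot>\<^bsub>SecT top\<^esub> \<one>\<^bsub>SecT top\<^esub>"
proof -
  show "sdom (point_map g) = T" "scod (point_map g) = G" by (simp_all add: point_map_def SMan_comp slice_map_simps reduced_inclusion_simps)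
  show pm: "x \<in> top \<Longrightarrow> pmap (point_map g) x = g" for x using g by (simp add: point_map_def SMan_comp slice_map_simps reduced_inclusion_simps)
  show "g \<in> W \<Longrightarrow> preimg (point_map g) W = top" using pm by (auto simp: preimg_def point_map_def SMan_comp slice_map_simps)
  assume W: "openin X W" "g \<in> W" "s \<in> carrier (SecG W)"
  have o: "openin X top" by simp
  have "(\<lambda>K\<in>Pow {..<m}. \<lambda>y\<in>top. lift W s K g) = val W s g \<odot>\<^bsub>S m top\<^esub> \<one>\<^bsub>S m top\<^esub>"
    by (rule S_eqI[of _ m top]) (use W in \<open>auto simp: S_apply lift_apply intro!: S_memI hol_const S_smult_closed S_one_closed\<close>)
  then have "enc top (\<lambda>K\<in>Pow {..<m}. \<lambda>y\<in>top. lift W s K g) = val W s g \<odot>\<^bsub>SecT top\<^esub> \<one>\<^bsub>SecT top\<^esub>"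
    using superalg_homD[OF enc_hom[OF o]] S_one_closed[OF o] by simp
  then show "pull (point_map g) W s = val W s g \<odot>\<^bsub>SecT top\<^esub> \<one>\<^bsub>SecT top\<^esub>"
    using W by (simp add: point_map_def SMan_comp slice_map_simps reduced_inclusion_simps enc_closed lift_closed)
qed

text \<open>A morphism factoring through a reduced point is given by a character of a stalk, hence by an
  evaluation.\<close>

lemma point_map_unique:
  assumes f: "f \<in> Hom SMan T G" and fz: "Comp SMan f (base_map T) = f"
  shows "f = point_map (pmap f x0)"
proof -
  have f': "is_supermap f" "sdom f = T" "scod f = G" using f by (auto simp: SMan_simps)
  note z = base_map_simps[OF T_supermanifold]
  define g where "g = pmap f x0"
  have g: "g \<in> top" unfolding g_def using is_supermapD(1)[OF f'(1)] f' x0 by simp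
  have pf: "pmap f x = g" if "x \<in> top" for x
  proof -
    have "pmap (Comp SMan f (base_map T)) x = g" using that by (simp add: SMan_comp z g_def)
    then show ?thesis using fz by simp
  qed
  have pre: "preimg f W = top" if "g \<in> W" for W using that pf f' by (auto simp: preimg_def)
  have o: "openin X top" by simp
  define k where "k W s = dec top (pull f W s) {} x0" for W s
  have h: "pull f W \<in> superalg_hom (SecG W) (SecT top)" if "openin X W" "g \<in> W" for W
    using is_supermapD(2)[OF f'(1), of W] f' pre that by simp
  have pc: "pull f W s \<in> carrier (SecT top)" if "openin X W" "g \<in> W" "s \<in> carrier (SecG W)" for W s
    using superalg_hom_closed[OF h[OF that(1,2)] that(3)] .
  have kv: "k W s = val W s g" if W: "openin X W" "g \<in> W" "s \<in> carrier (SecG W)" for W s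
  proof (rule character_is_val[OF W(2,1,3)])
    fix W a b assume W: "openin X W" "g \<in> W" and a: "a \<in> carrier (SecG W)" and b: "b \<in> carrier (SecG W)"
    show "k W (a \<oplus>\<^bsub>SecG W\<^esub> b) = k W a + k W b" "k W (a \<otimes>\<^bsub>SecG W\<^esub> b) = k W a * k W b"
      using superalg_homD[OF h[OF W]] superalg_homD[OF dec_hom[OF o]] a b pc[OF W] x0 by (simp_all add: k_def S_apply[OF o] wedge_def)
  next
    fix W assume W: "openin X W" "g \<in> W"
    show "k W \<one>\<^bsub>SecG W\<^esub> = 1"
      using superalg_homD[OF h[OF W]] superalg_homD[OF dec_hom[OF o]] x0 by (simp_all add: k_def S_apply[OF o])
  next
    fix W a c assume W: "openin X W" "g \<in> W" and a: "a \<in> carrier (SecG W)"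
    show "k W (c \<odot>\<^bsub>SecG W\<^esub> a) = c * k W a"
      using superalg_homD[OF h[OF W]] superalg_homD[OF dec_hom[OF o]] a pc[OF W] x0 by (simp_all add: k_def S_apply[OF o])
  next
    fix W W' a assume W: "openin X W" "openin X W'" "g \<in> W'" "W' \<subseteq> W" and a: "a \<in> carrier (SecG W)"
    have gW: "g \<in> W" using W by blast
    have "pull f W' (ResG W W' a) = Res (osheaf T) top top (pull f W a)"
      using is_supermapD(4)[OF f'(1), of W W' a] f' W a pre[OF gW] pre[OF W(3)] by simp
    also have "\<dots> = pull f W a"
      by (rule supermanifoldD(6)[OF T_supermanifold]) (use pc[OF W(1) gW a] in auto)
    finally show "k W' (ResG W W' a) = k W a" by (simp add: k_def)
  qed
  note c = point_map_simps[OF g]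
  have "f = point_map g"
  proof (rule supermap_eqI'[OF f'(1)])
    show "is_supermap (point_map g)" "sdom f = sdom (point_map g)" "scod f = scod (point_map g)" "supermanifold (sdom f)"
      using point_map_hom[OF g] f' T_supermanifold by (auto simp: SMan_simps)
    show "pmap f x = pmap (point_map g) x" if "x \<in> topspace (sm_top (sdom f))" for x
      using that f' pf c by simp
    fix W s x assume a: "openin (sm_top (scod f)) W" "s \<in> carrier (Sec (osheaf (scod f)) W)"
       "x \<in> topspace (sm_top (sdom f))" "pmap f x \<in> W"
    have W: "openin X W" "s \<in> carrier (SecG W)" "g \<in> W" using a f' pf by simp_all
    have "pull f W s = pull (Comp SMan f (base_map T)) W s" using fz by simp
    also have "\<dots> = pull (base_map T) top (pull f W s)" using W f' by (simp add: SMan_comp pre)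
    also have "\<dots> = k W s \<odot>\<^bsub>SecT top\<^esub> \<one>\<^bsub>SecT top\<^esub>" using z(5)[OF o x0 pc[OF W(1,3,2)]] by (simp add: k_def)
    also have "\<dots> = pull (point_map g) W s" using c(5)[OF W(1,3,2)] kv[OF W(1,3,2)] by simp
    finally show "pull f W s = pull (point_map g) W s" .
  qed
  then show ?thesis by (simp add: g_def)
qed

lemma point_map_base_map:
  assumes g: "g \<in> top"
  shows "Comp SMan (point_map g) (base_map T) = point_map g"
proof -
  note z = base_map_simps[OF T_supermanifold] and c = point_map_simps[OF g]
  have o: "openin X top" by simp
  have h: "Comp SMan (point_map g) (base_map T) \<in> Hom SMan T G"
    by (rule SMan_hom_comp[OF base_map_hom[OF T_supermanifold] point_map_hom[OF g] G])
  show ?thesis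
  proof (rule supermap_eqI')
    show "is_supermap (Comp SMan (point_map g) (base_map T))" "is_supermap (point_map g)" "sdom (Comp SMan (point_map g) (base_map T)) = sdom (point_map g)"
      "scod (Comp SMan (point_map g) (base_map T)) = scod (point_map g)" "supermanifold (sdom (Comp SMan (point_map g) (base_map T)))"
      using h point_map_hom[OF g] T_supermanifold by (auto simp: SMan_simps)
    show pm: "pmap (Comp SMan (point_map g) (base_map T)) x = pmap (point_map g) x"
      if "x \<in> topspace (sm_top (sdom (Comp SMan (point_map g) (base_map T))))" for x
      using that x0 by (simp add: SMan_comp z c)
    fix W s x assume a: "openin (sm_top (scod (Comp SMan (point_map g) (base_map T)))) W"
      "s \<in> carrier (Sec (osheaf (scod (Comp SMan (point_map g) (base_map T)))) W)"
      "x \<in> topspace (sm_top (sdom (Comp SMan (point_map g) (base_map T))))" "pmap (Comp SMan (point_map g) (base_map T)) x \<in> W"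
    have W: "openin X W" "s \<in> carrier (SecG W)" using a by (simp_all add: SMan_comp c)
    have gW: "g \<in> W" using a(4) pm[OF a(3)] a(3) by (simp add: SMan_comp c z)
    have cl: "\<one>\<^bsub>SecT top\<^esub> \<in> carrier (SecT top)" "\<And>d. d \<odot>\<^bsub>SecT top\<^esub> \<one>\<^bsub>SecT top\<^esub> \<in> carrier (SecT top)"
      using superalg_closed[OF SecT_superalg[OF o]] by auto
    have "dec top (d \<odot>\<^bsub>SecT top\<^esub> \<one>\<^bsub>SecT top\<^esub>) {} x0 = d" for d
      using superalg_homD[OF dec_hom[OF o]] cl x0 by (simp add: S_apply[OF o])
    then show "pull (Comp SMan (point_map g) (base_map T)) W s = pull (point_map g) W s"
      using W gW z(5)[OF o x0 cl(2)] by (simp add: SMan_comp c)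
  qed
qed

lemma odd_disc_slice_map:
  assumes t: "trivialization U \<theta>" and p: "p \<in> U" and g: "g \<in> top"
  shows "Comp SMan (odd_disc p U \<theta>) (slice_map g) = odd_disc p U \<theta>"
proof -
  have o: "openin X top" by simp
  have h: "Comp SMan (odd_disc p U \<theta>) (slice_map g) \<in> Hom SMan T G"
    by (rule SMan_hom_comp[OF slice_map_hom[OF g] odd_disc_hom[OF t p] G])
  show ?thesis
  proof (rule supermap_eqI')
    show "is_supermap (Comp SMan (odd_disc p U \<theta>) (slice_map g))" "is_supermap (odd_disc p U \<theta>)"
      "sdom (Comp SMan (odd_disc p U \<theta>) (slice_map g)) = sdom (odd_disc p U \<theta>)"
      "scod (Comp SMan (odd_disc p U \<theta>) (slice_map g)) = scod (odd_disc p U \<theta>)"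
      "supermanifold (sdom (Comp SMan (odd_disc p U \<theta>) (slice_map g)))"
      using h odd_disc_hom[OF t p] T_supermanifold by (auto simp: SMan_simps)
    show pm: "pmap (Comp SMan (odd_disc p U \<theta>) (slice_map g)) x = pmap (odd_disc p U \<theta>) x"
      if "x \<in> topspace (sm_top (sdom (Comp SMan (odd_disc p U \<theta>) (slice_map g))))" for x
      using that g by (simp add: SMan_comp slice_map_simps odd_disc_simps)
    fix W s x assume a: "openin (sm_top (scod (Comp SMan (odd_disc p U \<theta>) (slice_map g)))) W"
      "s \<in> carrier (Sec (osheaf (scod (Comp SMan (odd_disc p U \<theta>) (slice_map g)))) W)"
      "x \<in> topspace (sm_top (sdom (Comp SMan (odd_disc p U \<theta>) (slice_map g))))" "pmap (Comp SMan (odd_disc p U \<theta>) (slice_map g)) x \<in> W"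
    have W: "openin X W" "s \<in> carrier (SecG W)" using a by (simp_all add: SMan_comp odd_disc_simps)
    have gW: "p \<in> W" using a(4) pm[OF a(3)] a(3) by (simp add: SMan_comp slice_map_simps odd_disc_simps)
    define B where "B = (\<lambda>K\<in>Pow {..<m}. \<lambda>y\<in>top. \<theta> (U \<inter> W) (ResG W (U \<inter> W) s) K p)"
    have B: "B \<in> carrier (S m top)" unfolding B_def by (intro S_memI hol_const o)
    have "(\<lambda>K\<in>Pow {..<m}. \<lambda>y\<in>top. dec top (enc top B) K g) = B"
      unfolding dec_enc[OF o B] using g by (auto simp: B_def intro!: restrict_ext)
    then show "pull (Comp SMan (odd_disc p U \<theta>) (slice_map g)) W s = pull (odd_disc p U \<theta>) W s"
      using W gW g enc_closed[OF o B] by (simp add: SMan_comp slice_map_simps odd_disc_simps B_def[symmetric])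
  qed
qed

end

locale super_group = pointed_super_manifold G m x0 + group_object SMan G E P Q p q r s mu e iota
  for G :: "('p, 's) superspace" and m x0 E P Q p q r s mu e iota
begin

sublocale gl: group_object_laws SMan G E P Q p q r s mu e iota
  by (intro group_object_laws.intro SMan_laws group_object_axioms)

lemma T_obj: "T \<in> Obj SMan" and G_obj: "G \<in> Obj SMan"
  using T_supermanifold G by (auto simp: SMan_simps)

definition unit_point :: 'p where "unit_point = pmap (gl.gunit T) x0"

lemma unit_point: "unit_point \<in> top"
  using is_supermapD(1)[of "gl.gunit T" x0] gl.gunit_hom[OF T_obj] x0 by (simp add: unit_point_def SMan_simps)

lemma unit_point_map: "gl.gunit T = point_map unit_point"
  unfolding unit_point_def
  by (rule point_map_unique[OF gl.gunit_hom[OF T_obj] gl.gunit_comp[OF T_obj T_obj base_map_hom[OF T_supermanifold]]])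

text \<open>On points with odd parameters \<open>\<xi>\<close> this is \<open>(g, \<xi>) \<mapsto> g b(\<xi>)\<close>, where \<open>b\<close> is the odd disc through
  the unit.\<close>

definition translated_disc :: "'p set \<Rightarrow> ('p set \<Rightarrow> 's \<Rightarrow> nat set \<Rightarrow> 'p \<Rightarrow> complex) \<Rightarrow> ('p, 's) supermap" where
  "translated_disc U \<theta> = gl.gmult T reduced_inclusion (odd_disc unit_point U \<theta>)"

context
  fixes U \<theta>
  assumes t: "trivialization U \<theta>" and U: "unit_point \<in> U"
begin

abbreviation b where "b \<equiv> odd_disc unit_point U \<theta>"
abbreviation h where "h \<equiv> translated_disc U \<theta>"

lemmas b_hom = odd_disc_hom[OF t U]

lemma h_hom: "h \<in> Hom SMan T G"
  unfolding translated_disc_def by (rule gl.gmult_hom[OF T_obj reduced_inclusion_hom b_hom])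

lemma h_slice_map: "g \<in> top \<Longrightarrow> Comp SMan h (slice_map g) = gl.gmult T (point_map g) b"
  unfolding translated_disc_def
  using gl.gmult_comp[OF T_obj T_obj reduced_inclusion_hom b_hom slice_map_hom] odd_disc_slice_map[OF t U] by (simp add: point_map_def)

text \<open>The centre of the odd disc is the unit.\<close>

lemma b_base_map: "Comp SMan b (base_map T) = gl.gunit T"
proof -
  note z = base_map_hom[OF T_supermanifold]
  have bz: "Comp SMan b (base_map T) \<in> Hom SMan T G" by (rule SMan_hom_comp[OF z b_hom G])
  have "Comp SMan (Comp SMan b (base_map T)) (base_map T) = Comp SMan b (base_map T)"
    using gl.comp_assoc[OF T_obj T_obj T_obj G_obj z z b_hom] base_map_comp[OF T_supermanifold T_supermanifold z] by simp
  then have "Comp SMan b (base_map T) = point_map (pmap (Comp SMan b (base_map T)) x0)" by (rule point_map_unique[OF bz])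
  also have "pmap (Comp SMan b (base_map T)) x0 = unit_point"
    using x0 by (simp add: SMan_comp base_map_simps[OF T_supermanifold] odd_disc_simps)
  finally show ?thesis by (simp add: unit_point_map)
qed

text \<open>The underlying point of \<open>g b(\<xi>)\<close> is found by putting \<open>\<xi> = 0\<close>, that is by composing with
  \<open>base_map T\<close>, where \<open>b\<close> becomes the unit.\<close>

lemma h_pmap:
  assumes g: "g \<in> top"
  shows "pmap h g = g"
proof -
  note z = base_map_hom[OF T_supermanifold]
  have hi: "Comp SMan h (slice_map g) \<in> Hom SMan T G" by (rule SMan_hom_comp[OF slice_map_hom[OF g] h_hom G])
  have "Comp SMan (Comp SMan h (slice_map g)) (base_map T) = point_map g"
    using gl.gmult_comp[OF T_obj T_obj point_map_hom[OF g] b_hom z] gl.gmult_unit_right[OF T_obj point_map_hom[OF g]]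
    by (simp add: h_slice_map[OF g] b_base_map point_map_base_map[OF g])
  then have "pmap (Comp SMan (Comp SMan h (slice_map g)) (base_map T)) x0 = g" using point_map_simps(3)[OF g x0] by simp
  then show ?thesis using x0 by (simp add: SMan_comp base_map_simps[OF T_supermanifold] slice_map_simps)
qed

lemma h_preimg: "openin X W \<Longrightarrow> preimg h W = W"
  using h_pmap openin_subset[of X W] h_hom by (auto simp: preimg_def SMan_simps)

definition left_translation :: "'p \<Rightarrow> ('p, 's) supermap" where
  "left_translation g = gl.gmult G (Comp SMan (Comp SMan iota (point_map g)) (base_map G)) (Ident SMan G)"

lemma left_translation_hom:
  assumes g: "g \<in> top"
  shows "left_translation g \<in> Hom SMan G G"
  unfolding left_translation_def
  by (rule gl.gmult_hom[OF G_obj SMan_hom_comp[OF base_map_hom[OF G] SMan_hom_comp[OF point_map_hom[OF g] iota G] G] gl.ident_hom[OF G_obj]])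

text \<open>This is \<open>g\<^sup>-\<^sup>1 (g b) = b\<close> in the group of \<open>T\<close>-valued points; as \<open>left_translation g\<close> is a
  morphism of \<open>G\<close>, it shows that the odd coordinates at the unit are pullbacks along
  \<open>translated_disc\<close> of sections near \<open>g\<close>.\<close>

lemma left_translation_h:
  assumes g: "g \<in> top"
  shows "Comp SMan (left_translation g) (Comp SMan h (slice_map g)) = b"
proof -
  let ?f = "Comp SMan h (slice_map g)" and ?c = "Comp SMan iota (point_map g)"
  have f: "?f \<in> Hom SMan T G" by (rule SMan_hom_comp[OF slice_map_hom[OF g] h_hom G])
  have c: "?c \<in> Hom SMan T G" by (rule SMan_hom_comp[OF point_map_hom[OF g] iota G])
  note zG = base_map_hom[OF G] and zT = base_map_hom[OF T_supermanifold]
  have cz: "Comp SMan ?c (base_map T) = ?c"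
    using gl.comp_assoc[OF T_obj T_obj G_obj G_obj zT point_map_hom[OF g] iota] point_map_base_map[OF g] by simp
  have "Comp SMan (Comp SMan ?c (base_map G)) ?f = ?c"
    using gl.comp_assoc[OF T_obj G_obj T_obj G_obj f zG c] base_map_comp[OF G T_supermanifold f] cz by simp
  moreover have "Comp SMan (Ident SMan G) ?f = ?f" by (rule gl.ident_left[OF T_obj G_obj f])
  ultimately have "Comp SMan (left_translation g) ?f = gl.gmult T ?c ?f"
    unfolding left_translation_def
    using gl.gmult_comp[OF G_obj T_obj SMan_hom_comp[OF zG c G] gl.ident_hom[OF G_obj] f] by simp
  also have "\<dots> = gl.gmult T (gl.gmult T ?c (point_map g)) b"
    unfolding h_slice_map[OF g] using gl.gmult_assoc[OF T_obj c point_map_hom[OF g] b_hom] by simp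
  also have "\<dots> = b"
    using gl.gmult_inverse_left[OF T_obj point_map_hom[OF g]] gl.gmult_unit_left[OF T_obj b_hom] by simp
  finally show ?thesis .
qed

definition kappa :: "'p set \<Rightarrow> 's \<Rightarrow> nat set \<Rightarrow> 'p \<Rightarrow> complex" where
  "kappa W a = dec W (pull h W a)"

lemma h_pull: "openin X W \<Longrightarrow> pull h W \<in> superalg_hom (SecG W) (SecT W)"
  using is_supermapD(2)[of h W] h_hom h_preimg by (simp add: SMan_simps)

lemma kappa_hom: "openin X W \<Longrightarrow> kappa W \<in> superalg_hom (SecG W) (S m W)"
  unfolding kappa_def by (rule superalg_hom_comp[OF h_pull dec_hom])

lemma kappa_Res:
  assumes "openin X V" "openin X W" "W \<subseteq> V" "a \<in> carrier (SecG V)"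
  shows "kappa W (ResG V W a) = Res (super_hol (body G) m) V W (kappa V a)"
proof -
  have c: "pull h V a \<in> carrier (SecT V)" using superalg_hom_closed[OF h_pull] assms by blast
  have "pull h W (ResG V W a) = Res (osheaf T) V W (pull h V a)"
    using is_supermapD(4)[of h V W a] h_hom h_preimg assms by (simp add: SMan_simps)
  then show ?thesis
    unfolding kappa_def using T_Res[OF assms(1) c] S_Res_closed[OF assms(2,3) dec_closed[OF assms(1) c]] assms(2) by simp
qed

text \<open>The sections are the odd coordinates at the unit, pulled back along the translation by \<open>g\<^sup>-\<^sup>1\<close>.\<close>

lemma kappa_odd_coordinates:
  assumes g: "g \<in> top"
  shows "\<exists>V \<sigma>. openin X V \<and> g \<in> V \<and> (\<forall>i<m. \<sigma> i \<in> odd_part (SecG V) \<and>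
    (\<forall>K\<subseteq>{..<m}. kappa V (\<sigma> i) K g = (if K = {i} then 1 else 0)))"
proof -
  let ?L = "left_translation g" and ?f = "Comp SMan h (slice_map g)"
  note L = left_translation_hom[OF g] and oU = trivializationD(1)[OF t]
  have L': "is_supermap ?L" "sdom ?L = G" "scod ?L = G" using L by (auto simp: SMan_simps)
  have f: "is_supermap ?f" "sdom ?f = T" "scod ?f = G"
    using SMan_hom_comp[OF slice_map_hom[OF g] h_hom G] by (auto simp: SMan_simps)
  have h': "is_supermap h" "sdom h = T" "scod h = G" using h_hom by (auto simp: SMan_simps)
  define V where "V = preimg ?L U"
  have V: "openin X V" unfolding V_def using preimg_open[OF L'(1), of U] L' oU by simp
  have "pmap ?L g = pmap (Comp SMan ?L ?f) x0"
    using x0 h_pmap[OF g] by (simp add: SMan_comp slice_map_simps)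
  also have "\<dots> = unit_point" using left_translation_h[OF g] odd_disc_simps(3)[OF x0] by simp
  finally have gV: "g \<in> V" unfolding V_def preimg_def using g L' U by simp
  define \<xi> where "\<xi> i = (\<lambda>K\<in>Pow {..<m}. \<lambda>x\<in>U. if K = {i} then 1 else (0::complex))" for i :: nat
  have xc: "\<xi> i \<in> carrier (S m U)" for i unfolding \<xi>_def
    by (intro S_memI hol_const oU)
  have xi: "\<xi> i \<in> odd_part (S m U)" for i
    by (rule S_oddI[OF xc]) (auto simp: \<xi>_def)
  define \<zeta> where "\<zeta> i = inv_into (carrier (SecG U)) (\<theta> U) (\<xi> i)" for i
  have "inv_into (carrier (SecG U)) (\<theta> U) \<in> superalg_iso (S m U) (SecG U)"
    by (rule superalg_iso_inverse[OF SecG[OF oU] comm_superalgebra_S[OF oU] trivializationD(2)[OF t oU subset_refl]])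
  then have ih: "inv_into (carrier (SecG U)) (\<theta> U) \<in> superalg_hom (S m U) (SecG U)"
    by (simp add: superalg_iso_def)
  have zo: "\<zeta> i \<in> odd_part (SecG U)" for i
    unfolding \<zeta>_def by (rule superalg_homD(6)[OF ih xi])
  have zc: "\<zeta> i \<in> carrier (SecG U)" for i using SecG_closed(7)[OF oU zo] .
  have tz: "\<theta> U (\<zeta> i) = \<xi> i" for i
    unfolding \<zeta>_def using trivializationD(4)[OF t oU subset_refl] xc[of i] by (simp add: bij_betw_def f_inv_into_f)
  define \<sigma> where "\<sigma> i = pull ?L U (\<zeta> i)" for i
  have so: "\<sigma> i \<in> odd_part (SecG V)" for i
    unfolding \<sigma>_def V_def using superalg_homD(6)[OF is_supermapD(2)[OF L'(1), of U], of "\<zeta> i"] zo[of i] L' oU by simp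
  have sc: "\<sigma> i \<in> carrier (SecG V)" for i using SecG_closed(7)[OF V so] .
  have o: "openin X top" by simp
  have "kappa V (\<sigma> i) K g = (if K = {i} then 1 else 0)" if K: "K \<subseteq> {..<m}" for i K
  proof -
    have hc: "pull h V (\<sigma> i) \<in> carrier (SecT V)" using superalg_hom_closed[OF h_pull[OF V] sc] .
    have "pull ?f V (\<sigma> i) = pull (slice_map g) V (pull h V (\<sigma> i))"
      using V sc h' h_preimg[OF V] by (simp add: SMan_comp)
    also have "\<dots> = enc top (\<lambda>K\<in>Pow {..<m}. \<lambda>y\<in>top. kappa V (\<sigma> i) K g)"
      unfolding kappa_def by (rule slice_map_simps(5)[OF V gV hc])
    finally have 1: "pull ?f V (\<sigma> i) = enc top (\<lambda>K\<in>Pow {..<m}. \<lambda>y\<in>top. kappa V (\<sigma> i) K g)" .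
    have "pull (Comp SMan ?L ?f) U (\<zeta> i) = pull ?f V (\<sigma> i)"
      unfolding \<sigma>_def V_def by (rule SMan_comp(4)) (use L' oU zc in simp_all)
    moreover have "pull b U (\<zeta> i) = enc top (\<lambda>K\<in>Pow {..<m}. \<lambda>y\<in>top. \<xi> i K unit_point)"
      using odd_disc_simps(5)[OF oU U zc, of U \<theta> i] ResG_id[OF oU zc] tz by simp
    ultimately have eq: "enc top (\<lambda>K\<in>Pow {..<m}. \<lambda>y\<in>top. kappa V (\<sigma> i) K g) = enc top (\<lambda>K\<in>Pow {..<m}. \<lambda>y\<in>top. \<xi> i K unit_point)"
      using left_translation_h[OF g] 1 by simp
    have "(\<lambda>K\<in>Pow {..<m}. \<lambda>y\<in>top. f K) \<in> carrier (S m top)" for f :: "nat set \<Rightarrow> complex"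
      by (intro S_memI hol_const o)
    then have "(\<lambda>K\<in>Pow {..<m}. \<lambda>y\<in>top. kappa V (\<sigma> i) K g) = (\<lambda>K\<in>Pow {..<m}. \<lambda>y\<in>top. \<xi> i K unit_point)"
      by (intro enc_inj[OF o, THEN inj_onD, OF eq])
    from fun_cong[OF fun_cong[OF this, of K], of x0] show ?thesis
      using K x0 U by (simp add: \<xi>_def)
  qed
  then show ?thesis using V gV so by blast
qed

end

lemma kappa_exists:
  "\<exists>\<kappa>. (\<forall>W. openin X W \<longrightarrow> \<kappa> W \<in> superalg_hom (SecG W) (S m W)) \<and>
     (\<forall>V W a. openin X V \<longrightarrow> openin X W \<longrightarrow> W \<subseteq> V \<longrightarrow> a \<in> carrier (SecG V) \<longrightarrow>
        \<kappa> W (ResG V W a) = Res (super_hol (body G) m) V W (\<kappa> V a)) \<and>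
     (\<forall>g\<in>top. \<exists>V \<sigma>. openin X V \<and> g \<in> V \<and> (\<forall>i<m. \<sigma> i \<in> odd_part (SecG V) \<and>
        (\<forall>K\<subseteq>{..<m}. \<kappa> V (\<sigma> i) K g = (if K = {i} then 1 else 0))))"
proof -
  obtain U \<theta> where "trivialization U \<theta>" "unit_point \<in> U" using trivialization_ex[OF unit_point] .
  note u = this
  show ?thesis
    by (rule exI[of _ "kappa U \<theta>"])
      (intro conjI allI impI ballI kappa_hom[OF u] kappa_Res[OF u] kappa_odd_coordinates[OF u])
qed

end

section \<open>Homomorphisms inducing the identity on values\<close>

context cman
begin

text \<open>The powers of the ideal generated by the odd generators, in terms of coefficients.\<close>

definition Jpow :: "nat \<Rightarrow> 'p set \<Rightarrow> nat \<Rightarrow> (nat set \<Rightarrow> 'p \<Rightarrow> complex) set" where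
  "Jpow m U k = {F \<in> carrier (S m U). \<forall>K\<subseteq>{..<m}. card K < k \<longrightarrow> (\<forall>x\<in>U. F K x = 0)}"

definition monomial :: "nat \<Rightarrow> 'p set \<Rightarrow> ('p \<Rightarrow> complex) \<Rightarrow> nat set \<Rightarrow> nat set \<Rightarrow> 'p \<Rightarrow> complex" where
  "monomial m U f I = (\<lambda>K\<in>Pow {..<m}. \<lambda>x\<in>U. if K = I then f x else 0)"

lemma JpowD: "F \<in> Jpow m U k \<Longrightarrow> F \<in> carrier (S m U)"
  "F \<in> Jpow m U k \<Longrightarrow> K \<subseteq> {..<m} \<Longrightarrow> card K < k \<Longrightarrow> x \<in> U \<Longrightarrow> F K x = 0"
  by (auto simp: Jpow_def)

lemma JpowI: "F \<in> carrier (S m U) \<Longrightarrow> (\<And>K x. K \<subseteq> {..<m} \<Longrightarrow> card K < k \<Longrightarrow> x \<in> U \<Longrightarrow> F K x = 0) \<Longrightarrow> F \<in> Jpow m U k"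
  by (auto simp: Jpow_def)

lemma wedge_low:
  assumes "finite K" "card K < a + b" "\<And>I. I \<subseteq> K \<Longrightarrow> card I < a \<Longrightarrow> f I = 0" "\<And>I. I \<subseteq> K \<Longrightarrow> card I < b \<Longrightarrow> g I = 0"
  shows "wedge f g K = 0"
  unfolding wedge_def
proof (intro sum.neutral ballI)
  fix I assume I: "I \<in> Pow K"
  then have "card K = card I + card (K - I)"
    by (metis Pow_iff assms(1) card_Diff_subset card_mono finite_subset le_add_diff_inverse)
  then have "card I < a \<or> card (K - I) < b" using assms(2) by auto
  then show "shuffle_sign I (K - I) * f I * g (K - I) = 0"
    using assms(3)[of I] assms(4)[of "K - I"] I by auto
qed

context
  fixes m :: nat and U :: "'p set"
  assumes U: "openin X U"
begin

lemma monomial_closed: "f \<in> hol M U \<Longrightarrow> monomial m U f I \<in> carrier (S m U)"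
  unfolding monomial_def
proof (rule S_memI)
  fix K assume "f \<in> hol M U"
  then show "(\<lambda>x\<in>U. if K = I then f x else 0) \<in> hol M U"
    using hol_const[OF U] hol_shift by (cases "K = I") auto
qed

lemma monomial_apply: "K \<subseteq> {..<m} \<Longrightarrow> x \<in> U \<Longrightarrow> monomial m U f I K x = (if K = I then f x else 0)"
  by (simp add: monomial_def)

lemma Jpow_mult: "F \<in> Jpow m U a \<Longrightarrow> G \<in> Jpow m U b \<Longrightarrow> F \<otimes>\<^bsub>S m U\<^esub> G \<in> Jpow m U (a + b)"
proof (rule JpowI)
  fix K x assume F: "F \<in> Jpow m U a" "G \<in> Jpow m U b" and K: "K \<subseteq> {..<m}" "card K < a + b" "x \<in> U"
  show "(F \<otimes>\<^bsub>S m U\<^esub> G) K x = 0"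
    unfolding S_apply[OF U K(1,3)]
    by (rule wedge_low[OF fin_gens[OF U K(1)] K(2)]) (use F JpowD(2) K in \<open>auto dest: order_trans[OF _ K(1)]\<close>)
qed (auto intro!: S_closed U dest: JpowD)

lemma Jpow_add:
  assumes F: "F \<in> Jpow m U a" and G: "G \<in> Jpow m U a"
  shows "F \<oplus>\<^bsub>S m U\<^esub> G \<in> Jpow m U a"
proof (rule JpowI[OF S_add_closed[OF U JpowD(1)[OF F] JpowD(1)[OF G]]])
  fix K x assume K: "K \<subseteq> {..<m}" "card K < a" "x \<in> U"
  show "(F \<oplus>\<^bsub>S m U\<^esub> G) K x = 0"
    using JpowD(2)[OF F K] JpowD(2)[OF G K] K by (simp add: S_apply[OF U])
qed

lemma Jpow_0: "Jpow m U 0 = carrier (S m U)" by (auto simp: Jpow_def)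

lemma Jpow_top: "F \<in> Jpow m U (Suc m) \<Longrightarrow> F = \<zero>\<^bsub>S m U\<^esub>"
proof (rule S_eqI[of _ m U])
  fix K x assume F: "F \<in> Jpow m U (Suc m)" and K: "K \<subseteq> {..<m}" "x \<in> U"
  have "card K < Suc m" using card_mono[of "{..<m}" K] K by simp
  then show "F K x = \<zero>\<^bsub>S m U\<^esub> K x" using JpowD(2)[OF F K(1) _ K(2)] K by (simp add: S_apply[OF U])
qed (auto intro: S_closed[OF U] dest: JpowD)

lemma monomial_Jpow: "f \<in> hol M U \<Longrightarrow> monomial m U f I \<in> Jpow m U (card I)"
  by (rule JpowI[OF monomial_closed]) (auto simp: monomial_apply)

lemma odd_Jpow: "F \<in> odd_part (S m U) \<Longrightarrow> F \<in> Jpow m U 1"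
proof (rule JpowI[OF S_parity_carrier(2)])
  fix K x assume F: "F \<in> odd_part (S m U)" and K: "K \<subseteq> {..<m}" "card K < 1" "x \<in> U"
  have "card K = 0" using K(2) by simp
  then show "F K x = 0" using S_parity_zero(2)[OF F K(1) _ K(3)] by simp
qed

lemma S_diff_zero: 
  assumes "F \<in> carrier (S m U)" "G \<in> carrier (S m U)" "F \<oplus>\<^bsub>S m U\<^esub> (-1) \<odot>\<^bsub>S m U\<^esub> G = \<zero>\<^bsub>S m U\<^esub>"
  shows "F = G"
proof (rule S_eqI[OF assms(1,2)])
  fix K x assume K: "K \<subseteq> {..<m}" "x \<in> U"
  have "(F \<oplus>\<^bsub>S m U\<^esub> (-1) \<odot>\<^bsub>S m U\<^esub> G) K x = \<zero>\<^bsub>S m U\<^esub> K x" using assms(3) by simp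
  then show "F K x = G K x" using K by (simp add: S_apply[OF U])
qed

text \<open>Every element is a finite sum of monomials, whence the induction by adding one at a time.\<close>

lemma Jpow_induct [consumes 1, case_names zero step]:
  assumes F: "F \<in> Jpow m U k"
    and zero: "R \<zero>\<^bsub>S m U\<^esub>"
    and step: "\<And>F f I. F \<in> carrier (S m U) \<Longrightarrow> f \<in> hol M U \<Longrightarrow> I \<subseteq> {..<m} \<Longrightarrow> k \<le> card I \<Longrightarrow> R F \<Longrightarrow> R (F \<oplus>\<^bsub>S m U\<^esub> monomial m U f I)"
  shows "R F"
proof -
  define cut where "cut A = (\<lambda>K\<in>Pow {..<m}. \<lambda>x\<in>U. if K \<in> A then F K x else 0)" for A
  have Fc: "F \<in> carrier (S m U)" using F by (rule JpowD)
  have cc: "cut A \<in> carrier (S m U)" for A unfolding cut_def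
  proof (rule S_memI)
    fix K assume "K \<subseteq> {..<m}"
    then show "(\<lambda>x\<in>U. if K \<in> A then F K x else 0) \<in> hol M U"
      using hol_const[OF U] hol_shift[OF S_hol[OF Fc]] by (cases "K \<in> A") auto
  qed
  have "R (cut A)" if "finite A" "A \<subseteq> {K. K \<subseteq> {..<m} \<and> k \<le> card K}" for A
    using that
  proof (induction A)
    case empty
    have "cut {} = \<zero>\<^bsub>S m U\<^esub>"
      by (rule S_eqI[OF cc S_zero_closed[OF U]]) (simp add: cut_def S_apply[OF U])
    then show ?case using zero by simp
  next
    case (insert I A)
    have I: "I \<subseteq> {..<m}" "k \<le> card I" using insert by auto
    have "cut (insert I A) = cut A \<oplus>\<^bsub>S m U\<^esub> monomial m U (F I) I"
      by (rule S_eqI[OF cc S_add_closed[OF U cc monomial_closed[OF S_hol[OF Fc I(1)]]]])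
        (use insert in \<open>auto simp: cut_def S_apply[OF U] monomial_apply\<close>)
    then show ?case using step[OF cc S_hol[OF Fc I(1)] I] insert by simp
  qed
  moreover have "finite {K. K \<subseteq> {..<m} \<and> k \<le> card K}" by (rule finite_subset[of _ "Pow {..<m}"]) auto
  moreover have "cut {K. K \<subseteq> {..<m} \<and> k \<le> card K} = F"
    by (rule S_eqI[OF cc Fc]) (use JpowD(2)[OF F] in \<open>auto simp: cut_def not_le\<close>)
  ultimately show ?thesis by (metis subset_refl)
qed

text \<open>Adjoining a largest index on the right costs no sign.\<close>

lemma monomial_insert:
  assumes f: "f \<in> hol M U" and I: "finite I" "\<forall>j\<in>I. j < i" "insert i I \<subseteq> {..<m}"
  shows "monomial m U f (insert i I) = monomial m U f I \<otimes>\<^bsub>S m U\<^esub> monomial m U (\<lambda>x\<in>U. 1) {i}"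
proof (rule S_eqI[OF monomial_closed[OF f] S_mult_closed[OF U monomial_closed[OF f] monomial_closed[OF hol_const[OF U]]]])
  fix K x assume K: "K \<subseteq> {..<m}" "x \<in> U"
  have ni: "i \<notin> I" using I by auto
  have s: "shuffle_sign I {i} = 1"
  proof -
    have "{(a, j). a \<in> I \<and> j \<in> {i} \<and> j < a} = {}" using I(2) by auto
    then show ?thesis unfolding shuffle_sign_def by (simp only:) simp
  qed
  have "wedge (\<lambda>J. monomial m U f I J x) (\<lambda>J. monomial m U (\<lambda>x\<in>U. 1) {i} J x) K =
     wedge (\<lambda>J. if J = I then f x else 0) (\<lambda>J. if J = {i} then 1 else 0) K"
    by (rule wedge_cong) (use K in \<open>auto simp: monomial_def\<close>)
  also have "\<dots> = (if K = insert i I then f x else 0)"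
  proof (cases "I \<subseteq> K")
    case False
    then show ?thesis unfolding wedge_def by (subst sum.neutral) auto
  next
    case True
    have "wedge (\<lambda>J. if J = I then f x else 0) (\<lambda>J. if J = {i} then 1 else 0) K =
      (\<Sum>J\<in>{I}. shuffle_sign J (K - J) * (if J = I then f x else 0) * (if K - J = {i} then 1 else 0))"
      unfolding wedge_def by (rule sum.mono_neutral_right) (use True fin_gens[OF U K(1)] in auto)
    also have "\<dots> = (if K - I = {i} then f x else 0)" using s by simp
    also have "K - I = {i} \<longleftrightarrow> K = insert i I" using True ni by auto
    finally show ?thesis .
  qed
  finally show "monomial m U f (insert i I) K x = (monomial m U f I \<otimes>\<^bsub>S m U\<^esub> monomial m U (\<lambda>x\<in>U. 1) {i}) K x"
    using K by (simp add: S_apply[OF U] monomial_apply)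
qed

end

lemma finite_max_induct [consumes 1, case_names empty insert]:
  fixes I :: "nat set"
  assumes "finite I" "R {}" "\<And>i I. finite I \<Longrightarrow> \<forall>j\<in>I. j < i \<Longrightarrow> R I \<Longrightarrow> R (insert i I)"
  shows "R I"
  using assms by (rule finite_linorder_max_induct) 

definition value_preserving :: "nat \<Rightarrow> 'p set \<Rightarrow> ((nat set \<Rightarrow> 'p \<Rightarrow> complex) \<Rightarrow> nat set \<Rightarrow> 'p \<Rightarrow> complex) \<Rightarrow> bool" where
  "value_preserving m U \<eta> \<longleftrightarrow> \<eta> \<in> superalg_hom (S m U) (S m U) \<and> (\<forall>F\<in>carrier (S m U). \<forall>x\<in>U. \<eta> F {} x = F {} x)"

context
  fixes m :: nat and U :: "'p set" and \<eta>
  assumes U: "openin X U" and \<eta>: "value_preserving m U \<eta>"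
begin

lemma \<eta>_hom: "\<eta> \<in> superalg_hom (S m U) (S m U)" and \<eta>_val: "F \<in> carrier (S m U) \<Longrightarrow> x \<in> U \<Longrightarrow> \<eta> F {} x = F {} x"
  using \<eta> by (auto simp: value_preserving_def)

lemmas \<eta>_closed = superalg_hom_closed[OF \<eta>_hom]

lemma \<eta>_simps:
  assumes "F \<in> carrier (S m U)"
  shows "G \<in> carrier (S m U) \<Longrightarrow> \<eta> (F \<otimes>\<^bsub>S m U\<^esub> G) = \<eta> F \<otimes>\<^bsub>S m U\<^esub> \<eta> G"
    "G \<in> carrier (S m U) \<Longrightarrow> \<eta> (F \<oplus>\<^bsub>S m U\<^esub> G) = \<eta> F \<oplus>\<^bsub>S m U\<^esub> \<eta> G"
    "\<eta> (c \<odot>\<^bsub>S m U\<^esub> F) = c \<odot>\<^bsub>S m U\<^esub> \<eta> F" "\<eta> \<zero>\<^bsub>S m U\<^esub> = \<zero>\<^bsub>S m U\<^esub>" "\<eta> \<one>\<^bsub>S m U\<^esub> = \<one>\<^bsub>S m U\<^esub>"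
  using \<eta>_hom assms superalg_hom_zero[OF comm_superalgebra_S[OF U] comm_superalgebra_S[OF U] \<eta>_hom]
  by (auto simp: superalg_hom_def ring_hom_def)

lemma \<eta>_monomial_Jpow:
  assumes f: "f \<in> hol M U" and I: "I \<subseteq> {..<m}"
  shows "\<eta> (monomial m U f I) \<in> Jpow m U (card I)"
proof -
  have "finite I" using I finite_subset by blast
  then show ?thesis using I
  proof (induction I rule: finite_max_induct)
    case empty
    then show ?case using \<eta>_closed[OF monomial_closed[OF U f]] by (simp add: Jpow_0[OF U])
  next
    case (insert i I)
    note xc = monomial_closed[OF U hol_const[OF U]] and fc = monomial_closed[OF U f]
    have "monomial m U (\<lambda>x\<in>U. 1) {i} \<in> odd_part (S m U)"
      by (rule S_oddI[OF xc]) (auto simp: monomial_apply[OF U])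
    then have "\<eta> (monomial m U (\<lambda>x\<in>U. 1) {i}) \<in> Jpow m U 1"
      using \<eta>_hom by (intro odd_Jpow[OF U]) (auto simp: superalg_hom_def)
    then have "\<eta> (monomial m U f I) \<otimes>\<^bsub>S m U\<^esub> \<eta> (monomial m U (\<lambda>x\<in>U. 1) {i}) \<in> Jpow m U (card I + 1)"
      using insert by (intro Jpow_mult[OF U]) auto
    moreover have "card (insert i I) = card I + 1" using insert by (subst card_insert_disjoint) auto
    ultimately show ?case using \<eta>_simps(1)[OF fc xc] insert by (simp add: monomial_insert[OF U f])
  qed
qed

lemma \<eta>_Jpow: "F \<in> Jpow m U k \<Longrightarrow> \<eta> F \<in> Jpow m U k"
proof (induction rule: Jpow_induct[OF U, consumes 1, case_names zero step])
  case zero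
  then show ?case using \<eta>_simps(4)[OF S_zero_closed[OF U]] S_zero_closed[OF U] by (simp add: JpowI S_apply[OF U])
next
  case (step F f I)
  have "\<eta> (monomial m U f I) \<in> Jpow m U k"
    using \<eta>_monomial_Jpow[OF step(2,3)] step(4) by (auto simp: Jpow_def)
  then show ?case using Jpow_add[OF U step(5)] \<eta>_simps(2)[OF step(1) monomial_closed[OF U step(2)]] by simp
qed

text \<open>Bijectivity follows from the existence of odd superfunctions \<open>t i\<close> which are sent to the generators
  up to terms of higher order.\<close>

context
  fixes t :: "nat \<Rightarrow> nat set \<Rightarrow> 'p \<Rightarrow> complex"
  assumes t: "\<And>i. i < m \<Longrightarrow> t i \<in> odd_part (S m U)"
    and \<eta>t: "\<And>i K x. i < m \<Longrightarrow> K \<subseteq> {..<m} \<Longrightarrow> card K = 1 \<Longrightarrow> x \<in> U \<Longrightarrow> \<eta> (t i) K x = (if K = {i} then 1 else 0)"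
begin

text \<open>The products of the \<open>t i\<close> in increasing order.\<close>

lemma leading_monomials:
  assumes I: "I \<subseteq> {..<m}"
  shows "\<exists>F\<in>Jpow m U (card I). \<forall>K\<subseteq>{..<m}. card K \<le> card I \<longrightarrow> (\<forall>x\<in>U. \<eta> F K x = (if K = I then 1 else 0))"
proof -
  have "finite I" using I finite_subset by blast
  then show ?thesis using I
  proof (induction I rule: finite_max_induct)
    case empty
    show ?case
    proof (rule bexI[of _ "\<one>\<^bsub>S m U\<^esub>"])
      show "\<one>\<^bsub>S m U\<^esub> \<in> Jpow m U (card {})" using S_one_closed[OF U] by (simp add: Jpow_0[OF U])
      show "\<forall>K\<subseteq>{..<m}. card K \<le> card {} \<longrightarrow> (\<forall>x\<in>U. \<eta> \<one>\<^bsub>S m U\<^esub> K x = (if K = {} then 1 else 0))"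
        using \<eta>_simps(5)[OF S_one_closed[OF U]] by (simp add: S_apply[OF U])
    qed
  next
    case (insert i I)
    then obtain F where F: "F \<in> Jpow m U (card I)"
      "\<And>K x. K \<subseteq> {..<m} \<Longrightarrow> card K \<le> card I \<Longrightarrow> x \<in> U \<Longrightarrow> \<eta> F K x = (if K = I then 1 else 0)" by auto
    have i: "i < m" "insert i I \<subseteq> {..<m}" using insert by auto
    have cI: "card (insert i I) = card I + 1" using insert by (subst card_insert_disjoint) auto
    note Fc = JpowD(1)[OF F(1)] and tc = S_parity_carrier(2)[OF t[OF i(1)]]
    have t1: "t i \<in> Jpow m U 1" by (rule odd_Jpow[OF U t[OF i(1)]])
    show ?case
    proof (rule bexI[of _ "F \<otimes>\<^bsub>S m U\<^esub> t i"], intro allI impI ballI)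
      show "F \<otimes>\<^bsub>S m U\<^esub> t i \<in> Jpow m U (card (insert i I))"
        unfolding cI by (rule Jpow_mult[OF U F(1) t1])
      fix K x assume K: "K \<subseteq> {..<m}" "card K \<le> card (insert i I)" "x \<in> U"
      let ?o = "\<lambda>x\<in>U. 1 :: complex"
      note xc = monomial_closed[OF U hol_const[OF U]]
      have sub: "L \<subseteq> {..<m}" "finite L" "card L \<le> card K" if "L \<subseteq> K" for L
        using that K(1) fin_gens[OF U K(1)] by (auto intro: card_mono finite_subset)
      have eF: "\<eta> F L x = 0" if "L \<subseteq> K" "card L < card I" for L
        using F(2)[OF sub(1)[OF that(1)] _ K(3)] that by auto
      have et: "\<eta> (t i) L x = 0" if "L \<subseteq> K" "card L < 1" for L
        using JpowD(2)[OF \<eta>_Jpow[OF t1] sub(1)[OF that(1)] _ K(3)] that by auto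
      have "wedge (\<lambda>L. \<eta> F L x) (\<lambda>L. \<eta> (t i) L x) K = wedge (\<lambda>L. monomial m U ?o I L x) (\<lambda>L. monomial m U ?o {i} L x) K"
        unfolding wedge_def
      proof (intro sum.cong refl)
        fix L assume L: "L \<in> Pow K"
        then have LK: "L \<subseteq> K" "K - L \<subseteq> K" by auto
        have c: "card K = card L + card (K - L)" using L fin_gens[OF U K(1)]
          by (metis Pow_iff card_Diff_subset card_mono finite_subset le_add_diff_inverse)
        consider "card L < card I" | "card (K - L) < 1" | "card L = card I" "card (K - L) = 1"
          using c K(2) cI by linarith
        then show "shuffle_sign L (K - L) * \<eta> F L x * \<eta> (t i) (K - L) x =
            shuffle_sign L (K - L) * monomial m U ?o I L x * monomial m U ?o {i} (K - L) x"
        proof cases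
          case 1
          then show ?thesis using eF[OF LK(1)] sub(1)[OF LK(1)] K by (auto simp: monomial_apply[OF U])
        next
          case 2
          then show ?thesis using et[OF LK(2)] sub(1)[OF LK(2)] K by (auto simp: monomial_apply[OF U])
        next
          case 3
          then show ?thesis using F(2)[OF sub(1)[OF LK(1)] _ K(3)] \<eta>t[OF i(1) sub(1)[OF LK(2)] _ K(3)] 
              sub(1)[OF LK(1)] sub(1)[OF LK(2)] K by (simp add: monomial_apply[OF U])
        qed
      qed
      also have "\<dots> = monomial m U ?o (insert i I) K x"
        using monomial_insert[OF U hol_const[OF U] insert(1,2) i(2)] K by (simp add: S_apply[OF U])
      finally show "\<eta> (F \<otimes>\<^bsub>S m U\<^esub> t i) K x = (if K = insert i I then 1 else 0)"
        using \<eta>_simps(1)[OF Fc tc] K by (simp add: S_apply[OF U] monomial_apply[OF U])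
    qed
  qed
qed

text \<open>Terms of lowest order are removed one after the other, by means of the preceding lemma; the powers of
  the ideal vanish eventually.\<close>

lemma value_preserving_surj:
  assumes "H \<in> carrier (S m U)"
  shows "\<exists>F\<in>carrier (S m U). \<eta> F = H"
proof -
  have step: "\<exists>F\<in>carrier (S m U). H \<oplus>\<^bsub>S m U\<^esub> (-1) \<odot>\<^bsub>S m U\<^esub> \<eta> F \<in> Jpow m U (Suc k)" if H: "H \<in> Jpow m U k" for H k
    using H
  proof (induction rule: Jpow_induct[OF U, consumes 1, case_names zero step])
    case zero
    show ?case
      by (rule bexI[OF _ S_zero_closed[OF U]], rule JpowI)
        (simp_all add: S_closed[OF U] S_apply[OF U] \<eta>_simps(4)[OF S_zero_closed[OF U]])
  next
    case (step H f I)
    obtain F where F: "F \<in> carrier (S m U)" "H \<oplus>\<^bsub>S m U\<^esub> (-1) \<odot>\<^bsub>S m U\<^esub> \<eta> F \<in> Jpow m U (Suc k)" using step by auto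
    obtain E where E: "E \<in> Jpow m U (card I)"
      "\<And>K x. K \<subseteq> {..<m} \<Longrightarrow> card K \<le> card I \<Longrightarrow> x \<in> U \<Longrightarrow> \<eta> E K x = (if K = I then 1 else 0)"
      using leading_monomials[OF step(3)] by auto
    note Ec = JpowD(1)[OF E(1)]
    have fc: "monomial m U f I \<in> carrier (S m U)" and f0: "monomial m U f {} \<in> carrier (S m U)" by (intro monomial_closed[OF U step(2)])+
    define F' where "F' = monomial m U f {} \<otimes>\<^bsub>S m U\<^esub> E"
    have F': "F' \<in> carrier (S m U)" unfolding F'_def by (rule S_mult_closed[OF U f0 Ec])
    have "monomial m U f I \<oplus>\<^bsub>S m U\<^esub> (-1) \<odot>\<^bsub>S m U\<^esub> \<eta> F' \<in> Jpow m U (Suc k)"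
    proof (rule JpowI)
      show "monomial m U f I \<oplus>\<^bsub>S m U\<^esub> (-1) \<odot>\<^bsub>S m U\<^esub> \<eta> F' \<in> carrier (S m U)" by (intro S_closed[OF U] fc \<eta>_closed F')
      fix K x assume K: "K \<subseteq> {..<m}" "card K < Suc k" "x \<in> U"
      have cK: "card K \<le> card I" using K(2) step(4) by simp
      have "wedge (\<lambda>L. \<eta> (monomial m U f {}) L x) (\<lambda>L. \<eta> E L x) K = \<eta> (monomial m U f {}) {} x * \<eta> E K x"
      proof (rule wedge_leading[OF fin_gens[OF U K(1)] cK])
        fix L assume "L \<subseteq> K" "card L < card I"
        then show "\<eta> E L x = 0" using E(2)[of L x] K by auto
      qed
      also have "\<dots> = f x * (if K = I then 1 else 0)"
        using \<eta>_val[OF f0 K(3)] E(2)[OF K(1) cK K(3)] K by (simp add: monomial_apply[OF U])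
      finally show "(monomial m U f I \<oplus>\<^bsub>S m U\<^esub> (-1) \<odot>\<^bsub>S m U\<^esub> \<eta> F') K x = 0"
        using K \<eta>_simps(1)[OF f0 Ec] by (simp add: F'_def S_apply[OF U] monomial_apply[OF U])
    qed
    from Jpow_add[OF U F(2) this] have "(H \<oplus>\<^bsub>S m U\<^esub> (-1) \<odot>\<^bsub>S m U\<^esub> \<eta> F) \<oplus>\<^bsub>S m U\<^esub> (monomial m U f I \<oplus>\<^bsub>S m U\<^esub> (-1) \<odot>\<^bsub>S m U\<^esub> \<eta> F') \<in> Jpow m U (Suc k)" .
    also have "(H \<oplus>\<^bsub>S m U\<^esub> (-1) \<odot>\<^bsub>S m U\<^esub> \<eta> F) \<oplus>\<^bsub>S m U\<^esub> (monomial m U f I \<oplus>\<^bsub>S m U\<^esub> (-1) \<odot>\<^bsub>S m U\<^esub> \<eta> F') =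
      (H \<oplus>\<^bsub>S m U\<^esub> monomial m U f I) \<oplus>\<^bsub>S m U\<^esub> (-1) \<odot>\<^bsub>S m U\<^esub> \<eta> (F \<oplus>\<^bsub>S m U\<^esub> F')"
      by (rule S_eqI[of _ m U])
        (auto intro!: S_closed[OF U] \<eta>_closed step F F' fc simp: S_apply[OF U] \<eta>_simps(2)[OF F(1) F'] algebra_simps)
    finally show ?case using S_add_closed[OF U F(1) F'] by blast
  qed
  have "\<exists>F\<in>carrier (S m U). H \<oplus>\<^bsub>S m U\<^esub> (-1) \<odot>\<^bsub>S m U\<^esub> \<eta> F \<in> Jpow m U k" for k
  proof (induction k)
    case 0
    show ?case unfolding Jpow_0[OF U]
      by (intro bexI[OF _ S_zero_closed[OF U]] S_closed[OF U] assms \<eta>_closed)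
  next
    case (Suc k)
    then obtain F where F: "F \<in> carrier (S m U)" "H \<oplus>\<^bsub>S m U\<^esub> (-1) \<odot>\<^bsub>S m U\<^esub> \<eta> F \<in> Jpow m U k" by blast
    obtain F' where F': "F' \<in> carrier (S m U)"
      "(H \<oplus>\<^bsub>S m U\<^esub> (-1) \<odot>\<^bsub>S m U\<^esub> \<eta> F) \<oplus>\<^bsub>S m U\<^esub> (-1) \<odot>\<^bsub>S m U\<^esub> \<eta> F' \<in> Jpow m U (Suc k)" using step[OF F(2)] by blast
    have "(H \<oplus>\<^bsub>S m U\<^esub> (-1) \<odot>\<^bsub>S m U\<^esub> \<eta> F) \<oplus>\<^bsub>S m U\<^esub> (-1) \<odot>\<^bsub>S m U\<^esub> \<eta> F' = H \<oplus>\<^bsub>S m U\<^esub> (-1) \<odot>\<^bsub>S m U\<^esub> \<eta> (F \<oplus>\<^bsub>S m U\<^esub> F')"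
      by (rule S_eqI[of _ m U])
        (auto intro!: S_closed[OF U] \<eta>_closed assms F F' simp: S_apply[OF U] \<eta>_simps(2)[OF F(1) F'(1)])
    then show ?case using F'(2) S_add_closed[OF U F(1) F'(1)] by (intro bexI[of _ "F \<oplus>\<^bsub>S m U\<^esub> F'"]) auto
  qed
  from this[of "Suc m"] obtain F where F: "F \<in> carrier (S m U)" "H \<oplus>\<^bsub>S m U\<^esub> (-1) \<odot>\<^bsub>S m U\<^esub> \<eta> F \<in> Jpow m U (Suc m)" by blast
  have "H = \<eta> F" by (rule S_diff_zero[OF U assms \<eta>_closed[OF F(1)] Jpow_top[OF U F(2)]])
  then show ?thesis using F by auto
qed

text \<open>Multiplying a lowest order coefficient by the complementary monomial moves it to the top degree,
  where the homomorphism acts by an invertible function.\<close>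

lemma value_preserving_inj:
  assumes F: "F \<in> carrier (S m U)" and z: "\<eta> F = \<zero>\<^bsub>S m U\<^esub>"
  shows "F = \<zero>\<^bsub>S m U\<^esub>"
proof (rule ccontr)
  assume ne: "F \<noteq> \<zero>\<^bsub>S m U\<^esub>"
  define P where "P k \<longleftrightarrow> (\<exists>K x. K \<subseteq> {..<m} \<and> card K = k \<and> x \<in> U \<and> F K x \<noteq> 0)" for k
  have "\<exists>k. P k"
  proof (rule ccontr)
    assume "\<nexists>k. P k"
    then have "F = \<zero>\<^bsub>S m U\<^esub>" by (intro S_eqI[OF F S_zero_closed[OF U]]) (auto simp: P_def S_apply[OF U])
    then show False using ne by simp
  qed
  define k where "k = (LEAST k. P k)"
  have "P k" unfolding k_def using \<open>\<exists>k. P k\<close> by (rule LeastI_ex)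
  then obtain I x where I: "I \<subseteq> {..<m}" "card I = k" "x \<in> U" "F I x \<noteq> 0" by (auto simp: P_def)
  have low: "F K y = 0" if "K \<subseteq> {..<m}" "card K < k" "y \<in> U" for K y
  proof (rule ccontr)
    assume "F K y \<noteq> 0"
    then have "P (card K)" unfolding P_def using that by blast
    then show False using not_less_Least[of "card K" P] that(2) unfolding k_def by simp
  qed
  have Fk: "F \<in> Jpow m U k" by (rule JpowI[OF F low])
  let ?o = "\<lambda>x\<in>U. 1 :: complex" and ?N = "{..<m}"
  define J where "J = ?N - I"
  have fin: "finite I" "finite J" "I \<union> J = ?N" "I \<inter> J = {}" "J \<subseteq> ?N"
    using I(1) finite_subset[OF I(1)] by (auto simp: J_def)
  have cJ: "k + card J = m" using card_Un_disjoint[OF fin(1,2,4)] fin(3) I(2) by simp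
  note oc = monomial_closed[OF U hol_const[OF U]]
  obtain E where E: "E \<in> Jpow m U m" "\<And>x. x \<in> U \<Longrightarrow> \<eta> E ?N x = 1"
    using leading_monomials[of ?N] by auto
  note Ec = JpowD(1)[OF E(1)]
  have top: "L = ?N" if "L \<subseteq> ?N" "\<not> card L < m" for L 
    using that card_mono[of ?N L] by (intro card_subset_eq) auto
  have sc: "monomial m U f {} \<otimes>\<^bsub>S m U\<^esub> monomial m U ?o ?N = monomial m U f ?N" if f: "f \<in> hol M U" for f
  proof (rule S_eqI[OF S_mult_closed[OF U monomial_closed[OF U f] oc] monomial_closed[OF U f]])
    fix K x assume K: "K \<subseteq> {..<m}" "x \<in> U"
    have "wedge (\<lambda>L. monomial m U f {} L x) (\<lambda>L. monomial m U ?o ?N L x) K = wedge (\<lambda>L. if L = {} then f x else 0) (\<lambda>L. monomial m U ?o ?N L x) K"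
      by (rule wedge_cong) (use K in \<open>auto simp: monomial_def\<close>)
    also have "\<dots> = f x * monomial m U ?o ?N K x" by (rule wedge_one_left[OF fin_gens[OF U K(1)]])
    finally show "(monomial m U f {} \<otimes>\<^bsub>S m U\<^esub> monomial m U ?o ?N) K x = monomial m U f ?N K x"
      using K by (simp add: S_apply[OF U] monomial_apply[OF U])
  qed
  define w where "w = \<eta> (monomial m U ?o ?N)"
  have w: "w \<in> Jpow m U m" unfolding w_def using \<eta>_monomial_Jpow[OF hol_const[OF U], of ?N] by simp
  have \<eta>top: "\<eta> (monomial m U f ?N) ?N y = f y * w ?N y" if f: "f \<in> hol M U" and y: "y \<in> U" for f y
  proof -
    have "\<eta> (monomial m U f ?N) = \<eta> (monomial m U f {}) \<otimes>\<^bsub>S m U\<^esub> w"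
      using sc[OF f] \<eta>_simps(1)[OF monomial_closed[OF U f] oc] by (metis w_def)
    moreover have "wedge (\<lambda>L. \<eta> (monomial m U f {}) L y) (\<lambda>L. w L y) ?N = \<eta> (monomial m U f {}) {} y * w ?N y"
      by (rule wedge_leading[of _ m]) (use JpowD(2)[OF w] y in auto)
    ultimately show ?thesis using y \<eta>_val[OF monomial_closed[OF U f] y] by (simp add: S_apply[OF U] monomial_apply[OF U])
  qed
  have "E = monomial m U (E ?N) ?N"
    by (rule S_eqI[OF Ec monomial_closed[OF U S_hol[OF Ec subset_refl]]])
      (use JpowD(2)[OF E(1)] top in \<open>auto simp: monomial_apply[OF U]\<close>)
  then have "E ?N x * w ?N x = 1" using \<eta>top[OF S_hol[OF Ec subset_refl] I(3)] E(2)[OF I(3)] by metis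
  then have w0: "w ?N x \<noteq> 0" by auto
  have "F \<otimes>\<^bsub>S m U\<^esub> monomial m U ?o J \<in> Jpow m U (k + card J)"
    by (rule Jpow_mult[OF U Fk monomial_Jpow[OF U hol_const[OF U]]])
  then have FJ: "F \<otimes>\<^bsub>S m U\<^esub> monomial m U ?o J \<in> Jpow m U m" using cJ by simp
  define D where "D = F \<otimes>\<^bsub>S m U\<^esub> monomial m U ?o J"
  have Dc: "D \<in> carrier (S m U)" using FJ JpowD by (simp add: D_def)
  have "D = monomial m U (D ?N) ?N"
    by (rule S_eqI[OF Dc monomial_closed[OF U S_hol[OF Dc subset_refl]]])
      (use JpowD(2)[OF FJ] top in \<open>auto simp: monomial_apply[OF U] D_def\<close>)
  then have 1: "\<eta> D ?N x = D ?N x * w ?N x" using \<eta>top[OF S_hol[OF Dc subset_refl] I(3)] by metis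
  have "wedge (\<lambda>L. F L x) (\<lambda>L. monomial m U ?o J L x) ?N = (\<Sum>L\<in>{I}. shuffle_sign L (?N - L) * F L x * monomial m U ?o J (?N - L) x)"
    unfolding wedge_def
  proof (rule sum.mono_neutral_right)
    show "\<forall>L\<in>Pow ?N - {I}. shuffle_sign L (?N - L) * F L x * monomial m U ?o J (?N - L) x = 0"
    proof
      fix L assume L: "L \<in> Pow ?N - {I}"
      then have "?N - L \<noteq> J" unfolding J_def using I(1) by (metis Diff_iff Pow_iff double_diff insertI1 order_refl)
      then show "shuffle_sign L (?N - L) * F L x * monomial m U ?o J (?N - L) x = 0" using I by (simp add: monomial_apply[OF U])
    qed
  qed (use I in auto)
  also have "\<dots> = shuffle_sign I J * F I x" using I fin by (simp add: monomial_apply[OF U] J_def)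
  finally have "D ?N x = shuffle_sign I J * F I x" using I by (simp add: D_def S_apply[OF U])
  moreover have "shuffle_sign I J \<noteq> 0" using shuffle_sign_square[of I J] by (metis mult_zero_left zero_neq_one)
  ultimately have "\<eta> D ?N x \<noteq> 0" using 1 w0 I by simp
  moreover have "\<eta> D ?N x = 0"
  proof -
    interpret ring "S m U" by (rule ring_S[OF U])
    have "\<eta> D = \<zero>\<^bsub>S m U\<^esub> \<otimes>\<^bsub>S m U\<^esub> \<eta> (monomial m U ?o J)" unfolding D_def using \<eta>_simps(1)[OF F oc] z by simp
    then have "\<eta> D = \<zero>\<^bsub>S m U\<^esub>" using l_null[OF \<eta>_closed[OF oc]] by simp
    then show ?thesis using I by (simp add: S_apply[OF U])
  qed
  ultimately show False by simp
qed

lemma value_preserving_bij: "bij_betw \<eta> (carrier (S m U)) (carrier (S m U))"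
proof (rule bij_betwI')
  fix F F' assume F: "F \<in> carrier (S m U)" "F' \<in> carrier (S m U)"
  show "\<eta> F = \<eta> F' \<longleftrightarrow> F = F'"
  proof
    assume eq: "\<eta> F = \<eta> F'"
    let ?D = "F \<oplus>\<^bsub>S m U\<^esub> (-1) \<odot>\<^bsub>S m U\<^esub> F'"
    have D: "?D \<in> carrier (S m U)" by (intro S_closed[OF U] F)
    have "\<eta> ?D = \<eta> F \<oplus>\<^bsub>S m U\<^esub> (-1) \<odot>\<^bsub>S m U\<^esub> \<eta> F'"
      using \<eta>_simps(2)[OF F(1) S_smult_closed[OF U F(2)]] \<eta>_simps(3)[OF F(2)] by simp
    also have "\<dots> = \<zero>\<^bsub>S m U\<^esub>"
      by (rule S_eqI[of _ m U]) (auto intro!: S_closed[OF U] \<eta>_closed F simp: S_apply[OF U] eq)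
    finally have "?D = \<zero>\<^bsub>S m U\<^esub>" by (rule value_preserving_inj[OF D])
    then show "F = F'" by (rule S_diff_zero[OF U F])
  qed simp
next
  show "F \<in> carrier (S m U) \<Longrightarrow> \<eta> F \<in> carrier (S m U)" for F by (rule \<eta>_closed)
  fix H assume "H \<in> carrier (S m U)"
  then show "\<exists>F\<in>carrier (S m U). H = \<eta> F" using value_preserving_surj by metis
qed

end
end
end

section \<open>Local and global bijectivity\<close>

context super_manifold
begin

text \<open>Separation gives injectivity.  For surjectivity the local preimages are unique, hence agree on
  overlaps, and are glued.\<close>

lemma locally_bij_imp_bij:
  fixes \<kappa> :: "'p set \<Rightarrow> 's \<Rightarrow> nat set \<Rightarrow> 'p \<Rightarrow> complex"
  assumes cl: "\<And>W a. openin X W \<Longrightarrow> a \<in> carrier (SecG W) \<Longrightarrow> \<kappa> W a \<in> carrier (S m W)"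
    and res: "\<And>V W a. openin X V \<Longrightarrow> openin X W \<Longrightarrow> W \<subseteq> V \<Longrightarrow> a \<in> carrier (SecG V) \<Longrightarrow>
      \<kappa> W (ResG V W a) = Res (super_hol (body G) m) V W (\<kappa> V a)"
    and loc: "\<And>g. g \<in> topspace X \<Longrightarrow> \<exists>N. openin X N \<and> g \<in> N \<and>
      (\<forall>W. openin X W \<and> W \<subseteq> N \<longrightarrow> bij_betw (\<kappa> W) (carrier (SecG W)) (carrier (S m W)))"
    and W: "openin X W"
  shows "bij_betw (\<kappa> W) (carrier (SecG W)) (carrier (S m W))"
proof -
  define B where "B = {N. openin X N \<and> N \<subseteq> W \<and> (\<forall>V. openin X V \<and> V \<subseteq> N \<longrightarrow> bij_betw (\<kappa> V) (carrier (SecG V)) (carrier (S m V)))}"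
  have Bo: "openin X N" "N \<subseteq> W" if "N \<in> B" for N using that by (auto simp: B_def)
  have Bb: "bij_betw (\<kappa> V) (carrier (SecG V)) (carrier (S m V))" if "N \<in> B" "openin X V" "V \<subseteq> N" for N V
    using that by (simp add: B_def)
  have cov: "\<exists>N\<in>B. x \<in> N" if x: "x \<in> W" for x
  proof -
    have "x \<in> topspace X" using x openin_subset[OF W] by auto
    then obtain N where N: "openin X N" "x \<in> N" "\<And>V. openin X V \<Longrightarrow> V \<subseteq> N \<Longrightarrow> bij_betw (\<kappa> V) (carrier (SecG V)) (carrier (S m V))"
      using loc[of x] by metis
    have "N \<inter> W \<in> B" using N(1,3) W by (simp add: B_def openin_Int)
    then show ?thesis using N(2) x by (intro bexI[of _ "N \<inter> W"]) simp_all
  qed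
  have BW: "\<Union>B = W" using cov Bo(2) by blast
  note sheaf = supermanifoldD(2)[OF G, unfolded superalg_sheaf_def, THEN conjunct2, rule_format, of B, unfolded BW]
  have rc: "ResG W N a \<in> carrier (SecG N)" if "N \<in> B" "a \<in> carrier (SecG W)" for N a
    by (rule ResG_closed[OF W Bo[OF that(1)] that(2)])
  have inj: "a = b" if "openin X V" "V \<subseteq> N" "N \<in> B" "a \<in> carrier (SecG V)" "b \<in> carrier (SecG V)" "\<kappa> V a = \<kappa> V b" for V N a b
    using Bb[OF that(3,1,2)] that by (simp add: bij_betw_def inj_on_def)
  show ?thesis
  proof (rule bij_betwI')
    fix a b assume a: "a \<in> carrier (SecG W)" and b: "b \<in> carrier (SecG W)"
    show "\<kappa> W a = \<kappa> W b \<longleftrightarrow> a = b"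
    proof
      assume eq: "\<kappa> W a = \<kappa> W b"
      have Req: "ResG W N a = ResG W N b" if N: "N \<in> B" for N
        by (rule inj[OF Bo(1)[OF N] subset_refl N rc[OF N a] rc[OF N b]])
          (simp add: res[OF W Bo[OF N] a] res[OF W Bo[OF N] b] eq)
      have "\<exists>!u. u \<in> carrier (SecG W) \<and> (\<forall>N\<in>B. ResG W N u = ResG W N a)"
      proof (rule sheaf, intro conjI ballI)
        fix N N' assume N: "N \<in> B" "N' \<in> B"
        have o: "openin X (N \<inter> N')" using Bo(1)[OF N(1)] Bo(1)[OF N(2)] by (rule openin_Int)
        show "ResG N (N \<inter> N') (ResG W N a) = ResG N' (N \<inter> N') (ResG W N' a)"
          using ResG_comp[OF W Bo(1)[OF N(1)] o _ Bo(2)[OF N(1)] a] ResG_comp[OF W Bo(1)[OF N(2)] o _ Bo(2)[OF N(2)] a] by simp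
      qed (use Bo rc a in auto)
      then show "a = b" using a b Req by (elim ex1E) (metis (no_types, lifting))
    qed simp
  next
    fix a assume "a \<in> carrier (SecG W)" then show "\<kappa> W a \<in> carrier (S m W)" by (rule cl[OF W])
  next
    fix F assume F: "F \<in> carrier (S m W)"
    define s where "s N = inv_into (carrier (SecG N)) (\<kappa> N) (Res (super_hol (body G) m) W N F)" for N
    have RF: "Res (super_hol (body G) m) W N F \<in> carrier (S m N)" if "N \<in> B" for N
      by (rule S_Res_closed[OF Bo[OF that] F])
    have s: "s N \<in> carrier (SecG N)" "\<kappa> N (s N) = Res (super_hol (body G) m) W N F" if N: "N \<in> B" for N
    proof -
      have "Res (super_hol (body G) m) W N F \<in> \<kappa> N ` carrier (SecG N)"
        using Bb[OF N Bo(1)[OF N] subset_refl] RF[OF N] by (simp add: bij_betw_def)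
      then show "s N \<in> carrier (SecG N)" "\<kappa> N (s N) = Res (super_hol (body G) m) W N F"
        unfolding s_def by (rule inv_into_into, rule f_inv_into_f)
    qed
    have "\<exists>!u. u \<in> carrier (SecG W) \<and> (\<forall>N\<in>B. ResG W N u = s N)"
    proof (rule sheaf, intro conjI ballI)
      fix N N' assume N: "N \<in> B" "N' \<in> B"
      have o: "openin X (N \<inter> N')" using Bo(1)[OF N(1)] Bo(1)[OF N(2)] by (rule openin_Int)
      note r = ResG_closed[OF Bo(1)[OF N(1)] o _ s(1)[OF N(1)]] ResG_closed[OF Bo(1)[OF N(2)] o _ s(1)[OF N(2)]]
      show "ResG N (N \<inter> N') (s N) = ResG N' (N \<inter> N') (s N')"
      proof (rule inj[OF o _ N(1) r])
        have "\<kappa> (N \<inter> N') (ResG N (N \<inter> N') (s N)) = Res (super_hol (body G) m) N (N \<inter> N') (Res (super_hol (body G) m) W N F)"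
          "\<kappa> (N \<inter> N') (ResG N' (N \<inter> N') (s N')) = Res (super_hol (body G) m) N' (N \<inter> N') (Res (super_hol (body G) m) W N' F)"
          using res[OF Bo(1)[OF N(1)] o _ s(1)[OF N(1)]] res[OF Bo(1)[OF N(2)] o _ s(1)[OF N(2)]] s(2)[OF N(1)] s(2)[OF N(2)] by simp_all
        then show "\<kappa> (N \<inter> N') (ResG N (N \<inter> N') (s N)) = \<kappa> (N \<inter> N') (ResG N' (N \<inter> N') (s N'))"
          by (auto simp: S_Res intro!: restrict_ext)
      qed auto
    qed (use Bo s in auto)
    then have "\<exists>u. u \<in> carrier (SecG W) \<and> (\<forall>N\<in>B. ResG W N u = s N)" by (rule ex1_implies_ex)
    then obtain u where u0: "u \<in> carrier (SecG W) \<and> (\<forall>N\<in>B. ResG W N u = s N)" by (rule exE)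
    have u: "u \<in> carrier (SecG W)" "\<And>N. N \<in> B \<Longrightarrow> ResG W N u = s N" using u0 by simp_all
    have "F = \<kappa> W u"
    proof (rule S_eqI[OF F cl[OF W u(1)]])
      fix K x assume K: "K \<subseteq> {..<m}" and x: "x \<in> W"
      obtain N where N: "N \<in> B" "x \<in> N" using cov[OF x] by blast
      have "Res (super_hol (body G) m) W N (\<kappa> W u) = Res (super_hol (body G) m) W N F"
        using res[OF W Bo[OF N(1)] u(1)] u(2)[OF N(1)] s(2)[OF N(1)] by simp
      then have "Res (super_hol (body G) m) W N (\<kappa> W u) K x = Res (super_hol (body G) m) W N F K x" by simp
      then show "F K x = \<kappa> W u K x" using K N by (simp add: S_Res_apply)
    qed
    then show "\<exists>a\<in>carrier (SecG W). F = \<kappa> W a" using u(1) by blast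
  qed
qed

context
  fixes \<kappa> :: "'p set \<Rightarrow> 's \<Rightarrow> nat set \<Rightarrow> 'p \<Rightarrow> complex"
  assumes hom: "\<And>W. openin X W \<Longrightarrow> \<kappa> W \<in> superalg_hom (SecG W) (S m W)"
    and res: "\<And>V W a. openin X V \<Longrightarrow> openin X W \<Longrightarrow> W \<subseteq> V \<Longrightarrow> a \<in> carrier (SecG V) \<Longrightarrow>
        \<kappa> W (ResG V W a) = Res (super_hol (body G) m) V W (\<kappa> V a)"
begin

text \<open>The values of \<open>\<kappa> W a\<close> at a fixed point define a character of the stalk.\<close>

lemma hom_val:
  assumes W: "openin X W" "x \<in> W" and a: "a \<in> carrier (SecG W)"
  shows "\<kappa> W a {} x = val W a x"
proof (rule character_is_val[OF W(2,1) a, where \<kappa> = "\<lambda>W a. \<kappa> W a {} x"])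
  fix V V' a assume V: "openin X V" "openin X V'" "x \<in> V'" "V' \<subseteq> V" "a \<in> carrier (SecG V)"
  then show "\<kappa> V' (ResG V V' a) {} x = \<kappa> V a {} x" using res[OF V(1,2,4,5)] by (simp add: S_Res_apply)
qed (simp_all add: superalg_homD[OF hom] S_apply wedge_def)

lemma hom_closed: "openin X W \<Longrightarrow> a \<in> carrier (SecG W) \<Longrightarrow> \<kappa> W a \<in> carrier (S m W)"
  using superalg_hom_closed[OF hom] .

text \<open>The sections that multiply by a given function in lowest order; they are the coefficients in
  linear combinations of odd sections.\<close>

lemma coefficient_section:
  assumes t: "trivialization U \<theta>" and N: "openin X N" "N \<subseteq> U" and f: "f \<in> hol (body G) N"
  shows "\<exists>\<phi>\<in>even_part (SecG N). \<forall>x\<in>N. val N \<phi> x = f x"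
proof -
  let ?i = "inv_into (carrier (SecG N)) (\<theta> N)"
  have mc: "monomial m N f {} \<in> carrier (S m N)" by (rule monomial_closed[OF N(1) f])
  have me: "monomial m N f {} \<in> even_part (S m N)"
    by (rule S_evenI[OF mc]) (auto simp: monomial_apply[OF N(1)])
  have ih: "?i \<in> superalg_hom (S m N) (SecG N)"
    using superalg_iso_inverse[OF SecG[OF N(1)] comm_superalgebra_S[OF N(1)] trivializationD(2)[OF t N]] by (simp add: superalg_iso_def)
  have e: "?i (monomial m N f {}) \<in> even_part (SecG N)" by (rule superalg_homD(5)[OF ih me])
  have "\<theta> N (?i (monomial m N f {})) = monomial m N f {}"
    using trivializationD(4)[OF t N] mc by (simp add: bij_betw_def f_inv_into_f)
  then have "val N (?i (monomial m N f {})) x = f x" if "x \<in> N" for x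
    using val_trivialization[OF t N that SecG_closed(6)[OF N(1) e]] that by (simp add: monomial_apply[OF N(1)])
  then show ?thesis using e by blast
qed

lemma linear_part_mult:
  assumes N: "openin X N" "x \<in> N" and \<phi>: "\<phi> \<in> even_part (SecG N)" and a: "a \<in> odd_part (SecG N)" and j: "j < m"
  shows "\<kappa> N (\<phi> \<otimes>\<^bsub>SecG N\<^esub> a) {j} x = val N \<phi> x * \<kappa> N a {j} x"
proof -
  have c: "\<phi> \<in> carrier (SecG N)" "a \<in> carrier (SecG N)" using SecG_closed(6,7)[OF N(1)] \<phi> a by auto
  have "wedge (\<lambda>I. \<kappa> N \<phi> I x) (\<lambda>I. \<kappa> N a I x) {j} = \<kappa> N \<phi> {} x * \<kappa> N a {j} x"
  proof (rule wedge_leading[of _ 1])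
    fix I assume "I \<subseteq> {j}" "card I < 1"
    then have "I = {}" using finite_subset[of I "{j}"] by simp
    then show "\<kappa> N a I x = 0" using S_parity_zero(2)[OF superalg_homD(6)[OF hom[OF N(1)] a], of "{}" x] N by simp
  qed auto
  then show ?thesis using c j N by (simp add: superalg_homD(1)[OF hom[OF N(1)]] S_apply[OF N(1)] hom_val)
qed

text \<open>Gaussian elimination on the matrix of linear parts; near the point the pivots do not vanish.\<close>

lemma normalize_coordinates:
  assumes t: "trivialization U \<theta>" and g: "g \<in> U"
    and start: "\<And>i. i < m \<Longrightarrow> \<sigma> i \<in> odd_part (SecG U)" "\<And>i j. i < m \<Longrightarrow> j < m \<Longrightarrow> \<kappa> U (\<sigma> i) {j} g = (if j = i then 1 else 0)"
    and k: "k \<le> m"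
  shows "\<exists>N \<tau>. openin X N \<and> g \<in> N \<and> N \<subseteq> U \<and> (\<forall>i<m. \<tau> i \<in> odd_part (SecG N)) \<and>
    (\<forall>i<m. \<forall>j<m. \<kappa> N (\<tau> i) {j} g = (if j = i then 1 else 0)) \<and>
    (\<forall>i<m. \<forall>j<k. \<forall>x\<in>N. \<kappa> N (\<tau> i) {j} x = (if j = i then 1 else 0))"
  using k
proof (induction k)
  case 0
  then show ?case using trivializationD(1)[OF t] g start by (intro exI[of _ U] exI[of _ \<sigma>]) auto
next
  case (Suc k)
  obtain N \<tau> where ex: "openin X N \<and> g \<in> N \<and> N \<subseteq> U \<and> (\<forall>i<m. \<tau> i \<in> odd_part (SecG N)) \<and>
    (\<forall>i<m. \<forall>j<m. \<kappa> N (\<tau> i) {j} g = (if j = i then 1 else 0)) \<and>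
    (\<forall>i<m. \<forall>j<k. \<forall>x\<in>N. \<kappa> N (\<tau> i) {j} x = (if j = i then 1 else 0))"
    using Suc.IH[OF Suc_leD[OF Suc.prems]] by (elim exE)
  have N: "openin X N" "g \<in> N" "N \<subseteq> U" and to: "\<And>i. i < m \<Longrightarrow> \<tau> i \<in> odd_part (SecG N)"
    and tg: "\<And>i j. i < m \<Longrightarrow> j < m \<Longrightarrow> \<kappa> N (\<tau> i) {j} g = (if j = i then 1 else 0)"
    and tk: "\<And>i j x. i < m \<Longrightarrow> j < k \<Longrightarrow> x \<in> N \<Longrightarrow> \<kappa> N (\<tau> i) {j} x = (if j = i then 1 else 0)"
    using ex by simp_all
  have km: "k < m" using Suc by simp
  note tc = SecG_closed(7)[OF N(1) to]
  define c where "c = \<kappa> N (\<tau> k) {k}"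
  have ch: "c \<in> hol (body G) N" unfolding c_def using S_hol[OF hom_closed[OF N(1) tc[OF km]]] km by simp
  define N' where "N' = {x \<in> N. c x \<noteq> 0}"
  have N': "openin X N'" "N' \<subseteq> N" "g \<in> N'" "N' \<subseteq> U"
    unfolding N'_def using hol_open_nonzero[OF N(1) ch] N tg[OF km km] by (auto simp: c_def)
  define \<rho> where "\<rho> i = ResG N N' (\<tau> i)" for i
  have ro: "\<rho> i \<in> odd_part (SecG N')" if "i < m" for i
    unfolding \<rho>_def by (rule superalg_homD(6)[OF ResG_hom[OF N(1) N'(1,2)] to[OF that]])
  note rc = SecG_closed(7)[OF N'(1) ro]
  have kr: "\<kappa> N' (\<rho> i) {j} x = \<kappa> N (\<tau> i) {j} x" if "i < m" "j < m" "x \<in> N'" for i j x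
    unfolding \<rho>_def res[OF N(1) N'(1,2) tc[OF that(1)]] by (rule S_Res_apply) (use that in auto)
  have "(\<lambda>x\<in>N'. inverse (restrict c N' x)) \<in> hol (body G) N'"
    by (rule hol_inverse[OF N'(1) hol_restrict[OF N'(1,2) ch]]) (auto simp: N'_def)
  from coefficient_section[OF t N'(1,4) this]
  obtain \<phi> where \<phi>: "\<phi> \<in> even_part (SecG N')" "\<And>x. x \<in> N' \<Longrightarrow> val N' \<phi> x = inverse (c x)" by auto
  define \<upsilon> where "\<upsilon> = \<phi> \<otimes>\<^bsub>SecG N'\<^esub> \<rho> k"
  interpret A: comm_superalgebra "SecG N'" by (rule SecG[OF N'(1)])
  have uo: "\<upsilon> \<in> odd_part (SecG N')" unfolding \<upsilon>_def by (rule A.even_odd[OF \<phi>(1) ro[OF km]])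
  note uc = SecG_closed(7)[OF N'(1) uo]
  have ku: "\<kappa> N' \<upsilon> {j} x = \<kappa> N (\<tau> k) {j} x / c x" if "j < m" "x \<in> N'" for j x
    unfolding \<upsilon>_def using linear_part_mult[OF N'(1) that(2) \<phi>(1) ro[OF km] that(1)] kr[OF km that] \<phi>(2)[OF that(2)]
    by (simp add: field_simps)
  have "\<exists>\<psi>\<in>even_part (SecG N'). \<forall>x\<in>N'. val N' \<psi> x = (\<lambda>x\<in>N'. - \<kappa> N' (\<rho> i) {k} x) x" if "i < m" for i
    by (rule coefficient_section[OF t N'(1,4) hol_uminus[OF N'(1) S_hol[OF hom_closed[OF N'(1) rc[OF that]]]]]) (use km in simp)
  then obtain \<psi> where \<psi>: "\<And>i. i < m \<Longrightarrow> \<psi> i \<in> even_part (SecG N')" "\<And>i x. i < m \<Longrightarrow> x \<in> N' \<Longrightarrow> val N' (\<psi> i) x = - \<kappa> N' (\<rho> i) {k} x"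
    by (metis restrict_apply')
  define \<omega> where "\<omega> i = (if i = k then \<upsilon> else \<rho> i \<oplus>\<^bsub>SecG N'\<^esub> \<psi> i \<otimes>\<^bsub>SecG N'\<^esub> \<upsilon>)" for i
  have po: "\<psi> i \<otimes>\<^bsub>SecG N'\<^esub> \<upsilon> \<in> odd_part (SecG N')" if "i < m" for i by (rule A.even_odd[OF \<psi>(1)[OF that] uo])
  have wo: "\<omega> i \<in> odd_part (SecG N')" if "i < m" for i
    unfolding \<omega>_def using uo superalg_parts_closed(6)[OF SecG[OF N'(1)] ro[OF that] po[OF that]] by simp
  have kw: "\<kappa> N' (\<omega> i) {j} x = (if i = k then \<kappa> N (\<tau> k) {j} x / c x
      else \<kappa> N (\<tau> i) {j} x - \<kappa> N (\<tau> i) {k} x * \<kappa> N (\<tau> k) {j} x / c x)" if "i < m" "j < m" "x \<in> N'" for i j x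
    unfolding \<omega>_def
    using that ku[OF that(2,3)] kr[OF that] kr[OF that(1) km that(3)] linear_part_mult[OF N'(1) that(3) \<psi>(1)[OF that(1)] uo that(2)]
      \<psi>(2)[OF that(1,3)] superalg_homD(2)[OF hom[OF N'(1)] rc[OF that(1)] SecG_closed(7)[OF N'(1) po[OF that(1)]]]
    by (simp add: S_apply[OF N'(1)])
  have cg: "c g = 1" using tg[OF km km] by (simp add: c_def)
  have cnz: "c x \<noteq> 0" "x \<in> N" if "x \<in> N'" for x using that by (auto simp: N'_def)
  show ?case
  proof (intro exI[of _ N'] exI[of _ \<omega>] conjI allI impI ballI N' wo)
    fix i j assume "i < m" "j < m"
    then show "\<kappa> N' (\<omega> i) {j} g = (if j = i then 1 else 0)"
      using kw[OF _ _ N'(3), of i j] tg[of i j] tg[of k j] tg[of i k] cg km by auto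
  next
    fix i j x assume i: "i < m" and j: "j < Suc k" and x: "x \<in> N'"
    show "\<kappa> N' (\<omega> i) {j} x = (if j = i then 1 else 0)"
    proof (cases "j = k")
      case True
      then show ?thesis using kw[OF i km x] cnz[OF x] by (auto simp: c_def)
    next
      case False
      then have jk: "j < k" "j < m" using j km by auto
      show ?thesis using kw[OF i jk(2) x] tk[OF i jk(1) cnz(2)[OF x]] tk[OF km jk(1) cnz(2)[OF x]] False by auto
    qed
  qed
qed

text \<open>In a trivialization \<open>\<kappa>\<close> becomes an endomorphism of superfunctions that preserves values, and
  the normalized coordinates are the odd elements needed for its bijectivity.\<close>

lemma hom_locally_bij:
  assumes coord: "openin X V" "g \<in> V" "\<And>i. i < m \<Longrightarrow> \<sigma> i \<in> odd_part (SecG V)"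
      "\<And>i K. i < m \<Longrightarrow> K \<subseteq> {..<m} \<Longrightarrow> \<kappa> V (\<sigma> i) K g = (if K = {i} then 1 else 0)"
  shows "\<exists>N. openin X N \<and> g \<in> N \<and>
      (\<forall>W. openin X W \<and> W \<subseteq> N \<longrightarrow> bij_betw (\<kappa> W) (carrier (SecG W)) (carrier (S m W)))"
proof -
  obtain U \<theta> where t: "trivialization U \<theta>" and U: "g \<in> U" "U \<subseteq> V" "openin X U" using small_trivialization[OF coord(1,2)] .
  have o: "ResG V U (\<sigma> i) \<in> odd_part (SecG U)" if "i < m" for i
    by (rule superalg_homD(6)[OF ResG_hom[OF coord(1) U(3,2)] coord(3)[OF that]])
  have k: "\<kappa> U (ResG V U (\<sigma> i)) {j} g = (if j = i then 1 else 0)" if "i < m" "j < m" for i j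
    using res[OF coord(1) U(3,2) SecG_closed(7)[OF coord(1) coord(3)[OF that(1)]]] coord(4)[OF that(1), of "{j}"] that U(1)
    by (simp add: S_Res_apply)
  have "\<exists>N \<tau>. openin X N \<and> g \<in> N \<and> N \<subseteq> U \<and> (\<forall>i<m. \<tau> i \<in> odd_part (SecG N)) \<and>
    (\<forall>i<m. \<forall>j<m. \<kappa> N (\<tau> i) {j} g = (if j = i then 1 else 0)) \<and>
    (\<forall>i<m. \<forall>j<m. \<forall>x\<in>N. \<kappa> N (\<tau> i) {j} x = (if j = i then 1 else 0))"
    by (rule normalize_coordinates[OF t U(1), where \<sigma> = "\<lambda>i. ResG V U (\<sigma> i)"]) (simp_all add: o k)
  then obtain N \<tau> where ex: "openin X N \<and> g \<in> N \<and> N \<subseteq> U \<and> (\<forall>i<m. \<tau> i \<in> odd_part (SecG N)) \<and>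
    (\<forall>i<m. \<forall>j<m. \<kappa> N (\<tau> i) {j} g = (if j = i then 1 else 0)) \<and>
    (\<forall>i<m. \<forall>j<m. \<forall>x\<in>N. \<kappa> N (\<tau> i) {j} x = (if j = i then 1 else 0))"
    by (elim exE)
  have N: "openin X N" "g \<in> N" "N \<subseteq> U" and to: "\<And>i. i < m \<Longrightarrow> \<tau> i \<in> odd_part (SecG N)"
    and tk: "\<And>i j x. i < m \<Longrightarrow> j < m \<Longrightarrow> x \<in> N \<Longrightarrow> \<kappa> N (\<tau> i) {j} x = (if j = i then 1 else 0)"
    using ex by simp_all
  have "bij_betw (\<kappa> W) (carrier (SecG W)) (carrier (S m W))" if W: "openin X W" and WN: "W \<subseteq> N" for W
  proof -
    have WU: "W \<subseteq> U" using WN N(3) by auto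
    let ?i = "inv_into (carrier (SecG W)) (\<theta> W)"
    have ih: "?i \<in> superalg_hom (S m W) (SecG W)"
      using superalg_iso_inverse[OF SecG[OF W] comm_superalgebra_S[OF W] trivializationD(2)[OF t W WU]] by (simp add: superalg_iso_def)
    have bij: "bij_betw (\<theta> W) (carrier (SecG W)) (carrier (S m W))" by (rule trivializationD(4)[OF t W WU])
    have i1: "?i (\<theta> W a) = a" if "a \<in> carrier (SecG W)" for a using bij that by (simp add: bij_betw_def)
    have i2: "\<theta> W (?i F) = F" if "F \<in> carrier (S m W)" for F using bij that by (simp add: bij_betw_def f_inv_into_f)
    define \<eta> where "\<eta> F = \<kappa> W (?i F)" for F
    have \<eta>: "value_preserving m W \<eta>" unfolding value_preserving_def
    proof (intro conjI ballI)
      show "\<eta> \<in> superalg_hom (S m W) (S m W)" unfolding \<eta>_def by (rule superalg_hom_comp[OF ih hom[OF W]])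
      fix F x assume F: "F \<in> carrier (S m W)" and x: "x \<in> W"
      show "\<eta> F {} x = F {} x"
        using hom_val[OF W x superalg_hom_closed[OF ih F]] val_trivialization[OF t W WU x superalg_hom_closed[OF ih F]] i2[OF F]
        by (simp add: \<eta>_def)
    qed
    define \<rho> where "\<rho> i = ResG N W (\<tau> i)" for i
    have ro: "\<rho> i \<in> odd_part (SecG W)" if "i < m" for i
      unfolding \<rho>_def by (rule superalg_homD(6)[OF ResG_hom[OF N(1) W WN] to[OF that]])
    have b: "bij_betw \<eta> (carrier (S m W)) (carrier (S m W))"
    proof (rule value_preserving_bij[OF W \<eta>, where t = "\<lambda>i. \<theta> W (\<rho> i)"])
      fix i assume i: "i < m"
      show "\<theta> W (\<rho> i) \<in> odd_part (S m W)" by (rule superalg_homD(6)[OF trivializationD(3)[OF t W WU] ro[OF i]])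
      fix K x assume K: "K \<subseteq> {..<m}" "card K = 1" and x: "x \<in> W"
      obtain j where j: "K = {j}" using K(2) by (auto simp: card_1_singleton_iff)
      have "\<eta> (\<theta> W (\<rho> i)) = \<kappa> W (\<rho> i)" unfolding \<eta>_def i1[OF SecG_closed(7)[OF W ro[OF i]]] ..
      also have "\<dots> = Res (super_hol (body G) m) N W (\<kappa> N (\<tau> i))"
        unfolding \<rho>_def by (rule res[OF N(1) W WN SecG_closed(7)[OF N(1) to[OF i]]])
      finally show "\<eta> (\<theta> W (\<rho> i)) K x = (if K = {i} then 1 else 0)"
        using tk[OF i, of j x] j K x WN by (auto simp: S_Res_apply)
    qed
    have "bij_betw (\<eta> \<circ> \<theta> W) (carrier (SecG W)) (carrier (S m W))" by (rule bij_betw_trans[OF bij b])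
    then show ?thesis
      by (rule bij_betw_cong[THEN iffD1, rotated]) (simp add: \<eta>_def i1)
  qed
  then show ?thesis using N by blast
qed

end
end

context super_group
begin

lemma sheaf_isomorphic: "sheaf_isomorphic_on X top (osheaf G) (super_hol (body G) m)"
proof -
  obtain \<kappa> where k: "(\<forall>W. openin X W \<longrightarrow> \<kappa> W \<in> superalg_hom (SecG W) (S m W)) \<and>
     (\<forall>V W a. openin X V \<longrightarrow> openin X W \<longrightarrow> W \<subseteq> V \<longrightarrow> a \<in> carrier (SecG V) \<longrightarrow>
        \<kappa> W (ResG V W a) = Res (super_hol (body G) m) V W (\<kappa> V a)) \<and>
     (\<forall>g\<in>top. \<exists>V \<sigma>. openin X V \<and> g \<in> V \<and> (\<forall>i<m. \<sigma> i \<in> odd_part (SecG V) \<and>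
        (\<forall>K\<subseteq>{..<m}. \<kappa> V (\<sigma> i) K g = (if K = {i} then 1 else 0))))"
    using kappa_exists by (rule exE)
  note hom = k[THEN conjunct1, rule_format]
    and res = k[THEN conjunct2, THEN conjunct1, rule_format]
    and coord = k[THEN conjunct2, THEN conjunct2]
  have b: "bij_betw (\<kappa> W) (carrier (SecG W)) (carrier (S m W))" if "openin X W" for W
  proof (rule locally_bij_imp_bij[OF superalg_hom_closed[OF hom] res _ that])
    fix g assume "g \<in> top"
    from coord[rule_format, OF this] obtain V \<sigma> where V: "openin X V" "g \<in> V" "\<forall>i<m. \<sigma> i \<in> odd_part (SecG V) \<and>
        (\<forall>K\<subseteq>{..<m}. \<kappa> V (\<sigma> i) K g = (if K = {i} then 1 else 0))" by (elim exE conjE)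
    show "\<exists>N. openin X N \<and> g \<in> N \<and>
      (\<forall>W. openin X W \<and> W \<subseteq> N \<longrightarrow> bij_betw (\<kappa> W) (carrier (SecG W)) (carrier (S m W)))"
      by (rule hom_locally_bij[OF hom res V(1,2), where \<sigma> = \<sigma>]) (use V(3) in simp_all)
  qed
  show ?thesis unfolding sheaf_isomorphic_on_def
  proof (intro exI[of _ \<kappa>] conjI allI impI ballI; elim conjE)
    fix V assume "openin X V"
    then show "\<kappa> V \<in> superalg_iso (SecG V) (S m V)" using hom b by (simp add: superalg_iso_def)
  next
    fix V W s assume "openin X V" "openin X W" "W \<subseteq> V" "s \<in> carrier (SecG V)"
    then show "\<kappa> W (ResG V W s) = Res (super_hol (body G) m) V W (\<kappa> V s)" by (rule res)
  qed
qed

end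

section \<open>The exterior algebra of a free module of sections\<close>

definition trivial_bundle :: "'p topology \<Rightarrow> nat \<Rightarrow> ('p, nat \<Rightarrow> complex) vbundle" where
  "trivial_bundle X m = \<lparr>rank = m,
     fibre = (\<lambda>x. \<lparr>carrier = Cn m, mult = undefined, one = undefined, zero = (\<lambda>_. 0),
                   add = (\<lambda>a b j. a j + b j), smult = (\<lambda>c a j. c * a j)\<rparr>),
     trivs = {(topspace X, \<lambda>x v. v)}\<rparr>"

definition conv :: "('e list \<Rightarrow> complex) \<Rightarrow> ('e list \<Rightarrow> complex) \<Rightarrow> 'e list \<Rightarrow> complex" where
  "conv f g w = (\<Sum>k\<le>length w. f (take k w) * g (drop k w))"

lemma conv_Nil: "conv f g [] = f [] * g []"
  by (simp add: conv_def)

lemma conv_Cons: "conv f g (a # w) = f [] * g (a # w) + conv (\<lambda>u. f (a # u)) g w"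
  by (simp add: conv_def sum.atMost_Suc_shift del: sum.atMost_Suc)

lemma conv_add_left: "conv (\<lambda>u. f u + f' u) g w = conv f g w + conv f' g w"
  and conv_add_right: "conv f (\<lambda>u. g u + g' u) w = conv f g w + conv f g' w"
  and conv_scale_left: "conv (\<lambda>u. c * f u) g w = c * conv f g w"
  and conv_scale_right: "conv f (\<lambda>u. c * g u) w = c * conv f g w"
  by (simp_all add: conv_def algebra_simps sum.distrib sum_distrib_left)

text \<open>Associativity of the free algebra, by splitting off the first letter.\<close>

lemma conv_assoc: "conv (conv f g) h w = conv f (conv g h) w"
proof (induction w arbitrary: f)
  case Nil
  then show ?case by (simp add: conv_Nil)
next
  case (Cons a w)
  have "conv (conv f g) h (a # w) = f [] * g [] * h (a # w) + conv (\<lambda>u. f [] * g (a # u) + conv (\<lambda>u. f (a # u)) g u) h w"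
    by (simp add: conv_Cons conv_Nil)
  also have "\<dots> = f [] * g [] * h (a # w) + f [] * conv (\<lambda>u. g (a # u)) h w + conv (\<lambda>u. f (a # u)) (conv g h) w"
    using Cons.IH by (simp add: conv_add_left conv_scale_left)
  also have "\<dots> = conv f (conv g h) (a # w)" by (simp add: conv_Cons algebra_simps)
  finally show ?case .
qed

lemma conv_eq_sum_pairs:
  assumes S: "finite S1" "finite S2" and f: "\<And>u. u \<notin> S1 \<Longrightarrow> f u = 0" and g: "\<And>u. u \<notin> S2 \<Longrightarrow> g u = 0"
  shows "conv f g w = (\<Sum>p\<in>{p \<in> S1 \<times> S2. fst p @ snd p = w}. f (fst p) * g (snd p))"
proof -
  let ?c = "\<lambda>k. (take k w, drop k w)"
  have "inj_on ?c {..length w}"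
  proof (rule inj_onI)
    fix k l assume "k \<in> {..length w}" "l \<in> {..length w}" "?c k = ?c l"
    then have "length (take k w) = length (take l w)" by simp
    then show "k = l" using \<open>k \<in> _\<close> \<open>l \<in> _\<close> by simp
  qed
  then have "conv f g w = (\<Sum>p\<in>?c ` {..length w}. f (fst p) * g (snd p))"
    unfolding conv_def by (subst sum.reindex) auto
  also have "\<dots> = (\<Sum>p\<in>{p \<in> S1 \<times> S2. fst p @ snd p = w}. f (fst p) * g (snd p))"
  proof (rule sum.mono_neutral_right)
    show "{p \<in> S1 \<times> S2. fst p @ snd p = w} \<subseteq> ?c ` {..length w}"
    proof
      fix p assume "p \<in> {p \<in> S1 \<times> S2. fst p @ snd p = w}"
      then show "p \<in> ?c ` {..length w}" by (intro image_eqI[of _ _ "length (fst p)"]) auto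
    qed
    show "\<forall>p\<in>?c ` {..length w} - {p \<in> S1 \<times> S2. fst p @ snd p = w}. f (fst p) * g (snd p) = 0"
      using f g by fastforce
  qed simp
  finally show ?thesis .
qed

text \<open>The vector \<open>v\<close> as an element of degree one of the exterior algebra.\<close>

definition degree_one :: "(nat \<Rightarrow> complex) \<Rightarrow> nat set \<Rightarrow> complex" where
  "degree_one v K = (if is_singleton K then v (the_elem K) else 0)"

primrec word_value :: "('p \<Rightarrow> nat \<Rightarrow> complex) list \<Rightarrow> 'p \<Rightarrow> nat set \<Rightarrow> complex" where
  "word_value [] x = (\<lambda>K. if K = {} then 1 else 0)"
| "word_value (s # w) x = wedge (degree_one (s x)) (word_value w x)"

lemma word_value_append:
  "finite K \<Longrightarrow> word_value (u @ v) x K = wedge (word_value u x) (word_value v x) K"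
proof (induction u arbitrary: K)
  case Nil
  then show ?case by (simp add: wedge_one_left)
next
  case (Cons s u)
  have "word_value ((s # u) @ v) x K = wedge (degree_one (s x)) (wedge (word_value u x) (word_value v x)) K"
    unfolding append_Cons word_value.simps
    by (rule wedge_cong) (use Cons finite_subset in auto)
  then show ?case using Cons.prems by (simp add: wedge_assoc)
qed

lemma word_value_single: "finite K \<Longrightarrow> word_value [s] x K = degree_one (s x) K"
  by (simp add: wedge_one_right)

lemma degree_one_square:
  assumes "finite K"
  shows "wedge (degree_one v) (degree_one v) K = 0"
proof -
  have "degree_one v I = 0" if "even (card I)" for I using that by (auto simp: degree_one_def is_singleton_def)
  then have "wedge (degree_one v) (degree_one v) K = - wedge (degree_one v) (degree_one v) K" by (intro wedge_odd_anticommute assms)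
  then show ?thesis by simp
qed

lemma word_value_cong: "(\<And>s. s \<in> set w \<Longrightarrow> f s x = s x) \<Longrightarrow> word_value (map f w) x = word_value w x"
  by (induction w) auto

context cman
begin

lemma trivial_bundle: "holomorphic_vector_bundle M (trivial_bundle X m)"
proof -
  let ?F = "\<lparr>carrier = Cn m, mult = undefined, one = undefined, zero = (\<lambda>_. 0),
     add = (\<lambda>a b j. a j + b j), smult = (\<lambda>c a j. c * a j)\<rparr> :: (complex, nat \<Rightarrow> complex) module"
  have ag: "abelian_group ?F"
  proof (rule abelian_groupI)
    fix v assume "v \<in> carrier ?F"
    then show "\<exists>w\<in>carrier ?F. w \<oplus>\<^bsub>?F\<^esub> v = \<zero>\<^bsub>?F\<^esub>"
      by (intro bexI[of _ "\<lambda>j. - v j"]) (auto simp: Cn_def)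
  qed (auto simp: Cn_def algebra_simps)
  have "module complex_ring ?F"
    by (rule moduleI[OF cring_complex_ring ag]) (auto simp: Cn_def algebra_simps)
  moreover have "(\<lambda>x\<in>topspace X. w j) \<in> hol M (topspace X)" for w :: "nat \<Rightarrow> complex" and j
    by (rule hol_const) simp
  ultimately show ?thesis
    unfolding holomorphic_vector_bundle_def trivial_bundle_def by (simp add: bij_betw_def)
qed

context
  fixes m :: nat and U :: "'p set"
  assumes U: "openin X U"
begin

abbreviation R where "R \<equiv> hol_ring M U"
abbreviation E where "E \<equiv> hol_sections M (trivial_bundle X m) U"
abbreviation A where "A \<equiv> free_alg R (carrier E)"
abbreviation supp where "supp f \<equiv> {w. f w \<noteq> \<zero>\<^bsub>R\<^esub>}"

lemma R_simps: "carrier R = hol M U" "f \<otimes>\<^bsub>R\<^esub> g = (\<lambda>x\<in>U. f x * g x)" "\<one>\<^bsub>R\<^esub> = (\<lambda>x\<in>U. 1)"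
  "\<zero>\<^bsub>R\<^esub> = (\<lambda>x\<in>U. 0)" "f \<oplus>\<^bsub>R\<^esub> g = (\<lambda>x\<in>U. f x + g x)"
  by (simp_all add: hol_ring_def)

lemma cring_R: "cring R"
proof (rule cringI)
  show "abelian_group R"
  proof (rule abelian_groupI)
    fix f assume "f \<in> carrier R"
    then show "\<exists>g\<in>carrier R. g \<oplus>\<^bsub>R\<^esub> f = \<zero>\<^bsub>R\<^esub>"
      using hol_uminus[OF U, of f] by (intro bexI[of _ "\<lambda>x\<in>U. - f x"]) (auto simp: R_simps)
  next
    fix f assume "f \<in> carrier R"
    then show "\<zero>\<^bsub>R\<^esub> \<oplus>\<^bsub>R\<^esub> f = f"
      using hol_shift[of f U] hol_ext[of f U] by (intro extensionalityI[of _ U]) (auto simp: R_simps)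
  qed (auto simp: R_simps hol_add[OF U] hol_const[OF U] add_ac intro!: restrict_ext)
  show "comm_monoid R"
  proof (rule comm_monoidI)
    fix f assume "f \<in> carrier R"
    then show "\<one>\<^bsub>R\<^esub> \<otimes>\<^bsub>R\<^esub> f = f"
      using hol_ext[of f U] by (intro extensionalityI[of _ U]) (auto simp: R_simps)
  qed (auto simp: R_simps hol_mult[OF U] hol_const[OF U] mult_ac intro!: restrict_ext)
qed (auto simp: R_simps algebra_simps intro!: restrict_ext)

lemma R_finsum:
  assumes "finite I" "\<And>i. i \<in> I \<Longrightarrow> f i \<in> hol M U"
  shows "finsum R f I = (\<lambda>x\<in>U. \<Sum>i\<in>I. f i x)"
proof -
  interpret cring R by (rule cring_R)
  show ?thesis using assms
  proof (induction I)
    case (insert i I)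
    have "f i \<oplus>\<^bsub>R\<^esub> finsum R f I = (\<lambda>x\<in>U. \<Sum>i\<in>insert i I. f i x)"
      using insert by (simp add: R_simps cong: restrict_cong)
    then show ?case using insert by (subst finsum_insert) (auto simp: R_simps)
  qed (simp add: R_simps)
qed

lemma E_carrier: "s \<in> carrier E \<longleftrightarrow> s \<in> extensional U \<and> (\<forall>x\<in>U. s x \<in> Cn m) \<and> (\<forall>j<m. (\<lambda>x\<in>U. s x j) \<in> hol M U)"
  using openin_subset[OF U] by (auto simp: hol_sections_def trivial_bundle_def Int_absorb2)

lemma E_ops: "s \<oplus>\<^bsub>E\<^esub> t = (\<lambda>x\<in>U. \<lambda>j. s x j + t x j)" "a \<odot>\<^bsub>E\<^esub> s = (\<lambda>x\<in>U. \<lambda>j. a x * s x j)"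
  by (simp_all add: hol_sections_def trivial_bundle_def)

lemma E_add_closed: "s \<in> carrier E \<Longrightarrow> t \<in> carrier E \<Longrightarrow> s \<oplus>\<^bsub>E\<^esub> t \<in> carrier E"
  unfolding E_carrier E_ops
proof (intro conjI ballI allI impI; (elim conjE)?)
  fix j assume "\<forall>j<m. (\<lambda>x\<in>U. s x j) \<in> hol M U" "\<forall>j<m. (\<lambda>x\<in>U. t x j) \<in> hol M U" "j < m"
  then have "(\<lambda>x\<in>U. (\<lambda>x\<in>U. s x j) x + (\<lambda>x\<in>U. t x j) x) \<in> hol M U" by (intro hol_add[OF U]) blast+
  then show "(\<lambda>x\<in>U. (\<lambda>x\<in>U. \<lambda>j. s x j + t x j) x j) \<in> hol M U" by (simp cong: restrict_cong)
qed (auto simp: Cn_def)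

lemma E_smult_closed: "a \<in> hol M U \<Longrightarrow> s \<in> carrier E \<Longrightarrow> a \<odot>\<^bsub>E\<^esub> s \<in> carrier E"
  unfolding E_carrier E_ops
proof (intro conjI ballI allI impI; (elim conjE)?)
  fix j assume "a \<in> hol M U" "\<forall>j<m. (\<lambda>x\<in>U. s x j) \<in> hol M U" "j < m"
  then have "(\<lambda>x\<in>U. a x * (\<lambda>x\<in>U. s x j) x) \<in> hol M U" by (intro hol_mult[OF U]) blast+
  then show "(\<lambda>x\<in>U. (\<lambda>x\<in>U. \<lambda>j. a x * s x j) x j) \<in> hol M U" by (simp cong: restrict_cong)
qed (auto simp: Cn_def)

lemma A_carrier: "f \<in> carrier A \<longleftrightarrow> (\<forall>w. f w \<in> hol M U) \<and> finite (supp f) \<and> (\<forall>w. f w \<noteq> \<zero>\<^bsub>R\<^esub> \<longrightarrow> set w \<subseteq> carrier E)"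
  by (simp add: free_alg_def R_simps)

lemma A_ops: "\<one>\<^bsub>A\<^esub> = word R []" "\<zero>\<^bsub>A\<^esub> = (\<lambda>w. \<zero>\<^bsub>R\<^esub>)" "f \<oplus>\<^bsub>A\<^esub> g = (\<lambda>w. f w \<oplus>\<^bsub>R\<^esub> g w)" "a \<odot>\<^bsub>A\<^esub> f = (\<lambda>w. a \<otimes>\<^bsub>R\<^esub> f w)"
  by (simp_all add: free_alg_def word_def)

lemma A_mult:
  assumes "f \<in> carrier A" "g \<in> carrier A"
  shows "(f \<otimes>\<^bsub>A\<^esub> g) w = (\<lambda>x\<in>U. conv (\<lambda>u. f u x) (\<lambda>u. g u x) w)"
proof -
  have "(f \<otimes>\<^bsub>A\<^esub> g) w = (\<Oplus>\<^bsub>R\<^esub>k\<in>{..length w}. f (take k w) \<otimes>\<^bsub>R\<^esub> g (drop k w))" by (simp add: free_alg_def)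
  also have "\<dots> = (\<lambda>x\<in>U. \<Sum>k\<in>{..length w}. (f (take k w) \<otimes>\<^bsub>R\<^esub> g (drop k w)) x)"
    by (rule R_finsum) (use assms hol_mult[OF U] in \<open>auto simp: A_carrier R_simps\<close>)
  also have "\<dots> = (\<lambda>x\<in>U. conv (\<lambda>u. f u x) (\<lambda>u. g u x) w)"
    by (rule restrict_ext) (simp add: R_simps conv_def)
  finally show ?thesis .
qed

lemma A_apply:
  assumes "x \<in> U"
  shows "(f \<oplus>\<^bsub>A\<^esub> g) w x = f w x + g w x" "(a \<odot>\<^bsub>A\<^esub> f) w x = a x * f w x" "\<zero>\<^bsub>A\<^esub> w x = 0"
    "word R u w x = (if w = u then 1 else 0)" "\<one>\<^bsub>A\<^esub> w x = (if w = [] then 1 else 0)"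
    "f \<in> carrier A \<Longrightarrow> g \<in> carrier A \<Longrightarrow> (f \<otimes>\<^bsub>A\<^esub> g) w x = conv (\<lambda>u. f u x) (\<lambda>u. g u x) w"
  using assms by (simp_all add: A_ops R_simps word_def A_mult)

lemma A_eqI:
  assumes "f \<in> carrier A" "g \<in> carrier A" "\<And>w x. x \<in> U \<Longrightarrow> f w x = g w x"
  shows "f = g"
proof
  fix w show "f w = g w"
    by (rule extensionalityI[of _ U]) (use assms hol_ext in \<open>auto simp: A_carrier\<close>)
qed

lemma supp_zero: "f \<in> carrier A \<Longrightarrow> w \<notin> supp f \<Longrightarrow> x \<in> U \<Longrightarrow> f w x = 0"
  by (simp add: R_simps)

lemma A_memI:
  assumes "\<And>w. f w \<in> hol M U" "finite T" "\<And>w. w \<notin> T \<Longrightarrow> f w = \<zero>\<^bsub>R\<^esub>" "\<And>w. w \<in> T \<Longrightarrow> set w \<subseteq> carrier E"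
  shows "f \<in> carrier A"
proof -
  have "supp f \<subseteq> T" using assms(3) by auto
  moreover have "set w \<subseteq> carrier E" if "f w \<noteq> \<zero>\<^bsub>R\<^esub>" for w using assms(3,4)[of w] that by metis
  ultimately show ?thesis using assms(1,2) finite_subset by (simp add: A_carrier)
qed

lemma A_fin: "f \<in> carrier A \<Longrightarrow> finite (supp f)" and A_hol: "f \<in> carrier A \<Longrightarrow> f w \<in> hol M U"
  and A_set: "f \<in> carrier A \<Longrightarrow> w \<in> supp f \<Longrightarrow> set w \<subseteq> carrier E"
  by (auto simp: A_carrier)

lemma A_add_closed: "f \<in> carrier A \<Longrightarrow> g \<in> carrier A \<Longrightarrow> f \<oplus>\<^bsub>A\<^esub> g \<in> carrier A"
proof (rule A_memI[of _ "supp f \<union> supp g"])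
  fix w assume "f \<in> carrier A" "g \<in> carrier A"
  then show "(f \<oplus>\<^bsub>A\<^esub> g) w \<in> hol M U" using hol_add[OF U A_hol A_hol] by (simp add: A_ops R_simps)
  assume "w \<notin> supp f \<union> supp g"
  then show "(f \<oplus>\<^bsub>A\<^esub> g) w = \<zero>\<^bsub>R\<^esub>" by (auto simp: A_ops R_simps)
qed (use A_fin A_set in auto)

lemma A_smult_closed: "a \<in> hol M U \<Longrightarrow> f \<in> carrier A \<Longrightarrow> a \<odot>\<^bsub>A\<^esub> f \<in> carrier A"
proof (rule A_memI[of _ "supp f"])
  fix w assume "a \<in> hol M U" "f \<in> carrier A"
  then show "(a \<odot>\<^bsub>A\<^esub> f) w \<in> hol M U" using hol_mult[OF U _ A_hol] by (simp add: A_ops R_simps)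
  assume "w \<notin> supp f"
  then show "(a \<odot>\<^bsub>A\<^esub> f) w = \<zero>\<^bsub>R\<^esub>" by (auto simp: A_ops R_simps)
qed (use A_fin A_set in auto)

lemma A_mult_closed:
  assumes f: "f \<in> carrier A" and g: "g \<in> carrier A"
  shows "f \<otimes>\<^bsub>A\<^esub> g \<in> carrier A"
proof (rule A_memI[of _ "(\<lambda>p. fst p @ snd p) ` (supp f \<times> supp g)"])
  fix w
  have "(\<lambda>x\<in>U. f (take k w) x * g (drop k w) x) \<in> hol M U" for k by (intro hol_mult U A_hol f g)
  then show "(f \<otimes>\<^bsub>A\<^esub> g) w \<in> hol M U" unfolding A_mult[OF f g] conv_def by (rule hol_sum[OF U])
  assume w: "w \<notin> (\<lambda>p. fst p @ snd p) ` (supp f \<times> supp g)"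
  have "conv (\<lambda>u. f u x) (\<lambda>u. g u x) w = 0" if x: "x \<in> U" for x
  proof -
    have "{p \<in> supp f \<times> supp g. fst p @ snd p = w} = {}" using w by blast
    then show ?thesis
      using conv_eq_sum_pairs[OF A_fin[OF f] A_fin[OF g] supp_zero[OF f _ x] supp_zero[OF g _ x], where w = w] by (simp only: sum.empty)
  qed
  then show "(f \<otimes>\<^bsub>A\<^esub> g) w = \<zero>\<^bsub>R\<^esub>" unfolding A_mult[OF f g] R_simps by (intro restrict_ext)
next
  fix w assume "w \<in> (\<lambda>p. fst p @ snd p) ` (supp f \<times> supp g)"
  then obtain u v where "u \<in> supp f" "v \<in> supp g" "w = u @ v" by auto
  then show "set w \<subseteq> carrier E" using A_set[OF f, of u] A_set[OF g, of v] by simp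
qed (use A_fin f g in auto)

lemma word_closed: "set u \<subseteq> carrier E \<Longrightarrow> word R u \<in> carrier A"
  by (rule A_memI[of _ "{u}"]) (auto simp: word_def R_simps hol_const[OF U])

lemma A_zero_closed: "\<zero>\<^bsub>A\<^esub> \<in> carrier A"
  by (rule A_memI[of _ "{}"]) (auto simp: A_ops R_simps hol_const[OF U])

lemma A_one_closed: "\<one>\<^bsub>A\<^esub> \<in> carrier A" unfolding A_ops by (rule word_closed) simp

lemmas A_closed = A_add_closed A_smult_closed A_mult_closed A_zero_closed A_one_closed

lemma ring_A: "ring A"
proof (rule ringI)
  show "abelian_group A"
  proof (rule abelian_groupI)
    fix f assume f: "f \<in> carrier A"
    show "\<exists>g\<in>carrier A. g \<oplus>\<^bsub>A\<^esub> f = \<zero>\<^bsub>A\<^esub>"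
      by (rule bexI[of _ "(\<lambda>x\<in>U. -1) \<odot>\<^bsub>A\<^esub> f"], rule A_eqI)
        (auto intro!: A_closed hol_const U f simp: A_apply)
    show "\<zero>\<^bsub>A\<^esub> \<oplus>\<^bsub>A\<^esub> f = f" by (rule A_eqI[OF A_add_closed[OF A_zero_closed f] f]) (simp add: A_apply)
  next
    fix f g h assume "f \<in> carrier A" "g \<in> carrier A" "h \<in> carrier A"
    then show "f \<oplus>\<^bsub>A\<^esub> g \<oplus>\<^bsub>A\<^esub> h = f \<oplus>\<^bsub>A\<^esub> (g \<oplus>\<^bsub>A\<^esub> h)" by (intro A_eqI A_closed) (simp_all add: A_apply)
  next
    fix f g assume "f \<in> carrier A" "g \<in> carrier A"
    then show "f \<oplus>\<^bsub>A\<^esub> g = g \<oplus>\<^bsub>A\<^esub> f" by (intro A_eqI A_closed) (simp_all add: A_apply)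
  qed (intro A_closed; assumption)+
  show "monoid A"
  proof (rule monoidI)
    fix f g h assume f: "f \<in> carrier A" "g \<in> carrier A" "h \<in> carrier A"
    show "f \<otimes>\<^bsub>A\<^esub> g \<otimes>\<^bsub>A\<^esub> h = f \<otimes>\<^bsub>A\<^esub> (g \<otimes>\<^bsub>A\<^esub> h)"
      by (intro A_eqI A_closed f) (simp add: A_apply A_mult_closed f conv_assoc[unfolded fun_eq_iff])
  next
    fix f assume f: "f \<in> carrier A"
    have 1: "conv (\<lambda>u. if u = [] then 1 else 0) g w = g w" for g :: "('p \<Rightarrow> nat \<Rightarrow> complex) list \<Rightarrow> complex" and w
      by (cases w) (simp_all add: conv_Nil conv_Cons, simp add: conv_def)
    have 2: "conv g (\<lambda>u. if u = [] then 1 else 0) w = g w" for g :: "('p \<Rightarrow> nat \<Rightarrow> complex) list \<Rightarrow> complex" and w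
      by (induction w arbitrary: g) (simp_all add: conv_Nil conv_Cons)
    show "\<one>\<^bsub>A\<^esub> \<otimes>\<^bsub>A\<^esub> f = f" "f \<otimes>\<^bsub>A\<^esub> \<one>\<^bsub>A\<^esub> = f"
      by (intro A_eqI A_closed f; simp add: A_apply A_one_closed f 1 2)+
  qed (intro A_closed; assumption)+
next
  fix f g h assume f: "f \<in> carrier A" "g \<in> carrier A" "h \<in> carrier A"
  show "(f \<oplus>\<^bsub>A\<^esub> g) \<otimes>\<^bsub>A\<^esub> h = f \<otimes>\<^bsub>A\<^esub> h \<oplus>\<^bsub>A\<^esub> g \<otimes>\<^bsub>A\<^esub> h"
    by (intro A_eqI A_closed f) (simp add: A_apply A_closed f conv_add_left)
  show "h \<otimes>\<^bsub>A\<^esub> (f \<oplus>\<^bsub>A\<^esub> g) = h \<otimes>\<^bsub>A\<^esub> f \<oplus>\<^bsub>A\<^esub> h \<otimes>\<^bsub>A\<^esub> g"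
    by (intro A_eqI A_closed f) (simp add: A_apply A_closed f conv_add_right)
qed

lemma A_smult_mult:
  assumes "a \<in> hol M U" "f \<in> carrier A" "g \<in> carrier A"
  shows "(a \<odot>\<^bsub>A\<^esub> f) \<otimes>\<^bsub>A\<^esub> g = a \<odot>\<^bsub>A\<^esub> (f \<otimes>\<^bsub>A\<^esub> g)" "f \<otimes>\<^bsub>A\<^esub> (a \<odot>\<^bsub>A\<^esub> g) = a \<odot>\<^bsub>A\<^esub> (f \<otimes>\<^bsub>A\<^esub> g)"
  by (intro A_eqI A_closed assms; simp add: A_apply A_closed assms conv_scale_left conv_scale_right)+

lemma word_append:
  assumes "set u \<subseteq> carrier E" "set v \<subseteq> carrier E"
  shows "word R u \<otimes>\<^bsub>A\<^esub> word R v = word R (u @ v)"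
proof (rule A_eqI)
  fix w x assume x: "x \<in> U"
  have "conv (\<lambda>t. word R u t x) (\<lambda>t. word R v t x) w =
      (\<Sum>p\<in>{p \<in> {u} \<times> {v}. fst p @ snd p = w}. word R u (fst p) x * word R v (snd p) x)"
    by (rule conv_eq_sum_pairs) (use x in \<open>auto simp: A_apply\<close>)
  also have "{p \<in> {u} \<times> {v}. fst p @ snd p = w} = (if w = u @ v then {(u, v)} else {})" by auto
  finally show "(word R u \<otimes>\<^bsub>A\<^esub> word R v) w x = word R (u @ v) w x"
    using x by (simp add: A_apply word_closed assms)
qed (use assms in \<open>auto intro!: A_closed word_closed\<close>)

text \<open>Words are replaced by wedge products of their letters.  The kernel of this map turns out to be the
  ideal of relations of the exterior algebra.\<close>

definition word_eval :: "(('p \<Rightarrow> nat \<Rightarrow> complex) list \<Rightarrow> 'p \<Rightarrow> complex) \<Rightarrow> nat set \<Rightarrow> 'p \<Rightarrow> complex" where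
  "word_eval f = (\<lambda>K\<in>Pow {..<m}. \<lambda>x\<in>U. \<Sum>w\<in>supp f. f w x * word_value w x K)"

lemma word_eval_apply:
  assumes f: "f \<in> carrier A" and T: "finite T" "supp f \<subseteq> T" and x: "x \<in> U" "K \<subseteq> {..<m}"
  shows "word_eval f K x = (\<Sum>w\<in>T. f w x * word_value w x K)"
proof -
  have "(\<Sum>w\<in>supp f. f w x * word_value w x K) = (\<Sum>w\<in>T. f w x * word_value w x K)"
    by (rule sum.mono_neutral_left[OF T]) (use x in \<open>auto simp: R_simps\<close>)
  then show ?thesis using x by (simp add: word_eval_def)
qed

lemma word_value_hol:
  "set w \<subseteq> carrier E \<Longrightarrow> K \<subseteq> {..<m} \<Longrightarrow> (\<lambda>x\<in>U. word_value w x K) \<in> hol M U"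
proof (induction w arbitrary: K)
  case Nil
  show ?case unfolding word_value.simps by (rule hol_const[OF U])
next
  case (Cons s w)
  have l: "(\<lambda>x\<in>U. degree_one (s x) I) \<in> hol M U" if "I \<subseteq> K" for I
  proof (cases "is_singleton I")
    case True
    then obtain j where "I = {j}" by (auto simp: is_singleton_def)
    then show ?thesis using Cons.prems that by (auto simp: degree_one_def E_carrier)
  next
    case False
    then show ?thesis using hol_const[OF U] by (simp add: degree_one_def)
  qed
  have "(\<lambda>x\<in>U. wedge (\<lambda>I. (\<lambda>x\<in>U. degree_one (s x) I) x) (\<lambda>I. (\<lambda>x\<in>U. word_value w x I) x) K) \<in> hol M U"
    by (rule hol_wedge[OF U l]) (use Cons in auto)
  then show ?case unfolding word_value.simps
    by (rule back_subst[of "\<lambda>f. f \<in> hol M U"]) (auto intro!: restrict_ext)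
qed

lemma word_eval_closed:
  assumes f: "f \<in> carrier A"
  shows "word_eval f \<in> carrier (S m U)"
  unfolding word_eval_def
proof (rule S_memI, rule hol_sum[OF U])
  fix K w assume K: "K \<subseteq> {..<m}" and w: "w \<in> supp f"
  have "(\<lambda>x\<in>U. f w x * (\<lambda>x\<in>U. word_value w x K) x) \<in> hol M U"
    by (rule hol_mult[OF U A_hol[OF f] word_value_hol[OF A_set[OF f w] K]])
  then show "(\<lambda>x\<in>U. f w x * word_value w x K) \<in> hol M U" by (simp cong: restrict_cong)
qed

lemma word_eval_word:
  assumes "set u \<subseteq> carrier E" "x \<in> U" "K \<subseteq> {..<m}"
  shows "word_eval (word R u) K x = word_value u x K"
proof -
  have "word_eval (word R u) K x = (\<Sum>w\<in>{u}. word R u w x * word_value w x K)"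
    by (rule word_eval_apply[OF word_closed[OF assms(1)] _ _ assms(2,3)]) (auto simp: word_def)
  then show ?thesis using assms by (simp add: A_apply)
qed

lemma word_eval_add:
  assumes f: "f \<in> carrier A" and g: "g \<in> carrier A"
  shows "word_eval (f \<oplus>\<^bsub>A\<^esub> g) = word_eval f \<oplus>\<^bsub>S m U\<^esub> word_eval g"
proof (rule S_eqI[OF word_eval_closed[OF A_add_closed[OF f g]] S_add_closed[OF U word_eval_closed[OF f] word_eval_closed[OF g]]])
  fix K x assume K: "K \<subseteq> {..<m}" "x \<in> U"
  let ?T = "supp f \<union> supp g \<union> supp (f \<oplus>\<^bsub>A\<^esub> g)"
  have T: "finite ?T" using A_fin f g A_add_closed[OF f g] by auto
  have "word_eval f K x = (\<Sum>w\<in>?T. f w x * word_value w x K)" "word_eval g K x = (\<Sum>w\<in>?T. g w x * word_value w x K)"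
    "word_eval (f \<oplus>\<^bsub>A\<^esub> g) K x = (\<Sum>w\<in>?T. (f \<oplus>\<^bsub>A\<^esub> g) w x * word_value w x K)"
    by (rule word_eval_apply[OF _ T _ K(2,1)]; use f g A_add_closed[OF f g] in blast)+
  then show "word_eval (f \<oplus>\<^bsub>A\<^esub> g) K x = (word_eval f \<oplus>\<^bsub>S m U\<^esub> word_eval g) K x"
    using K by (simp add: S_apply[OF U] A_apply algebra_simps sum.distrib)
qed

lemma word_eval_smult:
  assumes a: "a \<in> hol M U" and f: "f \<in> carrier A" and K: "K \<subseteq> {..<m}" "x \<in> U"
  shows "word_eval (a \<odot>\<^bsub>A\<^esub> f) K x = a x * word_eval f K x"
proof -
  let ?T = "supp f \<union> supp (a \<odot>\<^bsub>A\<^esub> f)"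
  have T: "finite ?T" using A_fin f A_smult_closed[OF a f] by auto
  have "word_eval f K x = (\<Sum>w\<in>?T. f w x * word_value w x K)"
    "word_eval (a \<odot>\<^bsub>A\<^esub> f) K x = (\<Sum>w\<in>?T. (a \<odot>\<^bsub>A\<^esub> f) w x * word_value w x K)"
    by (rule word_eval_apply[OF _ T _ K(2,1)]; use f A_smult_closed[OF a f] in blast)+
  then show ?thesis using K by (simp add: A_apply sum_distrib_left mult_ac)
qed

lemma word_eval_mult:
  assumes f: "f \<in> carrier A" and g: "g \<in> carrier A"
  shows "word_eval (f \<otimes>\<^bsub>A\<^esub> g) = word_eval f \<otimes>\<^bsub>S m U\<^esub> word_eval g"
proof (rule S_eqI[OF word_eval_closed[OF A_mult_closed[OF f g]] S_mult_closed[OF U word_eval_closed[OF f] word_eval_closed[OF g]]])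
  fix K x assume K: "K \<subseteq> {..<m}" "x \<in> U"
  let ?ap = "\<lambda>p. fst p @ snd p" and ?P = "supp f \<times> supp g"
  let ?T = "?ap ` ?P \<union> supp (f \<otimes>\<^bsub>A\<^esub> g)"
  have T: "finite ?T" using A_fin f g A_mult_closed[OF f g] by auto
  have P: "finite ?P" using A_fin f g by auto
  have c: "(f \<otimes>\<^bsub>A\<^esub> g) w x = (\<Sum>p\<in>{p \<in> ?P. ?ap p = w}. f (fst p) x * g (snd p) x)" for w
    using conv_eq_sum_pairs[OF A_fin[OF f] A_fin[OF g] supp_zero[OF f _ K(2)] supp_zero[OF g _ K(2)], where w = w] K f g
    by (simp add: A_apply)
  have "word_eval (f \<otimes>\<^bsub>A\<^esub> g) K x = (\<Sum>w\<in>?T. (f \<otimes>\<^bsub>A\<^esub> g) w x * word_value w x K)"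
    by (rule word_eval_apply[OF A_mult_closed[OF f g] T _ K(2,1)]) blast
  also have "\<dots> = (\<Sum>w\<in>?T. \<Sum>p\<in>{p \<in> ?P. ?ap p = w}. f (fst p) x * g (snd p) x * word_value (?ap p) x K)"
    unfolding c sum_distrib_right by (intro sum.cong refl) auto
  also have "\<dots> = (\<Sum>p\<in>?P. f (fst p) x * g (snd p) x * word_value (?ap p) x K)"
    by (rule sum.group[OF P T]) auto
  also have "\<dots> = (\<Sum>u\<in>supp f. \<Sum>v\<in>supp g. f u x * g v x * wedge (word_value u x) (word_value v x) K)"
    using K by (subst sum.cartesian_product) (auto intro!: sum.cong simp: word_value_append fin_gens[OF U])
  also have "\<dots> = wedge (\<lambda>I. \<Sum>u\<in>supp f. f u x * word_value u x I) (\<lambda>I. \<Sum>v\<in>supp g. g v x * word_value v x I) K"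
    by (simp add: wedge_sum_left wedge_sum_right wedge_scale_left wedge_scale_right sum_distrib_left mult_ac)
  also have "\<dots> = wedge (\<lambda>I. word_eval f I x) (\<lambda>I. word_eval g I x) K"
    by (rule wedge_cong) (use K in \<open>auto simp: word_eval_def\<close>)
  finally show "word_eval (f \<otimes>\<^bsub>A\<^esub> g) K x = (word_eval f \<otimes>\<^bsub>S m U\<^esub> word_eval g) K x"
    using K by (simp add: S_apply[OF U])
qed

lemma word_eval_ring_hom: "ring_hom_ring A (S m U) word_eval"
proof (rule ring_hom_ringI[OF ring_A ring_S[OF U]])
  show "word_eval \<one>\<^bsub>A\<^esub> = \<one>\<^bsub>S m U\<^esub>"
    unfolding A_ops by (rule S_eqI[OF word_eval_closed[OF word_closed] S_one_closed[OF U]]) (auto simp: word_eval_word S_apply[OF U])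
qed (auto intro: word_eval_closed word_eval_mult word_eval_add)

definition ext_gens where
  "ext_gens = {word R [x \<oplus>\<^bsub>E\<^esub> y] \<ominus>\<^bsub>A\<^esub> (word R [x] \<oplus>\<^bsub>A\<^esub> word R [y]) | x y. x \<in> carrier E \<and> y \<in> carrier E} \<union>
     {word R [a \<odot>\<^bsub>E\<^esub> x] \<ominus>\<^bsub>A\<^esub> (a \<odot>\<^bsub>A\<^esub> word R [x]) | a x. a \<in> carrier R \<and> x \<in> carrier E} \<union>
     {word R [x] \<otimes>\<^bsub>A\<^esub> word R [x] | x. x \<in> carrier E}"

abbreviation I where "I \<equiv> ext_ideal R E"

lemma I_def: "I = Idl\<^bsub>A\<^esub> ext_gens"
  by (simp add: ext_ideal_def ext_gens_def Let_def)

lemma ext_gens_closed: "ext_gens \<subseteq> carrier A"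
proof -
  interpret ring A by (rule ring_A)
  show ?thesis unfolding ext_gens_def
    by (auto simp: R_simps intro!: minus_closed A_closed word_closed E_add_closed E_smult_closed)
qed

lemma ideal_I: "ideal I A"
  unfolding I_def by (rule ring.genideal_ideal[OF ring_A ext_gens_closed])

lemma I_subset: "I \<subseteq> carrier A" using ideal.Icarr[OF ideal_I] by auto

lemma word_eval_minus:
  "f \<in> carrier A \<Longrightarrow> g \<in> carrier A \<Longrightarrow> word_eval (f \<ominus>\<^bsub>A\<^esub> g) = word_eval f \<ominus>\<^bsub>S m U\<^esub> word_eval g"
proof -
  interpret ring_hom_ring A "S m U" word_eval by (rule word_eval_ring_hom)
  assume "f \<in> carrier A" "g \<in> carrier A"
  then show ?thesis by (simp add: a_minus_def)
qed

text \<open>The relations hold in the exterior algebra, hence the ideal is contained in the kernel.\<close>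

lemma word_eval_I: "f \<in> I \<Longrightarrow> word_eval f = \<zero>\<^bsub>S m U\<^esub>"
proof -
  interpret SR: ring "S m U" by (rule ring_S[OF U])
  interpret h: ring_hom_ring A "S m U" word_eval by (rule word_eval_ring_hom)
  have k: "ideal (a_kernel A (S m U) word_eval) A" by (rule h.kernel_is_ideal)
  have z: "word_eval f \<ominus>\<^bsub>S m U\<^esub> word_eval g = \<zero>\<^bsub>S m U\<^esub>" if "f \<in> carrier A" "g \<in> carrier A"
    "\<And>K x. K \<subseteq> {..<m} \<Longrightarrow> x \<in> U \<Longrightarrow> word_eval f K x = word_eval g K x" for f g
  proof -
    have "word_eval f = word_eval g" by (rule S_eqI[OF word_eval_closed[OF that(1)] word_eval_closed[OF that(2)] that(3)])
    then show ?thesis using SR.r_neg[OF word_eval_closed[OF that(2)]] by (simp add: a_minus_def)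
  qed
  have w1: "word_eval (word R [s]) K x = degree_one (s x) K" if "s \<in> carrier E" "K \<subseteq> {..<m}" "x \<in> U" for s K x
    using that word_eval_word[of "[s]" x K] word_value_single[OF fin_gens[OF U that(2)], of s x] by simp
  have "ext_gens \<subseteq> a_kernel A (S m U) word_eval"
  proof
    fix f assume f: "f \<in> ext_gens"
    then have fc: "f \<in> carrier A" using ext_gens_closed by auto
    from f consider (add) x y where "x \<in> carrier E" "y \<in> carrier E" "f = word R [x \<oplus>\<^bsub>E\<^esub> y] \<ominus>\<^bsub>A\<^esub> (word R [x] \<oplus>\<^bsub>A\<^esub> word R [y])"
      | (smult) a x where "a \<in> hol M U" "x \<in> carrier E" "f = word R [a \<odot>\<^bsub>E\<^esub> x] \<ominus>\<^bsub>A\<^esub> (a \<odot>\<^bsub>A\<^esub> word R [x])"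
      | (square) x where "x \<in> carrier E" "f = word R [x] \<otimes>\<^bsub>A\<^esub> word R [x]"
      unfolding ext_gens_def by (auto simp: R_simps)
    then have wz: "word_eval f = \<zero>\<^bsub>S m U\<^esub>"
    proof cases
      case add
      note c = word_closed[of "[_]", simplified]
      show ?thesis unfolding add(3)
      proof (subst word_eval_minus)
        show "word_eval (word R [x \<oplus>\<^bsub>E\<^esub> y]) \<ominus>\<^bsub>S m U\<^esub> word_eval (word R [x] \<oplus>\<^bsub>A\<^esub> word R [y]) = \<zero>\<^bsub>S m U\<^esub>"
        proof (rule z)
          fix K x' assume "K \<subseteq> {..<m}" "x' \<in> U"
          then show "word_eval (word R [x \<oplus>\<^bsub>E\<^esub> y]) K x' = word_eval (word R [x] \<oplus>\<^bsub>A\<^esub> word R [y]) K x'"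
            using add by (simp add: word_eval_add c w1 S_apply[OF U] E_add_closed) (simp add: degree_one_def E_ops)
        qed (use add c E_add_closed A_add_closed in auto)
      qed (use add c E_add_closed A_add_closed in auto)
    next
      case smult
      note c = word_closed[of "[_]", simplified]
      show ?thesis unfolding smult(3)
      proof (subst word_eval_minus)
        show "word_eval (word R [a \<odot>\<^bsub>E\<^esub> x]) \<ominus>\<^bsub>S m U\<^esub> word_eval (a \<odot>\<^bsub>A\<^esub> word R [x]) = \<zero>\<^bsub>S m U\<^esub>"
        proof (rule z)
          fix K x' assume "K \<subseteq> {..<m}" "x' \<in> U"
          then show "word_eval (word R [a \<odot>\<^bsub>E\<^esub> x]) K x' = word_eval (a \<odot>\<^bsub>A\<^esub> word R [x]) K x'"
            using smult by (simp add: word_eval_smult c w1 E_smult_closed) (simp add: degree_one_def E_ops)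
        qed (use smult c E_smult_closed A_smult_closed in auto)
      qed (use smult c E_smult_closed A_smult_closed in auto)
    next
      case square
      note c = word_closed[of "[x]", simplified, OF square(1)]
      show ?thesis unfolding square(2) word_eval_mult[OF c c]
      proof (rule S_eqI[OF S_mult_closed[OF U word_eval_closed[OF c] word_eval_closed[OF c]] S_zero_closed[OF U]])
        fix K x' assume K: "K \<subseteq> {..<m}" "x' \<in> U"
        have "wedge (\<lambda>L. word_eval (word R [x]) L x') (\<lambda>L. word_eval (word R [x]) L x') K = wedge (degree_one (x x')) (degree_one (x x')) K"
          by (rule wedge_cong) (use K square in \<open>auto simp: w1\<close>)
        also have "\<dots> = 0" by (rule degree_one_square[OF fin_gens[OF U K(1)]])
        finally show "(word_eval (word R [x]) \<otimes>\<^bsub>S m U\<^esub> word_eval (word R [x])) K x' = \<zero>\<^bsub>S m U\<^esub> K x'"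
          using K by (simp add: S_apply[OF U])
      qed
    qed
    show "f \<in> a_kernel A (S m U) word_eval" unfolding a_kernel_def' by (intro CollectI conjI fc wz)
  qed
  then have "I \<subseteq> a_kernel A (S m U) word_eval" unfolding I_def by (rule ring.genideal_minimal[OF ring_A k])
  moreover assume "f \<in> I"
  ultimately have "f \<in> a_kernel A (S m U) word_eval" by (rule subsetD)
  then show ?thesis unfolding a_kernel_def' mem_Collect_eq by (rule conjunct2)
qed

abbreviation cls where "cls f \<equiv> I +>\<^bsub>A\<^esub> f"

lemma cls_eq_iff:
  assumes "f \<in> carrier A" "g \<in> carrier A"
  shows "cls f = cls g \<longleftrightarrow> f \<ominus>\<^bsub>A\<^esub> g \<in> I"
  by (rule ring.quotient_eq_iff_same_a_r_cos[OF ring_A ideal_I assms, symmetric])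

lemma cls_hom: "ring_hom_ring A (A Quot I) cls"
  by (rule ideal.rcos_ring_hom_ring[OF ideal_I])

lemma cls_add: "\<lbrakk>f \<in> carrier A; g \<in> carrier A; f' \<in> carrier A; g' \<in> carrier A; cls f = cls f'; cls g = cls g'\<rbrakk> \<Longrightarrow>
    cls (f \<oplus>\<^bsub>A\<^esub> g) = cls (f' \<oplus>\<^bsub>A\<^esub> g')"
  and cls_mult: "\<lbrakk>f \<in> carrier A; g \<in> carrier A; f' \<in> carrier A; g' \<in> carrier A; cls f = cls f'; cls g = cls g'\<rbrakk> \<Longrightarrow>
    cls (f \<otimes>\<^bsub>A\<^esub> g) = cls (f' \<otimes>\<^bsub>A\<^esub> g')"
proof -
  interpret ring_hom_ring A "A Quot I" cls by (rule cls_hom)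
  show "\<lbrakk>f \<in> carrier A; g \<in> carrier A; f' \<in> carrier A; g' \<in> carrier A; cls f = cls f'; cls g = cls g'\<rbrakk> \<Longrightarrow>
    cls (f \<oplus>\<^bsub>A\<^esub> g) = cls (f' \<oplus>\<^bsub>A\<^esub> g')" by (simp only: hom_add)
  show "\<lbrakk>f \<in> carrier A; g \<in> carrier A; f' \<in> carrier A; g' \<in> carrier A; cls f = cls f'; cls g = cls g'\<rbrakk> \<Longrightarrow>
    cls (f \<otimes>\<^bsub>A\<^esub> g) = cls (f' \<otimes>\<^bsub>A\<^esub> g')" by (simp only: hom_mult)
qed

lemma cls_smult:
  assumes "a \<in> hol M U" "f \<in> carrier A" "g \<in> carrier A" "cls f = cls g"
  shows "cls (a \<odot>\<^bsub>A\<^esub> f) = cls (a \<odot>\<^bsub>A\<^esub> g)"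
proof -
  interpret ring A by (rule ring_A)
  note a = A_smult_closed[OF assms(1) A_one_closed]
  have "cls ((a \<odot>\<^bsub>A\<^esub> \<one>\<^bsub>A\<^esub>) \<otimes>\<^bsub>A\<^esub> f) = cls ((a \<odot>\<^bsub>A\<^esub> \<one>\<^bsub>A\<^esub>) \<otimes>\<^bsub>A\<^esub> g)"
    by (rule cls_mult[OF a assms(2) a assms(3) refl assms(4)])
  then show ?thesis
    using A_smult_mult(1)[OF assms(1) A_one_closed assms(2)] A_smult_mult(1)[OF assms(1) A_one_closed assms(3)] assms by simp
qed

lemma word1_closed: "s \<in> carrier E \<Longrightarrow> word R [s] \<in> carrier A"
  by (rule word_closed) simp

lemma cls_gen_eq: "f \<in> carrier A \<Longrightarrow> g \<in> carrier A \<Longrightarrow> f \<ominus>\<^bsub>A\<^esub> g \<in> ext_gens \<Longrightarrow> cls f = cls g"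
  using cls_eq_iff ring.genideal_self[OF ring_A ext_gens_closed] unfolding I_def by blast

lemma cls_word_add: "x \<in> carrier E \<Longrightarrow> y \<in> carrier E \<Longrightarrow> cls (word R [x \<oplus>\<^bsub>E\<^esub> y]) = cls (word R [x] \<oplus>\<^bsub>A\<^esub> word R [y])"
  by (rule cls_gen_eq) (auto simp: ext_gens_def intro!: word1_closed E_add_closed A_add_closed)

lemma cls_word_smult: "a \<in> hol M U \<Longrightarrow> x \<in> carrier E \<Longrightarrow> cls (word R [a \<odot>\<^bsub>E\<^esub> x]) = cls (a \<odot>\<^bsub>A\<^esub> word R [x])"
  by (rule cls_gen_eq) (auto simp: ext_gens_def R_simps intro!: word1_closed E_smult_closed A_smult_closed)

lemma cls_zeroI: "f \<in> I \<Longrightarrow> cls f = cls \<zero>\<^bsub>A\<^esub>"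
proof -
  interpret ring A by (rule ring_A)
  assume f: "f \<in> I"
  then have "f \<in> carrier A" using I_subset by auto
  then show ?thesis using f by (subst cls_eq_iff) (auto simp: a_minus_def)
qed

lemma cls_word_square: "x \<in> carrier E \<Longrightarrow> cls (word R [x] \<otimes>\<^bsub>A\<^esub> word R [x]) = cls \<zero>\<^bsub>A\<^esub>"
proof (rule cls_zeroI)
  assume "x \<in> carrier E"
  then have "word R [x] \<otimes>\<^bsub>A\<^esub> word R [x] \<in> ext_gens" by (auto simp: ext_gens_def)
  then show "word R [x] \<otimes>\<^bsub>A\<^esub> word R [x] \<in> I" unfolding I_def using ring.genideal_self[OF ring_A ext_gens_closed] by auto
qed

text \<open>Polarization of \<open>(x + y)\<^sup>2 = 0\<close>.\<close>

lemma cls_word_swap: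
  assumes x: "x \<in> carrier E" and y: "y \<in> carrier E"
  shows "cls (word R [x] \<otimes>\<^bsub>A\<^esub> word R [y]) = cls ((\<lambda>x\<in>U. -1) \<odot>\<^bsub>A\<^esub> (word R [y] \<otimes>\<^bsub>A\<^esub> word R [x]))"
proof -
  interpret A: ring A by (rule ring_A)
  interpret Q: ring "A Quot I" by (rule ideal.quotient_is_ring[OF ideal_I])
  interpret h: ring_hom_ring A "A Quot I" cls by (rule cls_hom)
  let ?x = "word R [x]" and ?y = "word R [y]" and ?m = "\<lambda>x\<in>U. -1 :: complex"
  note c = word1_closed[OF x] word1_closed[OF y]
  have m: "?m \<odot>\<^bsub>A\<^esub> f = \<ominus>\<^bsub>A\<^esub> f" if "f \<in> carrier A" for f
  proof (rule A.minus_equality[symmetric])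
    show "?m \<odot>\<^bsub>A\<^esub> f \<oplus>\<^bsub>A\<^esub> f = \<zero>\<^bsub>A\<^esub>" by (rule A_eqI) (auto intro!: A_closed hol_const U that simp: A_apply)
  qed (auto intro!: A_closed hol_const U that)
  have "cls \<zero>\<^bsub>A\<^esub> = cls (word R [x \<oplus>\<^bsub>E\<^esub> y] \<otimes>\<^bsub>A\<^esub> word R [x \<oplus>\<^bsub>E\<^esub> y])"
    by (rule cls_word_square[symmetric, OF E_add_closed[OF x y]])
  also have "\<dots> = cls ((?x \<oplus>\<^bsub>A\<^esub> ?y) \<otimes>\<^bsub>A\<^esub> (?x \<oplus>\<^bsub>A\<^esub> ?y))"
    using c E_add_closed[OF x y] by (intro cls_mult cls_word_add x y word1_closed A_add_closed)
  also have "(?x \<oplus>\<^bsub>A\<^esub> ?y) \<otimes>\<^bsub>A\<^esub> (?x \<oplus>\<^bsub>A\<^esub> ?y) = (?x \<otimes>\<^bsub>A\<^esub> ?x \<oplus>\<^bsub>A\<^esub> ?y \<otimes>\<^bsub>A\<^esub> ?y) \<oplus>\<^bsub>A\<^esub> (?x \<otimes>\<^bsub>A\<^esub> ?y \<oplus>\<^bsub>A\<^esub> ?y \<otimes>\<^bsub>A\<^esub> ?x)"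
    using c by (intro A_eqI A_closed) (auto simp: A_apply A_closed conv_add_left conv_add_right)
  also have "cls \<dots> = cls ((\<zero>\<^bsub>A\<^esub> \<oplus>\<^bsub>A\<^esub> \<zero>\<^bsub>A\<^esub>) \<oplus>\<^bsub>A\<^esub> (?x \<otimes>\<^bsub>A\<^esub> ?y \<oplus>\<^bsub>A\<^esub> ?y \<otimes>\<^bsub>A\<^esub> ?x))"
    using c by (intro cls_add cls_word_square x y refl A_closed)
  also have "\<dots> = cls (?x \<otimes>\<^bsub>A\<^esub> ?y \<oplus>\<^bsub>A\<^esub> ?y \<otimes>\<^bsub>A\<^esub> ?x)" using c by simp
  finally have "cls (?x \<otimes>\<^bsub>A\<^esub> ?y \<oplus>\<^bsub>A\<^esub> ?y \<otimes>\<^bsub>A\<^esub> ?x) = cls \<zero>\<^bsub>A\<^esub>" ..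
  then have "?x \<otimes>\<^bsub>A\<^esub> ?y \<oplus>\<^bsub>A\<^esub> ?y \<otimes>\<^bsub>A\<^esub> ?x \<ominus>\<^bsub>A\<^esub> \<zero>\<^bsub>A\<^esub> \<in> I" using c by (subst (asm) cls_eq_iff) auto
  then have "?x \<otimes>\<^bsub>A\<^esub> ?y \<ominus>\<^bsub>A\<^esub> (\<ominus>\<^bsub>A\<^esub> (?y \<otimes>\<^bsub>A\<^esub> ?x)) \<in> I" using c by (simp add: a_minus_def)
  then show ?thesis using c m[of "?y \<otimes>\<^bsub>A\<^esub> ?x"] by (subst cls_eq_iff) (auto intro!: A_closed)
qed

text \<open>The sections \<open>basis j\<close> form a basis; the words in which they occur in increasing order span
  the exterior algebra.\<close>

definition basis :: "nat \<Rightarrow> 'p \<Rightarrow> nat \<Rightarrow> complex" where "basis j = (\<lambda>x\<in>U. \<lambda>i. if i = j then 1 else 0)"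

definition basis_word :: "nat set \<Rightarrow> ('p \<Rightarrow> nat \<Rightarrow> complex) list" where
  "basis_word K = map basis (sorted_list_of_set K)"

definition normal_form :: "(nat set \<Rightarrow> 'p \<Rightarrow> complex) \<Rightarrow> ('p \<Rightarrow> nat \<Rightarrow> complex) list \<Rightarrow> 'p \<Rightarrow> complex" where
  "normal_form F w = (if w \<in> basis_word ` Pow {..<m} then F (inv_into (Pow {..<m}) basis_word w) else \<zero>\<^bsub>R\<^esub>)"

lemma basis_closed: "j < m \<Longrightarrow> basis j \<in> carrier E"
  unfolding E_carrier basis_def
proof (intro conjI ballI allI impI)
  fix i show "(\<lambda>x\<in>U. (\<lambda>x\<in>U. \<lambda>i. if i = j then 1 else 0) x i) \<in> hol M U"
    using hol_const[OF U, of "if i = j then 1 else 0"] by (simp cong: restrict_cong)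
qed (auto simp: Cn_def)

lemma basis_words_closed: "set l \<subseteq> {..<m} \<Longrightarrow> set (map basis l) \<subseteq> carrier E"
  using basis_closed by auto

lemma basis_word_closed: "K \<subseteq> {..<m} \<Longrightarrow> set (basis_word K) \<subseteq> carrier E"
  unfolding basis_word_def using fin_gens[OF U] by (intro basis_words_closed) simp

lemma normal_form_closed:
  assumes F: "F \<in> carrier (S m U)"
  shows "normal_form F \<in> carrier A"
proof (rule A_memI[of _ "basis_word ` Pow {..<m}"])
  fix w show "normal_form F w \<in> hol M U"
    using S_hol[OF F, of "inv_into (Pow {..<m}) basis_word w"] inv_into_into[of w basis_word "Pow {..<m}"] hol_const[OF U]
    by (auto simp: normal_form_def R_simps)
qed (use basis_word_closed in \<open>auto simp: normal_form_def\<close>)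

context
  assumes ne: "U \<noteq> {}"
begin

lemma basis_inj: "inj basis"
proof (rule injI)
  fix i j assume eq: "basis i = basis j"
  obtain x where "x \<in> U" using ne by auto
  then show "i = j" using fun_cong[OF fun_cong[OF eq, of x], of i] by (simp add: basis_def split: if_splits)
qed

lemma basis_word_inj: "inj_on basis_word (Pow {..<m})"
proof (rule inj_onI)
  fix K L assume K: "K \<in> Pow {..<m}" "L \<in> Pow {..<m}" "basis_word K = basis_word L"
  then have "sorted_list_of_set K = sorted_list_of_set L" unfolding basis_word_def using basis_inj by (simp add: inj_map_eq_map)
  then have "set (sorted_list_of_set K) = set (sorted_list_of_set L)" by simp
  then show "K = L" using K fin_gens[OF U] by simp
qed

lemma normal_form_basis_word: "K \<subseteq> {..<m} \<Longrightarrow> normal_form F (basis_word K) = F K"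
  using basis_word_inj by (simp add: normal_form_def)

lemma normal_form_cases:
  obtains K where "K \<subseteq> {..<m}" "w = basis_word K" | "w \<notin> basis_word ` Pow {..<m}" "\<And>F. normal_form F w = \<zero>\<^bsub>R\<^esub>"
  by (cases "w \<in> basis_word ` Pow {..<m}") (auto simp: normal_form_def)

lemma normal_form_add:
  assumes F: "F \<in> carrier (S m U)" and F': "F' \<in> carrier (S m U)"
  shows "normal_form (F \<oplus>\<^bsub>S m U\<^esub> F') = normal_form F \<oplus>\<^bsub>A\<^esub> normal_form F'"
proof (rule A_eqI[OF normal_form_closed[OF S_add_closed[OF U F F']] A_add_closed[OF normal_form_closed[OF F] normal_form_closed[OF F']]])
  fix w x assume x: "x \<in> U"
  show "normal_form (F \<oplus>\<^bsub>S m U\<^esub> F') w x = (normal_form F \<oplus>\<^bsub>A\<^esub> normal_form F') w x"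
    by (rule normal_form_cases[of w]) (use x in \<open>simp_all add: A_apply normal_form_basis_word S_apply[OF U] R_simps\<close>)
qed

definition scale :: "('p \<Rightarrow> complex) \<Rightarrow> (nat set \<Rightarrow> 'p \<Rightarrow> complex) \<Rightarrow> nat set \<Rightarrow> 'p \<Rightarrow> complex" where
  "scale a F = (\<lambda>K\<in>Pow {..<m}. \<lambda>x\<in>U. a x * F K x)"

lemma scale_closed: "a \<in> hol M U \<Longrightarrow> F \<in> carrier (S m U) \<Longrightarrow> scale a F \<in> carrier (S m U)"
  unfolding scale_def by (rule S_memI, rule hol_mult[OF U]) (auto intro: S_hol)

lemma normal_form_scale:
  assumes a: "a \<in> hol M U" and F: "F \<in> carrier (S m U)"
  shows "normal_form (scale a F) = a \<odot>\<^bsub>A\<^esub> normal_form F"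
proof (rule A_eqI[OF normal_form_closed[OF scale_closed[OF a F]] A_smult_closed[OF a normal_form_closed[OF F]]])
  fix w x assume x: "x \<in> U"
  show "normal_form (scale a F) w x = (a \<odot>\<^bsub>A\<^esub> normal_form F) w x"
    by (rule normal_form_cases[of w]) (use x in \<open>simp_all add: A_apply normal_form_basis_word scale_def R_simps\<close>)
qed

lemma normal_form_monomial:
  assumes f: "f \<in> hol M U" and K: "K \<subseteq> {..<m}"
  shows "normal_form (monomial m U f K) = f \<odot>\<^bsub>A\<^esub> word R (basis_word K)"
proof (rule A_eqI[OF normal_form_closed[OF monomial_closed[OF U f]] A_smult_closed[OF f word_closed[OF basis_word_closed[OF K]]]])
  fix w x assume x: "x \<in> U"
  show "normal_form (monomial m U f K) w x = (f \<odot>\<^bsub>A\<^esub> word R (basis_word K)) w x"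
  proof (rule normal_form_cases[of w])
    fix L assume L: "L \<subseteq> {..<m}" "w = basis_word L"
    have "basis_word L = basis_word K \<longleftrightarrow> L = K" using basis_word_inj L K by (auto simp: inj_on_def)
    then show ?thesis using x L by (simp add: A_apply normal_form_basis_word monomial_apply[OF U])
  next
    assume w: "w \<notin> basis_word ` Pow {..<m}" "\<And>F. normal_form F w = \<zero>\<^bsub>R\<^esub>"
    then have "w \<noteq> basis_word K" using K by auto
    then show ?thesis using x w by (simp add: A_apply R_simps)
  qed
qed

lemma basis_list_value:
  assumes "sorted_wrt (<) l" "set l \<subseteq> {..<m}" "x \<in> U"
  shows "finite K \<Longrightarrow> word_value (map basis l) x K = (if K = set l then 1 else 0)"
  using assms(1,2)
proof (induction l arbitrary: K)
  case (Cons i l)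
  have fl: "finite L" if "L \<subseteq> K" for L using that Cons.prems(1) finite_subset by blast
  have b: "degree_one (basis i x) L = (if L = {i} then 1 else 0)" for L
    using assms(3) by (auto simp: degree_one_def basis_def is_singleton_def)
  have "word_value (map basis (i # l)) x K = wedge (\<lambda>L. if L = {i} then 1 else 0) (\<lambda>L. if L = set l then 1 else 0) K"
    unfolding list.map word_value.simps by (rule wedge_cong) (use Cons fl b in auto)
  also have "\<dots> = (if K = set (i # l) then 1 else 0)"
  proof (cases "i \<in> K")
    case False
    then show ?thesis unfolding wedge_def by (subst sum.neutral) auto
  next
    case True
    have s: "shuffle_sign {i} (set l) = 1"
    proof -
      have "{(a, j). a \<in> {i} \<and> j \<in> set l \<and> j < a} = {}" using Cons.prems(2) by auto
      then show ?thesis unfolding shuffle_sign_def by (simp only:) simp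
    qed
    have "wedge (\<lambda>L. if L = {i} then 1 else 0) (\<lambda>L. if L = set l then 1 else 0) K =
      (\<Sum>L\<in>{{i}}. shuffle_sign L (K - L) * (if L = {i} then 1 else 0) * (if K - L = set l then 1 else 0))"
      unfolding wedge_def by (rule sum.mono_neutral_right) (use True Cons.prems(1) in auto)
    also have "\<dots> = (if K - {i} = set l then 1 else 0)" using s by simp
    also have "K - {i} = set l \<longleftrightarrow> K = set (i # l)" using True Cons.prems(2) by auto
    finally show ?thesis .
  qed
  finally show ?case .
qed auto

lemma basis_word_value: "L \<subseteq> {..<m} \<Longrightarrow> K \<subseteq> {..<m} \<Longrightarrow> x \<in> U \<Longrightarrow> word_value (basis_word L) x K = (if K = L then 1 else 0)"
  unfolding basis_word_def using fin_gens[OF U] by (subst basis_list_value) (auto simp: strict_sorted_list_of_set)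

lemma word_eval_normal_form:
  assumes F: "F \<in> carrier (S m U)"
  shows "word_eval (normal_form F) = F"
proof (rule S_eqI[OF word_eval_closed[OF normal_form_closed[OF F]] F])
  fix K x assume K: "K \<subseteq> {..<m}" "x \<in> U"
  let ?P = "Pow {..<m}"
  have "word_eval (normal_form F) K x = (\<Sum>w\<in>basis_word ` ?P. normal_form F w x * word_value w x K)"
    by (rule word_eval_apply[OF normal_form_closed[OF F] _ _ K(2,1)]) (auto simp: normal_form_def split: if_splits)
  also have "\<dots> = (\<Sum>L\<in>?P. F L x * (if K = L then 1 else 0))"
    using K by (subst sum.reindex[OF basis_word_inj]) (auto intro!: sum.cong simp: normal_form_basis_word basis_word_value)
  also have "\<dots> = (\<Sum>L\<in>{K}. F L x * (if K = L then 1 else 0))"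
    by (rule sum.mono_neutral_right) (use K in auto)
  finally show "word_eval (normal_form F) K x = F K x" by simp
qed

text \<open>An element congruent to a linear combination of increasing words.  As reducible elements are closed under left
  multiplication by letters, all elements are reducible.\<close>

definition reducible where
  "reducible f \<longleftrightarrow> f \<in> carrier A \<and> (\<exists>F\<in>carrier (S m U). cls f = cls (normal_form F))"

lemma reducible_cong: "f \<in> carrier A \<Longrightarrow> reducible g \<Longrightarrow> cls f = cls g \<Longrightarrow> reducible f"
  by (auto simp: reducible_def)

lemma reducible_add:
  assumes "reducible f" "reducible g"
  shows "reducible (f \<oplus>\<^bsub>A\<^esub> g)"
proof -
  obtain F F' where F: "F \<in> carrier (S m U)" "cls f = cls (normal_form F)" "f \<in> carrier A"
    and F': "F' \<in> carrier (S m U)" "cls g = cls (normal_form F')" "g \<in> carrier A"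
    using assms unfolding reducible_def by auto
  have "cls (f \<oplus>\<^bsub>A\<^esub> g) = cls (normal_form F \<oplus>\<^bsub>A\<^esub> normal_form F')"
    by (rule cls_add[OF F(3) F'(3) normal_form_closed[OF F(1)] normal_form_closed[OF F'(1)] F(2) F'(2)])
  then show ?thesis unfolding reducible_def normal_form_add[OF F(1) F'(1), symmetric]
    using S_add_closed[OF U F(1) F'(1)] A_add_closed[OF F(3) F'(3)] by blast
qed

lemma reducible_smult:
  assumes a: "a \<in> hol M U" and "reducible f"
  shows "reducible (a \<odot>\<^bsub>A\<^esub> f)"
proof -
  obtain F where F: "F \<in> carrier (S m U)" "cls f = cls (normal_form F)" "f \<in> carrier A"
    using assms unfolding reducible_def by auto
  have "cls (a \<odot>\<^bsub>A\<^esub> f) = cls (a \<odot>\<^bsub>A\<^esub> normal_form F)" by (rule cls_smult[OF a F(3) normal_form_closed[OF F(1)] F(2)])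
  then show ?thesis unfolding reducible_def normal_form_scale[OF a F(1), symmetric]
    using scale_closed[OF a F(1)] A_smult_closed[OF a F(3)] by blast
qed

lemma smult_one: "f \<in> carrier A \<Longrightarrow> (\<lambda>x\<in>U. 1) \<odot>\<^bsub>A\<^esub> f = f"
  by (intro A_eqI A_smult_closed hol_const U) (simp_all add: A_apply)

lemma smult_zero: "f \<in> carrier A \<Longrightarrow> (\<lambda>x\<in>U. 0) \<odot>\<^bsub>A\<^esub> f = \<zero>\<^bsub>A\<^esub>"
  by (intro A_eqI A_smult_closed A_zero_closed hol_const U) (simp_all add: A_apply)

lemma reducible_basis_word: "K \<subseteq> {..<m} \<Longrightarrow> reducible (word R (basis_word K))"
  unfolding reducible_def
  using normal_form_monomial[OF hol_const[OF U], of K 1] monomial_closed[OF U hol_const[OF U], of m 1 K]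
    smult_one[OF word_closed[OF basis_word_closed]] word_closed[OF basis_word_closed] by metis

lemma reducible_zero: "reducible \<zero>\<^bsub>A\<^esub>"
proof -
  have w: "word R (basis_word {}) \<in> carrier A" by (rule word_closed[OF basis_word_closed]) simp
  show ?thesis using reducible_smult[OF hol_const[OF U, of 0] reducible_basis_word[of "{}"]] smult_zero[OF w] by simp
qed

lemma basis_word_sorted: "sorted_wrt (<) l \<Longrightarrow> basis_word (set l) = map basis l"
  unfolding basis_word_def by (simp add: sorted_list_of_set.idem_if_sorted_distinct strict_sorted_iff)

text \<open>Sorting by transpositions: modulo the ideal each of them costs a sign, and a repeated letter
  gives zero.\<close>

lemma basis_insort:
  assumes "sorted_wrt (<) l" "set l \<subseteq> {..<m}" "k < m"
  shows "\<exists>c\<in>hol M U. \<exists>l'. cls (word R (map basis (k # l))) = cls (c \<odot>\<^bsub>A\<^esub> word R (map basis l')) \<and>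
    sorted_wrt (<) l' \<and> set l' \<subseteq> insert k (set l)"
  using assms
proof (induction l)
  case Nil
  show ?case
  proof (intro bexI[of _ "\<lambda>x\<in>U. 1"] exI[of _ "[k]"] conjI hol_const U)
    have "(\<lambda>x\<in>U. 1) \<odot>\<^bsub>A\<^esub> word R (map basis [k]) = word R (map basis [k])"
      by (rule smult_one[OF word_closed[OF basis_words_closed]]) (use Nil in simp)
    then show "cls (word R (map basis [k])) = cls ((\<lambda>x\<in>U. 1) \<odot>\<^bsub>A\<^esub> word R (map basis [k]))" by simp
  qed auto
next
  case (Cons j l)
  interpret A: ring A by (rule ring_A)
  have jl: "j < m" "set l \<subseteq> {..<m}" "sorted_wrt (<) l" "\<forall>i\<in>set l. j < i" using Cons.prems by auto
  note km = Cons.prems(3)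
  note bk = basis_closed[OF km] and bj = basis_closed[OF jl(1)]
  note wk = word1_closed[OF bk] and wj = word1_closed[OF bj]
  have wl: "set (map basis l) \<subseteq> carrier E" by (rule basis_words_closed[OF jl(2)])
  note wc = word_closed[OF wl]
  have split: "word R (map basis (k # j # l)) = (word R [basis k] \<otimes>\<^bsub>A\<^esub> word R [basis j]) \<otimes>\<^bsub>A\<^esub> word R (map basis l)"
    using bk bj wl by (simp add: word_append)
  consider "k < j" | "k = j" | "j < k" by linarith
  then show ?case
  proof cases
    case 1
    have "set (k # j # l) \<subseteq> {..<m}" using Cons.prems by auto
    then have e: "(\<lambda>x\<in>U. 1) \<odot>\<^bsub>A\<^esub> word R (map basis (k # j # l)) = word R (map basis (k # j # l))"
      by (intro smult_one word_closed basis_words_closed)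
    have "sorted_wrt (<) (k # j # l)" using 1 Cons.prems by auto
    then show ?thesis
      by (intro bexI[of _ "\<lambda>x\<in>U. 1"] exI[of _ "k # j # l"] conjI hol_const[OF U] arg_cong[where f = cls] e[symmetric]) simp_all
  next
    case 2
    have "cls (word R (map basis (k # j # l))) = cls (\<zero>\<^bsub>A\<^esub> \<otimes>\<^bsub>A\<^esub> word R (map basis l))"
      unfolding 2 split[unfolded 2]
      by (rule cls_mult[OF A_mult_closed[OF wj wj] wc A_zero_closed wc cls_word_square[OF bj] refl])
    also have "\<dots> = cls \<zero>\<^bsub>A\<^esub>" using wc by simp
    also have "\<dots> = cls ((\<lambda>x\<in>U. 0) \<odot>\<^bsub>A\<^esub> word R (map basis []))" using smult_zero[OF word_closed[of "map basis []"]] by simp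
    finally have "cls (word R (map basis (k # j # l))) = cls ((\<lambda>x\<in>U. 0) \<odot>\<^bsub>A\<^esub> word R (map basis []))" .
    then have e: "cls (word R (map basis (k # j # l))) = cls ((\<lambda>x\<in>U. 0) \<odot>\<^bsub>A\<^esub> word R (map basis []))" .
    show ?thesis by (intro bexI[of _ "\<lambda>x\<in>U. 0"] exI[of _ "[]"] conjI hol_const[OF U] e) simp_all
  next
    case 3
    obtain c l' where c: "c \<in> hol M U" "cls (word R (map basis (k # l))) = cls (c \<odot>\<^bsub>A\<^esub> word R (map basis l'))"
      "sorted_wrt (<) l'" "set l' \<subseteq> insert k (set l)" using Cons.IH[OF jl(3,2) km] by blast
    have l'm: "set l' \<subseteq> {..<m}" using c(4) jl km by auto
    have wl': "set (map basis l') \<subseteq> carrier E" by (rule basis_words_closed[OF l'm])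
    let ?m = "\<lambda>x\<in>U. -1 :: complex"
    have hm: "?m \<in> hol M U" by (rule hol_const[OF U])
    define d where "d = (\<lambda>x\<in>U. ?m x * c x)"
    have d: "d \<in> hol M U" unfolding d_def by (rule hol_mult[OF U hm c(1)])
    note jk = A_mult_closed[OF wj wk] and kl = A_mult_closed[OF wk wc]
    have kl': "word R (map basis (k # l)) = word R [basis k] \<otimes>\<^bsub>A\<^esub> word R (map basis l)" using bk wl by (simp add: word_append)
    note cw = A_smult_closed[OF c(1) word_closed[OF wl']]
    have "cls (word R (map basis (k # j # l))) = cls ((?m \<odot>\<^bsub>A\<^esub> (word R [basis j] \<otimes>\<^bsub>A\<^esub> word R [basis k])) \<otimes>\<^bsub>A\<^esub> word R (map basis l))"
      unfolding split
      by (rule cls_mult[OF A_mult_closed[OF wk wj] wc A_smult_closed[OF hm jk] wc cls_word_swap[OF bk bj] refl])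
    also have "(?m \<odot>\<^bsub>A\<^esub> (word R [basis j] \<otimes>\<^bsub>A\<^esub> word R [basis k])) \<otimes>\<^bsub>A\<^esub> word R (map basis l) =
        ?m \<odot>\<^bsub>A\<^esub> (word R [basis j] \<otimes>\<^bsub>A\<^esub> word R (map basis (k # l)))"
      unfolding kl' using A_smult_mult(1)[OF hm jk wc] A.m_assoc[OF wj wk wc] by simp
    also have "cls \<dots> = cls (?m \<odot>\<^bsub>A\<^esub> (word R [basis j] \<otimes>\<^bsub>A\<^esub> (c \<odot>\<^bsub>A\<^esub> word R (map basis l'))))"
      unfolding kl'
      by (rule cls_smult[OF hm A_mult_closed[OF wj kl] A_mult_closed[OF wj cw] cls_mult[OF wj kl wj cw refl c(2)[unfolded kl']]])
    also have "?m \<odot>\<^bsub>A\<^esub> (word R [basis j] \<otimes>\<^bsub>A\<^esub> (c \<odot>\<^bsub>A\<^esub> word R (map basis l'))) = d \<odot>\<^bsub>A\<^esub> word R (map basis (j # l'))"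
    proof -
      have "word R [basis j] \<otimes>\<^bsub>A\<^esub> (c \<odot>\<^bsub>A\<^esub> word R (map basis l')) = c \<odot>\<^bsub>A\<^esub> word R (map basis (j # l'))"
        using A_smult_mult(2)[OF c(1) wj word_closed[OF wl']] bj wl' by (simp add: word_append)
      moreover have jl': "word R (map basis (j # l')) \<in> carrier A" using bj wl' by (intro word_closed) simp
      moreover have "?m \<odot>\<^bsub>A\<^esub> (c \<odot>\<^bsub>A\<^esub> word R (map basis (j # l'))) = d \<odot>\<^bsub>A\<^esub> word R (map basis (j # l'))"
        by (rule A_eqI[OF A_smult_closed[OF hm A_smult_closed[OF c(1) jl']] A_smult_closed[OF d jl']]) (simp add: A_apply d_def)
      ultimately show ?thesis by simp
    qed
    finally have "cls (word R (map basis (k # j # l))) = cls (d \<odot>\<^bsub>A\<^esub> word R (map basis (j # l')))" .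
    moreover have "sorted_wrt (<) (j # l')" using c(3,4) jl(4) 3 by auto
    ultimately show ?thesis using d c(4) by (intro bexI[of _ d] exI[of _ "j # l'"]) auto
  qed
qed

lemma reducible_basis_Cons:
  assumes K: "K \<subseteq> {..<m}" and k: "k < m"
  shows "reducible (word R (basis k # basis_word K))"
proof -
  have s: "sorted_wrt (<) (sorted_list_of_set K)" "set (sorted_list_of_set K) = K"
    using strict_sorted_list_of_set fin_gens[OF U K] by auto
  obtain c l' where c: "c \<in> hol M U" "cls (word R (map basis (k # sorted_list_of_set K))) = cls (c \<odot>\<^bsub>A\<^esub> word R (map basis l'))"
    "sorted_wrt (<) l'" "set l' \<subseteq> insert k K" using basis_insort[OF s(1) _ k] s(2) K by auto
  have l': "set l' \<subseteq> {..<m}" using c(4) K k by auto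
  have "reducible (c \<odot>\<^bsub>A\<^esub> word R (map basis l'))"
    using reducible_smult[OF c(1) reducible_basis_word[OF l']] basis_word_sorted[OF c(3)] by simp
  then show ?thesis
    using c(2) basis_closed[OF k] basis_word_closed[OF K] by (intro reducible_cong[OF word_closed]) (auto simp: basis_word_def)
qed

text \<open>A section is expanded in the basis one coordinate at a time.\<close>

lemma reducible_section_Cons:
  assumes s: "s \<in> carrier E" and K: "K \<subseteq> {..<m}"
  shows "reducible (word R (s # basis_word K))"
proof -
  define p where "p k = (\<lambda>x\<in>U. \<lambda>j. if j < k then s x j else 0)" for k
  have p: "p k \<in> carrier E" for k
    unfolding E_carrier p_def
  proof (intro conjI ballI allI impI)
    fix j assume "j < m"
    then have "(\<lambda>x\<in>U. s x j) \<in> hol M U" using s by (simp add: E_carrier)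
    then show "(\<lambda>x\<in>U. (\<lambda>x\<in>U. \<lambda>j. if j < k then s x j else 0) x j) \<in> hol M U"
      using hol_const[OF U, of 0] by (cases "j < k") (simp_all cong: restrict_cong)
  qed (use s in \<open>auto simp: Cn_def E_carrier\<close>)
  note bw = basis_word_closed[OF K]
  note wb = word_closed[OF bw]
  have "reducible (word R (p k # basis_word K))" if "k \<le> m" for k
    using that
  proof (induction k)
    case 0
    have "p 0 = (\<lambda>x\<in>U. 0) \<odot>\<^bsub>E\<^esub> p 0" by (auto simp: p_def E_ops intro!: restrict_ext)
    then have "cls (word R [p 0]) = cls ((\<lambda>x\<in>U. 0) \<odot>\<^bsub>A\<^esub> word R [p 0])"
      using cls_word_smult[OF hol_const[OF U] p, of 0 0] by simp
    also have "\<dots> = cls \<zero>\<^bsub>A\<^esub>" by (simp add: smult_zero word1_closed p)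
    finally have "cls (word R [p 0] \<otimes>\<^bsub>A\<^esub> word R (basis_word K)) = cls (\<zero>\<^bsub>A\<^esub> \<otimes>\<^bsub>A\<^esub> word R (basis_word K))"
      by (intro cls_mult word1_closed p wb A_zero_closed refl)
    also have "\<zero>\<^bsub>A\<^esub> \<otimes>\<^bsub>A\<^esub> word R (basis_word K) = \<zero>\<^bsub>A\<^esub>"
    proof -
      interpret ring A by (rule ring_A)
      show ?thesis using wb by simp
    qed
    finally show ?case
      using reducible_zero p bw by (intro reducible_cong[OF word_closed _]) (auto simp: word_append)
  next
    case (Suc k)
    then have k: "k < m" by simp
    interpret A: ring A by (rule ring_A)
    define a where "a = (\<lambda>x\<in>U. s x k)"
    have a: "a \<in> hol M U" using s k by (simp add: E_carrier a_def)
    note bk = basis_closed[OF k]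
    note ab = E_smult_closed[OF a bk] and wbk = word1_closed[OF bk]
    have "p (Suc k) = p k \<oplus>\<^bsub>E\<^esub> a \<odot>\<^bsub>E\<^esub> basis k"
      by (auto simp: p_def E_ops a_def basis_def less_Suc_eq intro!: restrict_ext)
    then have "cls (word R [p (Suc k)]) = cls (word R [p k] \<oplus>\<^bsub>A\<^esub> word R [a \<odot>\<^bsub>E\<^esub> basis k])"
      using cls_word_add[OF p ab] by simp
    also have "\<dots> = cls (word R [p k] \<oplus>\<^bsub>A\<^esub> a \<odot>\<^bsub>A\<^esub> word R [basis k])"
      by (intro cls_add word1_closed p ab A_smult_closed a bk refl cls_word_smult)
    finally have "cls (word R [p (Suc k)] \<otimes>\<^bsub>A\<^esub> word R (basis_word K)) =
        cls ((word R [p k] \<oplus>\<^bsub>A\<^esub> a \<odot>\<^bsub>A\<^esub> word R [basis k]) \<otimes>\<^bsub>A\<^esub> word R (basis_word K))"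
      by (intro cls_mult word1_closed p wb A_add_closed A_smult_closed a bk refl)
    also have "(word R [p k] \<oplus>\<^bsub>A\<^esub> a \<odot>\<^bsub>A\<^esub> word R [basis k]) \<otimes>\<^bsub>A\<^esub> word R (basis_word K) =
        word R (p k # basis_word K) \<oplus>\<^bsub>A\<^esub> a \<odot>\<^bsub>A\<^esub> word R (basis k # basis_word K)"
      using A.l_distr[OF word1_closed[OF p[of k]] A_smult_closed[OF a wbk] wb] A_smult_mult(1)[OF a wbk wb]
      by (simp add: word_append p bk bw)
    finally have "cls (word R (p (Suc k) # basis_word K)) = cls (word R (p k # basis_word K) \<oplus>\<^bsub>A\<^esub> a \<odot>\<^bsub>A\<^esub> word R (basis k # basis_word K))"
      by (simp add: word_append p bw)
    moreover have "reducible (word R (p k # basis_word K) \<oplus>\<^bsub>A\<^esub> a \<odot>\<^bsub>A\<^esub> word R (basis k # basis_word K))"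
      using Suc by (intro reducible_add reducible_smult a reducible_basis_Cons[OF K k]) simp
    ultimately show ?case using p bw by (intro reducible_cong[OF word_closed]) simp_all
  qed
  moreover have "p m = s"
  proof (rule extensionalityI[of _ U])
    fix x assume "x \<in> U"
    then show "p m x = s x" using s by (auto simp: p_def E_carrier Cn_def fun_eq_iff)
  qed (use s in \<open>auto simp: p_def E_carrier\<close>)
  ultimately show ?thesis by (metis le_refl)
qed

lemma reducible_left_mult:
  assumes s: "s \<in> carrier E" and "reducible f"
  shows "reducible (word R [s] \<otimes>\<^bsub>A\<^esub> f)"
proof -
  interpret A: ring A by (rule ring_A)
  note ws = word1_closed[OF s]
  have nf: "reducible (word R [s] \<otimes>\<^bsub>A\<^esub> normal_form F)" if "F \<in> Jpow m U 0" for F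
    using that
  proof (induction rule: Jpow_induct[OF U, consumes 1, case_names zero step])
    case zero
    have "normal_form \<zero>\<^bsub>S m U\<^esub> = \<zero>\<^bsub>A\<^esub>"
    proof (rule A_eqI[OF normal_form_closed[OF S_zero_closed[OF U]] A_zero_closed])
      fix w x assume x: "x \<in> U"
      show "normal_form \<zero>\<^bsub>S m U\<^esub> w x = \<zero>\<^bsub>A\<^esub> w x"
        by (rule normal_form_cases[of w]) (use x in \<open>simp_all add: A_apply normal_form_basis_word S_apply[OF U] R_simps\<close>)
    qed
    then show ?case using reducible_zero ws by simp
  next
    case (step F f K)
    note wK = word_closed[OF basis_word_closed[OF step(3)]]
    have "word R [s] \<otimes>\<^bsub>A\<^esub> normal_form (F \<oplus>\<^bsub>S m U\<^esub> monomial m U f K) =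
        word R [s] \<otimes>\<^bsub>A\<^esub> normal_form F \<oplus>\<^bsub>A\<^esub> f \<odot>\<^bsub>A\<^esub> word R (s # basis_word K)"
      unfolding normal_form_add[OF step(1) monomial_closed[OF U step(2)]] normal_form_monomial[OF step(2,3)]
      using A.r_distr[OF normal_form_closed[OF step(1)] A_smult_closed[OF step(2) wK] ws] A_smult_mult(2)[OF step(2) ws wK]
      by (simp add: word_append s basis_word_closed[OF step(3)])
    then show ?case
      using reducible_add[OF step(5) reducible_smult[OF step(2) reducible_section_Cons[OF s step(3)]]] by simp
  qed
  obtain F where F: "F \<in> carrier (S m U)" "cls f = cls (normal_form F)" "f \<in> carrier A"
    using assms unfolding reducible_def by auto
  have "cls (word R [s] \<otimes>\<^bsub>A\<^esub> f) = cls (word R [s] \<otimes>\<^bsub>A\<^esub> normal_form F)"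
    by (rule cls_mult[OF ws F(3) ws normal_form_closed[OF F(1)] refl F(2)])
  then show ?thesis using nf[of F] F(1) by (intro reducible_cong[OF A_mult_closed[OF ws F(3)]]) (simp_all add: Jpow_0[OF U])
qed

lemma reducible_word: "set w \<subseteq> carrier E \<Longrightarrow> reducible (word R w)"
proof (induction w)
  case Nil
  then show ?case using reducible_basis_word[of "{}"] by (simp add: basis_word_def)
next
  case (Cons s w)
  then show ?case using reducible_left_mult[of s "word R w"] by (simp add: word_append)
qed

lemma reducible_all:
  assumes f: "f \<in> carrier A"
  shows "reducible f"
proof -
  define cut where "cut B = (\<lambda>w. if w \<in> B then f w else \<zero>\<^bsub>R\<^esub>)" for B
  have cut: "cut B \<in> carrier A" for B
    by (rule A_memI[of _ "supp f"]) (use f A_hol A_fin A_set hol_const[OF U] in \<open>auto simp: cut_def R_simps\<close>)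
  have "reducible (cut B)" if "finite B" "B \<subseteq> supp f" for B
    using that
  proof (induction B)
    case empty
    have "cut {} = \<zero>\<^bsub>A\<^esub>" by (simp add: cut_def A_ops)
    then show ?case using reducible_zero by simp
  next
    case (insert w B)
    have w: "set w \<subseteq> carrier E" using insert A_set[OF f] by auto
    have "cut (insert w B) = cut B \<oplus>\<^bsub>A\<^esub> f w \<odot>\<^bsub>A\<^esub> word R w"
      by (rule A_eqI[OF cut A_add_closed[OF cut A_smult_closed[OF A_hol[OF f] word_closed[OF w]]]])
        (use insert in \<open>auto simp: cut_def A_apply R_simps\<close>)
    then show ?case using reducible_add[OF _ reducible_smult[OF A_hol[OF f] reducible_word[OF w]]] insert by simp
  qed
  moreover have "cut (supp f) = f" by (auto simp: cut_def)
  ultimately show ?thesis using A_fin[OF f] by (metis subset_refl)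
qed

end

text \<open>An element of the kernel is congruent to a normal form, whose coefficients are determined by
  evaluation and therefore vanish.\<close>

lemma word_eval_kernel:
  assumes f: "f \<in> carrier A" and z: "word_eval f = \<zero>\<^bsub>S m U\<^esub>"
  shows "f \<in> I"
proof -
  interpret A: ring A by (rule ring_A)
  interpret ideal I A by (rule ideal_I)
  show ?thesis
  proof (cases "U = {}")
    case True
    then have "f = \<zero>\<^bsub>A\<^esub>" by (intro A_eqI f A_zero_closed) simp
    then show ?thesis using zero_closed by simp
  next
    case False
    obtain F where F: "F \<in> carrier (S m U)" "cls f = cls (normal_form F)"
      using reducible_all[OF False f] unfolding reducible_def[OF False] by auto
    note nc = normal_form_closed[OF F(1)]
    have "f \<ominus>\<^bsub>A\<^esub> normal_form F \<in> I" using F(2) cls_eq_iff[OF f nc] by simp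
    from word_eval_I[OF this] have e: "\<zero>\<^bsub>S m U\<^esub> \<ominus>\<^bsub>S m U\<^esub> F = \<zero>\<^bsub>S m U\<^esub>"
      using word_eval_minus[OF f nc] word_eval_normal_form[OF False F(1)] z by simp
    have "F = \<zero>\<^bsub>S m U\<^esub>"
    proof (rule S_eqI[OF F(1) S_zero_closed[OF U]])
      fix K x assume K: "K \<subseteq> {..<m}" "x \<in> U"
      have "(\<zero>\<^bsub>S m U\<^esub> \<oplus>\<^bsub>S m U\<^esub> (-1) \<odot>\<^bsub>S m U\<^esub> F) K x = \<zero>\<^bsub>S m U\<^esub> K x"
        using e by (simp add: a_minus_def S_uminus[OF U F(1)])
      then show "F K x = \<zero>\<^bsub>S m U\<^esub> K x" using K by (simp add: S_apply[OF U])
    qed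
    then have "normal_form F = \<zero>\<^bsub>A\<^esub>"
    proof -
      assume F0: "F = \<zero>\<^bsub>S m U\<^esub>"
      show "normal_form F = \<zero>\<^bsub>A\<^esub>"
      proof (rule A_eqI[OF nc A_zero_closed])
        fix w x assume x: "x \<in> U"
        show "normal_form F w x = \<zero>\<^bsub>A\<^esub> w x"
          by (rule normal_form_cases[OF False, of w])
            (use x F0 in \<open>simp_all add: A_apply normal_form_basis_word[OF False] S_apply[OF U] R_simps\<close>)
      qed
    qed
    then show ?thesis using \<open>f \<ominus>\<^bsub>A\<^esub> normal_form F \<in> I\<close> f by (simp add: a_minus_def)
  qed
qed

lemma word_eval_surj:
  assumes F: "F \<in> carrier (S m U)"
  shows "\<exists>f\<in>carrier A. word_eval f = F \<and>
    (F \<in> even_part (S m U) \<longrightarrow> (\<forall>w. odd (length w) \<longrightarrow> f w = \<zero>\<^bsub>R\<^esub>)) \<and>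
    (F \<in> odd_part (S m U) \<longrightarrow> (\<forall>w. even (length w) \<longrightarrow> f w = \<zero>\<^bsub>R\<^esub>))"
proof (cases "U = {}")
  case True
  have "word_eval \<zero>\<^bsub>A\<^esub> = F" by (rule S_eqI[OF word_eval_closed[OF A_zero_closed] F]) (simp add: True)
  then show ?thesis using A_zero_closed by (intro bexI[of _ "\<zero>\<^bsub>A\<^esub>"]) (auto simp: A_ops)
next
  case False
  note nc = normal_form_closed[OF F]
  have z: "normal_form F w = \<zero>\<^bsub>R\<^esub>" if "\<And>K x. K \<subseteq> {..<m} \<Longrightarrow> length w = card K \<Longrightarrow> x \<in> U \<Longrightarrow> F K x = 0" for w
  proof (rule normal_form_cases[OF False, of w])
    fix K assume K: "K \<subseteq> {..<m}" "w = basis_word K"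
    have "length w = card K" using K by (simp add: basis_word_def)
    then have "F K = \<zero>\<^bsub>R\<^esub>"
      unfolding R_simps using that[OF K(1)] hol_ext[OF S_hol[OF F K(1)]] by (intro extensionalityI[of _ U]) auto
    then show ?thesis using normal_form_basis_word[OF False K(1)] K by simp
  qed
  show ?thesis
  proof (intro bexI[OF _ nc] conjI impI allI word_eval_normal_form[OF False F])
    fix w :: "('p \<Rightarrow> nat \<Rightarrow> complex) list" assume "F \<in> even_part (S m U)" "odd (length w)"
    then show "normal_form F w = \<zero>\<^bsub>R\<^esub>" by (intro z) (auto simp: S_parity_zero)
  next
    fix w :: "('p \<Rightarrow> nat \<Rightarrow> complex) list" assume "F \<in> odd_part (S m U)" "even (length w)"
    then show "normal_form F w = \<zero>\<^bsub>R\<^esub>" by (intro z) (auto simp: S_parity_zero)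
  qed
qed

end
end

section \<open>The exterior sheaf of a trivial bundle\<close>

context cman
begin

text \<open>The exterior algebras of the sections of a trivial bundle already form a sheaf, namely that of
  superfunctions; the context below says that sheafification then changes nothing.\<close>

context
  fixes m :: nat and P :: "('p, 's) presheaf" and h :: "'p set \<Rightarrow> (nat set \<Rightarrow> 'p \<Rightarrow> complex) \<Rightarrow> 's"
  assumes bij: "\<And>V. openin X V \<Longrightarrow> bij_betw (h V) (carrier (S m V)) (carrier (Sec P V))"
    and mult: "\<And>V a b. openin X V \<Longrightarrow> a \<in> carrier (S m V) \<Longrightarrow> b \<in> carrier (S m V) \<Longrightarrow>
      h V (a \<otimes>\<^bsub>S m V\<^esub> b) = h V a \<otimes>\<^bsub>Sec P V\<^esub> h V b"
    and add: "\<And>V a b. openin X V \<Longrightarrow> a \<in> carrier (S m V) \<Longrightarrow> b \<in> carrier (S m V) \<Longrightarrow>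
      h V (a \<oplus>\<^bsub>S m V\<^esub> b) = h V a \<oplus>\<^bsub>Sec P V\<^esub> h V b"
    and one: "\<And>V. openin X V \<Longrightarrow> h V \<one>\<^bsub>S m V\<^esub> = \<one>\<^bsub>Sec P V\<^esub>"
    and smult: "\<And>V c a. openin X V \<Longrightarrow> a \<in> carrier (S m V) \<Longrightarrow> h V (c \<odot>\<^bsub>S m V\<^esub> a) = c \<odot>\<^bsub>Sec P V\<^esub> h V a"
    and even: "\<And>V a. openin X V \<Longrightarrow> a \<in> even_part (S m V) \<Longrightarrow> h V a \<in> even_part (Sec P V)"
    and odd: "\<And>V a. openin X V \<Longrightarrow> a \<in> odd_part (S m V) \<Longrightarrow> h V a \<in> odd_part (Sec P V)"
    and res: "\<And>V W a. openin X V \<Longrightarrow> openin X W \<Longrightarrow> W \<subseteq> V \<Longrightarrow> a \<in> carrier (S m V) \<Longrightarrow>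
      Res P V W (h V a) = h W (Res (super_hol M m) V W a)"
begin

definition agree where
  "agree x V a W b \<longleftrightarrow> (\<exists>N. openin X N \<and> x \<in> N \<and> N \<subseteq> V \<inter> W \<and> (\<forall>K\<subseteq>{..<m}. \<forall>y\<in>N. a K y = (b K y :: complex)))"

lemma Res_eq_iff:
  assumes "openin X N" "N \<subseteq> V" "N \<subseteq> W" "a \<in> carrier (S m V)" "b \<in> carrier (S m W)"
  shows "Res (super_hol M m) V N a = Res (super_hol M m) W N b \<longleftrightarrow> (\<forall>K\<subseteq>{..<m}. \<forall>y\<in>N. a K y = b K y)"
proof
  assume eq: "Res (super_hol M m) V N a = Res (super_hol M m) W N b"
  show "\<forall>K\<subseteq>{..<m}. \<forall>y\<in>N. a K y = b K y"
  proof (intro allI impI ballI)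
    fix K y assume K: "K \<subseteq> {..<m}" "y \<in> N"
    have "Res (super_hol M m) V N a K y = Res (super_hol M m) W N b K y" using eq by simp
    then show "a K y = b K y" using K by (simp add: S_Res_apply)
  qed
next
  assume eq: "\<forall>K\<subseteq>{..<m}. \<forall>y\<in>N. a K y = b K y"
  show "Res (super_hol M m) V N a = Res (super_hol M m) W N b"
    by (rule S_eqI[OF S_Res_closed[OF assms(1,2,4)] S_Res_closed[OF assms(1,3,5)]]) (use eq in \<open>simp add: S_Res_apply\<close>)
qed

lemma h_closed: "openin X V \<Longrightarrow> a \<in> carrier (S m V) \<Longrightarrow> h V a \<in> carrier (Sec P V)"
  using bij by (auto simp: bij_betw_def)

lemma germ_mem:
  assumes V: "openin X V" "a \<in> carrier (S m V)"
  shows "(W, t) \<in> germ X P x V (h V a) \<longleftrightarrow> openin X W \<and> x \<in> W \<and> (\<exists>b\<in>carrier (S m W). t = h W b \<and> agree x V a W b)"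
proof -
  have *: "Res P V N (h V a) = Res P W N (h W b) \<longleftrightarrow> (\<forall>K\<subseteq>{..<m}. \<forall>y\<in>N. a K y = b K y)"
    if N: "openin X N" "N \<subseteq> V" "N \<subseteq> W" and W: "openin X W" "b \<in> carrier (S m W)" for N b
  proof -
    have "Res P V N (h V a) = Res P W N (h W b) \<longleftrightarrow> Res (super_hol M m) V N a = Res (super_hol M m) W N b"
      unfolding res[OF V(1) N(1,2) V(2)] res[OF W(1) N(1,3) W(2)]
      using bij[OF N(1)] S_Res_closed[OF N(1,2) V(2)] S_Res_closed[OF N(1,3) W(2)] by (auto simp: bij_betw_def inj_on_def)
    then show ?thesis using Res_eq_iff[OF N V(2) W(2)] by simp
  qed
  show ?thesis
  proof
    assume "(W, t) \<in> germ X P x V (h V a)"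
    then obtain N where W: "openin X W" "x \<in> W" "t \<in> carrier (Sec P W)"
      and N: "openin X N" "x \<in> N" "N \<subseteq> V \<inter> W" "Res P V N (h V a) = Res P W N t" unfolding germ_def by auto
    have "t \<in> h W ` carrier (S m W)" using bij[OF W(1)] W(3) by (simp add: bij_betw_def)
    then obtain b where b: "b \<in> carrier (S m W)" "t = h W b" by blast
    have "agree x V a W b" unfolding agree_def
      using N * [of N b] W b by (intro exI[of _ N]) auto
    then show "openin X W \<and> x \<in> W \<and> (\<exists>b\<in>carrier (S m W). t = h W b \<and> agree x V a W b)" using W b by blast
  next
    assume "openin X W \<and> x \<in> W \<and> (\<exists>b\<in>carrier (S m W). t = h W b \<and> agree x V a W b)"
    then obtain b N where W: "openin X W" "x \<in> W" and b: "b \<in> carrier (S m W)" "t = h W b"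
      and N: "openin X N" "x \<in> N" "N \<subseteq> V \<inter> W" "\<forall>K\<subseteq>{..<m}. \<forall>y\<in>N. a K y = b K y" unfolding agree_def by auto
    have "Res P V N (h V a) = Res P W N t" using * [of N b] N W b by simp
    then show "(W, t) \<in> germ X P x V (h V a)"
      unfolding germ_def using W N b h_closed[OF W(1) b(1)] by auto
  qed
qed

lemma agree_refl: "openin X V \<Longrightarrow> x \<in> V \<Longrightarrow> agree x V a V a"
  unfolding agree_def by blast

lemma agree_trans: "agree x V a W b \<Longrightarrow> agree x W b Z c \<Longrightarrow> agree x V a Z c"
proof -
  assume "agree x V a W b" "agree x W b Z c"
  then obtain N N' where N: "openin X N" "x \<in> N" "N \<subseteq> V \<inter> W" "\<forall>K\<subseteq>{..<m}. \<forall>y\<in>N. a K y = b K y"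
    and N': "openin X N'" "x \<in> N'" "N' \<subseteq> W \<inter> Z" "\<forall>K\<subseteq>{..<m}. \<forall>y\<in>N'. b K y = c K y" unfolding agree_def by auto
  have "openin X (N \<inter> N')" using N N' by blast
  then show ?thesis unfolding agree_def using N N' by (intro exI[of _ "N \<inter> N'"]) auto
qed

lemma agree_sym: "agree x V a W b \<Longrightarrow> agree x W b V a"
  unfolding agree_def by (metis Int_commute)

lemma germ_self:
  assumes V: "openin X V" "x \<in> V" and a: "a \<in> carrier (S m V)"
  shows "(V, h V a) \<in> germ X P x V (h V a)"
  unfolding germ_mem[OF V(1) a] by (intro conjI V bexI[OF _ a] refl agree_refl)

lemma germ_eq_iff:
  assumes V: "openin X V" "x \<in> V" "a \<in> carrier (S m V)" and W: "openin X W" "x \<in> W" "b \<in> carrier (S m W)"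
  shows "germ X P x V (h V a) = germ X P x W (h W b) \<longleftrightarrow> agree x V a W b"
proof
  assume eq: "germ X P x V (h V a) = germ X P x W (h W b)"
  have "(W, h W b) \<in> germ X P x W (h W b)"
    using germ_mem[OF W(1,3)] W agree_refl[OF W(1,2)] by blast
  then obtain b' where b': "b' \<in> carrier (S m W)" "h W b = h W b'" "agree x V a W b'"
    using germ_mem[OF V(1,3)] eq by blast
  have "b' = b" using bij[OF W(1)] b' W(3) by (auto simp: bij_betw_def inj_on_def)
  then show "agree x V a W b" using b' by simp
next
  assume ag: "agree x V a W b"
  have "(Z, t) \<in> germ X P x V (h V a) \<longleftrightarrow> (Z, t) \<in> germ X P x W (h W b)" for Z t
    unfolding germ_mem[OF V(1,3)] germ_mem[OF W(1,3)] using agree_trans[OF ag] agree_trans[OF agree_sym[OF ag]] by blast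
  then show "germ X P x V (h V a) = germ X P x W (h W b)" by (auto simp: set_eq_iff)
qed

text \<open>The union defining an operation on germs is a union of equal sets, because the operation on
  superfunctions is pointwise.\<close>

lemma germ_map2_eq:
  fixes opS :: "'p set \<Rightarrow> (nat set \<Rightarrow> 'p \<Rightarrow> complex) \<Rightarrow> (nat set \<Rightarrow> 'p \<Rightarrow> complex) \<Rightarrow> nat set \<Rightarrow> 'p \<Rightarrow> complex"
  assumes V: "openin X V" "x \<in> V" and a: "a \<in> carrier (S m V)" and b: "b \<in> carrier (S m V)"
    and cl: "\<And>W a b. openin X W \<Longrightarrow> a \<in> carrier (S m W) \<Longrightarrow> b \<in> carrier (S m W) \<Longrightarrow> opS W a b \<in> carrier (S m W)"
    and hop: "\<And>W a b. openin X W \<Longrightarrow> a \<in> carrier (S m W) \<Longrightarrow> b \<in> carrier (S m W) \<Longrightarrow> opP W (h W a) (h W b) = h W (opS W a b)"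
    and loc: "\<And>W W' a b a' b' K y. openin X W \<Longrightarrow> openin X W' \<Longrightarrow> y \<in> W \<Longrightarrow> y \<in> W' \<Longrightarrow> K \<subseteq> {..<m} \<Longrightarrow>
      (\<And>I. I \<subseteq> K \<Longrightarrow> a I y = a' I y) \<Longrightarrow> (\<And>I. I \<subseteq> K \<Longrightarrow> b I y = b' I y) \<Longrightarrow> opS W a b K y = opS W' a' b' K y"
  shows "germ_map2 X P opP x (germ X P x V (h V a)) (germ X P x V (h V b)) = germ X P x V (h V (opS V a b))"
proof -
  let ?B = "{germ X P x N (opP N s t) | N s t. (N, s) \<in> germ X P x V (h V a) \<and> (N, t) \<in> germ X P x V (h V b)}"
  have 1: "g = germ X P x V (h V (opS V a b))" if gB: "g \<in> ?B" for g
  proof -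
    obtain N s t where g: "g = germ X P x N (opP N s t)" "(N, s) \<in> germ X P x V (h V a)" "(N, t) \<in> germ X P x V (h V b)"
      using gB by blast
    obtain a' where N: "openin X N" "x \<in> N" and a': "a' \<in> carrier (S m N)" "s = h N a'" "agree x V a N a'"
      using g(2) unfolding germ_mem[OF V(1) a] by blast
    obtain b' where b': "b' \<in> carrier (S m N)" "t = h N b'" "agree x V b N b'"
      using g(3) unfolding germ_mem[OF V(1) b] by blast
    obtain N1 where N1: "openin X N1" "x \<in> N1" "N1 \<subseteq> V \<inter> N" "\<forall>K\<subseteq>{..<m}. \<forall>y\<in>N1. a K y = a' K y"
      using a'(3) unfolding agree_def by blast
    obtain N2 where N2: "openin X N2" "x \<in> N2" "N2 \<subseteq> V \<inter> N" "\<forall>K\<subseteq>{..<m}. \<forall>y\<in>N2. b K y = b' K y"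
      using b'(3) unfolding agree_def by blast
    have "agree x N (opS N a' b') V (opS V a b)"
      unfolding agree_def
    proof (intro exI[of _ "N1 \<inter> N2"] conjI allI impI ballI)
      show "openin X (N1 \<inter> N2)" using N1 N2 by blast
      fix K y assume K: "K \<subseteq> {..<m}" and y: "y \<in> N1 \<inter> N2"
      show "opS N a' b' K y = opS V a b K y"
      proof (rule loc[OF N(1) V(1) _ _ K])
        fix I assume "I \<subseteq> K"
        then have "I \<subseteq> {..<m}" using K by blast
        then show "a' I y = a I y" "b' I y = b I y" using N1(4) N2(4) y by simp_all
      qed (use y N1 N2 in auto)
    qed (use N1 N2 in auto)
    then show ?thesis
      unfolding g(1) a'(2) b'(2) hop[OF N(1) a'(1) b'(1)]
      using germ_eq_iff[OF N cl[OF N(1) a'(1) b'(1)] V cl[OF V(1) a b]] by blast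
  qed
  have "germ X P x V (opP V (h V a) (h V b)) \<in> ?B" using germ_self[OF V a] germ_self[OF V b] by blast
  then have 2: "germ X P x V (h V (opS V a b)) \<in> ?B" unfolding hop[OF V(1) a b] .
  have "?B = {germ X P x V (h V (opS V a b))}"
  proof (intro equalityI subsetI)
    fix g assume "g \<in> ?B"
    then show "g \<in> {germ X P x V (h V (opS V a b))}" unfolding singleton_iff by (rule 1)
  next
    fix g assume "g \<in> {germ X P x V (h V (opS V a b))}"
    then have "g = germ X P x V (h V (opS V a b))" by (rule singletonD)
    then show "g \<in> ?B" using 2 by (simp only:)
  qed
  then show ?thesis unfolding germ_map2_def by (simp only: cSup_singleton)
qed

lemma germ_map_smult:
  assumes V: "openin X V" "x \<in> V" and a: "a \<in> carrier (S m V)"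
  shows "germ_map X P (\<lambda>N. module.smult (Sec P N) c) x (germ X P x V (h V a)) = germ X P x V (h V (c \<odot>\<^bsub>S m V\<^esub> a))"
proof -
  let ?g = "germ X P x V (h V (c \<odot>\<^bsub>S m V\<^esub> a))"
  have 1: "germ X P x N (c \<odot>\<^bsub>Sec P N\<^esub> s) = ?g" if Ns: "(N, s) \<in> germ X P x V (h V a)" for N s
  proof -
    obtain a' where N: "openin X N" "x \<in> N" and a': "a' \<in> carrier (S m N)" "s = h N a'" "agree x V a N a'"
      using Ns unfolding germ_mem[OF V(1) a] by blast
    obtain N1 where N1: "openin X N1" "x \<in> N1" "N1 \<subseteq> V \<inter> N" "\<forall>K\<subseteq>{..<m}. \<forall>y\<in>N1. a K y = a' K y"
      using a'(3) unfolding agree_def by blast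
    have "agree x N (c \<odot>\<^bsub>S m N\<^esub> a') V (c \<odot>\<^bsub>S m V\<^esub> a)"
      unfolding agree_def
    proof (intro exI[of _ N1] conjI allI impI ballI)
      fix K y assume K: "K \<subseteq> {..<m}" and y: "y \<in> N1"
      then have "y \<in> N" "y \<in> V" using N1(3) by auto
      then show "(c \<odot>\<^bsub>S m N\<^esub> a') K y = (c \<odot>\<^bsub>S m V\<^esub> a) K y"
        using K y N1(4) by (simp add: S_apply[OF N(1)] S_apply[OF V(1)])
    qed (use N1 in auto)
    then show ?thesis
      unfolding a'(2) smult[OF N(1) a'(1), symmetric]
      using germ_eq_iff[OF N S_smult_closed[OF N(1) a'(1)] V S_smult_closed[OF V(1) a]] by blast
  qed
  have "(\<lambda>(N, s). germ X P x N (c \<odot>\<^bsub>Sec P N\<^esub> s)) ` germ X P x V (h V a) = {?g}"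
  proof (intro equalityI subsetI singletonI)
    fix g assume "g \<in> (\<lambda>(N, s). germ X P x N (c \<odot>\<^bsub>Sec P N\<^esub> s)) ` germ X P x V (h V a)"
    then show "g \<in> {?g}" using 1 by (elim imageE) (simp split: prod.splits)
  next
    fix g assume "g \<in> {?g}"
    then show "g \<in> (\<lambda>(N, s). germ X P x N (c \<odot>\<^bsub>Sec P N\<^esub> s)) ` germ X P x V (h V a)"
      by (intro image_eqI[OF _ germ_self[OF V a]]) (simp add: smult[OF V(1) a])
  qed
  then show ?thesis unfolding germ_map_def by (simp only: cSup_singleton)
qed

lemma sheafify_super_hol: "sheaf_isomorphic_on X (topspace X) (super_hol M m) (sheafify X P)"
proof -
  define \<theta> where "\<theta> V a = (\<lambda>x\<in>V. germ X P x V (h V a))" for V a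
  let ?Q = "sheafify X P"
  have local_mem: "\<theta> V a \<in> local_germs X P C V" if "openin X V" "h V a \<in> C V" for V a C
    unfolding local_germs_def \<theta>_def using that by auto
  have closed: "\<theta> V a \<in> carrier (Sec ?Q V)" if "openin X V" "a \<in> carrier (S m V)" for V a
    using local_mem[OF that(1), of a "\<lambda>V. carrier (Sec P V)"] h_closed[OF that] by (simp add: sheafify_def)
  have hom: "\<theta> V \<in> superalg_hom (S m V) (Sec ?Q V)" if V: "openin X V" for V
    unfolding superalg_hom_def
  proof (intro CollectI conjI ring_hom_memI allI ballI closed V)
    fix a b assume ab: "a \<in> carrier (S m V)" "b \<in> carrier (S m V)"
    have "germ_map2 X P (\<lambda>N. monoid.mult (Sec P N)) x (germ X P x V (h V a)) (germ X P x V (h V b)) = germ X P x V (h V (a \<otimes>\<^bsub>S m V\<^esub> b))"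
      if "x \<in> V" for x
      by (rule germ_map2_eq[OF V that ab, where opS = "\<lambda>N. monoid.mult (S m N)"])
        (auto simp: mult S_mult_closed S_apply intro: wedge_cong)
    then show "\<theta> V (a \<otimes>\<^bsub>S m V\<^esub> b) = \<theta> V a \<otimes>\<^bsub>Sec ?Q V\<^esub> \<theta> V b"
      by (simp add: sheafify_def \<theta>_def cong: restrict_cong)
    have "germ_map2 X P (\<lambda>N. ring.add (Sec P N)) x (germ X P x V (h V a)) (germ X P x V (h V b)) = germ X P x V (h V (a \<oplus>\<^bsub>S m V\<^esub> b))"
      if "x \<in> V" for x
      by (rule germ_map2_eq[OF V that ab, where opS = "\<lambda>N. ring.add (S m N)"])
        (auto simp: add S_add_closed S_apply)
    then show "\<theta> V (a \<oplus>\<^bsub>S m V\<^esub> b) = \<theta> V a \<oplus>\<^bsub>Sec ?Q V\<^esub> \<theta> V b"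
      by (simp add: sheafify_def \<theta>_def cong: restrict_cong)
  next
    show "\<theta> V \<one>\<^bsub>S m V\<^esub> = \<one>\<^bsub>Sec ?Q V\<^esub>" by (simp add: sheafify_def \<theta>_def one[OF V])
  next
    fix c a assume a: "a \<in> carrier (S m V)"
    show "\<theta> V (c \<odot>\<^bsub>S m V\<^esub> a) = c \<odot>\<^bsub>Sec ?Q V\<^esub> \<theta> V a"
      using germ_map_smult[OF V _ a] by (simp add: sheafify_def \<theta>_def cong: restrict_cong)
  next
    show "\<theta> V ` even_part (S m V) \<subseteq> even_part (Sec ?Q V)"
      using local_mem[OF V, of _ "\<lambda>V. even_part (Sec P V)"] even[OF V] by (auto simp: sheafify_def)
    show "\<theta> V ` odd_part (S m V) \<subseteq> odd_part (Sec ?Q V)"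
      using local_mem[OF V, of _ "\<lambda>V. odd_part (Sec P V)"] odd[OF V] by (auto simp: sheafify_def)
  qed
  have bijt: "bij_betw (\<theta> V) (carrier (S m V)) (carrier (Sec ?Q V))" if V: "openin X V" for V
  proof (rule bij_betwI')
    fix a b assume a: "a \<in> carrier (S m V)" and b: "b \<in> carrier (S m V)"
    show "\<theta> V a = \<theta> V b \<longleftrightarrow> a = b"
    proof
      assume eq: "\<theta> V a = \<theta> V b"
      show "a = b"
      proof (rule S_eqI[OF a b])
        fix K x assume K: "K \<subseteq> {..<m}" and x: "x \<in> V"
        have "germ X P x V (h V a) = germ X P x V (h V b)" using fun_cong[OF eq, of x] x by (simp add: \<theta>_def)
        then have "agree x V a V b" using germ_eq_iff[OF V x a V x b] by simp
        then show "a K x = b K x" using K unfolding agree_def by blast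
      qed
    qed simp
  next
    fix a assume "a \<in> carrier (S m V)" then show "\<theta> V a \<in> carrier (Sec ?Q V)" by (rule closed[OF V])
  next
    fix \<sigma> assume "\<sigma> \<in> carrier (Sec ?Q V)"
    then have ext: "\<sigma> \<in> extensional V" and loc: "\<forall>x\<in>V. \<exists>W s. openin X W \<and> x \<in> W \<and> W \<subseteq> V \<and> s \<in> carrier (Sec P W) \<and>
        (\<forall>y\<in>W. \<sigma> y = germ X P y W s)"
      by (auto simp: sheafify_def local_germs_def)
    let ?Q = "\<lambda>x p. openin X (fst p) \<and> x \<in> fst p \<and> fst p \<subseteq> V \<and> snd p \<in> carrier (S m (fst p)) \<and>
        (\<forall>y\<in>fst p. \<sigma> y = germ X P y (fst p) (h (fst p) (snd p)))"
    have "\<forall>x\<in>V. \<exists>p. ?Q x p"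
    proof
      fix x assume xV: "x \<in> V"
      from loc[rule_format, OF xV] obtain W s where W: "openin X W" "x \<in> W" "W \<subseteq> V" "s \<in> carrier (Sec P W)"
        "\<forall>y\<in>W. \<sigma> y = germ X P y W s" by (elim exE conjE)
      have "s \<in> h W ` carrier (S m W)" using bij[OF W(1)] W(4) by (simp add: bij_betw_def)
      then obtain a where a: "a \<in> carrier (S m W)" "s = h W a" by (elim imageE)
      have "?Q x (W, a)" using W a by simp
      then show "\<exists>p. ?Q x p" by (rule exI[of "?Q x"])
    qed
    from bchoice[OF this] obtain p where p: "\<forall>x\<in>V. ?Q x (p x)" by (rule exE)
    define W a where "W x = fst (p x)" and "a x = snd (p x)" for x
    have W: "openin X (W x)" "x \<in> W x" "W x \<subseteq> V" and a: "a x \<in> carrier (S m (W x))"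
      and s: "y \<in> W x \<Longrightarrow> \<sigma> y = germ X P y (W x) (h (W x) (a x))" if "x \<in> V" for x y
      using p[rule_format, OF that] by (simp_all add: W_def a_def)
    have eq: "a y K y = a x K y" if x: "x \<in> V" and y: "y \<in> W x" and K: "K \<subseteq> {..<m}" for x y K
    proof -
      have yV: "y \<in> V" using W(3)[OF x] y by blast
      have "germ X P y (W y) (h (W y) (a y)) = germ X P y (W x) (h (W x) (a x))"
        using s[OF x y] s[OF yV W(2)[OF yV]] by simp
      then have "agree y (W y) (a y) (W x) (a x)"
        using germ_eq_iff[OF W(1)[OF yV] W(2)[OF yV] a[OF yV] W(1)[OF x] y a[OF x]] by simp
      then show ?thesis using K unfolding agree_def by blast
    qed
    define F where "F = (\<lambda>K\<in>Pow {..<m}. \<lambda>x\<in>V. a x K x)"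
    have F: "F \<in> carrier (S m V)" unfolding F_def
    proof (rule S_memI, rule hol_local[OF V])
      fix K x assume K: "K \<subseteq> {..<m}" and x: "x \<in> V"
      have hx: "a x K \<in> hol M (W x)" by (rule S_hol[OF a[OF x] K])
      have "restrict (\<lambda>x\<in>V. a x K x) (W x) = a x K"
        by (rule extensionalityI[OF restrict_extensional hol_ext[OF hx]])
          (use W(3)[OF x] eq[OF x _ K] in auto)
      then show "\<exists>N. openin X N \<and> x \<in> N \<and> N \<subseteq> V \<and> restrict (\<lambda>x\<in>V. a x K x) N \<in> hol M N"
        using W(1-3)[OF x] hx by (intro exI[of _ "W x"]) simp
    qed simp
    have "\<sigma> = \<theta> V F"
    proof (rule extensionalityI[OF ext])
      fix x assume x: "x \<in> V"
      have "agree x V F (W x) (a x)" unfolding agree_def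
      proof (intro exI[of _ "W x"] conjI allI impI ballI)
        fix K y assume K: "K \<subseteq> {..<m}" and y: "y \<in> W x"
        then show "F K y = a x K y" using W(3)[OF x] eq[OF x y K] by (auto simp: F_def)
      qed (use W(1-3)[OF x] in auto)
      then show "\<sigma> x = \<theta> V F x"
        using germ_eq_iff[OF V x F W(1,2)[OF x] a[OF x]] s[OF x W(2)[OF x]] x by (simp add: \<theta>_def)
    qed (simp add: \<theta>_def)
    then show "\<exists>a\<in>carrier (S m V). \<sigma> = \<theta> V a" using F by blast
  qed
  show ?thesis unfolding sheaf_isomorphic_on_def
  proof (intro exI[of _ \<theta>] conjI allI impI ballI; elim conjE)
    fix V assume "openin X V" then show "\<theta> V \<in> superalg_iso (S m V) (Sec ?Q V)" using hom bijt by (simp add: superalg_iso_def)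
  next
    fix V W a assume V: "openin X V" and W: "openin X W" "W \<subseteq> V" and a: "a \<in> carrier (S m V)"
    have "germ X P x W (h W (Res (super_hol M m) V W a)) = germ X P x V (h V a)" if x: "x \<in> W" for x
    proof -
      have "agree x W (Res (super_hol M m) V W a) V a" unfolding agree_def
        using W x by (intro exI[of _ W]) (auto simp: S_Res_apply)
      then show ?thesis using germ_eq_iff[OF W(1) x S_Res_closed[OF W a] V _ a] W x by blast
    qed
    then have "\<theta> W (Res (super_hol M m) V W a) = restrict (\<theta> V a) W"
      using subsetD[OF W(2)] by (intro extensionalityI[of _ W, OF _ restrict_extensional]) (simp_all add: \<theta>_def)
    then show "\<theta> W (Res (super_hol M m) V W a) = Res ?Q V W (\<theta> V a)" by (simp add: sheafify_def)
  qed
qed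

end

definition value_fibre :: "nat \<Rightarrow> 'p set \<Rightarrow> (nat set \<Rightarrow> 'p \<Rightarrow> complex) \<Rightarrow> (('p \<Rightarrow> nat \<Rightarrow> complex) list \<Rightarrow> 'p \<Rightarrow> complex) set" where
  "value_fibre m U F = {f \<in> carrier (A m U). word_eval m U f = F}"

text \<open>The ideal is the kernel of evaluation, so that its cosets are the fibres.\<close>

lemma cls_eq_value_fibre:
  assumes U: "openin X U" and f: "f \<in> carrier (A m U)"
  shows "cls m U f = value_fibre m U (word_eval m U f)"
proof (intro equalityI subsetI)
  interpret ring "A m U" by (rule ring_A[OF U])
  interpret I: ideal "I m U" "A m U" by (rule ideal_I[OF U])
  interpret SR: ring "S m U" by (rule ring_S[OF U])
  {
    fix g assume "g \<in> cls m U f"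
    then obtain i where i: "i \<in> I m U" "g = i \<oplus>\<^bsub>A m U\<^esub> f" by (auto simp: a_r_coset_def')
    have ic: "i \<in> carrier (A m U)" using I_subset[OF U] i by auto
    have "word_eval m U g = word_eval m U f"
      using word_eval_add[OF U ic f] word_eval_I[OF U i(1)] word_eval_closed[OF U f] i(2) by simp
    then show "g \<in> value_fibre m U (word_eval m U f)" using i ic f by (simp add: value_fibre_def)
  }
  fix g assume "g \<in> value_fibre m U (word_eval m U f)"
  then have g: "g \<in> carrier (A m U)" "word_eval m U g = word_eval m U f" by (auto simp: value_fibre_def)
  have "word_eval m U (g \<ominus>\<^bsub>A m U\<^esub> f) = \<zero>\<^bsub>S m U\<^esub>"
    using word_eval_minus[OF U g(1) f] word_eval_closed[OF U f] g(2) by (simp add: SR.r_neg a_minus_def)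
  then have "g \<ominus>\<^bsub>A m U\<^esub> f \<in> I m U" using word_eval_kernel[OF U minus_closed[OF g(1) f]] by simp
  then have "cls m U g = cls m U f" using cls_eq_iff[OF U g(1) f] by simp
  then show "g \<in> cls m U f" using I.a_rcos_self[OF g(1)] by simp
qed

lemma value_fibre_obtain:
  assumes U: "openin X U" and F: "F \<in> carrier (S m U)"
  obtains f where "f \<in> carrier (A m U)" "word_eval m U f = F" "value_fibre m U F = cls m U f"
  using word_eval_surj[OF U F] cls_eq_value_fibre[OF U] by metis

lemma value_fibre_union:
  assumes U: "openin X U" and F: "F \<in> carrier (S m U)" and eq: "\<And>f. f \<in> carrier (A m U) \<Longrightarrow> word_eval m U f = F \<Longrightarrow> g f = C"
  shows "(\<Union>f\<in>value_fibre m U F. g f) = C"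
proof -
  have "value_fibre m U F \<noteq> {}" using word_eval_surj[OF U F] by (auto simp: value_fibre_def)
  then show ?thesis using eq by (auto simp: value_fibre_def)
qed

abbreviation ext where "ext m \<equiv> ext_presheaf M (trivial_bundle X m)"

lemma ext_Sec:
  "carrier (Sec (ext m) U) = a_rcosets\<^bsub>A m U\<^esub> (I m U)" "monoid.mult (Sec (ext m) U) = rcoset_mult (A m U) (I m U)"
  "one (Sec (ext m) U) = cls m U \<one>\<^bsub>A m U\<^esub>" "ring.add (Sec (ext m) U) = set_add (A m U)"
  "c \<odot>\<^bsub>Sec (ext m) U\<^esub> C = (\<Union>f\<in>C. cls m U ((\<lambda>x\<in>U. c) \<odot>\<^bsub>A m U\<^esub> f))"
  "even_part (Sec (ext m) U) = {cls m U f | f. f \<in> carrier (A m U) \<and> (\<forall>w. odd (length w) \<longrightarrow> f w = \<zero>\<^bsub>R U\<^esub>)}"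
  "odd_part (Sec (ext m) U) = {cls m U f | f. f \<in> carrier (A m U) \<and> (\<forall>w. even (length w) \<longrightarrow> f w = \<zero>\<^bsub>R U\<^esub>)}"
  by (simp_all add: ext_presheaf_def ext_alg_def Let_def FactRing_def)

lemma restrict_section: "openin X U \<Longrightarrow> openin X V \<Longrightarrow> V \<subseteq> U \<Longrightarrow> s \<in> carrier (E m U) \<Longrightarrow> restrict s V \<in> carrier (E m V)"
proof -
  assume U: "openin X U" and V: "openin X V" "V \<subseteq> U" and s: "s \<in> carrier (E m U)"
  show ?thesis unfolding E_carrier[OF V(1)]
  proof (intro conjI ballI allI impI)
    fix j assume "j < m"
    then have "(\<lambda>x\<in>U. s x j) \<in> hol M U" using s by (simp add: E_carrier[OF U])
    then have "restrict (\<lambda>x\<in>U. s x j) V \<in> hol M V" by (rule hol_restrict[OF V])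
    then show "(\<lambda>x\<in>V. restrict s V x j) \<in> hol M V"
      by (rule back_subst[of "\<lambda>f. f \<in> hol M V"]) (use V in \<open>auto intro!: ext\<close>)
  qed (use s V in \<open>auto simp: E_carrier[OF U]\<close>)
qed

lemma restrict_words_eval:
  assumes U: "openin X U" and V: "openin X V" "V \<subseteq> U" and f: "f \<in> carrier (A m U)"
  shows "restrict_words M V f \<in> carrier (A m V)"
    "word_eval m V (restrict_words M V f) = Res (super_hol M m) U V (word_eval m U f)"
proof -
  let ?r = "map (\<lambda>s. restrict s V)" and ?g = "restrict_words M V f" and ?s = "supp U f"
  have fin: "finite ?s" by (rule A_fin[OF U f])
  have sub: "u \<in> ?s" if "restrict (f u) V \<noteq> \<zero>\<^bsub>R V\<^esub>" for u
  proof
    show "f u \<noteq> \<zero>\<^bsub>R U\<^esub>"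
    proof
      assume "f u = \<zero>\<^bsub>R U\<^esub>"
      then have "restrict (f u) V = \<zero>\<^bsub>R V\<^esub>" 
        unfolding R_simps[OF V(1)] by (intro restrict_ext) (use V(2) in \<open>auto simp: R_simps[OF U]\<close>)
      then show False using that by simp
    qed
  qed
  have g: "?g w = (\<lambda>x\<in>V. \<Sum>u\<in>{u. restrict (f u) V \<noteq> \<zero>\<^bsub>R V\<^esub> \<and> ?r u = w}. restrict (f u) V x)" for w
    unfolding restrict_words_def
  proof (rule R_finsum[OF V(1)])
    show "finite {u. restrict (f u) V \<noteq> \<zero>\<^bsub>R V\<^esub> \<and> ?r u = w}" by (rule finite_subset[OF _ fin]) (use sub in auto)
  qed (rule hol_restrict[OF V A_hol[OF U f]])
  have gx: "?g w x = (\<Sum>u\<in>{u \<in> ?s. ?r u = w}. f u x)" if x: "x \<in> V" for w x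
  proof -
    have "?g w x = (\<Sum>u\<in>{u. restrict (f u) V \<noteq> \<zero>\<^bsub>R V\<^esub> \<and> ?r u = w}. f u x)" using x by (simp add: g)
    also have "\<dots> = (\<Sum>u\<in>{u \<in> ?s. ?r u = w}. f u x)"
    proof (rule sum.mono_neutral_left)
      show "\<forall>u\<in>{u \<in> ?s. ?r u = w} - {u. restrict (f u) V \<noteq> \<zero>\<^bsub>R V\<^esub> \<and> ?r u = w}. f u x = 0"
      proof
        fix u assume "u \<in> {u \<in> ?s. ?r u = w} - {u. restrict (f u) V \<noteq> \<zero>\<^bsub>R V\<^esub> \<and> ?r u = w}"
        then have "restrict (f u) V = \<zero>\<^bsub>R V\<^esub>" by auto
        from fun_cong[OF this, of x] show "f u x = 0" using x by (simp add: R_simps[OF V(1)])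
      qed
    qed (use fin sub in auto)
    finally show ?thesis .
  qed
  show gA: "?g \<in> carrier (A m V)"
  proof (rule A_memI[OF V(1), of _ "?r ` ?s"])
    fix w
    have "(\<lambda>x\<in>V. restrict (f u) V x) \<in> hol M V" for u by (rule hol_shift[OF hol_restrict[OF V A_hol[OF U f]]])
    then show "?g w \<in> hol M V" unfolding g by (intro hol_sum[OF V(1)])
    assume w: "w \<notin> ?r ` ?s"
    then have "{u. restrict (f u) V \<noteq> \<zero>\<^bsub>R V\<^esub> \<and> ?r u = w} = {}" using sub by blast
    then show "?g w = \<zero>\<^bsub>R V\<^esub>" unfolding g R_simps[OF V(1)] by (simp only: sum.empty)
  next
    fix w assume "w \<in> ?r ` ?s"
    then obtain u where u: "u \<in> ?s" "w = ?r u" by auto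
    then show "set w \<subseteq> carrier (E m V)" using A_set[OF U f u(1)] restrict_section[OF U V] by auto
  qed (use fin in simp)
  show "word_eval m V ?g = Res (super_hol M m) U V (word_eval m U f)"
  proof (rule S_eqI[OF word_eval_closed[OF V(1) gA] S_Res_closed[OF V word_eval_closed[OF U f]]])
    fix K x assume K: "K \<subseteq> {..<m}" and x: "x \<in> V"
    let ?T = "?r ` ?s \<union> supp V ?g"
    have T: "finite ?T" using fin A_fin[OF V(1) gA] by simp
    have "word_eval m V ?g K x = (\<Sum>w\<in>?T. ?g w x * word_value w x K)"
      by (rule word_eval_apply[OF V(1) gA T _ x K]) blast
    also have "\<dots> = (\<Sum>w\<in>?T. \<Sum>u\<in>{u \<in> ?s. ?r u = w}. f u x * word_value (?r u) x K)"
      unfolding gx[OF x] sum_distrib_right by (intro sum.cong refl) auto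
    also have "\<dots> = (\<Sum>u\<in>?s. f u x * word_value (?r u) x K)"
      by (rule sum.group[OF fin T]) blast
    also have "\<dots> = (\<Sum>u\<in>?s. f u x * word_value u x K)"
      using x by (intro sum.cong refl arg_cong2[where f = "(*)"] fun_cong[OF word_value_cong]) simp
    also have "\<dots> = word_eval m U f K x"
      using x V(2) K by (subst word_eval_apply[OF U f fin subset_refl]) auto
    finally show "word_eval m V ?g K x = Res (super_hol M m) U V (word_eval m U f) K x"
      using K x by (simp add: S_Res_apply)
  qed
qed

theorem super_hol_exterior_sheaf:
  "sheaf_isomorphic_on X (topspace X) (super_hol M m) (exterior_sheaf M (trivial_bundle X m))"
  unfolding exterior_sheaf_def
proof (rule sheafify_super_hol[where h = "value_fibre m"])
  fix V assume V: "openin X V"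
  interpret I: ideal "I m V" "A m V" by (rule ideal_I[OF V])
  interpret ring "A m V" by (rule ring_A[OF V])
  note fo = value_fibre_obtain[OF V] and ev = cls_eq_value_fibre[OF V]
  have carr: "C \<in> a_rcosets\<^bsub>A m V\<^esub> (I m V) \<longleftrightarrow> (\<exists>f\<in>carrier (A m V). C = cls m V f)" for C
    by (auto simp: A_RCOSETS_def')
  show "bij_betw (value_fibre m V) (carrier (S m V)) (carrier (Sec (ext m) V))"
  proof (rule bij_betwI')
    fix F F' assume F: "F \<in> carrier (S m V)" "F' \<in> carrier (S m V)"
    obtain f where f: "f \<in> carrier (A m V)" "word_eval m V f = F" using word_eval_surj[OF V F(1)] by blast
    show "value_fibre m V F = value_fibre m V F' \<longleftrightarrow> F = F'"
    proof
      assume "value_fibre m V F = value_fibre m V F'"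
      moreover have "f \<in> value_fibre m V F" using f by (simp add: value_fibre_def)
      ultimately show "F = F'" using f by (simp add: value_fibre_def)
    qed simp
  next
    fix F assume F: "F \<in> carrier (S m V)"
    show "value_fibre m V F \<in> carrier (Sec (ext m) V)" unfolding ext_Sec carr by (rule fo[OF F]) blast
  next
    fix C assume "C \<in> carrier (Sec (ext m) V)"
    then obtain f where "f \<in> carrier (A m V)" "C = cls m V f" unfolding ext_Sec carr by blast
    then show "\<exists>F\<in>carrier (S m V). C = value_fibre m V F" using ev word_eval_closed[OF V] by blast
  qed
  show "value_fibre m V \<one>\<^bsub>S m V\<^esub> = \<one>\<^bsub>Sec (ext m) V\<^esub>"
  proof -
    have "word_eval m V \<one>\<^bsub>A m V\<^esub> = \<one>\<^bsub>S m V\<^esub>"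
      using ring_hom_one[OF ring_hom_ring.homh[OF word_eval_ring_hom[OF V]]] .
    then show ?thesis using ev[OF A_one_closed[OF V]] by (simp add: ext_Sec)
  qed
  fix F assume F: "F \<in> carrier (S m V)"
  obtain f where f: "f \<in> carrier (A m V)" "word_eval m V f = F" "value_fibre m V F = cls m V f" by (rule fo[OF F])
  {
    fix F' assume F': "F' \<in> carrier (S m V)"
    obtain f' where f': "f' \<in> carrier (A m V)" "word_eval m V f' = F'" "value_fibre m V F' = cls m V f'" by (rule fo[OF F'])
    show "value_fibre m V (F \<otimes>\<^bsub>S m V\<^esub> F') = value_fibre m V F \<otimes>\<^bsub>Sec (ext m) V\<^esub> value_fibre m V F'"
      unfolding f(3) f'(3) ext_Sec I.rcoset_mult_add[OF f(1) f'(1)] ev[OF A_mult_closed[OF V f(1) f'(1)]] word_eval_mult[OF V f(1) f'(1)] f(2) f'(2) ..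
    show "value_fibre m V (F \<oplus>\<^bsub>S m V\<^esub> F') = value_fibre m V F \<oplus>\<^bsub>Sec (ext m) V\<^esub> value_fibre m V F'"
      unfolding f(3) f'(3) ext_Sec I.a_rcos_sum[OF f(1) f'(1)] ev[OF A_add_closed[OF V f(1) f'(1)]] word_eval_add[OF V f(1) f'(1)] f(2) f'(2) ..
  }
  {
    fix c
    show "value_fibre m V (c \<odot>\<^bsub>S m V\<^esub> F) = c \<odot>\<^bsub>Sec (ext m) V\<^esub> value_fibre m V F"
      unfolding ext_Sec
    proof (rule value_fibre_union[OF V F, symmetric])
      fix f assume f: "f \<in> carrier (A m V)" "word_eval m V f = F"
      have h: "(\<lambda>x\<in>V. c) \<in> hol M V" by (rule hol_const[OF V])
      have "word_eval m V ((\<lambda>x\<in>V. c) \<odot>\<^bsub>A m V\<^esub> f) = c \<odot>\<^bsub>S m V\<^esub> F"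
        by (rule S_eqI[OF word_eval_closed[OF V A_smult_closed[OF V h f(1)]] S_smult_closed[OF V F]])
          (simp add: word_eval_smult[OF V h f(1)] f(2) S_apply[OF V])
      then show "cls m V ((\<lambda>x\<in>V. c) \<odot>\<^bsub>A m V\<^esub> f) = value_fibre m V (c \<odot>\<^bsub>S m V\<^esub> F)"
        using ev[OF A_smult_closed[OF V h f(1)]] by simp
    qed
  }
  fix W assume W: "openin X W" "W \<subseteq> V"
  show "Res (ext m) V W (value_fibre m V F) = value_fibre m W (Res (super_hol M m) V W F)"
  proof -
    have "Res (ext m) V W (value_fibre m V F) = (\<Union>f\<in>value_fibre m V F. cls m W (restrict_words M W f))"
      by (simp add: ext_presheaf_def)
    also have "\<dots> = value_fibre m W (Res (super_hol M m) V W F)"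
      by (rule value_fibre_union[OF V F]) (simp add: cls_eq_value_fibre[OF W(1)] restrict_words_eval[OF V W])
    finally show ?thesis .
  qed
next
  fix V F assume V: "openin X V" and F: "F \<in> even_part (S m V)"
  obtain f where "f \<in> carrier (A m V)" "word_eval m V f = F" "\<forall>w. odd (length w) \<longrightarrow> f w = \<zero>\<^bsub>R V\<^esub>"
    using word_eval_surj[OF V S_parity_carrier(1)[OF F]] F by blast
  then show "value_fibre m V F \<in> even_part (Sec (ext m) V)" unfolding ext_Sec using cls_eq_value_fibre[OF V] by blast
next
  fix V F assume V: "openin X V" and F: "F \<in> odd_part (S m V)"
  obtain f where "f \<in> carrier (A m V)" "word_eval m V f = F" "\<forall>w. even (length w) \<longrightarrow> f w = \<zero>\<^bsub>R V\<^esub>"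
    using word_eval_surj[OF V S_parity_carrier(2)[OF F]] F by blast
  then show "value_fibre m V F \<in> odd_part (Sec (ext m) V)" unfolding ext_Sec using cls_eq_value_fibre[OF V] by blast
qed

end

section \<open>Lie supergroups are split\<close>

lemma (in super_manifold) sheaf_isomorphic_empty:
  assumes "topspace X = {}"
  shows "sheaf_isomorphic_on X (topspace X) (osheaf G) (super_hol (body G) m)"
  unfolding sheaf_isomorphic_on_def
proof (intro exI[of _ "\<lambda>V _. \<zero>\<^bsub>S m V\<^esub>"] conjI allI impI ballI; elim conjE)
  fix V assume V: "openin X V"
  have e: "V = {}" using openin_subset[OF V] assms by auto
  note c = S_zero_closed[OF V, of m]
  have SS: "a = b" if "a \<in> carrier (S m V)" "b \<in> carrier (S m V)" for a b
    by (rule S_eqI[OF that]) (simp add: e)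
  have GG: "a = b" if "a \<in> carrier (SecG V)" "b \<in> carrier (SecG V)" for a b
    using sheaf_empty[OF supermanifoldD(2)[OF G]] that e by blast
  have "(\<lambda>_. \<zero>\<^bsub>S m V\<^esub>) \<in> superalg_hom (SecG V) (S m V)"
    by (rule superalg_hom_trivial[OF SecG[OF V] comm_superalgebra_S[OF V] SS c])
  moreover have "bij_betw (\<lambda>_. \<zero>\<^bsub>S m V\<^esub>) (carrier (SecG V)) (carrier (S m V))"
  proof (rule bij_betwI')
    fix a b assume "a \<in> carrier (SecG V)" "b \<in> carrier (SecG V)"
    then show "\<zero>\<^bsub>S m V\<^esub> = \<zero>\<^bsub>S m V\<^esub> \<longleftrightarrow> a = b" using GG by simp
  next
    fix a assume "a \<in> carrier (S m V)"
    then show "\<exists>b\<in>carrier (SecG V). a = \<zero>\<^bsub>S m V\<^esub>" using SS[OF _ c] SecG_closed(4)[OF V] by blast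
  qed (rule c)
  ultimately show "(\<lambda>_. \<zero>\<^bsub>S m V\<^esub>) \<in> superalg_iso (SecG V) (S m V)" by (simp add: superalg_iso_def)
next
  fix V W s assume V: "openin X V" "openin X W" "W \<subseteq> V"
  have "W = {}" using openin_subset[OF V(2)] assms by auto
  then show "\<zero>\<^bsub>S m W\<^esub> = Res (super_hol (body G) m) V W \<zero>\<^bsub>S m V\<^esub>"
    by (intro S_eqI[of _ m W] S_zero_closed S_Res_closed V) simp_all
qed

theorem mainTheorem4:
  fixes G :: "('p, 's) superspace"
  assumes "complex_Lie_supergroup G"
  shows "split_supermanifold G"
proof -
  obtain E P Q p q r s mu e iota where g: "group_object SMan G E P Q p q r s mu e iota"
    using assms unfolding complex_Lie_supergroup_def by (elim exE)
  have G: "supermanifold G" using group_object.obj[OF g] by (simp add: SMan_simps)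
  obtain m where m: "\<forall>x\<in>topspace (sm_top G). \<exists>U. openin (sm_top G) U \<and> x \<in> U \<and>
      sheaf_isomorphic_on (sm_top G) U (osheaf G) (super_hol (body G) m)"
    using G unfolding supermanifold_def by (elim conjE exE)
  interpret super_manifold G m using G m by (rule super_manifold.intro)
  have "sheaf_isomorphic_on (sm_top G) (topspace (sm_top G)) (osheaf G) (super_hol (body G) m)"
  proof (cases "topspace (sm_top G) = {}")
    case True
    then show ?thesis by (rule sheaf_isomorphic_empty)
  next
    case False
    then obtain x0 where x0: "x0 \<in> topspace (sm_top G)" by blast
    have "super_group G m x0 E P Q p q r s mu e iota"
      by (intro super_group.intro pointed_super_manifold.intro pointed_super_manifold_axioms.intro super_manifold_axioms x0 g)
    then show ?thesis by (rule super_group.sheaf_isomorphic)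
  qed
  then have "sheaf_isomorphic_on (sm_top G) (topspace (sm_top G)) (osheaf G) (exterior_sheaf (body G) (trivial_bundle (sm_top G) m))"
    using super_hol_exterior_sheaf by (rule sheaf_isomorphic_on_trans)
  then show ?thesis
    unfolding split_supermanifold_def by (intro conjI G exI[of _ "trivial_bundle (sm_top G) m"] trivial_bundle)
qed

end
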